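(* Let $\mathbf k$ be a field of positive prime characteristic, let $\Delta$ be a simplicial complex, and let $R=\mathbf k[\Delta]$ be its Stanley-Reisner ring, assumed to be Cohen-Macaulay of dimension $d$. Let $\mathfrak m$ be the unique maximal homogeneous ideal of $R$ and let $I_1,\dots,I_d$ be ideals of $R$, each generated by a linear system of parameters. Then for any joint reduction $(a_1,\dots,a_d)$ of the $d$-tuple $(I_1,\dots,I_d)$, the following are equivalent: (1) $\Delta$ is Eulerian. (2) $r(\mathfrak m)\le d-1$. (3) $a_1(\underline I^{S_1})^*+a_2(\underline I^{S_2})^*+\cdots+a_d(\underline I^{S_d})^*=(\underline I^{S})^*$ for all integers $s_1,\dots,s_d\ge 1$. (4) $\displaystyle e_d^*(I_1\cdots I_d)-\sum_{i=1}^d e_d^*\Big(\prod_{j\ne i}I_j\Big)+\sum_{1\le p<q\le d}e_d^*\Big(\prod_{j\ne p,q}I_j\Big)-\cdots+(-1)^{d-1}\sum_{i=1}^d e_d^*(I_i)=0.$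
   Context: $\mathbf k[\Delta]=\mathbf k[X_1,\dots,X_v]/I_\Delta$, where $v$ is the number of vertices and $I_\Delta$ is the Stanley-Reisner ideal; $\dim\Delta=d-1$. A linear system of parameters is a (homogeneous) system of parameters of $\mathbf k[\Delta]$ consisting of linear forms. If $(f_{-1},f_0,\dots,f_{d-1})$ is the $f$-vector of $\Delta$, its Euler characteristic is $\chi(\Delta)=f_0-f_1+\cdots+(-1)^{d-1}f_{d-1}$, and in this paper $\Delta$ is called Eulerian if $\chi(\Delta)=1$. For $S=(s_1,\dots,s_d)$ set $\underline I^{S}=I_1^{s_1}\cdots I_d^{s_d}$ and $\underline I^{S_i}=\big(\prod_{j\ne i}I_j^{s_j}\big)I_i^{s_i-1}$. $J^*$ denotes the tight closure of an ideal $J$: $x\in J^*$ iff there is $c\in R$ not in any minimal prime of $R$ with $cx^q\in J^{[q]}$ for all large powers $q$ of the characteristic, $J^{[q]}$ being generated by the $q$-th powers of elements of $J$. A $d$-tuple $(a_1,\dots,a_d)$ with $a_i\in I_i$ is a joint reduction of $(I_1,\dots,I_d)$ if the ideal $\sum_{i=1}^d a_i I_1\cdots I_{i-1}I_{i+1}\cdots I_d$ is a reduction of $I_1\cdots I_d$. The reduction number $r(\mathfrak m)$ is the minimum, over all minimal reductions $J$ of $\mathfrak m$, of the smallest integer $n$ with $J\mathfrak m^n=\mathfrak m^{n+1}$. For an $\mathfrak m$-primary ideal $I$ of the form considered, $\ell(R/(I^n)^* )$ agrees for all large $n$ with a polynomial $P_I^*(n)=e_0^*(I)\binom{n+d-1}{d}-e_1^*(I)\binom{n+d-2}{d-1}+\cdots+(-1)^d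 e_d^*(I)$; this defines $e_d^*(I)$.
   Formalization: In the definition of r(m), a minimal reduction is required to be minimal under inclusion and also generated by at most d elements; with inclusion-minimality alone, (1) ⇔ (2) fails over finite fields (e.g. F_2 and the graph with edges 12, 13, 23, 14). *)

theory Defs
  imports
    "HOL-Algebra.Algebra"
    "HOL-Algebra.Algebraic_Closure_Type"
    "HOL-Library.Poly_Mapping"
    "HOL-Library.Extended_Nat"
begin

section \<open>Commutative algebra\<close>

text \<open>The length of a chain \<open>X\<^sub>0 \<subset> \<dots> \<subset> X\<^sub>n\<close> is \<open>n\<close>; the supremum is \<open>\<infinity>\<close> if the lengths are unbounded.\<close>

definition chain_length :: "'a set set \<Rightarrow> enat" where
  "chain_length \<A> = (SUP C \<in> {C. finite C \<and> subset.chain \<A> C}. enat (card C - 1))"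

definition krull_dim :: "('a, 'b) ring_scheme \<Rightarrow> enat" where
  "krull_dim R = chain_length {P. primeideal P R}"

definition height :: "('a, 'b) ring_scheme \<Rightarrow> 'a set \<Rightarrow> enat" where
  "height R P = chain_length {Q. primeideal Q R \<and> Q \<subseteq> P}"

text \<open>The length of \<open>R\<close> as a module over itself. The \<open>R\<close>-submodules of \<open>R / J\<close> are the
  ideals of the ring \<open>R / J\<close>, so \<open>\<ell>(R / J)\<close> is \<open>ring_length (R Quot J)\<close>.\<close>

definition ring_length :: "('a, 'b) ring_scheme \<Rightarrow> enat" where
  "ring_length R = chain_length {I. ideal I R}"

definition regular_sequence :: "('a, 'b) ring_scheme \<Rightarrow> 'a list \<Rightarrow> bool" where
  "regular_sequence R xs \<longleftrightarrow>
     set xs \<subseteq> carrier R \<and> Idl\<^bsub>R\<^esub> (set xs) \<noteq> carrier R \<and>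
     (\<forall>i < length xs. \<forall>r \<in> carrier R.
        r \<otimes>\<^bsub>R\<^esub> xs ! i \<in> Idl\<^bsub>R\<^esub> (set (take i xs)) \<longrightarrow> r \<in> Idl\<^bsub>R\<^esub> (set (take i xs)))"

definition depth :: "('a, 'b) ring_scheme \<Rightarrow> 'a set \<Rightarrow> enat" where
  "depth R I = (SUP xs \<in> {xs. regular_sequence R xs \<and> set xs \<subseteq> I}. enat (length xs))"

definition cohen_macaulay :: "('a, 'b) ring_scheme \<Rightarrow> bool" where
  "cohen_macaulay R \<longleftrightarrow>
     cring R \<and> noetherian_ring R \<and> (\<forall>M. maximalideal M R \<longrightarrow> depth R M = height R M)"

definition minimal_prime :: "('a, 'b) ring_scheme \<Rightarrow> 'a set \<Rightarrow> bool" where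
  "minimal_prime R P \<longleftrightarrow>
     primeideal P R \<and> (\<forall>Q. primeideal Q R \<and> Q \<subseteq> P \<longrightarrow> Q = P)"

subsection \<open>Tight closure\<close>

definition frobenius_power :: "('a, 'b) ring_scheme \<Rightarrow> 'a set \<Rightarrow> nat \<Rightarrow> 'a set" where
  "frobenius_power R J q = Idl\<^bsub>R\<^esub> ((\<lambda>x. x [^]\<^bsub>R\<^esub> q) ` J)"

text \<open>Here \<open>p\<close> is the characteristic of \<open>R\<close>.\<close>

definition tight_closure :: "nat \<Rightarrow> ('a, 'b) ring_scheme \<Rightarrow> 'a set \<Rightarrow> 'a set" where
  "tight_closure p R J =
     {x \<in> carrier R. \<exists>c \<in> carrier R. (\<forall>P. minimal_prime R P \<longrightarrow> c \<notin> P) \<and>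
        (\<forall>\<^sub>F e in sequentially. c \<otimes>\<^bsub>R\<^esub> (x [^]\<^bsub>R\<^esub> (p ^ e)) \<in> frobenius_power R J (p ^ e))}"

text \<open>\<open>e 0, \<dots>, e d\<close> are the coefficients of the polynomial agreeing with
  \<open>\<ell>(R / (I\<^sup>n)\<^sup>*)\<close> for large \<open>n\<close>. Since \<open>n \<ge> 1\<close> eventually, the truncated subtraction
  in \<open>n + d - 1 - i\<close> is exact.\<close>

definition tight_hilbert_coeffs ::
  "nat \<Rightarrow> ('a, 'b) ring_scheme \<Rightarrow> nat \<Rightarrow> 'a set \<Rightarrow> (nat \<Rightarrow> int) \<Rightarrow> bool" where
  "tight_hilbert_coeffs p R d I e \<longleftrightarrow>
     (\<forall>\<^sub>F n in sequentially. \<exists>l::nat.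
        ring_length (R Quot tight_closure p R (I [^]\<^bsub>ideals_set R\<^esub> n)) = enat l \<and>
        int l = (\<Sum>i\<le>d. (- 1) ^ i * e i * int ((n + d - 1 - i) choose (d - i))))"

definition tight_hilbert_coeff ::
  "nat \<Rightarrow> ('a, 'b) ring_scheme \<Rightarrow> nat \<Rightarrow> nat \<Rightarrow> 'a set \<Rightarrow> int" where
  "tight_hilbert_coeff p R d i I = (THE c. \<exists>e. tight_hilbert_coeffs p R d I e \<and> e i = c)"

subsection \<open>Reductions\<close>

definition is_reduction :: "('a, 'b) ring_scheme \<Rightarrow> 'a set \<Rightarrow> 'a set \<Rightarrow> bool" where
  "is_reduction R J I \<longleftrightarrow>
     ideal J R \<and> J \<subseteq> I \<and>
     (\<exists>n::nat. J \<cdot>\<^bsub>R\<^esub> (I [^]\<^bsub>ideals_set R\<^esub> n) = I [^]\<^bsub>ideals_set R\<^esub> (n + 1))"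

text \<open>Minimal reductions, for ideals \<open>I\<close> primary to a maximal ideal of height \<open>dim R\<close>:
  minimal with respect to inclusion and generated by \<open>dim R\<close> elements. If the residue field
  is infinite, the second condition follows from the first. It has to be imposed over finite
  fields: for \<open>\<bbbF>\<^sub>2[\<Delta>]\<close>, where \<open>\<Delta>\<close> is the graph with edges \<open>12, 13, 23, 14\<close>, the
  ideal \<open>J = (X\<^sub>1 + X\<^sub>4, X\<^sub>2 + X\<^sub>4, X\<^sub>3 + X\<^sub>4)\<close> contains no smaller reduction of
  \<open>\<mm>\<close>, and \<open>J \<mm> = \<mm>\<^sup>2\<close>, whereas every linear system of parameters \<open>\<theta>\<close> has
  \<open>(\<theta>) \<mm> \<noteq> \<mm>\<^sup>2\<close>.\<close>

definition minimal_reduction :: "('a, 'b) ring_scheme \<Rightarrow> 'a set \<Rightarrow> 'a set \<Rightarrow> bool" where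
  "minimal_reduction R J I \<longleftrightarrow>
     is_reduction R J I \<and> (\<forall>K. is_reduction R K I \<and> K \<subseteq> J \<longrightarrow> K = J) \<and>
     (\<exists>A. A \<subseteq> carrier R \<and> finite A \<and> enat (card A) \<le> krull_dim R \<and> J = Idl\<^bsub>R\<^esub> A)"

definition reduction_number_wrt :: "('a, 'b) ring_scheme \<Rightarrow> 'a set \<Rightarrow> 'a set \<Rightarrow> nat" where
  "reduction_number_wrt R J I =
     (LEAST n. J \<cdot>\<^bsub>R\<^esub> (I [^]\<^bsub>ideals_set R\<^esub> n) = I [^]\<^bsub>ideals_set R\<^esub> (n + 1))"

definition reduction_number :: "('a, 'b) ring_scheme \<Rightarrow> 'a set \<Rightarrow> enat" where
  "reduction_number R I = (INF J \<in> {J. minimal_reduction R J I}. enat (reduction_number_wrt R J I))"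

definition joint_reduction ::
  "('a, 'b) ring_scheme \<Rightarrow> nat \<Rightarrow> (nat \<Rightarrow> 'a) \<Rightarrow> (nat \<Rightarrow> 'a set) \<Rightarrow> bool" where
  "joint_reduction R d a I \<longleftrightarrow>
     (\<forall>i \<in> {1..d}. a i \<in> I i) \<and>
     is_reduction R
       (\<Oplus>\<^bsub>ideals_set R\<^esub> i \<in> {1..d}. a i <#\<^bsub>R\<^esub> (\<Otimes>\<^bsub>ideals_set R\<^esub> j \<in> {1..d} - {i}. I j))
       (\<Otimes>\<^bsub>ideals_set R\<^esub> j \<in> {1..d}. I j)"

text \<open>\<open>I\<^sub>1\<^bsup>s\<^sub>1\<^esup> \<cdots> I\<^sub>d\<^bsup>s\<^sub>d\<^esup>\<close>; decreasing the \<open>i\<close>-th exponent by one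
  turns \<open>S\<close> into \<open>S\<^sub>i\<close>.\<close>

definition mixed_power ::
  "('a, 'b) ring_scheme \<Rightarrow> nat \<Rightarrow> (nat \<Rightarrow> 'a set) \<Rightarrow> (nat \<Rightarrow> nat) \<Rightarrow> 'a set" where
  "mixed_power R d I s = (\<Otimes>\<^bsub>ideals_set R\<^esub> j \<in> {1..d}. I j [^]\<^bsub>ideals_set R\<^esub> s j)"

section \<open>Simplicial complexes and Stanley--Reisner rings\<close>

text \<open>The vertex set is the whole type, so every variable corresponds to a vertex of the complex.\<close>

definition simplicial_complex :: "'v set set \<Rightarrow> bool" where
  "simplicial_complex \<Delta> \<longleftrightarrow> (\<forall>F \<in> \<Delta>. \<forall>G \<subseteq> F. G \<in> \<Delta>) \<and> (\<forall>x. {x} \<in> \<Delta>)"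

text \<open>\<open>num_faces \<Delta> i\<close> is \<open>f\<^sub>i\<close>, the number of \<open>i\<close>-dimensional faces.\<close>

definition num_faces :: "'v set set \<Rightarrow> nat \<Rightarrow> nat" where
  "num_faces \<Delta> i = card {F \<in> \<Delta>. card F = i + 1}"

definition euler_characteristic :: "'v set set \<Rightarrow> int" where
  "euler_characteristic \<Delta> = (\<Sum>i < Max (card ` \<Delta>). (- 1) ^ i * int (num_faces \<Delta> i))"

definition eulerian :: "'v set set \<Rightarrow> bool" where
  "eulerian \<Delta> \<longleftrightarrow> euler_characteristic \<Delta> = 1"

type_synonym ('v, 'k) mpoly = "('v \<Rightarrow>\<^sub>0 nat) \<Rightarrow>\<^sub>0 'k"

abbreviation poly_ring :: "('v, 'k::comm_ring_1) mpoly ring" where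
  "poly_ring \<equiv> ring_of_type_algebra"

definition indet :: "'v \<Rightarrow> ('v, 'k::comm_ring_1) mpoly" where
  "indet x = Poly_Mapping.single (Poly_Mapping.single x 1) 1"

definition const :: "'k \<Rightarrow> ('v, 'k::comm_ring_1) mpoly" where
  "const c = Poly_Mapping.single 0 c"

definition SR_ideal :: "'v set set \<Rightarrow> ('v::finite, 'k::comm_ring_1) mpoly set" where
  "SR_ideal \<Delta> = Idl\<^bsub>poly_ring\<^esub> {\<Prod>x\<in>F. indet x | F. F \<notin> \<Delta>}"

definition SR_ring :: "'v set set \<Rightarrow> ('v::finite, 'k::comm_ring_1) mpoly set ring" where
  "SR_ring \<Delta> = poly_ring Quot SR_ideal \<Delta>"

definition SR_class :: "'v set set \<Rightarrow> ('v::finite, 'k::comm_ring_1) mpoly \<Rightarrow> ('v, 'k) mpoly set" where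
  "SR_class \<Delta> f = SR_ideal \<Delta> +>\<^bsub>poly_ring\<^esub> f"

definition SR_max_ideal :: "'v set set \<Rightarrow> ('v::finite, 'k::comm_ring_1) mpoly set set" where
  "SR_max_ideal \<Delta> = Idl\<^bsub>SR_ring \<Delta>\<^esub> (range (\<lambda>x. SR_class \<Delta> (indet x)))"

definition SR_linear_forms :: "'v set set \<Rightarrow> ('v::finite, 'k::comm_ring_1) mpoly set set" where
  "SR_linear_forms \<Delta> = range (\<lambda>c. SR_class \<Delta> (\<Sum>x\<in>UNIV. const (c x) * indet x))"

definition linear_sop ::
  "'v set set \<Rightarrow> nat \<Rightarrow> (nat \<Rightarrow> ('v::finite, 'k::comm_ring_1) mpoly set) \<Rightarrow> bool" where
  "linear_sop \<Delta> d \<theta> \<longleftrightarrow>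
     krull_dim (SR_ring \<Delta> :: ('v, 'k) mpoly set ring) = enat d \<and>
     (\<forall>i \<in> {1..d}. \<theta> i \<in> SR_linear_forms \<Delta>) \<and>
     krull_dim (SR_ring \<Delta> Quot Idl\<^bsub>SR_ring \<Delta>\<^esub> (\<theta> ` {1..d})) = 0"

end

theory Submission
  imports Defs "HOL-Computational_Algebra.Polynomial" "HOL-Library.Function_Algebras"
begin

text \<open>
  For a face \<open>F\<close>, each \<open>I\<^sub>i\<close> maps onto the graded maximal ideal of the polynomial ring \<open>k[F]\<close>. Orders are
  additive in \<open>k[F]\<close>, and the sum of the squarefree facet monomials avoids all minimal primes and
  glues conditions on the facets; hence the tight closure of a product of \<open>n\<close> of the ideals \<open>I\<^sub>i\<close> is
  \<open>\<mm>\<^sup>n\<close>. So (2) and (3) both ask whether \<open>\<Sum> a\<^sub>i \<mm>\<^sup>n\<^sup>-\<^sup>1 = \<mm>\<^sup>n\<close> for all \<open>n \<ge> d\<close>. This holds for some large \<open>n\<close>,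
  which forces the linear parts of the \<open>a\<^sub>i\<close> to form a linear system of parameters; by descending
  induction on \<open>n\<close> only these linear parts \<open>\<theta>\<close> matter. As \<open>R\<close> is Cohen-Macaulay, the Koszul complex of
  \<open>\<theta>\<close> is exact in positive degrees, and the Euler characteristics of its graded strands show that
  \<open>R/(\<theta>)\<close> vanishes above degree \<open>d\<close> and has dimension \<open>\<plusminus> (1 - \<chi>(\<Delta>))\<close> in degree \<open>d\<close>. Up to sign, the
  same number is the constant term of the Hilbert polynomial of \<open>\<mm>\<^sup>k\<close> for every \<open>k \<ge> 1\<close>, hence every
  \<open>e\<^sub>d\<^sup>*\<close> occurring in (4), and the alternating sum of the binomial coefficients there is \<open>\<plusminus> 1\<close>.
\<close>

section \<open>Linear systems and Koszul complexes\<close>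

text \<open>The field may be finite, so nothing can be put in general position. Linear forms are
  tested on lines instead: those with a common zero in the coordinate subspace of a face vanish on
  the line through it, and as the equations are linear, zeros over the field itself suffice. The
  same lines show that no reduction lies properly inside (\<theta>).

  The Cohen-Macaulay property is stated through depth and yields only some regular sequence in
  \<mm>, in general neither homogeneous nor related to \<theta>. Koszul homology bridges the gap: a
  power of each member lies in (\<theta>), hence annihilates the homology of \<theta>, while
  regularity allows that power to be cancelled. The exactness so obtained is ungraded and is cut
  down to degree n afterwards.

  The number 1 - \<chi>(\<Delta>) has one source: the monomials with support F are counted in
  positive degrees by a polynomial of degree below |F|, which fails in degree 0 by (-1)^|F|. A d-th
  difference sees only this defect, and so does the Hilbert polynomial evaluated at 0.\<close>

lemma underdetermined_system:
  fixes a :: "'i \<Rightarrow> 't \<Rightarrow> 'k::field"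
  assumes "finite T" "finite S" "card T < card S"
  shows "\<exists>c. (\<exists>i\<in>S. c i \<noteq> 0) \<and> (\<forall>t\<in>T. (\<Sum>i\<in>S. c i * a i t) = 0)"
  using assms
proof (induction T arbitrary: S a rule: finite_induct)
  case empty
  hence "S \<noteq> {}" by auto
  then show ?case by (auto intro!: exI[of _ "\<lambda>_. 1"])
next
  case (insert t T)
  note fin = \<open>finite S\<close>
  have less: "Suc (card T) < card S" using insert.prems insert.hyps by simp
  show ?case
  proof (cases "\<forall>i\<in>S. a i t = 0")
    case True
    have "card T < card S" using less by simp
    from insert.IH[OF fin this, of a]
    obtain c where c: "\<exists>i\<in>S. c i \<noteq> 0" "\<forall>t\<in>T. (\<Sum>i\<in>S. c i * a i t) = 0"
      by blast
    have "(\<Sum>i\<in>S. c i * a i t) = 0" using True by simp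
    thus ?thesis using c by (intro exI[of _ c]) simp
  next
    case False
    then obtain j where j: "j \<in> S" "a j t \<noteq> 0" by auto
    have "card T < card (S - {j})" using less j fin by simp
    from insert.IH[OF _ this, of "\<lambda>i s. a i s - a i t / a j t * a j s"] fin
    obtain c where c: "\<exists>i\<in>S-{j}. c i \<noteq> 0"
      "\<forall>s\<in>T. (\<Sum>i\<in>S-{j}. c i * (a i s - a i t / a j t * a j s)) = 0" by auto
    define c' where "c' = c(j := - (\<Sum>l\<in>S-{j}. c l * (a l t / a j t)))"
    have sum: "(\<Sum>i\<in>S. c' i * a i s) = (\<Sum>l\<in>S-{j}. c l * (a l s - a l t / a j t * a j s))" for s
    proof -
      have "(\<Sum>i\<in>S. c' i * a i s) = c' j * a j s + (\<Sum>i\<in>S-{j}. c' i * a i s)"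
        using j fin by (simp add: sum.remove)
      also have "(\<Sum>i\<in>S-{j}. c' i * a i s) = (\<Sum>l\<in>S-{j}. c l * a l s)"
        by (intro sum.cong) (auto simp: c'_def)
      also have "c' j * a j s = - (\<Sum>l\<in>S-{j}. c l * (a l t / a j t * a j s))"
        by (simp add: c'_def sum_distrib_right mult.assoc)
      finally show ?thesis by (simp add: right_diff_distrib sum_subtractf)
    qed
    have "(\<Sum>i\<in>S. c' i * a i s) = 0" if "s \<in> insert t T" for s
      unfolding sum using that c(2) j by auto
    moreover have "\<exists>i\<in>S. c' i \<noteq> 0" using c(1) by (auto simp: c'_def)
    ultimately show ?thesis by (intro exI[of _ c']) simp
  qed
qed

text \<open>Induction on \<open>T\<close>. If \<open>W\<close> already attains all values on
  \<open>T\<close>, a new coordinate \<open>t\<close> is free unless every member of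
  \<open>W\<close> vanishing on \<open>T\<close> also vanishes at \<open>t\<close>; in that case the
  value at \<open>t\<close> is a fixed combination of the values on \<open>T\<close>, which gives
  the functional \<open>v\<close>. It serves for duality on a face, for surjectivity of evaluation,
  and for the linear parts of a reduction.\<close>

lemma full_or_orthogonal:
  fixes W :: "('t \<Rightarrow> 'k::field) set"
  assumes "finite T"
    and zero: "(\<lambda>_. 0) \<in> W" and add: "\<And>f g. f \<in> W \<Longrightarrow> g \<in> W \<Longrightarrow> (\<lambda>t. f t + g t) \<in> W"
    and scale: "\<And>c f. f \<in> W \<Longrightarrow> (\<lambda>t. c * f t) \<in> W"
  shows "(\<forall>g. \<exists>w\<in>W. \<forall>t\<in>T. w t = g t) \<or>
    (\<exists>v. (\<exists>t\<in>T. v t \<noteq> 0) \<and> (\<forall>w\<in>W. (\<Sum>t\<in>T. v t * w t) = 0))"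
  using \<open>finite T\<close>
proof (induction T rule: finite_induct)
  case empty
  then show ?case using zero by auto
next
  case (insert t T)
  have sum_in: "(\<lambda>x. \<Sum>s\<in>A. b s * g s x) \<in> W" if "finite A" "\<And>s. s \<in> A \<Longrightarrow> g s \<in> W" for A b and g :: "'t \<Rightarrow> 't \<Rightarrow> 'k"
    using that by (induction A rule: finite_induct) (auto intro!: zero add scale)
  from insert.IH show ?case
  proof (elim disjE)
    assume full: "\<forall>g. \<exists>w\<in>W. \<forall>t\<in>T. w t = g t"
    show ?thesis
    proof (cases "\<exists>w\<in>W. (\<forall>s\<in>T. w s = 0) \<and> w t \<noteq> 0")
      case True
      then obtain w0 where w0: "w0 \<in> W" "\<forall>s\<in>T. w0 s = 0" "w0 t \<noteq> 0" by auto
      have "\<exists>w\<in>W. \<forall>s\<in>insert t T. w s = g s" for g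
      proof -
        obtain w where w: "w \<in> W" "\<forall>s\<in>T. w s = g s" using full by blast
        have "(\<lambda>s. w s + (g t - w t) / w0 t * w0 s) \<in> W" using w w0 by (intro add scale)
        moreover have "\<forall>s\<in>insert t T. w s + (g t - w t) / w0 t * w0 s = g s" using w w0 by auto
        ultimately show ?thesis by (intro bexI)
      qed
      thus ?thesis by blast
    next
      case False
      have "\<forall>s. \<exists>w\<in>W. \<forall>r\<in>T. w r = (if r = s then 1 else 0)" using full by simp
      then obtain \<delta> where \<delta>: "\<And>s. \<delta> s \<in> W" "\<And>s r. r \<in> T \<Longrightarrow> \<delta> s r = (if r = s then 1 else 0)" by metis
      define v where "v s = (if s = t then 1 else - \<delta> s t)" for s
      have "(\<Sum>s\<in>insert t T. v s * w s) = 0" if "w \<in> W" for w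
      proof -
        have "(\<lambda>x. w x + (\<Sum>s\<in>T. (- w s) * \<delta> s x)) \<in> W"
          using that \<delta> insert by (intro add sum_in)
        moreover have "\<forall>r\<in>T. w r + (\<Sum>s\<in>T. (- w s) * \<delta> s r) = 0"
          using \<delta>(2) insert.hyps by (simp add: if_distrib[of "\<lambda>z. _ * z"] cong: if_cong)
        ultimately have "w t + (\<Sum>s\<in>T. (- w s) * \<delta> s t) = 0" using False by force
        moreover have "(\<Sum>s\<in>T. v s * w s) = (\<Sum>s\<in>T. (- w s) * \<delta> s t)"
          using insert.hyps by (intro sum.cong) (auto simp: v_def)
        ultimately show ?thesis using insert.hyps by (simp add: v_def)
      qed
      moreover have "v t \<noteq> 0" by (simp add: v_def)
      ultimately show ?thesis by blast
    qed
  next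
    assume "\<exists>v. (\<exists>t\<in>T. v t \<noteq> 0) \<and> (\<forall>w\<in>W. (\<Sum>t\<in>T. v t * w t) = 0)"
    then obtain v where v: "\<exists>t\<in>T. v t \<noteq> 0" "\<forall>w\<in>W. (\<Sum>t\<in>T. v t * w t) = 0" by auto
    have "(\<Sum>s\<in>insert t T. (v(t := 0)) s * w s) = (\<Sum>s\<in>T. v s * w s)" for w
      using insert.hyps by (simp add: sum.insert) (intro sum.cong; auto)
    moreover have "\<exists>s\<in>insert t T. (v(t := 0)) s \<noteq> 0" using v(1) insert.hyps by auto
    ultimately show ?thesis using v(2) by metis
  qed
qed

text \<open>A nonempty finite chain contains its union as its largest member; removing it gives the
  induction.\<close>

lemma finite_chain_enum:
  assumes "finite C" "subset.chain \<A> C"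
  shows "\<exists>J. C = J ` {..<card C} \<and> (\<forall>i j. i < j \<longrightarrow> j < card C \<longrightarrow> J i \<subset> (J j :: 'a set))"
  using assms
proof (induction "card C" arbitrary: C)
  case 0
  then show ?case by auto
next
  case (Suc n)
  hence ne: "C \<noteq> {}" by auto
  hence U: "\<Union>C \<in> C" using Suc.prems Union_in_chain by blast
  have "card (C - {\<Union>C}) = n" using Suc U by simp
  moreover have "subset.chain \<A> (C - {\<Union>C})" using Suc.prems by (auto simp: subset.chain_def)
  ultimately obtain J where J: "C - {\<Union>C} = J ` {..<n}" "\<forall>i j. i < j \<longrightarrow> j < n \<longrightarrow> J i \<subset> J j"
    using Suc.hyps(1)[of "C - {\<Union>C}"] Suc.prems by auto
  define J' where "J' = J(n := \<Union>C)"
  have J': "J' n = \<Union>C" "\<And>i. i < n \<Longrightarrow> J' i = J i" by (auto simp: J'_def)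
  have img: "C = J' ` {..<Suc n}"
  proof -
    have "J' ` {..<n} = J ` {..<n}" using J'(2) by (intro image_cong) auto
    hence "J' ` {..<Suc n} = insert (\<Union>C) (C - {\<Union>C})" unfolding J(1) lessThan_Suc by (simp add: J'(1))
    also have "\<dots> = C" using U by (rule insert_Diff)
    finally show ?thesis by (rule sym)
  qed
  have inc: "J' i \<subset> J' j" if "i < j" "j < Suc n" for i j
  proof (cases "j = n")
    case True
    have "J i \<in> C - {\<Union>C}" unfolding J(1) using that True by simp
    hence "J i \<subseteq> \<Union>C" "J i \<noteq> \<Union>C" by blast+
    thus ?thesis using that True J' by simp
  next
    case False
    thus ?thesis using J(2) J'(2) that by simp
  qed
  show ?case unfolding \<open>Suc n = card C\<close>[symmetric] using img inc by (intro exI[of _ J'] conjI) simp_all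
qed

text \<open>Ideals of a type-class ring as plain sets, so that computations stay in the polynomial
  type; HOL-Algebra ideals are reached through the surjections of \<open>ring_surj\<close>.\<close>

definition idealset :: "'r::comm_ring_1 set \<Rightarrow> bool" where
  "idealset J \<longleftrightarrow> 0 \<in> J \<and> (\<forall>a\<in>J. \<forall>b\<in>J. a + b \<in> J) \<and> (\<forall>a\<in>J. \<forall>r. r * a \<in> J)"

lemma idealset_0: "idealset J \<Longrightarrow> 0 \<in> J"
  and idealset_add: "idealset J \<Longrightarrow> a \<in> J \<Longrightarrow> b \<in> J \<Longrightarrow> a + b \<in> J"
  and idealset_mult: "idealset J \<Longrightarrow> a \<in> J \<Longrightarrow> r * a \<in> J"
  by (auto simp: idealset_def)

lemma idealset_mult_right: "idealset J \<Longrightarrow> a \<in> J \<Longrightarrow> a * r \<in> J"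
  using idealset_mult[of J a r] by (simp add: mult.commute)

lemma idealset_uminus: "idealset J \<Longrightarrow> a \<in> J \<Longrightarrow> - a \<in> J"
  using idealset_mult[of J a "- 1"] by simp

lemma idealset_diff: "idealset J \<Longrightarrow> a \<in> J \<Longrightarrow> b \<in> J \<Longrightarrow> a - b \<in> J"
  using idealset_add[of J a "- b"] idealset_uminus by auto

lemma idealset_sum: "idealset J \<Longrightarrow> (\<And>i. i \<in> A \<Longrightarrow> f i \<in> J) \<Longrightarrow> sum f A \<in> J"
  by (induction A rule: infinite_finite_induct) (auto intro: idealset_0 idealset_add)

section \<open>Koszul complexes and regular sequences\<close>

definition koszul_sign :: "nat \<Rightarrow> nat set \<Rightarrow> 'r::comm_ring_1" where
  "koszul_sign j A = (- 1) ^ card {i\<in>A. i < j}"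

text \<open>\<open>f A\<close> is the coefficient of the exterior basis element e_A. The
  differential is read from the target side: e_A receives one term for every index \<open>j\<close>
  outside \<open>A\<close>, with the sign given by the number of indices of \<open>A\<close> below
  \<open>j\<close>.\<close>

definition koszul_diff :: "nat \<Rightarrow> (nat \<Rightarrow> 'r::comm_ring_1) \<Rightarrow> (nat set \<Rightarrow> 'r) \<Rightarrow> nat set \<Rightarrow> 'r" where
  "koszul_diff n y f A = (\<Sum>j\<in>{1..n} - A. koszul_sign j A * (y j * f (insert j A)))"

definition koszul_chain :: "nat \<Rightarrow> nat \<Rightarrow> (nat set \<Rightarrow> 'r::comm_ring_1) \<Rightarrow> bool" where
  "koszul_chain n i f \<longleftrightarrow> (\<forall>A. f A \<noteq> 0 \<longrightarrow> A \<subseteq> {1..n} \<and> card A = i)"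

text \<open>Vanishing of the \<open>i\<close>-th Koszul homology of \<open>y\<close> with coefficients in the quotient by \<open>J\<close>;
  chains are represented by lifts.\<close>

definition koszul_exact :: "nat \<Rightarrow> (nat \<Rightarrow> 'r::comm_ring_1) \<Rightarrow> 'r set \<Rightarrow> nat \<Rightarrow> bool" where
  "koszul_exact n y J i \<longleftrightarrow>
     (\<forall>f. koszul_chain n i f \<longrightarrow> (\<forall>A\<subseteq>{1..n}. koszul_diff n y f A \<in> J) \<longrightarrow>
       (\<exists>g. koszul_chain n (Suc i) g \<and> (\<forall>A\<subseteq>{1..n}. f A - koszul_diff n y g A \<in> J)))"

lemma koszul_sign_insert:
  assumes "finite A" "j \<notin> A"
  shows "koszul_sign i (insert j A) = (if j < i then - koszul_sign i A else koszul_sign i A)"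
proof -
  have "{l \<in> insert j A. l < i} = (if j < i then insert j {l\<in>A. l < i} else {l\<in>A. l < i})" by auto
  thus ?thesis using assms by (simp add: koszul_sign_def)
qed

lemma koszul_sign_square: "koszul_sign i A * (koszul_sign i A * r) = r"
  by (simp add: koszul_sign_def power_mult_distrib[symmetric] mult.assoc[symmetric])

lemma koszul_sign_swap:
  assumes "finite A" "i \<notin> A" "j \<notin> A" "i \<noteq> j"
  shows "koszul_sign j A * koszul_sign i (insert j A) = - (koszul_sign i A * koszul_sign j (insert i A))"
  using assms by (auto simp: koszul_sign_insert mult.commute)

lemma koszul_diff_add: "koszul_diff n y (\<lambda>A. f A + g A) B = koszul_diff n y f B + koszul_diff n y g B"
  by (simp add: koszul_diff_def algebra_simps sum.distrib)

lemma koszul_diff_scale: "koszul_diff n y (\<lambda>A. c * f A) B = c * koszul_diff n y f B"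
  by (simp add: koszul_diff_def algebra_simps sum_distrib_left)

lemma koszul_diff_sum:
  "koszul_diff n y (\<lambda>A. \<Sum>k\<in>K. f k A) B = (\<Sum>k\<in>K. koszul_diff n y (f k) B)"
proof (induction K rule: infinite_finite_induct)
  case (insert k K)
  thus ?case by (simp add: koszul_diff_add)
qed (simp_all add: koszul_diff_def)

lemma koszul_diff_in:
  assumes "idealset J" "\<And>A. A \<subseteq> {1..n} \<Longrightarrow> f A \<in> J" "B \<subseteq> {1..n}"
  shows "koszul_diff n y f B \<in> J"
  unfolding koszul_diff_def using assms by (intro idealset_sum idealset_mult) auto

lemma koszul_diff_degree:
  assumes "koszul_chain n (Suc i) f" "A \<subseteq> {1..n}" "card A \<noteq> i"
  shows "koszul_diff n y f A = 0"
proof -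
  have "f (insert j A) = 0" if "j \<in> {1..n} - A" for j
  proof -
    have "finite A" using assms(2) finite_subset by blast
    hence "card (insert j A) \<noteq> Suc i" using that assms(3) by simp
    thus ?thesis using assms(1) unfolding koszul_chain_def by blast
  qed
  thus ?thesis by (simp add: koszul_diff_def)
qed

text \<open>The double sum splits into the pairs with j < i and those with i < j; the two orders of
  inserting i and j carry opposite signs.\<close>

lemma koszul_diff_diff:
  assumes "A \<subseteq> {1..n}"
  shows "koszul_diff n y (koszul_diff n y f) A = 0"
proof -
  define U where "U = {1..n} - A"
  have fin: "finite U" "finite A" using assms finite_subset by (auto simp: U_def)
  define h where "h j i = koszul_sign j A * koszul_sign i (insert j A) * (y j * y i * f (insert i (insert j A)))" for j i
  have U_ins: "{1..n} - insert j A = U - {j}" for j by (auto simp: U_def)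
  have "koszul_diff n y (koszul_diff n y f) A = (\<Sum>j\<in>U. \<Sum>i\<in>U - {j}. h j i)"
    unfolding koszul_diff_def U_ins U_def[symmetric] h_def sum_distrib_left by (simp add: mult_ac)
  also have "\<dots> = (\<Sum>(j,i)\<in>Sigma U (\<lambda>j. U - {j}). h j i)" using fin by (simp add: sum.Sigma)
  also have "Sigma U (\<lambda>j. U - {j}) = {(j,i). j \<in> U \<and> i \<in> U \<and> j < i} \<union> {(j,i). j \<in> U \<and> i \<in> U \<and> i < j}" by auto
  also have "(\<Sum>(j,i)\<in>\<dots>. h j i) = (\<Sum>(j,i)\<in>{(j,i). j \<in> U \<and> i \<in> U \<and> j < i}. h j i)
      + (\<Sum>(j,i)\<in>{(j,i). j \<in> U \<and> i \<in> U \<and> i < j}. h j i)"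
    by (intro sum.union_disjoint) (auto intro: finite_subset[of _ "U \<times> U"] simp: fin)
  also have "(\<Sum>(j,i)\<in>{(j,i). j \<in> U \<and> i \<in> U \<and> i < j}. h j i)
      = (\<Sum>(j,i)\<in>{(j,i). j \<in> U \<and> i \<in> U \<and> j < i}. h i j)"
    by (rule sum.reindex_bij_witness[of _ prod.swap prod.swap]) auto
  also have "\<dots> = (\<Sum>(j,i)\<in>{(j,i). j \<in> U \<and> i \<in> U \<and> j < i}. - h j i)"
  proof (intro sum.cong refl, clarify)
    fix j i assume *: "j \<in> U" "i \<in> U" "j < i"
    have "koszul_sign i A * koszul_sign j (insert i A) = (- (koszul_sign j A * koszul_sign i (insert j A)) :: 'a)"
      using * fin by (intro koszul_sign_swap) (auto simp: U_def)
    moreover have "insert i (insert j A) = insert j (insert i A)" by auto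
    ultimately show "h i j = - h j i" by (simp add: h_def mult_ac)
  qed
  also have "(\<Sum>(j,i)\<in>{(j,i). j \<in> U \<and> i \<in> U \<and> j < i}. h j i) + \<dots> = 0"
    by (simp add: sum_negf split_def)
  finally show ?thesis .
qed

text \<open>Exterior multiplication by e_k from the left.\<close>

definition koszul_homotopy :: "nat \<Rightarrow> (nat set \<Rightarrow> 'r::comm_ring_1) \<Rightarrow> nat set \<Rightarrow> 'r" where
  "koszul_homotopy k f A = (if k \<in> A then koszul_sign k (A - {k}) * f (A - {k}) else 0)"

text \<open>Multiplication by \<open>y k\<close> is null-homotopic, so the whole ideal of the
  \<open>y\<close> annihilates Koszul homology. For \<open>k\<close> in \<open>A\<close> the second
  summand contains the extra index \<open>k\<close>, where the sign squares to one, and all other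
  terms cancel by anticommutation; for \<open>k\<close> outside \<open>A\<close> only the index
  \<open>k\<close> survives.\<close>

lemma koszul_homotopy:
  assumes "k \<in> {1..n}" "A \<subseteq> {1..n}"
  shows "koszul_diff n y (koszul_homotopy k f) A + koszul_homotopy k (koszul_diff n y f) A = y k * f A"
proof (cases "k \<in> A")
  case True
  define B where "B = A - {k}"
  have A: "A = insert k B" "k \<notin> B" using True by (auto simp: B_def)
  have fin: "finite A" "finite B" using assms finite_subset by (auto simp: B_def)
  define V where "V = {1..n} - A"
  have V: "{1..n} - B = insert k V" "k \<notin> V" "finite V" using assms True by (auto simp: V_def B_def)
  have "koszul_homotopy k (koszul_diff n y f) A
      = koszul_sign k B * (\<Sum>j\<in>insert k V. koszul_sign j B * (y j * f (insert j B)))"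
    using True V by (simp add: koszul_homotopy_def koszul_diff_def flip: B_def)
  also have "\<dots> = y k * f A + (\<Sum>j\<in>V. koszul_sign k B * (koszul_sign j B * (y j * f (insert j B))))"
    using V A by (simp add: distrib_left koszul_sign_square sum_distrib_left)
  finally have 1: "koszul_homotopy k (koszul_diff n y f) A =
    y k * f A + (\<Sum>j\<in>V. koszul_sign k B * (koszul_sign j B * (y j * f (insert j B))))" .
  have "koszul_diff n y (koszul_homotopy k f) A
      = (\<Sum>j\<in>V. - (koszul_sign k B * (koszul_sign j B * (y j * f (insert j B)))))"
    unfolding koszul_diff_def V_def[symmetric]
  proof (intro sum.cong refl)
    fix j assume j: "j \<in> V"
    have "j \<noteq> k" "j \<notin> B" using j V by (auto simp: V_def B_def)
    have "insert j A - {k} = insert j B" using A \<open>j \<noteq> k\<close> by auto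
    hence "koszul_homotopy k f (insert j A) = koszul_sign k (insert j B) * f (insert j B)"
      using A by (simp add: koszul_homotopy_def)
    hence "koszul_sign j A * (y j * koszul_homotopy k f (insert j A))
        = koszul_sign j A * koszul_sign k (insert j B) * (y j * f (insert j B))" by (simp add: mult_ac)
    also have "koszul_sign j A * koszul_sign k (insert j B) = (- (koszul_sign k B * koszul_sign j B) :: 'a)"
      unfolding A(1) using fin A \<open>j \<noteq> k\<close> \<open>j \<notin> B\<close> by (auto simp: koszul_sign_insert mult.commute)
    finally show "koszul_sign j A * (y j * koszul_homotopy k f (insert j A))
        = - (koszul_sign k B * (koszul_sign j B * (y j * f (insert j B))))"
      by (simp add: mult.assoc)
  qed
  thus ?thesis unfolding 1 by (simp add: sum_negf)
next
  case False
  have "koszul_diff n y (koszul_homotopy k f) A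
      = (\<Sum>j\<in>{1..n} - A. if j = k then koszul_sign k A * (y k * koszul_homotopy k f (insert k A)) else 0)"
    unfolding koszul_diff_def using False by (intro sum.cong) (auto simp: koszul_homotopy_def)
  also have "\<dots> = koszul_sign k A * (y k * koszul_homotopy k f (insert k A))"
    using assms False by (simp add: sum.delta)
  also have "\<dots> = y k * f A"
    using False by (simp add: koszul_homotopy_def mult.left_commute[of "y k"] koszul_sign_square)
  finally show ?thesis using False by (simp add: koszul_homotopy_def)
qed

text \<open>The long exact homology sequence of multiplication by \<open>x\<close>, by hand. As
  \<open>x\<close> is regular modulo \<open>J\<close>, vanishing of homology in degree i + 1 modulo
  \<open>x\<close> makes \<open>x\<close> injective on homology in degree i. A power of
  \<open>x\<close> lies in the ideal of the \<open>y\<close> modulo \<open>J\<close>, so it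
  annihilates that homology, which is therefore zero.\<close>

lemma koszul_exact_step:
  fixes x :: "'r::comm_ring_1"
  assumes J: "idealset J"
    and regular: "\<And>r. r * x \<in> J \<Longrightarrow> r \<in> J"
    and nilpotent: "x ^ N - (\<Sum>k=1..n. c k * y k) \<in> J"
    and exact: "koszul_exact n y {a + r * x | a r. a \<in> J} (Suc i)"
  shows "koszul_exact n y J i"
proof -
  let ?U = "{1..n}"
  define bdry where "bdry f \<longleftrightarrow> (\<exists>g. koszul_chain n (Suc i) g \<and> (\<forall>A\<subseteq>?U. f A - koszul_diff n y g A \<in> J))" for f
  \<comment> \<open>The connecting map, modulo \<open>J\<close> and with d for the differential: if
    x f = d g, then \<open>g\<close> is a cycle modulo \<open>x\<close>, so g = d h + x e; thus x f
    = x d e, and \<open>x\<close> cancels.\<close>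
  have x_inj: "bdry f" if x: "bdry (\<lambda>A. x * f A)" for f
  proof -
    obtain g where g: "koszul_chain n (Suc i) g" "\<And>A. A \<subseteq> ?U \<Longrightarrow> x * f A - koszul_diff n y g A \<in> J"
      using x unfolding bdry_def by blast
    have "koszul_diff n y g A \<in> {a + r * x | a r. a \<in> J}" if "A \<subseteq> ?U" for A
    proof -
      have "koszul_diff n y g A = - (x * f A - koszul_diff n y g A) + f A * x" by (simp add: mult.commute)
      thus ?thesis using idealset_uminus[OF J g(2)[OF that]] by blast
    qed
    then obtain h where h: "koszul_chain n (Suc (Suc i)) h"
      "\<And>A. A \<subseteq> ?U \<Longrightarrow> g A - koszul_diff n y h A \<in> {a + r * x | a r. a \<in> J}"
      using exact g(1) unfolding koszul_exact_def by blast
    have "\<forall>A. \<exists>r. A \<subseteq> ?U \<longrightarrow> g A - koszul_diff n y h A - r * x \<in> J" 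
    proof
      fix A
      show "\<exists>r. A \<subseteq> ?U \<longrightarrow> g A - koszul_diff n y h A - r * x \<in> J"
      proof (cases "A \<subseteq> ?U")
        case True
        then obtain a r where "a \<in> J" "g A - koszul_diff n y h A = a + r * x" using h(2)[of A] by blast
        thus ?thesis by (intro exI[of _ r]) simp
      qed simp
    qed
    then obtain e0 where e0: "\<And>A. A \<subseteq> ?U \<Longrightarrow> g A - koszul_diff n y h A - e0 A * x \<in> J" by metis
    \<comment> \<open>\<open>e0\<close> is arbitrary in the wrong degrees; it may be cut off there
      because \<open>g\<close> and the boundary of \<open>h\<close> vanish in those degrees.\<close>
    define e where "e A = (if A \<subseteq> ?U \<and> card A = Suc i then e0 A else 0)" for A
    have e: "g A - koszul_diff n y h A - e A * x \<in> J" if "A \<subseteq> ?U" for A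
    proof (cases "card A = Suc i")
      case False
      hence "g A = 0" "koszul_diff n y h A = 0"
        using g(1) koszul_diff_degree[OF h(1) that] by (auto simp: koszul_chain_def)
      thus ?thesis using False J by (simp add: e_def idealset_0)
    qed (use e0[OF that] that in \<open>simp add: e_def\<close>)
    have e_chain: "koszul_chain n (Suc i) e" by (auto simp: koszul_chain_def e_def)
    have "f A - koszul_diff n y e A \<in> J" if A: "A \<subseteq> ?U" for A
    proof (rule regular)
      define q where "q B = g B - koszul_diff n y h B - e B * x" for B
      have "koszul_diff n y q A \<in> J" using J e A by (intro koszul_diff_in) (auto simp: q_def)
      moreover have "koszul_diff n y g A = koszul_diff n y (\<lambda>B. q B + (koszul_diff n y h B + x * e B)) A"
        by (simp add: q_def mult.commute)
      hence "koszul_diff n y g A = koszul_diff n y q A + x * koszul_diff n y e A"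
        using A by (simp add: koszul_diff_add koszul_diff_scale koszul_diff_diff)
      hence "(f A - koszul_diff n y e A) * x = (x * f A - koszul_diff n y g A) + koszul_diff n y q A"
        by (simp add: algebra_simps)
      ultimately show "(f A - koszul_diff n y e A) * x \<in> J"
        using idealset_add[OF J g(2)[OF A]] by simp
    qed
    thus ?thesis using e_chain unfolding bdry_def by blast
  qed
  have "bdry f" if f: "koszul_chain n i f" "\<And>A. A \<subseteq> ?U \<Longrightarrow> koszul_diff n y f A \<in> J" for f
  proof -
    \<comment> \<open>The homotopy for \<open>\<Sum>k. c k * y k\<close>, which is
      \<open>x ^ N\<close> modulo \<open>J\<close>; since \<open>f\<close> is a cycle modulo
      \<open>J\<close>, the boundary of \<open>g\<close> is \<open>x ^ N * f\<close> there.\<close>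
    define g where "g A = (\<Sum>k=1..n. c k * koszul_homotopy k f A)" for A
    have chain: "koszul_chain n (Suc i) g"
      unfolding koszul_chain_def
    proof (intro allI impI)
      fix A assume "g A \<noteq> 0"
      then obtain k where "k \<in> {1..n}" "koszul_homotopy k f A \<noteq> 0"
        unfolding g_def by (metis (no_types, lifting) mult_not_zero sum.neutral)
      hence k: "k \<in> {1..n}" "k \<in> A" "f (A - {k}) \<noteq> 0" by (auto simp: koszul_homotopy_def split: if_splits)
      hence *: "A - {k} \<subseteq> {1..n}" "card (A - {k}) = i" using f(1) unfolding koszul_chain_def by blast+
      hence "finite (A - {k})" using finite_subset by blast
      hence "finite A" by simp
      hence "card A = Suc i" using * k(2) by (metis card_Suc_Diff1)
      thus "A \<subseteq> ?U \<and> card A = Suc i" using * k by blast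
    qed
    have "x ^ N * f A - koszul_diff n y g A \<in> J" if A: "A \<subseteq> ?U" for A
    proof -
      have "koszul_homotopy k (koszul_diff n y f) A \<in> J" for k
        using J A f(2)[of "A - {k}"] by (auto simp: koszul_homotopy_def intro!: idealset_mult idealset_0)
      hence 1: "(\<Sum>k=1..n. c k * koszul_homotopy k (koszul_diff n y f) A) \<in> J"
        using J by (intro idealset_sum idealset_mult)
      have "koszul_diff n y g A = (\<Sum>k=1..n. c k * koszul_diff n y (koszul_homotopy k f) A)"
        unfolding g_def by (simp add: koszul_diff_sum koszul_diff_scale)
      also have "\<dots> = (\<Sum>k=1..n. c k * (y k * f A - koszul_homotopy k (koszul_diff n y f) A))"
      proof (intro sum.cong refl)
        fix k assume "k \<in> {1..n}"
        from koszul_homotopy[OF this A, of y f]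
        show "c k * koszul_diff n y (koszul_homotopy k f) A = c k * (y k * f A - koszul_homotopy k (koszul_diff n y f) A)"
          by (metis add_diff_cancel_right')
      qed
      also have "\<dots> = (\<Sum>k=1..n. c k * y k) * f A - (\<Sum>k=1..n. c k * koszul_homotopy k (koszul_diff n y f) A)"
        by (simp add: right_diff_distrib sum_subtractf sum_distrib_right mult.assoc)
      finally have "x ^ N * f A - koszul_diff n y g A = f A * (x ^ N - (\<Sum>k=1..n. c k * y k))
          + (\<Sum>k=1..n. c k * koszul_homotopy k (koszul_diff n y f) A)" by (simp add: algebra_simps)
      thus ?thesis using idealset_add[OF J idealset_mult[OF J nilpotent] 1] by simp
    qed
    hence "bdry (\<lambda>A. x ^ N * f A)" using chain unfolding bdry_def by blast
    \<comment> \<open>\<open>x_inj\<close> removes the factors \<open>x\<close> one at a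
      time.\<close>
    thus ?thesis
    proof (induction N)
      case (Suc N)
      thus ?case using x_inj[of "\<lambda>A. x ^ N * f A"] by (simp add: mult.assoc)
    qed simp
  qed
  thus ?thesis unfolding koszul_exact_def bdry_def by blast
qed

text \<open>Descent along \<open>x\<close>: modulo \<open>J n\<close> there are no nonzero chains in
  degrees above \<open>n\<close>, and each step from \<open>J (Suc k)\<close> back to
  \<open>J k\<close> improves the vanishing range by one degree, so that at \<open>J 0\<close> all
  positive degrees are reached. For this, \<open>x\<close> must have as many members as
  \<open>y\<close>; otherwise the two are related only by powers of the \<open>x k\<close> lying in
  the ideal of the \<open>y\<close>.\<close>

theorem koszul_exact_of_regular:
  fixes x y :: "nat \<Rightarrow> 'r::comm_ring_1" and J :: "nat \<Rightarrow> 'r set"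
  assumes J: "\<And>k. k \<le> n \<Longrightarrow> idealset (J k)"
    and J_Suc: "\<And>k. k < n \<Longrightarrow> J (Suc k) = {a + r * x k | a r. a \<in> J k}"
    and regular: "\<And>k r. k < n \<Longrightarrow> r * x k \<in> J k \<Longrightarrow> r \<in> J k"
    and nilpotent: "\<And>k. k < n \<Longrightarrow> \<exists>N c. x k ^ N - (\<Sum>j=1..n. c j * y j) \<in> J 0"
    and "i > 0"
  shows "koszul_exact n y (J 0) i"
proof -
  have sub: "J 0 \<subseteq> J k" if "k \<le> n" for k
    using that
  proof (induction k)
    case (Suc k)
    have "a \<in> J (Suc k)" if "a \<in> J k" for a
    proof -
      have "a = a + 0 * x k" by simp
      moreover have "k < n" using Suc.prems by simp
      ultimately show ?thesis unfolding J_Suc[OF \<open>k < n\<close>] using that by blast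
    qed
    thus ?case using Suc by auto
  qed simp
  have "\<forall>i>n - m. koszul_exact n y (J (n - m)) i" if "m \<le> n" for m
    using that
  proof (induction m)
    case 0
    have "koszul_exact n y (J n) i" if "i > n" for i
      unfolding koszul_exact_def
    proof (intro allI impI)
      fix f :: "nat set \<Rightarrow> 'r" assume f: "koszul_chain n i f"
      have "f A = 0" for A
      proof (rule ccontr)
        assume "f A \<noteq> 0"
        hence "A \<subseteq> {1..n}" "card A = i" using f by (auto simp: koszul_chain_def)
        thus False using card_mono[of "{1..n}" A] that by simp
      qed
      moreover have "koszul_diff n y (\<lambda>_. 0) A = 0" for A by (simp add: koszul_diff_def)
      ultimately show "\<exists>g. koszul_chain n (Suc i) g \<and> (\<forall>A\<subseteq>{1..n}. f A - koszul_diff n y g A \<in> J n)"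
        using idealset_0[OF J[of n]] by (intro exI[of _ "\<lambda>_. 0"]) (auto simp: koszul_chain_def)
    qed
    thus ?case by simp
  next
    case (Suc m)
    define k where "k = n - Suc m"
    have k: "k < n" "n - m = Suc k" using Suc.prems by (auto simp: k_def)
    obtain N c where "x k ^ N - (\<Sum>j=1..n. c j * y j) \<in> J 0" using nilpotent[OF k(1)] by blast
    hence "x k ^ N - (\<Sum>j=1..n. c j * y j) \<in> J k" using sub[of k] k by auto
    note nilp = this
    have "koszul_exact n y (J k) i" if "i > k" for i
    proof (rule koszul_exact_step[OF _ _ nilp])
      show "idealset (J k)" using J k by simp
      show "r \<in> J k" if "r * x k \<in> J k" for r using regular[OF k(1) that] .
      have "Suc i > Suc k" using that by simp
      hence "koszul_exact n y (J (Suc k)) (Suc i)" using Suc.IH Suc.prems k by auto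
      thus "koszul_exact n y {a + r * x k | a r. a \<in> J k} (Suc i)" unfolding J_Suc[OF k(1)] .
    qed
    thus ?case unfolding k_def by blast
  qed
  from this[of n] show ?thesis using \<open>i > 0\<close> by simp
qed

section \<open>Dimension counts for subspaces of one ambient vector space\<close>

context vector_space
begin

text \<open>The \<open>\<phi> t\<close> are dual coordinates for the \<open>e t\<close>; testing a
  relation with them gives both independence and injectivity of \<open>e\<close>.\<close>

lemma dim_coordinates:
  assumes "finite T"
    and e: "\<And>t. t \<in> T \<Longrightarrow> e t \<in> V"
    and \<phi>_sum: "\<And>c s. s \<in> T \<Longrightarrow> \<phi> s (\<Sum>t\<in>T. scale (c t) (e t)) = c s"
    and expand: "\<And>v. v \<in> V \<Longrightarrow> v = (\<Sum>t\<in>T. scale (\<phi> t v) (e t))"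
  shows "dim V = card T"
proof -
  have zero: "\<forall>t\<in>T. c t = 0" if "(\<Sum>t\<in>T. scale (c t) (e t)) = 0" for c
  proof
    fix t assume t: "t \<in> T"
    have "c t = \<phi> t (\<Sum>t\<in>T. scale (c t) (e t))" using \<phi>_sum t by simp
    also have "\<dots> = \<phi> t (\<Sum>t\<in>T. scale 0 (e t))" using that by simp
    also have "\<dots> = 0" using \<phi>_sum[OF t, of "\<lambda>_. 0"] by simp
    finally show "c t = 0" .
  qed
  have inj: "inj_on e T"
  proof (rule inj_onI, rule ccontr)
    fix s t assume *: "s \<in> T" "t \<in> T" "e s = e t" "s \<noteq> t"
    have "(\<Sum>r\<in>T. scale (if r = s then 1 else if r = t then - 1 else 0) (e r))
       = (\<Sum>r\<in>{s,t}. scale (if r = s then 1 else if r = t then - 1 else 0) (e r))"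
      using * assms(1) by (intro sum.mono_neutral_right) auto
    also have "\<dots> = 0" using * by simp
    finally show False using zero[of "\<lambda>r. if r = s then 1 else if r = t then - 1 else 0"] * by auto
  qed
  have "independent (e ` T)"
  proof (rule independent_if_scalars_zero)
    show "finite (e ` T)" using assms(1) by simp
    fix f x assume f: "(\<Sum>x\<in>e ` T. scale (f x) x) = 0" and x: "x \<in> e ` T"
    have "(\<Sum>t\<in>T. scale (f (e t)) (e t)) = 0" using f inj by (simp add: sum.reindex)
    from zero[of "\<lambda>t. f (e t)", OF this] show "f x = 0" using x by auto
  qed
  moreover have "V \<subseteq> span (e ` T)"
  proof
    fix v assume "v \<in> V"
    have "(\<Sum>t\<in>T. scale (\<phi> t v) (e t)) \<in> span (e ` T)"
      by (intro span_sum span_scale span_base) auto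
    thus "v \<in> span (e ` T)" using expand[OF \<open>v \<in> V\<close>] by simp
  qed
  ultimately have "card (e ` T) = dim V" using e by (intro basis_card_eq_dim) auto
  thus ?thesis using inj by (simp add: card_image)
qed

lemma finite_basis_exists:
  assumes "V \<subseteq> span S" "finite S"
  obtains B where "B \<subseteq> V" "independent B" "V \<subseteq> span B" "finite B" "card B = dim V"
proof -
  obtain B where B: "B \<subseteq> V" "independent B" "V \<subseteq> span B" "card B = dim V"
    using basis_exists[of V] by blast
  have "B \<subseteq> span S" using B(1) assms(1) by (rule order_trans)
  hence "finite B" using independent_span_bound[OF assms(2) B(2)] by blast
  with B that show ?thesis by blast
qed

lemma subspace_eq_of_dim:
  assumes "subspace W" "subspace V" "W \<subseteq> V" "V \<subseteq> span S" "finite S" "dim V \<le> dim W"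
  shows "W = V"
proof (rule ccontr)
  assume "W \<noteq> V"
  then obtain v where v: "v \<in> V" "v \<notin> W" using assms(3) by blast
  have "W \<subseteq> span S" using assms(3,4) by (rule order_trans)
  then obtain B where B: "B \<subseteq> W" "independent B" "W \<subseteq> span B" "finite B" "card B = dim W"
    using finite_basis_exists[OF _ assms(5)] by metis
  have "span B \<subseteq> W" using B(1) assms(1) by (rule span_minimal)
  hence "v \<notin> span B" using v(2) by blast
  hence ind: "independent (insert v B)" using B(2) by (rule independent_insertI)
  obtain C where C: "C \<subseteq> V" "independent C" "V \<subseteq> span C" "finite C" "card C = dim V"
    using finite_basis_exists[OF assms(4,5)] by metis
  have "insert v B \<subseteq> V" using v(1) B(1) assms(3) by blast
  hence "insert v B \<subseteq> span C" using C(3) by (rule order_trans)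
  hence "card (insert v B) \<le> dim V" using independent_span_bound[OF C(4) ind] C(5) by simp
  moreover have "v \<notin> B" using v(2) B(1) by blast
  ultimately show False using B(4,5) assms(6) by simp
qed

text \<open>A basis of the kernel is extended to one of \<open>V\<close>; the added vectors map to a
  basis of the image. The ambient space may have infinite dimension, so finiteness enters through
  the spanning set \<open>S\<close>.\<close>

lemma rank_nullity:
  assumes T: "Vector_Spaces.linear scale scale T"
    and V: "subspace V" "V \<subseteq> span S" "finite S"
  shows "dim V = dim {v \<in> V. T v = 0} + dim (T ` V)"
proof -
  interpret T: Vector_Spaces.linear scale scale T by (rule T)
  define K where "K = {v \<in> V. T v = 0}"
  have "K \<subseteq> span S" using V(2) by (auto simp: K_def)
  then obtain B0 where B0: "B0 \<subseteq> K" "independent B0" "K \<subseteq> span B0" "finite B0" "card B0 = dim K"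
    using finite_basis_exists[OF _ V(3)] by metis
  have "B0 \<subseteq> V" using B0(1) by (auto simp: K_def)
  then obtain B where B: "B0 \<subseteq> B" "B \<subseteq> V" "independent B" "V \<subseteq> span B"
    using maximal_independent_subset_extend[OF _ B0(2)] by metis
  have "B \<subseteq> span S" using B(2) V(2) by (rule order_trans)
  hence finB: "finite B" using independent_span_bound[OF V(3) B(3)] by blast
  have cardB: "card B = dim V" using B by (intro basis_card_eq_dim)
  define C where "C = B - B0"
  have zero: "\<forall>b\<in>C. c b = 0" if "T (\<Sum>b\<in>C. scale (c b) b) = 0" for c
  proof -
    have "(\<Sum>b\<in>C. scale (c b) b) \<in> K"
      using that B(2) V(1) by (auto simp: K_def C_def intro!: subspace_sum subspace_scale)
    hence "(\<Sum>b\<in>C. scale (c b) b) \<in> span B0" using B0(3) by blast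
    then obtain u where u: "(\<Sum>b\<in>C. scale (c b) b) = (\<Sum>b\<in>B0. scale (u b) b)"
      using span_finite[OF B0(4)] by auto
    define w where "w b = (if b \<in> B0 then - u b else c b)" for b
    have "(\<Sum>b\<in>B. scale (w b) b) = (\<Sum>b\<in>C. scale (w b) b) + (\<Sum>b\<in>B0. scale (w b) b)"
      unfolding C_def using B(1) finB by (rule sum.subset_diff)
    also have "(\<Sum>b\<in>C. scale (w b) b) = (\<Sum>b\<in>C. scale (c b) b)"
      by (intro sum.cong) (auto simp: w_def C_def)
    also have "(\<Sum>b\<in>B0. scale (w b) b) = - (\<Sum>b\<in>B0. scale (u b) b)"
      by (simp add: w_def sum_negf)
    finally have "(\<Sum>b\<in>B. scale (w b) b) = 0" using u by simp
    hence "w b = 0" if "b \<in> B" for b using independentD[OF B(3) finB order_refl _ that] by blast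
    hence "c b = 0" if "b \<in> C" for b
      using that by (metis DiffD1 DiffD2 C_def w_def)
    thus ?thesis by blast
  qed
  have finC: "finite C" using finB by (simp add: C_def)
  have T_sum: "T (\<Sum>b\<in>C. scale (c b) b) = (\<Sum>b\<in>C. scale (c b) (T b))" for c
    by (simp add: T.sum T.scale)
  have inj: "inj_on T C"
  proof (rule inj_onI, rule ccontr)
    fix s t assume *: "s \<in> C" "t \<in> C" "T s = T t" "s \<noteq> t"
    have "(\<Sum>r\<in>C. scale (if r = s then 1 else if r = t then - 1 else 0) (T r))
       = (\<Sum>r\<in>{s,t}. scale (if r = s then 1 else if r = t then - 1 else 0) (T r))"
      using * finC by (intro sum.mono_neutral_right) auto
    also have "\<dots> = 0" using * by simp
    finally show False
      using zero[of "\<lambda>r. if r = s then 1 else if r = t then - 1 else 0"] * unfolding T_sum by auto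
  qed
  have ind: "independent (T ` C)"
  proof (rule independent_if_scalars_zero)
    show "finite (T ` C)" using finC by simp
    fix f x assume f: "(\<Sum>x\<in>T ` C. scale (f x) x) = 0" and x: "x \<in> T ` C"
    have "(\<Sum>t\<in>C. scale (f (T t)) (T t)) = 0" using f inj by (simp add: sum.reindex)
    hence "T (\<Sum>b\<in>C. scale (f (T b)) b) = 0" unfolding T_sum .
    from zero[of "\<lambda>t. f (T t)", OF this] show "f x = 0" using x by auto
  qed
  have span: "T ` V \<subseteq> span (T ` C)"
  proof -
    have "T ` V \<subseteq> T ` span B" using B(4) by (rule image_mono)
    also have "\<dots> = span (T ` B)" by (simp add: T.span_image)
    also have "\<dots> \<subseteq> span (T ` C)"
    proof (rule span_minimal)
      show "T ` B \<subseteq> span (T ` C)"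
      proof safe
        fix b assume b: "b \<in> B"
        show "T b \<in> span (T ` C)"
        proof (cases "b \<in> B0")
          case True
          hence "T b = 0" using B0(1) by (auto simp: K_def)
          thus ?thesis by (simp add: span_zero)
        next
          case False
          thus ?thesis using b by (intro span_base) (auto simp: C_def)
        qed
      qed
    qed simp
    finally show ?thesis .
  qed
  have "T ` C \<subseteq> T ` V" using B(2) by (auto simp: C_def)
  hence "card (T ` C) = dim (T ` V)" using span ind by (rule basis_card_eq_dim)
  moreover have "card (T ` C) = card C" using inj by (rule card_image)
  moreover have "card C = card B - card B0" using B(1) finB by (simp add: C_def card_Diff_subset B0(4))
  moreover have "card B0 \<le> card B" using B(1) finB by (rule card_mono[rotated])
  ultimately show ?thesis using cardB B0(5) by (simp add: K_def)
qed

text \<open>Rank and nullity telescope, kernels being images in positive degrees. There is no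
  exactness in degree 0, which is why the last map remains in the result.\<close>

lemma euler_characteristic_exact:
  assumes D: "Vector_Spaces.linear scale scale D"
    and V: "\<And>i. subspace (V i)" "\<And>i. V i \<subseteq> span (S i)" "\<And>i. finite (S i)"
    and exact: "\<And>i. i > 0 \<Longrightarrow> {v \<in> V i. D v = 0} = D ` V (Suc i)"
    and vanish: "D ` V (Suc d) = {0}"
  shows "(\<Sum>i\<le>d. (- 1) ^ i * int (dim (V i))) = int (dim (V 0)) - int (dim (D ` V 1))"
proof -
  have rn: "int (dim (V (Suc i))) = int (dim (D ` V (Suc (Suc i)))) + int (dim (D ` V (Suc i)))" for i
    using rank_nullity[OF D V(1,2,3), of "Suc i"] exact[of "Suc i"] by simp
  have "(\<Sum>i\<le>m. (- 1) ^ i * int (dim (V i)))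
      = int (dim (V 0)) - int (dim (D ` V 1)) + (- 1) ^ m * int (dim (D ` V (Suc m)))" for m
  proof (induction m)
    case (Suc m)
    thus ?case using rn[of m] by (simp add: algebra_simps)
  qed simp
  moreover have "dim (D ` V (Suc d)) = 0" unfolding vanish by (metis dim_eq_card_independent dim_span span_empty card.empty independent_empty)
  ultimately show ?thesis by simp
qed

end

section \<open>Hilbert functions of simplicial complexes\<close>

text \<open>Upper negation extends the binomial coefficient to negative integers, so that Hilbert
  polynomials can be evaluated at 0; identities are transported from \<open>gchoose\<close> over the
  rationals.\<close>

definition int_choose :: "int \<Rightarrow> nat \<Rightarrow> int" (infix \<open>ichoose\<close> 64) where
  "z ichoose m = (if 0 \<le> z then int (nat z choose m) else (- 1) ^ m * int ((m + nat (- z) - 1) choose m))"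

lemma of_int_ichoose: "(of_int (z ichoose m) :: rat) = of_int z gchoose m"
  unfolding int_choose_def gbinomial_int_binomial[symmetric] by (rule of_int_gbinomial)

lemma ichoose_pascal: "z ichoose Suc m = ((z - 1) ichoose m) + ((z - 1) ichoose Suc m)"
proof -
  have "(of_int (z ichoose Suc m) :: rat) = of_int (((z - 1) ichoose m) + ((z - 1) ichoose Suc m))"
    using gbinomial_Suc_Suc[of "of_int (z - 1) :: rat" m] by (simp add: of_int_ichoose)
  thus ?thesis by (simp only: of_int_eq_iff)
qed

lemma ichoose_0 [simp]: "z ichoose 0 = 1"
  by (simp add: int_choose_def)

lemma ichoose_int: "int n ichoose m = int (n choose m)"
  by (simp add: int_choose_def)

lemma ichoose_minus_one: "(- 1) ichoose m = (- 1) ^ m"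
  by (simp add: int_choose_def)

text \<open>Pascal's rule turns the (d+1)-st finite difference of \<open>g\<close> into the d-th
  finite difference of its first difference.\<close>

lemma alternating_binomial_sum_Suc:
  fixes g :: "nat \<Rightarrow> int"
  shows "(\<Sum>i\<le>Suc d. (- 1) ^ i * int (Suc d choose i) * g i) = (\<Sum>i\<le>d. (- 1) ^ i * int (d choose i) * (g i - g (Suc i)))"
proof -
  define A where "A i = (- 1) ^ i * int (d choose i) * g i" for i
  define B where "B i = (- 1) ^ i * int (d choose i) * g (Suc i)" for i
  have "(- 1) ^ Suc i * int (Suc d choose Suc i) * g (Suc i) = A (Suc i) - B i" for i
    by (simp add: A_def B_def algebra_simps)
  hence "(\<Sum>i\<le>Suc d. (- 1) ^ i * int (Suc d choose i) * g i) = A 0 + (\<Sum>i\<le>d. A (Suc i) - B i)"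
    by (subst sum.atMost_Suc_shift) (simp add: A_def)
  also have "\<dots> = (\<Sum>i\<le>Suc d. A i) - (\<Sum>i\<le>d. B i)"
    unfolding sum_subtractf by (subst sum.atMost_Suc_shift) simp
  also have "(\<Sum>i\<le>Suc d. A i) = (\<Sum>i\<le>d. A i)" by (simp add: A_def)
  also have "(\<Sum>i\<le>d. A i) - (\<Sum>i\<le>d. B i) = (\<Sum>i\<le>d. A i - B i)" by (rule sum_subtractf[symmetric])
  finally show ?thesis by (simp only: A_def B_def right_diff_distrib)
qed

text \<open>A d-th finite difference of a polynomial of degree \<open>m < d\<close> vanishes; each
  difference lowers the binomial by one degree.\<close>

lemma alternating_ichoose_sum:
  "m < d \<Longrightarrow> (\<Sum>i\<le>d. (- 1) ^ i * int (d choose i) * ((z - int i) ichoose m)) = 0"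
proof (induction d arbitrary: z m)
  case (Suc d)
  show ?case
  proof (cases m)
    case 0
    thus ?thesis using alternating_binomial_sum_Suc[of d "\<lambda>_. 1"] by simp
  next
    case (Suc m')
    have "((z - int i) ichoose Suc m') - ((z - int (Suc i)) ichoose Suc m') = (z - 1 - int i) ichoose m'" for i
      using ichoose_pascal[of "z - int i" m'] by (simp add: algebra_simps)
    thus ?thesis using Suc.IH[of m' "z - 1"] Suc.prems
      by (simp add: alternating_binomial_sum_Suc Suc del: sum.atMost_Suc)
  qed
qed simp

text \<open>The coefficients are indexed by degree: up to sign, \<open>e (d - i)\<close> is the \<open>i\<close>-th Hilbert coefficient.\<close>

definition binomial_poly :: "nat \<Rightarrow> (nat \<Rightarrow> int) \<Rightarrow> int \<Rightarrow> int" where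
  "binomial_poly d e n = (\<Sum>j\<le>d. e j * ((n + int j - 1) ichoose j))"

text \<open>All basis polynomials of positive degree vanish at 0, which makes the last Hilbert
  coefficient, up to sign, the value of the polynomial at 0.\<close>

lemma binomial_poly_0: "binomial_poly d e 0 = e 0"
proof -
  have "(int j - 1) ichoose j = (if j = 0 then 1 else 0)" for j
    using ichoose_int[of "j - 1" j] by (cases j) auto
  thus ?thesis by (simp add: binomial_poly_def if_distrib[of "\<lambda>x. _ * x"] cong: if_cong)
qed

lemma binomial_poly_Suc:
  "binomial_poly (Suc d) e n = e 0 + (\<Sum>j\<le>d. e (Suc j) * ((n + int j) ichoose Suc j))"
  unfolding binomial_poly_def by (subst sum.atMost_Suc_shift) (simp add: algebra_simps)

lemma binomial_poly_diff:
  "binomial_poly (Suc d) e n - binomial_poly (Suc d) e (n - 1) = binomial_poly d (\<lambda>j. e (Suc j)) n"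
proof -
  have "((n + int j) ichoose Suc j) - ((n - 1 + int j) ichoose Suc j) = (n + int j - 1) ichoose j" for j
    using ichoose_pascal[of "n + int j" j] by (simp add: algebra_simps)
  hence "(\<Sum>j\<le>d. e (Suc j) * (((n + int j) ichoose Suc j) - ((n - 1 + int j) ichoose Suc j)))
     = binomial_poly d (\<lambda>j. e (Suc j)) n" by (simp add: binomial_poly_def)
  thus ?thesis unfolding binomial_poly_Suc by (simp add: right_diff_distrib sum_subtractf)
qed

text \<open>Summation shifts the coefficients by one, and \<open>f 0\<close> is the constant of
  integration; the induction runs in both directions over the integers.\<close>

lemma binomial_poly_of_diff:
  assumes "\<And>n. f n - f (n - 1) = binomial_poly d e n"
  shows "\<exists>e'. f = binomial_poly (Suc d) e'"
proof
  define e' where "e' = case_nat (f 0) e"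
  define g where "g n = f n - binomial_poly (Suc d) e' n" for n
  have *: "g n = g (n - 1)" for n
    using assms[of n] binomial_poly_diff[of d e' n] by (simp add: g_def e'_def)
  have "g n = 0" for n
  proof (induction n rule: int_induct[of _ 0])
    case base
    show ?case by (simp add: g_def binomial_poly_0 e'_def)
  next
    case (step1 i)
    thus ?case using *[of "i + 1"] by simp
  next
    case (step2 i)
    thus ?case using *[of i] by simp
  qed
  thus "f = binomial_poly (Suc d) e'" by (auto simp: g_def)
qed

lemma binomial_poly_sum: "(\<Sum>x\<in>A. binomial_poly d (e x) n) = binomial_poly d (\<lambda>j. \<Sum>x\<in>A. e x j) n"
  unfolding binomial_poly_def by (subst sum.swap) (simp add: sum_distrib_right)

lemma binomial_poly_mono:
  assumes "m \<le> d" shows "\<exists>e'. binomial_poly m e = binomial_poly d e'"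
proof (intro exI ext)
  show "binomial_poly m e n = binomial_poly d (\<lambda>j. if j \<le> m then e j else 0) n" for n
    unfolding binomial_poly_def using assms by (intro sum.mono_neutral_cong_left) auto
qed

text \<open>Lowering \<open>n\<close> by one shifts the argument by \<open>k\<close>, and the
  difference telescopes into \<open>k\<close> binomials of lower degree, which are binomial
  polynomials by induction.\<close>

lemma ichoose_linear_binomial_poly: "\<exists>e. \<forall>n. ((int k * n + c) ichoose m) = binomial_poly m e n"
proof (induction m arbitrary: c)
  case 0
  show ?case by (intro exI[of _ "\<lambda>_. 1"]) (simp add: binomial_poly_def)
next
  case (Suc m)
  have tele: "(z ichoose Suc m) - ((z - int t) ichoose Suc m) = (\<Sum>s<t. (z - 1 - int s) ichoose m)" for z :: int and t
  proof (induction t)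
    case (Suc t)
    thus ?case using ichoose_pascal[of "z - int t" m] by (simp add: algebra_simps)
  qed simp
  from Suc.IH have "\<forall>s. \<exists>e. \<forall>n. ((int k * n + (c - 1 - int s)) ichoose m) = binomial_poly m e n" by blast
  then obtain e where e: "\<And>s n. ((int k * n + (c - 1 - int s)) ichoose m) = binomial_poly m (e s) n" by metis
  have "((int k * n + c) ichoose Suc m) - ((int k * (n - 1) + c) ichoose Suc m)
      = binomial_poly m (\<lambda>j. \<Sum>s<k. e s j) n" for n
    using tele[of "int k * n + c" k] e[of n] by (simp add: algebra_simps flip: binomial_poly_sum)
  from binomial_poly_of_diff[of "\<lambda>n. (int k * n + c) ichoose Suc m", OF this] show ?case by metis
qed

lemma sum_ichoose_linear_binomial_poly:
  assumes "\<And>x. x \<in> A \<Longrightarrow> m x \<le> d"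
  shows "\<exists>e. \<forall>n. (\<Sum>x\<in>A. ((int k * n + c) ichoose m x)) = binomial_poly d e n"
proof -
  have "\<forall>x. \<exists>e. x \<in> A \<longrightarrow> (\<forall>n. ((int k * n + c) ichoose m x) = binomial_poly d e n)"
  proof
    fix x
    show "\<exists>e. x \<in> A \<longrightarrow> (\<forall>n. ((int k * n + c) ichoose m x) = binomial_poly d e n)"
    proof (cases "x \<in> A")
      case True
      obtain e where "\<forall>n. ((int k * n + c) ichoose m x) = binomial_poly (m x) e n"
        using ichoose_linear_binomial_poly by blast
      moreover obtain e' where "binomial_poly (m x) e = binomial_poly d e'"
        using binomial_poly_mono[OF assms[OF True]] by blast
      ultimately show ?thesis by auto
    qed simp
  qed
  then obtain e where e: "\<And>x n. x \<in> A \<Longrightarrow> ((int k * n + c) ichoose m x) = binomial_poly d (e x) n" by metis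
  have "(\<Sum>x\<in>A. ((int k * n + c) ichoose m x)) = binomial_poly d (\<lambda>j. \<Sum>x\<in>A. e x j) n" for n
    by (simp add: e flip: binomial_poly_sum)
  thus ?thesis by blast
qed

text \<open>Taking differences drops the constant coefficient and shifts the others, so these vanish
  by induction, and then the constant one does. This is what makes Hilbert coefficients
  unique.\<close>

lemma binomial_poly_eventually_zero:
  assumes "\<And>n. n \<ge> N \<Longrightarrow> binomial_poly d e n = 0"
  shows "j \<le> d \<Longrightarrow> e j = 0"
  using assms
proof (induction d arbitrary: e j N)
  case 0
  from 0(2)[of N] 0(1) show ?case by (simp add: binomial_poly_def)
next
  case (Suc d)
  have "binomial_poly d (\<lambda>j. e (Suc j)) n = 0" if "n \<ge> N + 1" for n
    using Suc.prems(2)[of n] Suc.prems(2)[of "n - 1"] that by (simp flip: binomial_poly_diff)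
  from Suc.IH[OF _ this] have *: "e (Suc j) = 0" if "j \<le> d" for j using that by blast
  hence "binomial_poly (Suc d) e N = e 0" by (simp add: binomial_poly_Suc)
  hence "e 0 = 0" using Suc.prems(2)[of N] by simp
  thus ?case using * Suc.prems(1) by (cases j) auto
qed

section \<open>Counting monomials by support and degree\<close>

definition mdeg :: "('v::finite \<Rightarrow>\<^sub>0 nat) \<Rightarrow> nat" where
  "mdeg u = (\<Sum>x\<in>UNIV. Poly_Mapping.lookup u x)"

lemma mdeg_0 [simp]: "mdeg 0 = 0"
  by (simp add: mdeg_def)

lemma mdeg_add [simp]: "mdeg (u + w) = mdeg u + mdeg w"
  by (simp add: mdeg_def lookup_add sum.distrib)

lemma mdeg_single [simp]: "mdeg (Poly_Mapping.single x n) = n"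
  by (simp add: mdeg_def lookup_single when_def)

lemma mdeg_eq_0_iff: "mdeg u = 0 \<longleftrightarrow> u = 0"
  by (auto simp: mdeg_def intro: poly_mapping_eqI)

lemma lookup_le_mdeg: "Poly_Mapping.lookup u x \<le> mdeg u"
  unfolding mdeg_def by (intro member_le_sum) auto

lemma keys_add_nat: "Poly_Mapping.keys (u + w) = Poly_Mapping.keys u \<union> Poly_Mapping.keys (w :: 'a \<Rightarrow>\<^sub>0 nat)"
  by (auto simp: in_keys_iff lookup_add)

lemma minus_single_add:
  assumes "x \<in> Poly_Mapping.keys (u :: 'a \<Rightarrow>\<^sub>0 nat)"
  shows "u - Poly_Mapping.single x 1 + Poly_Mapping.single x 1 = u"
  using assms by (intro poly_mapping_eqI) (auto simp: lookup_add lookup_minus lookup_single when_def in_keys_iff)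

lemma finite_mdeg_le: "finite {u :: 'v::finite \<Rightarrow>\<^sub>0 nat. mdeg u \<le> n}"
proof (rule finite_imageD)
  have "Poly_Mapping.lookup ` {u :: 'v \<Rightarrow>\<^sub>0 nat. mdeg u \<le> n} \<subseteq> (\<Pi>\<^sub>E x\<in>UNIV. {..n})"
  proof (rule image_subsetI)
    fix u :: "'v \<Rightarrow>\<^sub>0 nat" assume "u \<in> {u. mdeg u \<le> n}"
    hence "mdeg u \<le> n" by simp
    hence "Poly_Mapping.lookup u x \<le> n" for x using lookup_le_mdeg order_trans by blast
    thus "Poly_Mapping.lookup u \<in> (\<Pi>\<^sub>E x\<in>UNIV. {..n})" by (auto simp: PiE_def)
  qed
  thus "finite (Poly_Mapping.lookup ` {u :: 'v \<Rightarrow>\<^sub>0 nat. mdeg u \<le> n})"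
    by (rule finite_subset) (rule finite_PiE, simp_all)
next
  show "inj_on Poly_Mapping.lookup {u :: 'v \<Rightarrow>\<^sub>0 nat. mdeg u \<le> n}"
    by (rule inj_onI) (rule poly_mapping_eqI, simp)
qed

lemma finite_mdeg_le': "finite {u :: 'v::finite \<Rightarrow>\<^sub>0 nat. P u \<and> mdeg u \<le> n}"
  by (rule finite_subset[OF _ finite_mdeg_le[of n]]) auto

lemma finite_mdeg_eq: "finite {u :: 'v::finite \<Rightarrow>\<^sub>0 nat. P u \<and> mdeg u = n}"
  by (rule finite_subset[OF _ finite_mdeg_le[of n]]) auto

lemma finite_mdeg_less: "finite {u :: 'v::finite \<Rightarrow>\<^sub>0 nat. P u \<and> mdeg u < n}"
  by (rule finite_subset[OF _ finite_mdeg_le[of n]]) auto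

text \<open>Division by \<open>x\<close> either keeps the support or, if the exponent of
  \<open>x\<close> is one, removes \<open>x\<close> from it.\<close>

lemma card_monomials_insert:
  fixes F :: "'v::finite set"
  assumes "x \<notin> F"
  shows "card {u. Poly_Mapping.keys u = insert x F \<and> mdeg u = Suc j} =
    card {u. Poly_Mapping.keys u = insert x F \<and> mdeg u = j} + card {u. Poly_Mapping.keys u = F \<and> mdeg u = j}"
proof -
  let ?A = "\<lambda>G. {u. Poly_Mapping.keys u = G \<and> mdeg u = j}"
  let ?s = "\<lambda>u. u + Poly_Mapping.single x (1::nat)"
  have "{u. Poly_Mapping.keys u = insert x F \<and> mdeg u = Suc j} = ?s ` (?A (insert x F) \<union> ?A F)"
  proof (intro equalityI subsetI)
    fix u assume u: "u \<in> {u. Poly_Mapping.keys u = insert x F \<and> mdeg u = Suc j}"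
    define w where "w = u - Poly_Mapping.single x 1"
    have ku: "Poly_Mapping.keys u = insert x F" and du: "mdeg u = Suc j" using u by simp_all
    have uw: "?s w = u" unfolding w_def by (rule minus_single_add) (simp add: ku)
    have "mdeg w = j" using arg_cong[OF uw, of mdeg] by (simp add: du)
    moreover have "insert x (Poly_Mapping.keys w) = insert x F"
      using arg_cong[OF uw, of Poly_Mapping.keys] by (simp add: keys_add_nat ku)
    hence "Poly_Mapping.keys w = insert x F \<or> Poly_Mapping.keys w = F"
      using assms by (cases "x \<in> Poly_Mapping.keys w") (auto simp: insert_ident insert_absorb)
    ultimately have "w \<in> ?A (insert x F) \<union> ?A F" by simp
    thus "u \<in> ?s ` (?A (insert x F) \<union> ?A F)" by (rule image_eqI[where f = ?s and x = w, OF uw[symmetric]])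
  next
    fix u assume "u \<in> ?s ` (?A (insert x F) \<union> ?A F)"
    then obtain w where "w \<in> ?A (insert x F) \<union> ?A F" and u: "u = ?s w" by (rule imageE)
    hence w: "mdeg w = j" "insert x (Poly_Mapping.keys w) = insert x F" by auto
    have "Poly_Mapping.keys u = insert x (Poly_Mapping.keys w)" unfolding u by (simp add: keys_add_nat)
    moreover have "mdeg u = Suc j" unfolding u by (simp add: w(1))
    ultimately show "u \<in> {u. Poly_Mapping.keys u = insert x F \<and> mdeg u = Suc j}" by (simp add: w(2))
  qed
  moreover have "inj_on ?s (?A (insert x F) \<union> ?A F)" by (intro inj_onI) simp
  moreover have "?A (insert x F) \<inter> ?A F = {}" using assms by auto
  ultimately show ?thesis by (simp add: card_image card_Un_disjoint finite_mdeg_eq)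
qed

text \<open>For nonempty \<open>F\<close> these are the compositions of \<open>j\<close> into
  \<open>card F\<close> positive parts; the recursion on support and degree is Pascal's
  rule.\<close>

lemma card_monomials_support:
  fixes F :: "'v::finite set"
  shows "card {u. Poly_Mapping.keys u = F \<and> mdeg u = j} =
    (if F = {} then (if j = 0 then 1 else 0) else if j = 0 then 0 else (j - 1) choose (card F - 1))"
proof (induction F arbitrary: j rule: finite_induct[OF finite])
  case 1
  have "{u :: 'v \<Rightarrow>\<^sub>0 nat. Poly_Mapping.keys u = {} \<and> mdeg u = j} = (if j = 0 then {0} else {})"
    by auto
  thus ?case by simp
next
  case (2 x F)
  show ?case
  proof (induction j)
    case 0
    have e: "{u :: 'v \<Rightarrow>\<^sub>0 nat. Poly_Mapping.keys u = insert x F \<and> mdeg u = 0} = {}"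
      by (auto simp: mdeg_eq_0_iff)
    show ?case unfolding e by simp
  next
    case (Suc j)
    have rec: "card {u. Poly_Mapping.keys u = insert x F \<and> mdeg u = Suc j}
      = (if j = 0 then 0 else (j - 1) choose card F)
        + (if F = {} then (if j = 0 then 1 else 0) else if j = 0 then 0 else (j - 1) choose (card F - 1))"
      unfolding card_monomials_insert[OF 2(2)] Suc 2(3) using 2(1,2) by simp
    show ?case
    proof (cases "F = {}")
      case True
      thus ?thesis unfolding rec using 2(1,2) by simp
    next
      case False
      hence F: "card F = Suc (card F - 1)" by (simp add: card_gt_0_iff)
      have "j choose card F = (if j = 0 then 0 else ((j - 1) choose (card F - 1)) + ((j - 1) choose card F))"
        by (subst F, subst (2) F) (cases j; simp)
      thus ?thesis unfolding rec using False 2(1,2) by simp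
    qed
  qed
qed

definition hilbert_fun :: "'v::finite set set \<Rightarrow> nat \<Rightarrow> nat" where
  "hilbert_fun \<Delta> j = card {u. Poly_Mapping.keys u \<in> \<Delta> \<and> mdeg u = j}"

lemma hilbert_fun_eq_sum:
  "hilbert_fun \<Delta> j = (\<Sum>F\<in>\<Delta>. card {u :: 'v::finite \<Rightarrow>\<^sub>0 nat. Poly_Mapping.keys u = F \<and> mdeg u = j})"
proof -
  have "{u :: 'v \<Rightarrow>\<^sub>0 nat. Poly_Mapping.keys u \<in> \<Delta> \<and> mdeg u = j}
      = (\<Union>F\<in>\<Delta>. {u. Poly_Mapping.keys u = F \<and> mdeg u = j})" by auto
  thus ?thesis unfolding hilbert_fun_def by (simp only:) (intro card_UN_disjoint; auto simp: finite_mdeg_eq)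
qed

text \<open>The coefficient of t^n in (1-t)^d times the Hilbert series. \<open>Q F\<close> is the
  polynomial that counts monomials with support \<open>F\<close> in positive degrees; in degree 0 it
  is off by (-1)^|F|. As its degree is below \<open>d\<close>, the d-th difference kills it, and the
  correction survives only where \<open>n - i = 0\<close> with \<open>i \<le> d \<le> n\<close>,
  that is for \<open>i = n = d\<close>.\<close>

lemma alternating_hilbert_sum:
  fixes \<Delta> :: "'v::finite set set"
  assumes d: "\<And>F. F \<in> \<Delta> \<Longrightarrow> card F \<le> d" "d > 0" "n \<ge> d"
  shows "(\<Sum>i\<le>d. (- 1) ^ i * int (d choose i) * int (hilbert_fun \<Delta> (n - i)))
    = (if n = d then (- 1) ^ d * (\<Sum>F\<in>\<Delta>. (- 1) ^ card F) else 0)"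
proof -
  define Q :: "'v set \<Rightarrow> int \<Rightarrow> int" where "Q F z = (if F = {} then 0 else (z - 1) ichoose (card F - 1))" for F z
  have N: "int (card {u :: 'v \<Rightarrow>\<^sub>0 nat. Poly_Mapping.keys u = F \<and> mdeg u = j}) = Q F (int j) + (if j = 0 then (- 1) ^ card F else 0)" for F j
  proof (cases "F = {} \<or> j \<noteq> 0")
    case True
    thus ?thesis
      by (auto simp: card_monomials_support Q_def of_nat_diff simp flip: ichoose_int)
  next
    case False
    hence "card F = Suc (card F - 1)" by (simp add: card_gt_0_iff)
    hence "(- 1 :: int) ^ card F = - ((- 1) ^ (card F - 1))" by (metis power_Suc mult_minus1)
    thus ?thesis using False by (simp add: card_monomials_support Q_def ichoose_minus_one)
  qed
  have Q0: "(\<Sum>i\<le>d. (- 1) ^ i * int (d choose i) * Q F (int (n - i))) = 0" if "F \<in> \<Delta>" for F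
  proof (cases "F = {}")
    case False
    hence "card F - 1 < d" using d(1)[OF that] d(2) by (simp add: card_gt_0_iff)
    from alternating_ichoose_sum[OF this, of "int n - 1"]
    have "(\<Sum>i\<le>d. (- 1) ^ i * int (d choose i) * ((int n - 1 - int i) ichoose (card F - 1))) = 0" .
    also have "(\<Sum>i\<le>d. (- 1) ^ i * int (d choose i) * ((int n - 1 - int i) ichoose (card F - 1)))
        = (\<Sum>i\<le>d. (- 1) ^ i * int (d choose i) * Q F (int (n - i)))"
      using False d(3) by (intro sum.cong refl) (simp add: Q_def of_nat_diff algebra_simps)
    finally show ?thesis .
  qed (simp add: Q_def)
  have last: "(\<Sum>i\<le>d. (- 1) ^ i * int (d choose i) * (if n - i = 0 then (- 1) ^ card F else 0))
     = (if n = d then (- 1) ^ d * (- 1) ^ card F else 0)" for F :: "'v set"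
  proof -
    have "(\<Sum>i\<le>d. (- 1) ^ i * int (d choose i) * (if n - i = 0 then (- 1) ^ card F else 0))
      = (\<Sum>i\<le>d. if i = d then (if n = d then (- 1) ^ d * (- 1) ^ card F else 0) else 0)"
      using d(3) by (intro sum.cong refl) auto
    thus ?thesis by simp
  qed
  have "(\<Sum>i\<le>d. (- 1) ^ i * int (d choose i) * int (hilbert_fun \<Delta> (n - i)))
     = (\<Sum>F\<in>\<Delta>. \<Sum>i\<le>d. (- 1) ^ i * int (d choose i) * (Q F (int (n - i)) + (if n - i = 0 then (- 1) ^ card F else 0)))"
    unfolding hilbert_fun_eq_sum of_nat_sum N sum_distrib_left by (rule sum.swap)
  also have "\<dots> = (\<Sum>F\<in>\<Delta>. if n = d then (- 1) ^ d * (- 1) ^ card F else 0)"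
    by (intro sum.cong refl) (simp only: distrib_left sum.distrib Q0 last add_0)
  also have "\<dots> = (if n = d then (- 1) ^ d * (\<Sum>F\<in>\<Delta>. (- 1) ^ card F) else 0)"
    by (simp add: sum_distrib_left)
  finally show ?thesis .
qed

lemma card_monomials_below:
  fixes F :: "'v::finite set"
  assumes "n > 0"
  shows "card {u. Poly_Mapping.keys u = F \<and> mdeg u < n} = (n - 1) choose card F"
  using assms
proof (induction n)
  case (Suc n)
  have split: "{u. Poly_Mapping.keys u = F \<and> mdeg u < Suc n}
      = {u. Poly_Mapping.keys u = F \<and> mdeg u < n} \<union> {u. Poly_Mapping.keys u = F \<and> mdeg u = n}" by auto
  have "card {u. Poly_Mapping.keys u = F \<and> mdeg u < Suc n}
      = card {u. Poly_Mapping.keys u = F \<and> mdeg u < n} + card {u. Poly_Mapping.keys u = F \<and> mdeg u = n}"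
    unfolding split by (rule card_Un_disjoint) (auto simp: finite_mdeg_eq finite_mdeg_less)
  also have "\<dots> = n choose card F"
  proof (cases "n = 0")
    case True
    thus ?thesis by (auto simp: card_monomials_support card_gt_0_iff binomial_eq_0)
  next
    case False
    show ?thesis
    proof (cases "F = {}")
      case True
      thus ?thesis using False Suc.IH by (simp add: card_monomials_support)
    next
      case F: False
      hence "card F = Suc (card F - 1)" by (simp add: card_gt_0_iff)
      moreover have "n = Suc (n - 1)" using False by simp
      ultimately have "n choose card F = (n - 1 choose (card F - 1)) + (n - 1 choose card F)"
        by (metis binomial_Suc_Suc)
      thus ?thesis using F False Suc.IH by (simp add: card_monomials_support)
    qed
  qed
  finally show ?case by simp
qed simp

text \<open>The right-hand side is a polynomial in \<open>n\<close>; at \<open>n = 0\<close> each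
  face contributes binom(-1, |F|) = (-1)^|F|, which is the origin of the value in
  \<open>tight_hilbert_coeff_prod\<close>.\<close>

lemma card_monomials_faces_below:
  fixes \<Delta> :: "'v::finite set set"
  assumes "n > 0"
  shows "int (card {u :: 'v \<Rightarrow>\<^sub>0 nat. Poly_Mapping.keys u \<in> \<Delta> \<and> mdeg u < n}) = (\<Sum>F\<in>\<Delta>. (int n - 1) ichoose card F)"
proof -
  have "{u :: 'v \<Rightarrow>\<^sub>0 nat. Poly_Mapping.keys u \<in> \<Delta> \<and> mdeg u < n}
      = (\<Union>F\<in>\<Delta>. {u. Poly_Mapping.keys u = F \<and> mdeg u < n})" by auto
  hence "card {u :: 'v \<Rightarrow>\<^sub>0 nat. Poly_Mapping.keys u \<in> \<Delta> \<and> mdeg u < n}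
      = (\<Sum>F\<in>\<Delta>. card {u :: 'v \<Rightarrow>\<^sub>0 nat. Poly_Mapping.keys u = F \<and> mdeg u < n})"
    by (simp only:) (intro card_UN_disjoint; auto simp: finite_mdeg_less)
  thus ?thesis using assms by (simp add: card_monomials_below of_nat_diff flip: ichoose_int)
qed

section \<open>Orders and linear parts of polynomials\<close>

text \<open>The span of the monomials satisfying \<open>Q\<close>, an ideal if \<open>Q\<close> is
  stable under multiplication. One notion serves the powers of the irrelevant ideal, the homogeneous
  components, the Stanley-Reisner ideal and the primes of faces.\<close>

definition mon_ideal :: "('m \<Rightarrow> bool) \<Rightarrow> ('m \<Rightarrow>\<^sub>0 'k::zero) set" where
  "mon_ideal Q = {f. \<forall>u\<in>Poly_Mapping.keys f. Q u}"

lemma mon_ideal_iff: "f \<in> mon_ideal Q \<longleftrightarrow> (\<forall>u. Poly_Mapping.lookup f u \<noteq> 0 \<longrightarrow> Q u)"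
  by (auto simp: mon_ideal_def in_keys_iff)

lemma mon_ideal_mono: "f \<in> mon_ideal Q \<Longrightarrow> (\<And>u. Q u \<Longrightarrow> Q' u) \<Longrightarrow> f \<in> mon_ideal Q'"
  by (auto simp: mon_ideal_iff)

lemma mon_ideal_0: "0 \<in> mon_ideal Q"
  by (simp add: mon_ideal_iff)

lemma mon_ideal_add: "f \<in> mon_ideal Q \<Longrightarrow> g \<in> mon_ideal Q \<Longrightarrow> f + g \<in> mon_ideal Q"
  for f g :: "'m \<Rightarrow>\<^sub>0 'k::monoid_add"
  unfolding mon_ideal_iff lookup_add by (metis add.left_neutral)

lemma mon_ideal_uminus: "f \<in> mon_ideal Q \<Longrightarrow> - f \<in> mon_ideal Q"
  for f :: "'m \<Rightarrow>\<^sub>0 'k::ab_group_add"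
  by (simp add: mon_ideal_iff)

lemma mon_ideal_diff: "f \<in> mon_ideal Q \<Longrightarrow> g \<in> mon_ideal Q \<Longrightarrow> f - g \<in> mon_ideal Q"
  for f g :: "'m \<Rightarrow>\<^sub>0 'k::ab_group_add"
  using mon_ideal_add[of f Q "- g"] mon_ideal_uminus[of g Q] by simp

lemma mon_ideal_sum: "(\<And>i. i \<in> A \<Longrightarrow> f i \<in> mon_ideal Q) \<Longrightarrow> sum f A \<in> mon_ideal Q"
  for f :: "'i \<Rightarrow> 'm \<Rightarrow>\<^sub>0 'k::comm_monoid_add"
  by (induction A rule: infinite_finite_induct) (auto intro: mon_ideal_0 mon_ideal_add)

lemma mon_ideal_mult:
  fixes f g :: "'m::monoid_add \<Rightarrow>\<^sub>0 'k::semiring_0"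
  assumes "f \<in> mon_ideal Q" "g \<in> mon_ideal Q'" "\<And>u w. Q u \<Longrightarrow> Q' w \<Longrightarrow> Q'' (u + w)"
  shows "f * g \<in> mon_ideal Q''"
  unfolding mon_ideal_def
proof (clarify)
  fix z assume "z \<in> Poly_Mapping.keys (f * g)"
  then obtain u w where "z = u + w" "u \<in> Poly_Mapping.keys f" "w \<in> Poly_Mapping.keys g"
    using keys_mult[of f g] by blast
  thus "Q'' z" using assms by (simp add: mon_ideal_def)
qed

lemma idealset_mon_ideal:
  fixes Q :: "'m::comm_monoid_add \<Rightarrow> bool"
  assumes "\<And>u w. Q u \<Longrightarrow> Q (u + w)"
  shows "idealset (mon_ideal Q :: ('m \<Rightarrow>\<^sub>0 'k::comm_ring_1) set)"
proof -
  have "r * f \<in> mon_ideal Q" if "f \<in> mon_ideal Q" for r f :: "'m \<Rightarrow>\<^sub>0 'k"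
  proof (rule mon_ideal_mult)
    show "r \<in> mon_ideal (\<lambda>_. True)" by (simp add: mon_ideal_iff)
    show "Q (u + w)" if "Q w" for u w using assms[OF that, of u] by (simp add: add.commute)
  qed (rule that)
  thus ?thesis by (simp add: idealset_def mon_ideal_0 mon_ideal_add)
qed

lemma single_mon_ideal: "Q u \<Longrightarrow> Poly_Mapping.single u c \<in> mon_ideal Q"
  by (simp add: mon_ideal_iff lookup_single when_def)

text \<open>The projection along the remaining monomials: it picks normal forms modulo
  \<open>mon_ideal (\<lambda>u. \<not> P u)\<close>.\<close>

lift_definition part :: "('m \<Rightarrow> bool) \<Rightarrow> ('m \<Rightarrow>\<^sub>0 'k::zero) \<Rightarrow> ('m \<Rightarrow>\<^sub>0 'k)" is
  "\<lambda>P f u. if P u then f u else 0"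
  by (rule finite_subset[rotated]) auto

lemma lookup_part: "Poly_Mapping.lookup (part P f) u = (if P u then Poly_Mapping.lookup f u else 0)"
  by transfer simp

lemma part_0 [simp]: "part P 0 = 0"
  by (rule poly_mapping_eqI) (simp add: lookup_part)

lemma part_add: "part P (f + g) = part P f + part P g"
  for f g :: "'m \<Rightarrow>\<^sub>0 'k::monoid_add"
  by (rule poly_mapping_eqI) (simp add: lookup_part lookup_add)

lemma part_diff: "part P (f - g) = part P f - part P g"
  for f g :: "'m \<Rightarrow>\<^sub>0 'k::ab_group_add"
  by (rule poly_mapping_eqI) (simp add: lookup_part lookup_minus)

lemma part_sum: "part P (sum f A) = (\<Sum>i\<in>A. part P (f i))"
  for f :: "'i \<Rightarrow> 'm \<Rightarrow>\<^sub>0 'k::comm_monoid_add"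
  by (induction A rule: infinite_finite_induct) (simp_all add: part_add)

lemma part_commute: "part P (part Q f) = part Q (part P f)"
  by (rule poly_mapping_eqI) (simp add: lookup_part)

lemma part_in: "part P f \<in> mon_ideal P"
  by (simp add: mon_ideal_iff lookup_part)

lemma part_in_of: "f \<in> mon_ideal Q \<Longrightarrow> part P f \<in> mon_ideal Q"
  by (simp add: mon_ideal_iff lookup_part)

lemma minus_part_in: "f - part P f \<in> mon_ideal (\<lambda>u. \<not> P u)"
  for f :: "'m \<Rightarrow>\<^sub>0 'k::ab_group_add"
  by (simp add: mon_ideal_iff lookup_part lookup_minus)

lemma part_eq_0_iff: "part P f = 0 \<longleftrightarrow> f \<in> mon_ideal (\<lambda>u. \<not> P u)"
  unfolding poly_mapping_eq_iff fun_eq_iff lookup_part by (auto simp: mon_ideal_iff)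

lemma part_eq_self: "f \<in> mon_ideal P \<Longrightarrow> part P f = f"
  by (rule poly_mapping_eqI) (auto simp: mon_ideal_iff lookup_part)

lemma lookup_scale:
  fixes f :: "'m::comm_monoid_add \<Rightarrow>\<^sub>0 'k::comm_semiring_1"
  shows "Poly_Mapping.lookup (Poly_Mapping.single 0 c * f) u = c * Poly_Mapping.lookup f u"
  by (simp flip: mult_map_scale_conv_mult) (simp add: Poly_Mapping.map.rep_eq when_def)

lemma part_scale:
  fixes f :: "'m::comm_monoid_add \<Rightarrow>\<^sub>0 'k::comm_semiring_1"
  shows "part P (Poly_Mapping.single 0 c * f) = Poly_Mapping.single 0 c * part P f"
  by (rule poly_mapping_eqI) (simp add: lookup_part lookup_scale)

lemma scale_single:
  "Poly_Mapping.single 0 c * Poly_Mapping.single u b = Poly_Mapping.single (u :: 'm::comm_monoid_add) (c * b :: 'k::comm_semiring_1)"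
  by (simp add: mult_single)

lemma scale_mon_ideal:
  fixes f :: "'m::comm_monoid_add \<Rightarrow>\<^sub>0 'k::comm_semiring_1"
  shows "f \<in> mon_ideal Q \<Longrightarrow> Poly_Mapping.single 0 c * f \<in> mon_ideal Q"
  unfolding mon_ideal_iff lookup_scale by (metis mult_zero_right)

lemma sum_singles: "(\<Sum>u\<in>Poly_Mapping.keys f. Poly_Mapping.single u (Poly_Mapping.lookup f u)) = f"
  for f :: "'m \<Rightarrow>\<^sub>0 'k::comm_monoid_add"
proof (rule poly_mapping_eqI)
  fix w
  have "Poly_Mapping.lookup (\<Sum>u\<in>Poly_Mapping.keys f. Poly_Mapping.single u (Poly_Mapping.lookup f u)) w
      = (\<Sum>u\<in>Poly_Mapping.keys f. if u = w then Poly_Mapping.lookup f u else 0)"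
    by (simp add: lookup_sum lookup_single when_def)
  also have "\<dots> = Poly_Mapping.lookup f w" by (simp add: sum.delta in_keys_iff)
  finally show "Poly_Mapping.lookup (\<Sum>u\<in>Poly_Mapping.keys f. Poly_Mapping.single u (Poly_Mapping.lookup f u)) w
      = Poly_Mapping.lookup f w" .
qed

abbreviation Ge :: "nat \<Rightarrow> ('v::finite, 'k::comm_ring_1) mpoly set" where
  "Ge n \<equiv> mon_ideal (\<lambda>u. n \<le> mdeg u)"

abbreviation homog :: "nat \<Rightarrow> ('v::finite, 'k::comm_ring_1) mpoly set" where
  "homog n \<equiv> mon_ideal (\<lambda>u. mdeg u = n)"

abbreviation hcomp :: "nat \<Rightarrow> ('v::finite, 'k::comm_ring_1) mpoly \<Rightarrow> ('v, 'k) mpoly" where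
  "hcomp n \<equiv> part (\<lambda>u. mdeg u = n)"

abbreviation nonfaces :: "'v::finite set set \<Rightarrow> ('v, 'k::comm_ring_1) mpoly set" where
  "nonfaces \<Delta> \<equiv> mon_ideal (\<lambda>u. Poly_Mapping.keys u \<notin> \<Delta>)"

text \<open>The ideal of the variables outside \<open>F\<close>, that is the kernel of restriction
  to k[F]; \<open>part (\<lambda>u. Poly_Mapping.keys u \<subseteq> F)\<close> is this restriction,
  viewed inside the full polynomial ring.\<close>

abbreviation face_prime :: "'v::finite set \<Rightarrow> ('v, 'k::comm_ring_1) mpoly set" where
  "face_prime F \<equiv> mon_ideal (\<lambda>u. \<not> Poly_Mapping.keys u \<subseteq> F)"

lemma idealset_Ge: "idealset (Ge n)"
  by (rule idealset_mon_ideal) simp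

lemma idealset_face_prime: "idealset (face_prime F)"
  by (rule idealset_mon_ideal) (auto simp: keys_add_nat)

lemma idealset_nonfaces: "simplicial_complex \<Delta> \<Longrightarrow> idealset (nonfaces \<Delta>)"
  by (rule idealset_mon_ideal) (auto simp: keys_add_nat simplicial_complex_def)

lemma nonfaces_face_prime: "simplicial_complex \<Delta> \<Longrightarrow> F \<in> \<Delta> \<Longrightarrow> f \<in> nonfaces \<Delta> \<Longrightarrow> f \<in> face_prime F"
  by (erule mon_ideal_mono) (auto simp: simplicial_complex_def)

lemma Ge_0: "f \<in> Ge 0"
  by (simp add: mon_ideal_iff)

lemma Ge_mult: "f \<in> Ge a \<Longrightarrow> g \<in> Ge b \<Longrightarrow> f * g \<in> Ge (a + b)"
  by (erule mon_ideal_mult) (assumption, simp)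

lemma Ge_power: "f \<in> Ge a \<Longrightarrow> f ^ q \<in> Ge (q * a)"
proof (induction q)
  case (Suc q)
  thus ?case using Ge_mult[of f a "f ^ q" "q * a"] by simp
qed (simp add: mon_ideal_iff)

lemma Ge_mono: "f \<in> Ge a \<Longrightarrow> b \<le> a \<Longrightarrow> f \<in> Ge b"
  by (erule mon_ideal_mono) simp

lemma homog_Ge: "f \<in> homog n \<Longrightarrow> f \<in> Ge n"
  by (erule mon_ideal_mono) simp

lemma homog_mult: "f \<in> homog a \<Longrightarrow> g \<in> homog b \<Longrightarrow> f * g \<in> homog (a + b)"
  by (erule mon_ideal_mult) (assumption, simp)

lemma hcomp_eq_0: "f \<in> Ge (Suc n) \<Longrightarrow> hcomp n f = 0"
  unfolding part_eq_0_iff by (erule mon_ideal_mono) simp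

lemma minus_hcomp_Ge:
  assumes "f \<in> Ge n" shows "f - hcomp n f \<in> Ge (Suc n)"
proof -
  have "f - hcomp n f \<in> Ge n" using assms by (intro mon_ideal_diff part_in_of)
  moreover have "f - hcomp n f \<in> mon_ideal (\<lambda>u. mdeg u \<noteq> n)" by (rule minus_part_in)
  ultimately show ?thesis unfolding mon_ideal_def by fastforce
qed

lemma hcomp_mult_low:
  assumes f: "f \<in> Ge a" and g: "g \<in> Ge b"
  shows "hcomp (a + b) (f * g) = hcomp a f * hcomp b g"
proof -
  have "f * g - hcomp a f * hcomp b g = (f - hcomp a f) * g + hcomp a f * (g - hcomp b g)"
    by (simp add: algebra_simps)
  moreover have "(f - hcomp a f) * g \<in> Ge (Suc (a + b))"
    using Ge_mult[OF minus_hcomp_Ge[OF f] g] by simp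
  moreover have "hcomp a f * (g - hcomp b g) \<in> Ge (Suc (a + b))"
    using Ge_mult[OF part_in_of[OF f] minus_hcomp_Ge[OF g]] by simp
  ultimately have "f * g - hcomp a f * hcomp b g \<in> Ge (Suc (a + b))"
    by (simp only: mon_ideal_add)
  from hcomp_eq_0[OF this]
  have "hcomp (a + b) (f * g) = hcomp (a + b) (hcomp a f * hcomp b g)"
    by (simp only: part_diff right_minus_eq)
  also have "\<dots> = hcomp a f * hcomp b g"
    by (intro part_eq_self homog_mult part_in)
  finally show ?thesis .
qed

lemma hcomp_mult_homog:
  assumes "f \<in> homog a"
  shows "hcomp (a + b) (f * g) = f * hcomp b g"
proof -
  have "f * (g - hcomp b g) \<in> mon_ideal (\<lambda>u. mdeg u \<noteq> a + b)"
    by (rule mon_ideal_mult[OF assms minus_part_in]) simp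
  hence "hcomp (a + b) (f * (g - hcomp b g)) = 0" unfolding part_eq_0_iff .
  hence "hcomp (a + b) (f * g) = hcomp (a + b) (f * hcomp b g)"
    by (simp add: right_diff_distrib part_diff)
  also have "\<dots> = f * hcomp b g" by (intro part_eq_self homog_mult assms part_in)
  finally show ?thesis .
qed

lemma part_face_mult:
  "part (\<lambda>u. Poly_Mapping.keys u \<subseteq> F) (f * g)
    = part (\<lambda>u. Poly_Mapping.keys u \<subseteq> F) f * part (\<lambda>u. Poly_Mapping.keys u \<subseteq> F) (g :: ('v::finite, 'k::comm_ring_1) mpoly)"
  (is "?p (f * g) = ?p f * ?p g")
proof -
  have J: "idealset (face_prime F :: ('v, 'k) mpoly set)" by (rule idealset_face_prime)
  have "f * g - ?p f * ?p g = g * (f - ?p f) + ?p f * (g - ?p g)"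
    by (simp add: algebra_simps)
  also have "\<dots> \<in> face_prime F"
    by (intro idealset_add[OF J] idealset_mult[OF J] minus_part_in)
  finally have "?p (f * g - ?p f * ?p g) = 0" by (simp only: part_eq_0_iff)
  hence "?p (f * g) = ?p (?p f * ?p g)" by (simp only: part_diff right_minus_eq)
  also have "\<dots> = ?p f * ?p g"
    by (intro part_eq_self mon_ideal_mult[OF part_in part_in]) (simp add: keys_add_nat)
  finally show ?thesis .
qed

text \<open>Restriction to k[F] is multiplicative, and polynomials have no zero divisors. The linear
  order on the variables enters here: it orders the monomials, which is behind the latter
  fact.\<close>

lemma face_prime_prime:
  fixes f g :: "('v::{finite,linorder}, 'k::field) mpoly"
  assumes "f * g \<in> face_prime F" shows "f \<in> face_prime F \<or> g \<in> face_prime F"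
proof -
  have "part (\<lambda>u. Poly_Mapping.keys u \<subseteq> F) (f * g) = 0" using assms by (simp only: part_eq_0_iff)
  hence "part (\<lambda>u. Poly_Mapping.keys u \<subseteq> F) f = 0 \<or> part (\<lambda>u. Poly_Mapping.keys u \<subseteq> F) g = 0"
    unfolding part_face_mult by simp
  thus ?thesis by (simp only: part_eq_0_iff)
qed

lemma one_notin_face_prime: "1 \<notin> (face_prime F :: ('v::finite, 'k::comm_ring_1) mpoly set)"
  by (simp add: mon_ideal_def)

text \<open>For \<open>f = 0\<close> this is an unspecified \<open>Min {}\<close>; hence the
  hypotheses \<open>f \<noteq> 0\<close> in \<open>ord_ge_iff\<close> and
  \<open>ord_mult\<close>.\<close>

definition ord :: "('v::finite, 'k::comm_ring_1) mpoly \<Rightarrow> nat" where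
  "ord f = Min (mdeg ` Poly_Mapping.keys f)"

lemma ord_Ge: "f \<in> Ge (ord f)"
  by (simp add: mon_ideal_def ord_def)

lemma hcomp_ord_nonzero:
  assumes "f \<noteq> 0" shows "hcomp (ord f) f \<noteq> 0"
proof -
  have "ord f \<in> mdeg ` Poly_Mapping.keys f" unfolding ord_def using assms by (intro Min_in) auto
  then obtain u where "u \<in> Poly_Mapping.keys f" "mdeg u = ord f" by auto
  thus ?thesis unfolding part_eq_0_iff by (auto simp: mon_ideal_def)
qed

lemma ord_ge_iff: "f \<noteq> 0 \<Longrightarrow> f \<in> Ge n \<longleftrightarrow> n \<le> ord f"
  by (auto simp: mon_ideal_def ord_def)

text \<open>The product of the lowest components is nonzero, so it is the lowest component of the
  product.\<close>

lemma ord_mult: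
  fixes f g :: "('v::{finite,linorder}, 'k::field) mpoly"
  assumes "f \<noteq> 0" "g \<noteq> 0" shows "ord (f * g) = ord f + ord g"
proof (rule antisym)
  have fg: "f * g \<noteq> 0" using assms by simp
  show "ord f + ord g \<le> ord (f * g)"
    using Ge_mult[OF ord_Ge[of f] ord_Ge[of g]] unfolding ord_ge_iff[OF fg] .
  show "ord (f * g) \<le> ord f + ord g"
  proof (rule ccontr)
    assume "\<not> ord (f * g) \<le> ord f + ord g"
    hence "f * g \<in> Ge (Suc (ord f + ord g))" unfolding ord_ge_iff[OF fg] by simp
    hence "hcomp (ord f + ord g) (f * g) = 0" by (rule hcomp_eq_0)
    thus False using hcomp_mult_low[OF ord_Ge[of f] ord_Ge[of g]] hcomp_ord_nonzero[OF assms(1)] hcomp_ord_nonzero[OF assms(2)]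
      by simp
  qed
qed

lemma ord_power:
  fixes f :: "('v::{finite,linorder}, 'k::field) mpoly"
  assumes "f \<noteq> 0" shows "ord (f ^ q) = q * ord f"
proof (induction q)
  case 0
  show ?case by (simp add: ord_def)
qed (simp add: ord_mult assms)

section \<open>Linear forms and linear parts\<close>

definition linform :: "('v::finite \<Rightarrow> 'k) \<Rightarrow> ('v, 'k::comm_ring_1) mpoly" where
  "linform c = (\<Sum>x\<in>UNIV. const (c x) * indet x)"

definition linpart :: "('v::finite, 'k::comm_ring_1) mpoly \<Rightarrow> 'v \<Rightarrow> 'k" where
  "linpart f x = Poly_Mapping.lookup f (Poly_Mapping.single x 1)"

lemma const_mult_indet: "const c * indet x = Poly_Mapping.single (Poly_Mapping.single x 1) c"
  by (simp add: const_def indet_def mult_single)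

lemma linform_homog: "linform c \<in> homog 1"
  unfolding linform_def const_mult_indet by (intro mon_ideal_sum single_mon_ideal) simp

lemma linpart_linform:
  fixes c :: "'v::finite \<Rightarrow> 'k::comm_ring_1"
  shows "linpart (linform c) = c"
proof
  fix x :: 'v
  have inj: "Poly_Mapping.single y (1 :: nat) = Poly_Mapping.single x 1 \<longleftrightarrow> y = x" for y :: 'v
    by (metis keys_single singleton_inject zero_neq_one)
  have "linpart (linform c) x = (\<Sum>y\<in>UNIV. if y = x then c y else 0)"
    unfolding linpart_def linform_def const_mult_indet lookup_sum
    by (intro sum.cong refl) (simp only: lookup_single when_def inj)
  thus "linpart (linform c) x = c x" by simp
qed

lemma mdeg_1E:
  assumes "mdeg u = 1" obtains x where "u = Poly_Mapping.single x 1"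
proof -
  from assms obtain x where x: "x \<in> Poly_Mapping.keys u" by (metis mdeg_0 zero_neq_one keys_eq_empty ex_in_conv)
  define w where "w = u - Poly_Mapping.single x 1"
  have u: "w + Poly_Mapping.single x 1 = u" unfolding w_def by (rule minus_single_add[OF x])
  have "mdeg w = 0" using arg_cong[OF u, of mdeg] assms by simp
  hence "u = Poly_Mapping.single x 1" using u by (simp add: mdeg_eq_0_iff)
  thus ?thesis by (rule that)
qed

lemma hcomp_1: "hcomp 1 f = linform (linpart f)"
proof (rule poly_mapping_eqI)
  fix u
  show "Poly_Mapping.lookup (hcomp 1 f) u = Poly_Mapping.lookup (linform (linpart f)) u"
  proof (cases "mdeg u = 1")
    case True
    then obtain x where "u = Poly_Mapping.single x 1" by (rule mdeg_1E)
    thus ?thesis using fun_cong[OF linpart_linform[of "linpart f"], of x]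
      by (simp add: lookup_part linpart_def)
  next
    case False
    have "Poly_Mapping.lookup (linform (linpart f)) u = 0"
      using False linform_homog[of "linpart f"] unfolding mon_ideal_iff by blast
    thus ?thesis using False by (simp add: lookup_part)
  qed
qed

section \<open>Restriction to lines through the origin\<close>

definition mval :: "('v::finite \<Rightarrow> 'k::comm_ring_1) \<Rightarrow> ('v \<Rightarrow>\<^sub>0 nat) \<Rightarrow> 'k" where
  "mval v u = (\<Prod>x\<in>UNIV. v x ^ Poly_Mapping.lookup u x)"

text \<open>The restriction of a polynomial to the line through the origin and \<open>v\<close>.\<close>

definition ray :: "('v::finite \<Rightarrow> 'k::comm_ring_1) \<Rightarrow> ('v, 'k) mpoly \<Rightarrow> 'k poly" where
  "ray v f = (\<Sum>u\<in>Poly_Mapping.keys f. monom (Poly_Mapping.lookup f u * mval v u) (mdeg u))"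

lemma mval_add: "mval v (u + w) = mval v u * mval v w"
  by (simp add: mval_def lookup_add power_add prod.distrib)

lemma mval_0: "mval v 0 = 1"
  by (simp add: mval_def)

lemma mval_single: "mval v (Poly_Mapping.single x n) = v x ^ n"
proof -
  have "mval v (Poly_Mapping.single x n) = (\<Prod>y\<in>UNIV. if y = x then v y ^ n else 1)"
    unfolding mval_def by (intro prod.cong refl) (simp add: lookup_single when_def)
  thus ?thesis by simp
qed

lemma mval_eq_0:
  assumes "x \<in> Poly_Mapping.keys u" "v x = 0" shows "mval v u = 0"
proof -
  have "Poly_Mapping.lookup u x > 0" using assms(1) by (simp add: in_keys_iff)
  hence "v x ^ Poly_Mapping.lookup u x = 0" using assms(2) by (simp add: zero_power)
  hence "\<exists>x\<in>UNIV. v x ^ Poly_Mapping.lookup u x = 0" by blast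
  thus ?thesis unfolding mval_def by (rule prod_zero[OF finite])
qed

lemma ray_superset:
  assumes "Poly_Mapping.keys f \<subseteq> T" "finite T"
  shows "ray v f = (\<Sum>u\<in>T. monom (Poly_Mapping.lookup f u * mval v u) (mdeg u))"
  unfolding ray_def using assms by (intro sum.mono_neutral_left) (auto simp: in_keys_iff)

lemma ray_0 [simp]: "ray v 0 = 0"
  by (simp add: ray_def)

lemma ray_add: "ray v (f + g) = ray v f + ray v g"
proof -
  let ?T = "Poly_Mapping.keys f \<union> Poly_Mapping.keys g"
  have T: "finite ?T" "Poly_Mapping.keys f \<subseteq> ?T" "Poly_Mapping.keys g \<subseteq> ?T" "Poly_Mapping.keys (f + g) \<subseteq> ?T"
    using keys_add[of f g] by auto
  show ?thesis
    unfolding ray_superset[OF T(2,1)] ray_superset[OF T(3,1)] ray_superset[OF T(4,1)]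
    by (simp add: lookup_add distrib_right sum.distrib flip: add_monom)
qed

lemma ray_sum: "ray v (sum f A) = (\<Sum>i\<in>A. ray v (f i))"
  by (induction A rule: infinite_finite_induct) (simp_all add: ray_add)

lemma ray_single: "ray v (Poly_Mapping.single u c) = monom (c * mval v u) (mdeg u)"
proof -
  have "ray v (Poly_Mapping.single u c) = (\<Sum>w\<in>{u}. monom (Poly_Mapping.lookup (Poly_Mapping.single u c) w * mval v w) (mdeg w))"
    by (rule ray_superset) auto
  thus ?thesis by simp
qed

lemma ray_mult: "ray v (f * g) = ray v f * ray v g"
proof -
  let ?s = "\<lambda>f u. Poly_Mapping.single u (Poly_Mapping.lookup f u)"
  have "f * g = (\<Sum>u\<in>Poly_Mapping.keys f. ?s f u) * (\<Sum>w\<in>Poly_Mapping.keys g. ?s g w)"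
    by (simp only: sum_singles)
  also have "\<dots> = (\<Sum>u\<in>Poly_Mapping.keys f. \<Sum>w\<in>Poly_Mapping.keys g. ?s f u * ?s g w)"
    by (rule sum_product)
  finally have "ray v (f * g) = (\<Sum>u\<in>Poly_Mapping.keys f. \<Sum>w\<in>Poly_Mapping.keys g. ray v (?s f u * ?s g w))"
    by (simp only: ray_sum)
  also have "\<dots> = (\<Sum>u\<in>Poly_Mapping.keys f. \<Sum>w\<in>Poly_Mapping.keys g.
      monom (Poly_Mapping.lookup f u * mval v u) (mdeg u) * monom (Poly_Mapping.lookup g w * mval v w) (mdeg w))"
    by (simp add: mult_single ray_single mult_monom mval_add mult_ac)
  also have "\<dots> = ray v f * ray v g" by (simp add: ray_def sum_product)
  finally show ?thesis .
qed

lemma ray_diff: "ray v (f - g) = ray v f - ray v g"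
  using ray_add[of v "f - g" g] by simp

lemma ray_linform: "ray v (linform c) = monom (\<Sum>x\<in>UNIV. c x * v x) 1"
proof -
  have "ray v (linform c) = (\<Sum>x\<in>UNIV. monom (c x * v x) 1)"
    unfolding linform_def const_mult_indet ray_sum ray_single mval_single by simp
  thus ?thesis by (simp add: monom_sum)
qed

text \<open>The line through \<open>v\<close> lies in the coordinate subspace of the face
  \<open>F\<close>, where every monomial with nonface support vanishes.\<close>

lemma ray_nonfaces:
  assumes \<Delta>: "simplicial_complex \<Delta>" "F \<in> \<Delta>" and v: "\<And>x. x \<notin> F \<Longrightarrow> v x = 0" and f: "f \<in> nonfaces \<Delta>"
  shows "ray v f = 0"
  unfolding ray_def
proof (intro sum.neutral ballI)
  fix u assume "u \<in> Poly_Mapping.keys f"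
  hence "\<not> Poly_Mapping.keys u \<subseteq> F"
    using nonfaces_face_prime[OF \<Delta> f] by (simp add: mon_ideal_def)
  then obtain x where "x \<in> Poly_Mapping.keys u" "v x = 0" using v by blast
  hence "mval v u = 0" by (rule mval_eq_0)
  thus "monom (Poly_Mapping.lookup f u * mval v u) (mdeg u) = 0" by simp
qed

lemma coeff_ray_0: "coeff (ray v f) 0 = Poly_Mapping.lookup f 0"
proof -
  have "ray v f = (\<Sum>u\<in>insert 0 (Poly_Mapping.keys f). monom (Poly_Mapping.lookup f u * mval v u) (mdeg u))"
    by (rule ray_superset) auto
  hence "coeff (ray v f) 0 = (\<Sum>u\<in>insert 0 (Poly_Mapping.keys f). if u = 0 then Poly_Mapping.lookup f u * mval v u else 0)"
    by (simp only: coeff_sum coeff_monom mdeg_eq_0_iff)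
  thus ?thesis by (simp add: mval_0)
qed

text \<open>No nonzero point in the coordinate subspace of a face is a common zero of the forms;
  equivalently, their restrictions to each face span its dual space, see
  \<open>spanning_dual\<close>. This is the combinatorial criterion for a linear system of
  parameters.\<close>

definition spanning :: "'v::finite set set \<Rightarrow> nat \<Rightarrow> (nat \<Rightarrow> 'v \<Rightarrow> 'k::comm_ring_1) \<Rightarrow> bool" where
  "spanning \<Delta> d b \<longleftrightarrow> (\<forall>F\<in>\<Delta>. \<forall>v. (\<forall>x. x \<notin> F \<longrightarrow> v x = 0) \<longrightarrow>
     (\<forall>i\<in>{1..d}. (\<Sum>x\<in>UNIV. b i x * v x) = 0) \<longrightarrow> (\<forall>x. v x = 0))"

text \<open>Membership in the combinations of the \<open>a i\<close> modulo the nonface ideal, with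
  cofactors restricted by \<open>Q\<close>. Prescribing their degree, or a lower bound for it, gives
  the graded and the \<mm>-adic version alike.\<close>

definition covered :: "'v::finite set set \<Rightarrow> nat \<Rightarrow> (nat \<Rightarrow> ('v, 'k::comm_ring_1) mpoly) \<Rightarrow> (('v \<Rightarrow>\<^sub>0 nat) \<Rightarrow> bool) \<Rightarrow> ('v, 'k) mpoly \<Rightarrow> bool" where
  "covered \<Delta> d a Q f \<longleftrightarrow> (\<exists>g. (\<forall>i. g i \<in> mon_ideal Q) \<and> f - (\<Sum>i=1..d. a i * g i) \<in> nonfaces \<Delta>)"

text \<open>Vanishing in degree \<open>n\<close> of the Stanley-Reisner ring modulo the linear
  forms.\<close>

definition covers :: "'v::finite set set \<Rightarrow> nat \<Rightarrow> (nat \<Rightarrow> 'v \<Rightarrow> 'k::comm_ring_1) \<Rightarrow> nat \<Rightarrow> bool" where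
  "covers \<Delta> d b n \<longleftrightarrow> (\<forall>f\<in>homog n. covered \<Delta> d (\<lambda>i. linform (b i)) (\<lambda>u. mdeg u = n - 1) f)"

text \<open>The inhomogeneous counterpart, since a joint reduction need not consist of forms:
  \<mm>^n lies in the sum of the a_i \<mm>^(n-1).\<close>

definition gcovers :: "'v::finite set set \<Rightarrow> nat \<Rightarrow> (nat \<Rightarrow> ('v, 'k::comm_ring_1) mpoly) \<Rightarrow> nat \<Rightarrow> bool" where
  "gcovers \<Delta> d a n \<longleftrightarrow> (\<forall>f\<in>Ge n. covered \<Delta> d a (\<lambda>u. n - 1 \<le> mdeg u) f)"

text \<open>The \<open>a i\<close> have order at least 1 and the cofactors order at least
  \<open>n - 1\<close>, so degree \<open>n\<close> of each product sees only the lowest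
  components.\<close>

lemma gcovers_imp_covers:
  assumes a: "\<And>i. i \<in> {1..d} \<Longrightarrow> a i \<in> Ge 1" and n: "n \<ge> 1" and "gcovers \<Delta> d a n"
  shows "covers \<Delta> d (\<lambda>i. linpart (a i)) n"
  unfolding covers_def
proof
  fix f :: "('a, 'b) mpoly" assume f: "f \<in> homog n"
  then obtain g where g: "\<forall>i. g i \<in> Ge (n - 1)" "f - (\<Sum>i=1..d. a i * g i) \<in> nonfaces \<Delta>"
    using assms(3) homog_Ge[OF f] unfolding gcovers_def covered_def by blast
  have "hcomp n (a i * g i) = linform (linpart (a i)) * hcomp (n - 1) (g i)" if "i \<in> {1..d}" for i
    using hcomp_mult_low[OF a[OF that], of "g i" "n - 1"] g(1) n by (simp add: hcomp_1[unfolded One_nat_def])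
  hence "hcomp n (\<Sum>i=1..d. a i * g i) = (\<Sum>i=1..d. linform (linpart (a i)) * hcomp (n - 1) (g i))"
    unfolding part_sum by (rule sum.cong[OF refl])
  moreover have "hcomp n f = f" using f by (rule part_eq_self)
  ultimately have "f - (\<Sum>i=1..d. linform (linpart (a i)) * hcomp (n - 1) (g i)) = hcomp n (f - (\<Sum>i=1..d. a i * g i))"
    by (simp only: part_diff)
  also have "\<dots> \<in> nonfaces \<Delta>" using g(2) by (rule part_in_of)
  finally show "covered \<Delta> d (\<lambda>i. linform (linpart (a i))) (\<lambda>u. mdeg u = n - 1) f"
    unfolding covered_def by (intro exI[of _ "\<lambda>i. hcomp (n - 1) (g i)"]) (simp add: part_in)
qed

text \<open>Test with a pure power of a variable \<open>x\<close>: on the line through a common zero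
  \<open>v\<close> in a face the combination of the forms vanishes, so
  \<open>v x ^ n = 0\<close>.\<close>

lemma spanning_of_covers:
  fixes b :: "nat \<Rightarrow> 'v::finite \<Rightarrow> 'k::field"
  assumes \<Delta>: "simplicial_complex \<Delta>" and cov: "covers \<Delta> d b n" and n: "n \<ge> 1"
  shows "spanning \<Delta> d b"
  unfolding spanning_def
proof (intro ballI allI impI)
  fix F v x assume F: "F \<in> \<Delta>" and v: "\<forall>x. x \<notin> F \<longrightarrow> v x = 0"
    and b: "\<forall>i\<in>{1..d}. (\<Sum>x\<in>UNIV. b i x * v x) = 0"
  define f :: "('v, 'k) mpoly" where "f = Poly_Mapping.single (Poly_Mapping.single x n) 1"
  have "f \<in> homog n" unfolding f_def by (rule single_mon_ideal) simp
  then obtain g where g: "f - (\<Sum>i=1..d. linform (b i) * g i) \<in> nonfaces \<Delta>"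
    using cov unfolding covers_def covered_def by blast
  have "ray v (f - (\<Sum>i=1..d. linform (b i) * g i)) = 0"
    using v by (intro ray_nonfaces[OF \<Delta> F _ g]) simp
  hence "ray v f = (\<Sum>i=1..d. monom (\<Sum>x\<in>UNIV. b i x * v x) 1 * ray v (g i))"
    by (simp only: ray_diff ray_sum ray_mult ray_linform right_minus_eq)
  also have "\<dots> = 0" using b by (intro sum.neutral) simp
  finally have "monom (v x ^ n) n = 0" by (simp add: f_def ray_single mval_single)
  thus "v x = 0" by (simp add: monom_eq_0_iff)
qed

lemma covered_nonfaces: "f \<in> nonfaces \<Delta> \<Longrightarrow> covered \<Delta> d a Q f"
  unfolding covered_def by (auto intro!: exI[of _ "\<lambda>_. 0"] simp: mon_ideal_0)

lemma covered_add:
  assumes "covered \<Delta> d a Q f" "covered \<Delta> d a Q g" shows "covered \<Delta> d a Q (f + g)"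
proof -
  obtain r s where r: "\<forall>i. r i \<in> mon_ideal Q" "f - (\<Sum>i=1..d. a i * r i) \<in> nonfaces \<Delta>"
    and s: "\<forall>i. s i \<in> mon_ideal Q" "g - (\<Sum>i=1..d. a i * s i) \<in> nonfaces \<Delta>"
    using assms unfolding covered_def by blast
  have "f + g - (\<Sum>i=1..d. a i * (r i + s i)) = (f - (\<Sum>i=1..d. a i * r i)) + (g - (\<Sum>i=1..d. a i * s i))"
    by (simp add: distrib_left sum.distrib)
  also have "\<dots> \<in> nonfaces \<Delta>" using r s by (intro mon_ideal_add)
  finally show ?thesis unfolding covered_def
    using r s by (intro exI[of _ "\<lambda>i. r i + s i"]) (simp add: mon_ideal_add)
qed

lemma covered_scale:
  assumes "covered \<Delta> d a Q f" shows "covered \<Delta> d a Q (Poly_Mapping.single 0 c * f)"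
proof -
  obtain r where r: "\<forall>i. r i \<in> mon_ideal Q" "f - (\<Sum>i=1..d. a i * r i) \<in> nonfaces \<Delta>"
    using assms unfolding covered_def by blast
  let ?c = "Poly_Mapping.single 0 c"
  have "?c * f - (\<Sum>i=1..d. a i * (?c * r i)) = ?c * (f - (\<Sum>i=1..d. a i * r i))"
    by (simp add: right_diff_distrib sum_distrib_left mult_ac)
  also have "\<dots> \<in> nonfaces \<Delta>" using r by (intro scale_mon_ideal)
  finally show ?thesis unfolding covered_def
    using r by (intro exI[of _ "\<lambda>i. ?c * r i"]) (simp add: scale_mon_ideal)
qed

lemma covered_sum: "(\<And>j. j \<in> A \<Longrightarrow> covered \<Delta> d a Q (f j)) \<Longrightarrow> covered \<Delta> d a Q (sum f A)"
  by (induction A rule: infinite_finite_induct) (simp_all add: covered_add covered_nonfaces mon_ideal_0)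

lemma covered_of_monomials:
  assumes "\<And>u. u \<in> Poly_Mapping.keys f \<Longrightarrow> covered \<Delta> d a Q (Poly_Mapping.single u 1)"
  shows "covered \<Delta> d a Q f"
proof -
  have "covered \<Delta> d a Q (Poly_Mapping.single u (Poly_Mapping.lookup f u))" if "u \<in> Poly_Mapping.keys f" for u
    using covered_scale[OF assms[OF that], of "Poly_Mapping.lookup f u"] by (simp only: scale_single mult_1_right)
  hence "covered \<Delta> d a Q (\<Sum>u\<in>Poly_Mapping.keys f. Poly_Mapping.single u (Poly_Mapping.lookup f u))"
    by (rule covered_sum)
  thus ?thesis by (simp only: sum_singles)
qed

lemma gcovers_of_covers:
  assumes "\<And>m. m \<ge> n \<Longrightarrow> covers \<Delta> d b m"
  shows "gcovers \<Delta> d (\<lambda>i. linform (b i)) n"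
  unfolding gcovers_def
proof (rule ballI, rule covered_of_monomials)
  fix f :: "('a, 'b) mpoly" and u assume "f \<in> Ge n" "u \<in> Poly_Mapping.keys f"
  hence u: "mdeg u \<ge> n" by (simp add: mon_ideal_def)
  have "Poly_Mapping.single u 1 \<in> (homog (mdeg u) :: ('a, 'b) mpoly set)" by (rule single_mon_ideal) simp
  then obtain g where g: "\<forall>i. g i \<in> homog (mdeg u - 1)"
    "Poly_Mapping.single u 1 - (\<Sum>i=1..d. linform (b i) * g i) \<in> nonfaces \<Delta>"
    using assms[OF u] unfolding covers_def covered_def by blast
  have "g i \<in> Ge (n - 1)" for i using u by (intro Ge_mono[OF homog_Ge[OF g(1)[rule_format]]]) simp
  thus "covered \<Delta> d (\<lambda>i. linform (b i)) (\<lambda>u. n - 1 \<le> mdeg u) (Poly_Mapping.single u 1)"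
    using g(2) unfolding covered_def by blast
qed

lemma gcovers_Suc:
  fixes a :: "nat \<Rightarrow> ('v::finite, 'k::comm_ring_1) mpoly"
  assumes \<Delta>: "simplicial_complex \<Delta>" and "gcovers \<Delta> d a n"
  shows "gcovers \<Delta> d a (Suc n)"
  unfolding gcovers_def
proof (rule ballI, rule covered_of_monomials)
  fix f :: "('v, 'k) mpoly" and u assume "f \<in> Ge (Suc n)" "u \<in> Poly_Mapping.keys f"
  hence u: "mdeg u \<ge> Suc n" by (simp add: mon_ideal_def)
  hence "u \<noteq> 0" by auto
  then obtain x where x: "x \<in> Poly_Mapping.keys u" by (metis ex_in_conv keys_eq_empty)
  define w where "w = u - Poly_Mapping.single x 1"
  have uw: "w + Poly_Mapping.single x 1 = u" unfolding w_def by (rule minus_single_add[OF x])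
  have "mdeg w \<ge> n" using arg_cong[OF uw, of mdeg] u by simp
  hence "Poly_Mapping.single w 1 \<in> (Ge n :: ('v, 'k) mpoly set)" by (rule single_mon_ideal)
  then obtain g where g: "\<forall>i. g i \<in> Ge (n - 1)"
    "Poly_Mapping.single w 1 - (\<Sum>i=1..d. a i * g i) \<in> nonfaces \<Delta>"
    using assms(2) unfolding gcovers_def covered_def by blast
  have X: "(indet x :: ('v, 'k) mpoly) \<in> Ge 1" unfolding indet_def by (rule single_mon_ideal) simp
  have "indet x * g i \<in> Ge (Suc n - 1)" for i
    by (rule Ge_mono[OF Ge_mult[OF X g(1)[rule_format]]]) simp
  moreover have "indet x * Poly_Mapping.single w 1 = (Poly_Mapping.single u 1 :: ('v, 'k) mpoly)"
    unfolding indet_def mult_single uw[symmetric] by (simp add: add.commute)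
  hence "Poly_Mapping.single u 1 - (\<Sum>i=1..d. a i * (indet x * g i))
    = indet x * (Poly_Mapping.single w 1 - (\<Sum>i=1..d. a i * g i))"
    by (simp add: right_diff_distrib sum_distrib_left mult.left_commute)
  moreover have "\<dots> \<in> nonfaces \<Delta>" using g(2) by (rule idealset_mult[OF idealset_nonfaces[OF \<Delta>]])
  ultimately show "covered \<Delta> d a (\<lambda>u. Suc n - 1 \<le> mdeg u) (Poly_Mapping.single u 1)"
    unfolding covered_def by (intro exI[of _ "\<lambda>i. indet x * g i"]) simp
qed

lemma gcovers_mono:
  assumes "simplicial_complex \<Delta>" "gcovers \<Delta> d a n" "n \<le> m"
  shows "gcovers \<Delta> d a m"
  using assms(3,2) by (induction rule: dec_induct) (auto intro: gcovers_Suc[OF assms(1)])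

text \<open>Replacing each \<open>a i\<close> by its linear part in degree \<open>m\<close> leaves
  an error of order \<open>m + 1\<close>, which the case \<open>Suc m\<close> absorbs. The induction
  moves downward from the given \<open>M\<close>, so finitely many corrections suffice.\<close>

lemma gcovers_descend:
  fixes a :: "nat \<Rightarrow> ('v::finite, 'k::comm_ring_1) mpoly"
  assumes a: "\<And>i. i \<in> {1..d} \<Longrightarrow> a i \<in> Ge 1"
    and \<Delta>: "simplicial_complex \<Delta>"
    and cov: "\<And>m. m \<ge> n \<Longrightarrow> covers \<Delta> d (\<lambda>i. linpart (a i)) m"
    and top: "gcovers \<Delta> d a M" and n: "n \<ge> 1"
  shows "gcovers \<Delta> d a n"
proof -
  have step: "gcovers \<Delta> d a m" if m: "m \<ge> n" and IH: "gcovers \<Delta> d a (Suc m)" for m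
    unfolding gcovers_def
  proof
    fix f :: "('v, 'k) mpoly" assume f: "f \<in> Ge m"
    have "hcomp m f \<in> homog m" by (rule part_in)
    then obtain h where h: "\<forall>i. h i \<in> homog (m - 1)"
      "hcomp m f - (\<Sum>i=1..d. linform (linpart (a i)) * h i) \<in> nonfaces \<Delta>"
      using cov[OF m] unfolding covers_def covered_def by blast
    \<comment> \<open>What degree \<open>m\<close> leaves over: the part of \<open>f\<close> above
      degree \<open>m\<close>, corrected by the nonlinear parts of the \<open>a i\<close>.\<close>
    define w where "w = (f - hcomp m f) - (\<Sum>i=1..d. (a i - hcomp 1 (a i)) * h i)"
    have "(a i - hcomp 1 (a i)) * h i \<in> Ge (Suc m)" if "i \<in> {1..d}" for i
      using Ge_mult[OF minus_hcomp_Ge[OF a[OF that]] homog_Ge[OF h(1)[rule_format]]] m n by simp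
    hence "w \<in> Ge (Suc m)" unfolding w_def by (intro mon_ideal_diff mon_ideal_sum minus_hcomp_Ge f)
    then obtain g where g: "\<forall>i. g i \<in> Ge m" "w - (\<Sum>i=1..d. a i * g i) \<in> nonfaces \<Delta>"
      using IH unfolding gcovers_def covered_def by auto
    have "f - (\<Sum>i=1..d. a i * (g i + h i))
      = (w - (\<Sum>i=1..d. a i * g i)) + (hcomp m f - (\<Sum>i=1..d. linform (linpart (a i)) * h i))"
      unfolding w_def hcomp_1 by (simp add: algebra_simps sum.distrib sum_subtractf)
    also have "\<dots> \<in> nonfaces \<Delta>" using g(2) h(2) by (rule mon_ideal_add)
    finally have "f - (\<Sum>i=1..d. a i * (g i + h i)) \<in> nonfaces \<Delta>" .
    moreover have "g i + h i \<in> Ge (m - 1)" for i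
    proof (rule mon_ideal_add)
      show "g i \<in> Ge (m - 1)" by (rule Ge_mono[OF g(1)[rule_format]]) simp
      show "h i \<in> Ge (m - 1)" by (rule homog_Ge[OF h(1)[rule_format]])
    qed
    ultimately show "covered \<Delta> d a (\<lambda>u. m - 1 \<le> mdeg u) f"
      unfolding covered_def by (intro exI[of _ "\<lambda>i. g i + h i"]) simp
  qed
  have top': "gcovers \<Delta> d a (max n M)" using gcovers_mono[OF \<Delta> top] by simp
  have "n \<le> max n M" by simp
  thus ?thesis
  proof (rule inc_induct)
    show "gcovers \<Delta> d a m" if "n \<le> m" "gcovers \<Delta> d a (Suc m)" for m using step that .
  qed (rule top')
qed

text \<open>If the restrictions of the forms to \<open>F\<close> did not span all functions on
  \<open>F\<close>, a vector orthogonal to them, extended by zero, would contradict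
  \<open>spanning\<close>.\<close>

lemma spanning_dual:
  fixes b :: "nat \<Rightarrow> 'v::finite \<Rightarrow> 'k::field"
  assumes span: "spanning \<Delta> d b" and F: "F \<in> \<Delta>"
  shows "\<exists>l. \<forall>y\<in>F. (\<Sum>i=1..d. l i * b i y) = (if y = x then 1 else 0)"
proof -
  define cmb where "cmb l y = (\<Sum>i=1..d. l i * b i y)" for l :: "nat \<Rightarrow> 'k" and y
  define W where "W = range cmb"
  have "(\<forall>g. \<exists>w\<in>W. \<forall>t\<in>F. w t = g t) \<or> (\<exists>v. (\<exists>t\<in>F. v t \<noteq> 0) \<and> (\<forall>w\<in>W. (\<Sum>t\<in>F. v t * w t) = 0))"
  proof (rule full_or_orthogonal)
    have "cmb (\<lambda>_. 0) = (\<lambda>_. 0)" by (simp add: cmb_def fun_eq_iff)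
    thus "(\<lambda>_. 0) \<in> W" unfolding W_def by (metis rangeI)
    show "(\<lambda>t. f t + g t) \<in> W" if fg: "f \<in> W" "g \<in> W" for f g
    proof -
      obtain l m where "f = cmb l" "g = cmb m" using fg unfolding W_def image_iff by blast
      hence "(\<lambda>t. f t + g t) = cmb (\<lambda>i. l i + m i)" by (simp add: cmb_def distrib_right sum.distrib fun_eq_iff)
      thus ?thesis unfolding W_def by (metis rangeI)
    qed
    show "(\<lambda>t. c * f t) \<in> W" if fW: "f \<in> W" for c f
    proof -
      obtain l where "f = cmb l" using fW unfolding W_def image_iff by blast
      hence "(\<lambda>t. c * f t) = cmb (\<lambda>i. c * l i)" by (simp add: cmb_def sum_distrib_left mult.assoc fun_eq_iff)
      thus ?thesis unfolding W_def by (metis rangeI)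
    qed
  qed simp
  thus ?thesis
  proof
    assume full: "\<forall>g. \<exists>w\<in>W. \<forall>t\<in>F. w t = g t"
    obtain w where w: "w \<in> W" "\<forall>t\<in>F. w t = (if t = x then 1 else 0)"
      using full[rule_format, of "\<lambda>t. if t = x then 1 else 0"] by (elim bexE)
    obtain l where "w = cmb l" using w(1) unfolding W_def image_iff by blast
    thus ?thesis using w(2) unfolding cmb_def by (intro exI[of _ l]) simp
  next
    assume "\<exists>v. (\<exists>t\<in>F. v t \<noteq> 0) \<and> (\<forall>w\<in>W. (\<Sum>t\<in>F. v t * w t) = 0)"
    then obtain v where v: "\<exists>t\<in>F. v t \<noteq> 0" "\<forall>w\<in>W. (\<Sum>t\<in>F. v t * w t) = 0" by blast
    define v' where "v' x = (if x \<in> F then v x else 0)" for x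
    have "(\<Sum>x\<in>UNIV. b i x * v' x) = 0" if "i \<in> {1..d}" for i
    proof -
      have "cmb (\<lambda>j. if j = i then 1 else 0) = b i"
        using that by (simp add: cmb_def if_distrib[of "\<lambda>z. z * _"] fun_eq_iff cong: if_cong)
      hence "b i \<in> W" unfolding W_def by (metis rangeI)
      hence "(\<Sum>t\<in>F. v t * b i t) = 0" using v(2) by blast
      also have "(\<Sum>t\<in>F. v t * b i t) = (\<Sum>x\<in>UNIV. b i x * v' x)"
        by (intro sum.mono_neutral_cong_left) (auto simp: v'_def)
      finally show ?thesis .
    qed
    moreover have "\<forall>x. x \<notin> F \<longrightarrow> v' x = 0" by (simp add: v'_def)
    ultimately have v'0: "\<forall>x. v' x = 0" using span F unfolding spanning_def by blast
    obtain t where "t \<in> F" "v t \<noteq> 0" using v(1) by blast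
    thus ?thesis using v'0[rule_format, of t] by (simp add: v'_def)
  qed
qed

text \<open>A monomial supported on \<open>F\<close> with a repeated variable \<open>x\<close> is rewritten modulo the linear forms
  into monomials with larger support, by replacing one factor \<open>x\<close> by the variables outside \<open>F\<close>.\<close>

lemma covers_of_spanning:
  fixes b :: "nat \<Rightarrow> 'v::finite \<Rightarrow> 'k::field"
  assumes \<Delta>: "simplicial_complex \<Delta>" and span: "spanning \<Delta> d b" and n: "n > card (UNIV :: 'v set)"
  shows "covers \<Delta> d b n"
proof -
  let ?cov = "covered \<Delta> d (\<lambda>i. linform (b i)) (\<lambda>u. mdeg u = n - 1)"
  have mono: "?cov (Poly_Mapping.single u 1)" if "mdeg u = n" for u
    using that
  proof (induction "card (UNIV :: 'v set) - card (Poly_Mapping.keys u)" arbitrary: u rule: less_induct)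
    case less
    define F where "F = Poly_Mapping.keys u"
    show ?case
    proof (cases "F \<in> \<Delta>")
      case False
      hence "Poly_Mapping.single u 1 \<in> nonfaces \<Delta>" unfolding F_def by (rule single_mon_ideal)
      thus ?thesis by (rule covered_nonfaces)
    next
      case True
      \<comment> \<open>\<open>n\<close> exceeds the number of variables, so some exponent is at
        least 2, and removing one factor \<open>x\<close> keeps the support. The induction measure
        is the number of variables outside the support.\<close>
      obtain x where x: "Poly_Mapping.lookup u x \<ge> 2"
      proof (rule ccontr)
        assume "\<not> thesis"
        hence "Poly_Mapping.lookup u x \<le> 1" for x using that by (metis Suc_1 not_less_eq_eq)
        hence "mdeg u \<le> (\<Sum>x\<in>(UNIV :: 'v set). 1)" unfolding mdeg_def by (intro sum_mono)
        thus False using less.prems n by simp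
      qed
      define w where "w = u - Poly_Mapping.single x 1"
      have xF: "x \<in> F" using x by (simp add: F_def in_keys_iff)
      have uw: "w + Poly_Mapping.single x 1 = u"
        unfolding w_def by (rule minus_single_add) (use xF F_def in simp)
      have "Poly_Mapping.keys w = F"
        using x unfolding F_def w_def
        by (auto simp: in_keys_iff lookup_minus lookup_single when_def split: if_splits)
      have w: "mdeg w = n - 1" using arg_cong[OF uw, of mdeg] less.prems by simp
      obtain l where l: "\<forall>y\<in>F. (\<Sum>i=1..d. l i * b i y) = (if y = x then 1 else 0)" using spanning_dual[OF span True] by blast
      define e where "e y = (\<Sum>i=1..d. l i * b i y)" for y
      let ?X = "\<lambda>y c. Poly_Mapping.single (w + Poly_Mapping.single y 1) c :: ('v, 'k) mpoly"
      have lin: "(\<Sum>i=1..d. linform (b i) * Poly_Mapping.single w (l i)) = (\<Sum>y\<in>UNIV. ?X y (e y))"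
      proof -
        have "(\<Sum>i=1..d. linform (b i) * Poly_Mapping.single w (l i)) = (\<Sum>i=1..d. \<Sum>y\<in>UNIV. ?X y (l i * b i y))"
          unfolding linform_def const_mult_indet sum_distrib_right mult_single by (simp add: add.commute mult.commute)
        also have "\<dots> = (\<Sum>y\<in>UNIV. \<Sum>i=1..d. ?X y (l i * b i y))" by (rule sum.swap)
        also have "\<dots> = (\<Sum>y\<in>UNIV. ?X y (e y))"
        proof (intro sum.cong refl)
          fix y
          show "(\<Sum>i=1..d. ?X y (l i * b i y)) = ?X y (e y)" unfolding e_def
            by (rule poly_mapping_eqI) (simp add: lookup_sum lookup_single when_def)
        qed
        finally show ?thesis .
      qed
      have "(\<Sum>y\<in>UNIV. ?X y (e y)) = (\<Sum>y\<in>F. ?X y (e y)) + (\<Sum>y\<in>UNIV - F. ?X y (e y))"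
        using sum.subset_diff[of F UNIV "\<lambda>y. ?X y (e y)"] by (simp only: add.commute subset_UNIV finite)
      also have "(\<Sum>y\<in>F. ?X y (e y)) = (\<Sum>y\<in>F. if y = x then ?X x 1 else 0)"
        using l by (intro sum.cong refl) (auto simp: e_def)
      also have "\<dots> = Poly_Mapping.single u 1" using xF uw by (simp add: sum.delta)
      finally have eq: "Poly_Mapping.single u 1 = (\<Sum>i=1..d. linform (b i) * Poly_Mapping.single w (l i)) + (\<Sum>y\<in>UNIV - F. ?X y (- e y))"
        unfolding lin by (simp add: single_uminus sum_negf)
      have "?cov (?X y (- e y))" if "y \<in> UNIV - F" for y
      proof -
        have "card (insert y F) = Suc (card F)" using that by simp
        moreover have "card (insert y F) \<le> card (UNIV :: 'v set)" by (intro card_mono) auto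
        ultimately have "card (UNIV :: 'v set) - card (insert y F) < card (UNIV :: 'v set) - card F" by linarith
        moreover have "Poly_Mapping.keys (w + Poly_Mapping.single y 1) = insert y F"
          using \<open>Poly_Mapping.keys w = F\<close> by (simp add: keys_add_nat)
        moreover have "mdeg (w + Poly_Mapping.single y 1) = n" using w n by simp
        ultimately have "?cov (?X y 1)" using less.hyps[of "w + Poly_Mapping.single y 1"] F_def by simp
        from covered_scale[OF this, of "- e y"] show ?thesis by (simp only: scale_single mult_1_right)
      qed
      hence 1: "?cov (\<Sum>y\<in>UNIV - F. ?X y (- e y))" by (rule covered_sum)
      have 2: "?cov (\<Sum>i=1..d. linform (b i) * Poly_Mapping.single w (l i))"
        unfolding covered_def
        by (rule exI[of _ "\<lambda>i. Poly_Mapping.single w (l i)"]) (simp add: single_mon_ideal w mon_ideal_0)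
      show ?thesis unfolding eq using 2 1 by (rule covered_add)
    qed
  qed
  show ?thesis
    unfolding covers_def
  proof (rule ballI, rule covered_of_monomials, rule mono)
    fix f :: "('v, 'k) mpoly" and u assume "f \<in> homog n" "u \<in> Poly_Mapping.keys f"
    thus "mdeg u = n" by (simp add: mon_ideal_def)
  qed
qed

section \<open>Graded strands of the Koszul complex\<close>

text \<open>All strands of all degrees are subspaces of this one space of functions on index sets,
  so a single linear map serves as differential.\<close>

definition chain_scale :: "'k \<Rightarrow> (nat set \<Rightarrow> ('v::finite, 'k::field) mpoly) \<Rightarrow> nat set \<Rightarrow> ('v, 'k) mpoly" where
  "chain_scale c f = (\<lambda>A. Poly_Mapping.single 0 c * f A)"

interpretation chains: vector_space "chain_scale :: 'k::field \<Rightarrow> (nat set \<Rightarrow> ('v::finite, 'k) mpoly) \<Rightarrow> _"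
proof
  fix a b :: 'k and f g :: "nat set \<Rightarrow> ('v, 'k) mpoly"
  show "chain_scale a (f + g) = chain_scale a f + chain_scale a g"
    by (simp add: chain_scale_def fun_eq_iff distrib_left)
  show "chain_scale (a + b) f = chain_scale a f + chain_scale b f"
    by (simp add: chain_scale_def fun_eq_iff distrib_right single_add)
  have "Poly_Mapping.single 0 a * (Poly_Mapping.single 0 b * h) = Poly_Mapping.single 0 (a * b) * h" for h :: "('v, 'k) mpoly"
    unfolding mult.assoc[symmetric] scale_single ..
  thus "chain_scale a (chain_scale b f) = chain_scale (a * b) f"
    by (simp only: chain_scale_def)
  show "chain_scale 1 f = f"
    by (simp add: chain_scale_def)
qed

text \<open>The unique representative supported on faces; with it, the quotient by the nonface ideal
  becomes a subspace of the polynomials, and dimensions are counted by monomials.\<close>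

definition face_part :: "'v::finite set set \<Rightarrow> ('v, 'k::field) mpoly \<Rightarrow> ('v, 'k) mpoly" where
  "face_part \<Delta> = part (\<lambda>u. Poly_Mapping.keys u \<in> \<Delta>)"

text \<open>The Koszul differential of the quotient, on representatives supported on faces. The
  value 0 outside the subsets of \<open>{1..d}\<close> keeps meaningless coefficients out of kernels
  and images.\<close>

definition face_diff :: "'v::finite set set \<Rightarrow> nat \<Rightarrow> (nat \<Rightarrow> 'v \<Rightarrow> 'k::field) \<Rightarrow>
    (nat set \<Rightarrow> ('v, 'k) mpoly) \<Rightarrow> nat set \<Rightarrow> ('v, 'k) mpoly" where
  "face_diff \<Delta> d b f A = (if A \<subseteq> {1..d} then face_part \<Delta> (koszul_diff d (\<lambda>j. linform (b j)) f A) else 0)"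

text \<open>Position \<open>i\<close> in the strand of total degree \<open>n\<close>: each of the
  \<open>i\<close> exterior factors has degree 1. For \<open>i \<le> d \<le> n\<close> the
  subtraction \<open>n - i\<close> is exact.\<close>

definition chain_space :: "'v::finite set set \<Rightarrow> nat \<Rightarrow> nat \<Rightarrow> nat \<Rightarrow> (nat set \<Rightarrow> ('v, 'k::field) mpoly) set" where
  "chain_space \<Delta> d n i = {f. koszul_chain d i f \<and>
     (\<forall>A. f A \<in> mon_ideal (\<lambda>u. mdeg u = n - i \<and> Poly_Mapping.keys u \<in> \<Delta>))}"

lemma face_part_eq_iff: "face_part \<Delta> f = face_part \<Delta> g \<longleftrightarrow> f - g \<in> nonfaces \<Delta>"
proof -
  have "face_part \<Delta> f = face_part \<Delta> g \<longleftrightarrow> part (\<lambda>u. Poly_Mapping.keys u \<in> \<Delta>) (f - g) = 0"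
    by (simp add: face_part_def part_diff)
  thus ?thesis unfolding part_eq_0_iff .
qed

lemma face_part_minus: "face_part \<Delta> f - f \<in> nonfaces \<Delta>"
  using mon_ideal_uminus[OF minus_part_in[of f "\<lambda>u. Poly_Mapping.keys u \<in> \<Delta>"]] by (simp add: face_part_def)

lemma linear_face_diff:
  "Vector_Spaces.linear chain_scale chain_scale (face_diff \<Delta> d (b :: nat \<Rightarrow> 'a::finite \<Rightarrow> 'b::field))"
proof -
  have 1: "face_diff \<Delta> d b (f + g) = face_diff \<Delta> d b f + face_diff \<Delta> d b g" for f g :: "nat set \<Rightarrow> ('a, 'b) mpoly"
  proof
    fix A
    have "f + g = (\<lambda>A. f A + g A)" by (simp add: fun_eq_iff)
    thus "face_diff \<Delta> d b (f + g) A = (face_diff \<Delta> d b f + face_diff \<Delta> d b g) A"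
      by (simp add: face_diff_def koszul_diff_add face_part_def part_add)
  qed
  have 2: "face_diff \<Delta> d b (chain_scale c f) = chain_scale c (face_diff \<Delta> d b f)" for c and f :: "nat set \<Rightarrow> ('a, 'b) mpoly"
  proof
    fix A
    show "face_diff \<Delta> d b (chain_scale c f) A = chain_scale c (face_diff \<Delta> d b f) A"
      by (simp add: face_diff_def face_part_def chain_scale_def koszul_diff_scale part_scale)
  qed
  show ?thesis
    unfolding Vector_Spaces.linear_iff using chains.vector_space_axioms by (simp add: 1 2)
qed

lemma chain_space_subspace: "chains.subspace (chain_space \<Delta> d n i :: (nat set \<Rightarrow> ('v::finite, 'k::field) mpoly) set)"
proof (rule chains.subspaceI)
  show "0 \<in> chain_space \<Delta> d n i"
    by (auto simp: chain_space_def koszul_chain_def mon_ideal_0)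
next
  fix f g :: "nat set \<Rightarrow> ('v, 'k) mpoly" assume f: "f \<in> chain_space \<Delta> d n i" and g: "g \<in> chain_space \<Delta> d n i"
  have "koszul_chain d i (f + g)"
    unfolding koszul_chain_def
  proof (intro allI impI)
    fix A assume "(f + g) A \<noteq> 0"
    hence "f A \<noteq> 0 \<or> g A \<noteq> 0" by auto
    thus "A \<subseteq> {1..d} \<and> card A = i" using f g unfolding chain_space_def koszul_chain_def by blast
  qed
  thus "f + g \<in> chain_space \<Delta> d n i"
    using f g by (simp add: chain_space_def mon_ideal_add)
next
  fix c and f :: "nat set \<Rightarrow> ('v, 'k) mpoly" assume f: "f \<in> chain_space \<Delta> d n i"
  have "koszul_chain d i (chain_scale c f)"
    unfolding koszul_chain_def
  proof (intro allI impI)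
    fix A assume "chain_scale c f A \<noteq> 0"
    hence "f A \<noteq> 0" by (auto simp: chain_scale_def)
    thus "A \<subseteq> {1..d} \<and> card A = i" using f unfolding chain_space_def koszul_chain_def by blast
  qed
  thus "chain_scale c f \<in> chain_space \<Delta> d n i"
    using f by (simp add: chain_space_def chain_scale_def scale_mon_ideal)
qed

definition chain_index :: "'v::finite set set \<Rightarrow> nat \<Rightarrow> nat \<Rightarrow> nat \<Rightarrow> (nat set \<times> ('v \<Rightarrow>\<^sub>0 nat)) set" where
  "chain_index \<Delta> d n i = {A. A \<subseteq> {1..d} \<and> card A = i} \<times> {u. Poly_Mapping.keys u \<in> \<Delta> \<and> mdeg u = n - i}"

definition chain_basis :: "nat set \<times> ('v::finite \<Rightarrow>\<^sub>0 nat) \<Rightarrow> nat set \<Rightarrow> ('v, 'k::field) mpoly" where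
  "chain_basis t B = (if B = fst t then Poly_Mapping.single (snd t) 1 else 0)"

lemma finite_chain_index: "finite (chain_index \<Delta> d n i)"
  unfolding chain_index_def by (intro finite_SigmaI finite_mdeg_eq) simp

lemma card_chain_index: "card (chain_index \<Delta> d n i) = (d choose i) * hilbert_fun \<Delta> (n - i)"
  unfolding chain_index_def card_cartesian_product hilbert_fun_def using n_subsets[of "{1..d}" i] by simp

lemma chain_combination:
  assumes "finite T"
  shows "Poly_Mapping.lookup ((\<Sum>t\<in>T. chain_scale (c t) (chain_basis t)) A) u = (if (A, u) \<in> T then c (A, u) else 0)"
proof -
  have "(\<Sum>t\<in>T. chain_scale (c t) (chain_basis t)) A = (\<Sum>t\<in>T. chain_scale (c t) (chain_basis t) A)"
    using assms by (induction T rule: finite_induct) auto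
  hence "Poly_Mapping.lookup ((\<Sum>t\<in>T. chain_scale (c t) (chain_basis t)) A) u
    = (\<Sum>t\<in>T. Poly_Mapping.lookup (chain_scale (c t) (chain_basis t) A) u)" by (simp add: lookup_sum)
  also have "\<dots> = (\<Sum>t\<in>T. if t = (A, u) then c t else 0)"
  proof (intro sum.cong refl)
    fix t :: "nat set \<times> ('a \<Rightarrow>\<^sub>0 nat)"
    obtain B w where t: "t = (B, w)" by (cases t)
    show "Poly_Mapping.lookup (chain_scale (c t) (chain_basis t) A) u = (if t = (A, u) then c t else 0)"
      by (auto simp: t chain_scale_def chain_basis_def lookup_scale lookup_single when_def)
  qed
  also have "\<dots> = (if (A, u) \<in> T then c (A, u) else 0)" using assms by (simp add: sum.delta)
  finally show ?thesis .
qed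

lemma chain_space_expand:
  fixes f :: "nat set \<Rightarrow> ('v::finite, 'k::field) mpoly"
  assumes "f \<in> chain_space \<Delta> d n i"
  shows "f = (\<Sum>t\<in>chain_index \<Delta> d n i. chain_scale (Poly_Mapping.lookup (f (fst t)) (snd t)) (chain_basis t))"
proof (rule ext, rule poly_mapping_eqI)
  fix A u
  have "Poly_Mapping.lookup (f A) u = 0" if "(A, u) \<notin> chain_index \<Delta> d n i"
  proof (rule ccontr)
    assume nz: "Poly_Mapping.lookup (f A) u \<noteq> 0"
    hence "f A \<noteq> 0" by auto
    hence "A \<subseteq> {1..d} \<and> card A = i" using assms unfolding chain_space_def koszul_chain_def by blast
    moreover have "mdeg u = n - i \<and> Poly_Mapping.keys u \<in> \<Delta>"
      using assms nz unfolding chain_space_def mon_ideal_iff by blast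
    ultimately show False using that by (simp add: chain_index_def)
  qed
  thus "Poly_Mapping.lookup (f A) u = Poly_Mapping.lookup
     ((\<Sum>t\<in>chain_index \<Delta> d n i. chain_scale (Poly_Mapping.lookup (f (fst t)) (snd t)) (chain_basis t)) A) u"
    by (simp add: chain_combination[OF finite_chain_index])
qed

lemma chain_space_span: "chain_space \<Delta> d n i \<subseteq> chains.span (chain_basis ` chain_index \<Delta> d n i)"
proof
  fix f :: "nat set \<Rightarrow> ('a, 'b) mpoly" assume f: "f \<in> chain_space \<Delta> d n i"
  show "f \<in> chains.span (chain_basis ` chain_index \<Delta> d n i)"
    by (subst chain_space_expand[OF f]) (intro chains.span_sum chains.span_scale chains.span_base imageI)
qed

lemma dim_chain_space:
  "chains.dim (chain_space \<Delta> d n i :: (nat set \<Rightarrow> ('v::finite, 'k::field) mpoly) set) = (d choose i) * hilbert_fun \<Delta> (n - i)"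
  unfolding card_chain_index[symmetric]
proof (rule chains.dim_coordinates[where e = chain_basis and \<phi> = "\<lambda>t f. Poly_Mapping.lookup (f (fst t)) (snd t)"])
  fix t assume t: "t \<in> chain_index \<Delta> d n i"
  show "(chain_basis t :: nat set \<Rightarrow> ('v, 'k) mpoly) \<in> chain_space \<Delta> d n i"
    using t by (auto simp: chain_space_def chain_index_def chain_basis_def koszul_chain_def
        intro!: single_mon_ideal mon_ideal_0 split: if_splits)
next
  fix c :: "nat set \<times> ('v \<Rightarrow>\<^sub>0 nat) \<Rightarrow> 'k" and s assume "s \<in> chain_index \<Delta> d n i"
  thus "Poly_Mapping.lookup ((\<Sum>t\<in>chain_index \<Delta> d n i. chain_scale (c t) (chain_basis t)) (fst s)) (snd s) = c s"
    by (simp add: chain_combination[OF finite_chain_index])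
qed (use finite_chain_index chain_space_expand in blast)+

lemma face_part_koszul_diff:
  assumes "simplicial_complex \<Delta>" "A \<subseteq> {1..d}" "\<And>B. B \<subseteq> {1..d} \<Longrightarrow> f B - g B \<in> nonfaces \<Delta>"
  shows "face_part \<Delta> (koszul_diff d y f A) = face_part \<Delta> (koszul_diff d y g A)"
proof -
  have "koszul_diff d y (\<lambda>B. f B - g B) A \<in> nonfaces \<Delta>"
    using assms(2,3) by (intro koszul_diff_in[OF idealset_nonfaces[OF assms(1)]])
  moreover have "koszul_diff d y (\<lambda>B. f B - g B) A = koszul_diff d y f A - koszul_diff d y g A"
    using koszul_diff_add[of d y "\<lambda>B. f B - g B" g A] by simp
  ultimately show ?thesis by (simp add: face_part_eq_iff)
qed

lemma hcomp_koszul_diff: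
  fixes b :: "nat \<Rightarrow> 'a::finite \<Rightarrow> 'b::field"
  shows
  "hcomp (Suc m) (koszul_diff d (\<lambda>j. linform (b j)) f A) = koszul_diff d (\<lambda>j. linform (b j)) (\<lambda>B. hcomp m (f B)) A"
  unfolding koszul_diff_def part_sum
proof (intro sum.cong refl)
  fix j
  have "koszul_sign j A = (1 :: ('a, 'b) mpoly) \<or> koszul_sign j A = (- 1 :: ('a, 'b) mpoly)"
    by (simp add: koszul_sign_def minus_one_power_iff)
  hence "koszul_sign j A * linform (b j) \<in> homog 1"
  proof
    assume 1: "koszul_sign j A = (1 :: ('a, 'b) mpoly)"
    show ?thesis unfolding 1 using linform_homog by simp
  next
    assume 1: "koszul_sign j A = (- 1 :: ('a, 'b) mpoly)"
    show ?thesis unfolding 1 using mon_ideal_uminus[OF linform_homog, of "b j"] by simp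
  qed
  from hcomp_mult_homog[OF this, of m "f (insert j A)"]
  show "hcomp (Suc m) (koszul_sign j A * (linform (b j) * f (insert j A)))
    = koszul_sign j A * (linform (b j) * hcomp m (f (insert j A)))" by (simp add: mult.assoc)
qed

lemma face_diff_chain_space:
  fixes f :: "nat set \<Rightarrow> ('v::finite, 'k::field) mpoly"
  assumes f: "f \<in> chain_space \<Delta> d n (Suc i)" and "d \<le> n"
  shows "face_diff \<Delta> d b f \<in> chain_space \<Delta> d n i"
proof -
  have chain: "koszul_chain d (Suc i) f" and hom: "\<And>A. f A \<in> mon_ideal (\<lambda>u. mdeg u = n - Suc i \<and> Poly_Mapping.keys u \<in> \<Delta>)"
    using f by (auto simp: chain_space_def)
  have "koszul_chain d i (face_diff \<Delta> d b f)"
    unfolding koszul_chain_def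
  proof (intro allI impI)
    fix A assume nz: "face_diff \<Delta> d b f A \<noteq> 0"
    hence A: "A \<subseteq> {1..d}" by (auto simp: face_diff_def split: if_splits)
    moreover have "card A = i"
    proof (rule ccontr)
      assume "card A \<noteq> i"
      hence "koszul_diff d (\<lambda>j. linform (b j)) f A = 0" by (rule koszul_diff_degree[OF chain A])
      thus False using nz A by (simp add: face_diff_def face_part_def)
    qed
    ultimately show "A \<subseteq> {1..d} \<and> card A = i" by blast
  qed
  moreover have "face_diff \<Delta> d b f A \<in> mon_ideal (\<lambda>u. mdeg u = n - i \<and> Poly_Mapping.keys u \<in> \<Delta>)" for A
  proof (cases "A \<subseteq> {1..d} \<and> i < n")
    case True
    have "hcomp (n - Suc i) (f B) = f B" for B
      by (rule part_eq_self) (rule mon_ideal_mono[OF hom], simp)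
    hence "hcomp (n - i) (koszul_diff d (\<lambda>j. linform (b j)) f A) = koszul_diff d (\<lambda>j. linform (b j)) f A"
      using hcomp_koszul_diff[of "n - Suc i" d b f A] True by (simp add: Suc_diff_Suc)
    hence "koszul_diff d (\<lambda>j. linform (b j)) f A \<in> homog (n - i)" by (metis part_in)
    thus ?thesis using True unfolding face_diff_def face_part_def
      by (auto simp: mon_ideal_iff lookup_part split: if_splits)
  next
    case False
    \<comment> \<open>Here the degree \<open>n - Suc i\<close> is truncated, but a set of size
      \<open>i + 1 > d\<close> does not fit into \<open>{1..d}\<close>, so the chain is
      zero.\<close>
    have "f B = 0" if "n \<le> i" for B
    proof (rule ccontr)
      assume "f B \<noteq> 0"
      hence "B \<subseteq> {1..d}" "card B = Suc i" using chain by (auto simp: koszul_chain_def)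
      thus False using card_mono[of "{1..d}" B] that assms(2) by simp
    qed
    hence "face_diff \<Delta> d b f A = 0"
      using False by (auto simp: face_diff_def face_part_def koszul_diff_def)
    thus ?thesis by (simp add: mon_ideal_0)
  qed
  ultimately show ?thesis by (simp add: chain_space_def)
qed

lemma chain_space_big:
  assumes "i > d" shows "chain_space \<Delta> d n i = {0 :: nat set \<Rightarrow> ('v::finite, 'k::field) mpoly}"
proof (rule equalityI)
  show "chain_space \<Delta> d n i \<subseteq> {0 :: nat set \<Rightarrow> ('v, 'k) mpoly}"
  proof
    fix f :: "nat set \<Rightarrow> ('v, 'k) mpoly" assume "f \<in> chain_space \<Delta> d n i"
    hence c: "koszul_chain d i f" by (simp add: chain_space_def)
    have "f A = 0" for A
    proof (rule ccontr)
      assume "f A \<noteq> 0"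
      hence "A \<subseteq> {1..d}" "card A = i" using c by (auto simp: koszul_chain_def)
      thus False using card_mono[of "{1..d}" A] assms by simp
    qed
    thus "f \<in> {0}" by (simp add: fun_eq_iff)
  qed
qed (simp add: chains.subspace_0[OF chain_space_subspace])

lemma face_diff_0: "face_diff \<Delta> d b 0 = 0"
  using chains.scale_zero_left linear_face_diff[of \<Delta> d b] unfolding Vector_Spaces.linear_iff by metis

text \<open>\<open>koszul_exact\<close> provides some bounding chain, not a homogeneous one; as the
  forms have degree 1, its component of degree \<open>n - Suc i\<close>, reduced to faces, bounds
  within the strand.\<close>

lemma face_diff_exact:
  fixes b :: "nat \<Rightarrow> 'v::finite \<Rightarrow> 'k::field"
  assumes \<Delta>: "simplicial_complex \<Delta>" and n: "d \<le> n"
    and exact: "koszul_exact d (\<lambda>j. linform (b j)) (nonfaces \<Delta>) i"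
  shows "{f \<in> chain_space \<Delta> d n i. face_diff \<Delta> d b f = 0} = face_diff \<Delta> d b ` chain_space \<Delta> d n (Suc i)"
proof (rule equalityI; rule subsetI)
  let ?K = "koszul_diff d (\<lambda>j. linform (b j))"
  fix f :: "nat set \<Rightarrow> ('v, 'k) mpoly" assume "f \<in> {f \<in> chain_space \<Delta> d n i. face_diff \<Delta> d b f = 0}"
  hence f: "f \<in> chain_space \<Delta> d n i" and cyc: "face_diff \<Delta> d b f = 0" by auto
  have f0: "f A = 0" if "\<not> A \<subseteq> {1..d}" for A
    using f that unfolding chain_space_def koszul_chain_def by blast
  have face: "face_part \<Delta> (f A) = f A" for A
    unfolding face_part_def using f by (intro part_eq_self) (auto simp: chain_space_def elim!: mon_ideal_mono)
  show "f \<in> face_diff \<Delta> d b ` chain_space \<Delta> d n (Suc i)"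
  proof (cases "i < d")
    case True
    hence i: "n - i = Suc (n - Suc i)" using n by simp
    have "?K f A \<in> nonfaces \<Delta>" if "A \<subseteq> {1..d}" for A
    proof -
      have "face_part \<Delta> (?K f A) = 0" using fun_cong[OF cyc, of A] that by (simp add: face_diff_def)
      thus ?thesis unfolding face_part_def part_eq_0_iff .
    qed
    then obtain g where g: "koszul_chain d (Suc i) g" "\<And>A. A \<subseteq> {1..d} \<Longrightarrow> f A - ?K g A \<in> nonfaces \<Delta>"
      using exact f unfolding koszul_exact_def chain_space_def by blast
    define h where "h A = face_part \<Delta> (hcomp (n - Suc i) (g A))" for A :: "nat set"
    have hs: "h \<in> chain_space \<Delta> d n (Suc i)"
    proof -
      have "koszul_chain d (Suc i) h"
        unfolding koszul_chain_def
      proof (intro allI impI)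
        fix A assume "h A \<noteq> 0"
        hence "g A \<noteq> 0" by (auto simp: h_def face_part_def)
        thus "A \<subseteq> {1..d} \<and> card A = Suc i" using g(1) unfolding koszul_chain_def by blast
      qed
      moreover have "h A \<in> mon_ideal (\<lambda>u. mdeg u = n - Suc i \<and> Poly_Mapping.keys u \<in> \<Delta>)" for A
        by (auto simp: h_def face_part_def mon_ideal_iff lookup_part split: if_splits)
      ultimately show ?thesis by (simp add: chain_space_def)
    qed
    have eq: "face_diff \<Delta> d b h = f"
    proof
      fix A
      show "face_diff \<Delta> d b h A = f A"
      proof (cases "A \<subseteq> {1..d}")
        case True
        have "face_part \<Delta> (?K h A) = face_part \<Delta> (?K (\<lambda>A. hcomp (n - Suc i) (g A)) A)"
          unfolding h_def by (rule face_part_koszul_diff[OF \<Delta> True]) (rule face_part_minus)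
        also have "\<dots> = face_part \<Delta> (hcomp (n - i) (?K g A))"
          unfolding i hcomp_koszul_diff ..
        also have "\<dots> = hcomp (n - i) (face_part \<Delta> (?K g A))"
          unfolding face_part_def by (rule part_commute)
        also have "face_part \<Delta> (?K g A) = f A"
          using face_part_eq_iff[of \<Delta> "f A" "?K g A"] g(2)[OF True] face by simp
        also have "hcomp (n - i) (f A) = f A"
          using f by (intro part_eq_self) (auto simp: chain_space_def elim!: mon_ideal_mono)
        finally show ?thesis using True by (simp add: face_diff_def)
      qed (simp add: face_diff_def f0)
    qed
    show ?thesis using imageI[OF hs, of "face_diff \<Delta> d b"] unfolding eq .
  next
    case False
    have "?K f A \<in> nonfaces \<Delta>" if "A \<subseteq> {1..d}" for A
    proof -
      have "face_part \<Delta> (?K f A) = 0" using fun_cong[OF cyc, of A] that by (simp add: face_diff_def)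
      thus ?thesis unfolding face_part_def part_eq_0_iff .
    qed
    then obtain g where g: "koszul_chain d (Suc i) g" "\<And>A. A \<subseteq> {1..d} \<Longrightarrow> f A - ?K g A \<in> nonfaces \<Delta>"
      using exact f unfolding koszul_exact_def chain_space_def by blast
    \<comment> \<open>For \<open>i \<ge> d\<close> there is no index set of size
      \<open>i + 1\<close>, so \<open>g\<close> vanishes and \<open>f\<close> lies in the nonface
      ideal.\<close>
    have "g B = 0" for B
    proof (rule ccontr)
      assume "g B \<noteq> 0"
      hence "B \<subseteq> {1..d}" "card B = Suc i" using g(1) by (auto simp: koszul_chain_def)
      thus False using card_mono[of "{1..d}" B] False by simp
    qed
    hence "f A \<in> nonfaces \<Delta>" if "A \<subseteq> {1..d}" for A using g(2)[OF that] by (simp add: koszul_diff_def)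
    hence f0': "face_part \<Delta> (f A) = 0" if "A \<subseteq> {1..d}" for A using that unfolding face_part_def part_eq_0_iff by simp
    have "f A = 0" for A
      using f0'[of A] f0[of A] unfolding face by (cases "A \<subseteq> {1..d}") simp_all
    hence "f = face_diff \<Delta> d b 0" unfolding face_diff_0 by (simp add: fun_eq_iff)
    thus ?thesis using imageI[OF chains.subspace_0[OF chain_space_subspace], of "face_diff \<Delta> d b" \<Delta> d n "Suc i"] by simp
  qed
next
  let ?K = "koszul_diff d (\<lambda>j. linform (b j))"
  fix f :: "nat set \<Rightarrow> ('v, 'k) mpoly" assume "f \<in> face_diff \<Delta> d b ` chain_space \<Delta> d n (Suc i)"
  then obtain g where g: "g \<in> chain_space \<Delta> d n (Suc i)" and f: "f = face_diff \<Delta> d b g" by blast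
  have "face_diff \<Delta> d b f A = 0" for A
  proof (cases "A \<subseteq> {1..d}")
    case True
    have "face_part \<Delta> (?K f A) = face_part \<Delta> (?K (?K g) A)"
      by (rule face_part_koszul_diff[OF \<Delta> True]) (simp add: f face_diff_def face_part_minus)
    also have "?K (?K g) A = 0" by (rule koszul_diff_diff[OF True])
    finally show ?thesis by (simp add: face_diff_def face_part_def)
  qed (simp add: face_diff_def)
  hence "face_diff \<Delta> d b f = 0" by (simp add: fun_eq_iff)
  moreover have "f \<in> chain_space \<Delta> d n i" unfolding f by (rule face_diff_chain_space[OF g n])
  ultimately show "f \<in> {f \<in> chain_space \<Delta> d n i. face_diff \<Delta> d b f = 0}" by simp
qed

lemma koszul_diff_empty: "koszul_diff d y g {} = (\<Sum>j=1..d. y j * g {j})"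
  by (simp add: koszul_diff_def koszul_sign_def)

text \<open>The end of the strand is the map from d copies of R_(n-1) to R_n given by the forms; the
  singletons index these copies.\<close>

lemma covers_iff_surj:
  fixes b :: "nat \<Rightarrow> 'v::finite \<Rightarrow> 'k::field"
  assumes \<Delta>: "simplicial_complex \<Delta>" and n: "d \<le> n" "d > 0"
  shows "covers \<Delta> d b n \<longleftrightarrow> face_diff \<Delta> d b ` chain_space \<Delta> d n 1 = chain_space \<Delta> d n 0"
proof
  assume cov: "covers \<Delta> d b n"
  show "face_diff \<Delta> d b ` chain_space \<Delta> d n 1 = chain_space \<Delta> d n 0"
  proof (rule equalityI; rule subsetI)
    fix f assume "f \<in> face_diff \<Delta> d b ` chain_space \<Delta> d n 1"
    thus "f \<in> chain_space \<Delta> d n 0" using face_diff_chain_space[OF _ n(1), of _ \<Delta> 0 b] by auto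
  next
    fix f :: "nat set \<Rightarrow> ('v, 'k) mpoly" assume f: "f \<in> chain_space \<Delta> d n 0"
    have f0: "f A = 0" if "A \<noteq> {}" for A
    proof (rule ccontr)
      assume "f A \<noteq> 0"
      hence "A \<subseteq> {1..d}" "card A = 0" using f by (auto simp: chain_space_def koszul_chain_def)
      thus False using that finite_subset[of A "{1..d}"] by simp
    qed
    have "f {} \<in> homog n" using f by (auto simp: chain_space_def elim!: mon_ideal_mono)
    then obtain g where g: "\<forall>i. g i \<in> homog (n - 1)" "f {} - (\<Sum>i=1..d. linform (b i) * g i) \<in> nonfaces \<Delta>"
      using cov unfolding covers_def covered_def by blast
    define h where "h A = (if \<exists>j\<in>{1..d}. A = {j} then face_part \<Delta> (g (the_elem A)) else 0)" for A :: "nat set"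
    have h: "h {j} = face_part \<Delta> (g j)" if "j \<in> {1..d}" for j using that by (simp add: h_def)
    have hs: "h \<in> chain_space \<Delta> d n 1"
    proof -
      have "koszul_chain d 1 h" by (auto simp: koszul_chain_def h_def)
      moreover have "face_part \<Delta> (g j) \<in> mon_ideal (\<lambda>u. mdeg u = n - 1 \<and> Poly_Mapping.keys u \<in> \<Delta>)" for j
        using g(1) by (auto simp: face_part_def mon_ideal_iff lookup_part split: if_splits)
      hence "h A \<in> mon_ideal (\<lambda>u. mdeg u = n - 1 \<and> Poly_Mapping.keys u \<in> \<Delta>)" for A
        by (auto simp: h_def mon_ideal_0)
      ultimately show ?thesis by (simp add: chain_space_def)
    qed
    have "face_diff \<Delta> d b h A = f A" for A
    proof (cases "A = {}")
      case True
      have "face_part \<Delta> (\<Sum>j=1..d. linform (b j) * h {j}) = face_part \<Delta> (f {})"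
      proof -
        have "(\<Sum>j=1..d. linform (b j) * h {j}) - f {}
           = (\<Sum>j=1..d. linform (b j) * (h {j} - g j)) + - (f {} - (\<Sum>i=1..d. linform (b i) * g i))"
          by (simp add: right_diff_distrib sum_subtractf)
        also have "\<dots> \<in> nonfaces \<Delta>"
        proof (intro mon_ideal_add mon_ideal_sum mon_ideal_uminus g(2))
          fix j assume "j \<in> {1..d}"
          thus "linform (b j) * (h {j} - g j) \<in> nonfaces \<Delta>"
            using idealset_mult[OF idealset_nonfaces[OF \<Delta>] face_part_minus] by (simp only: h)
        qed
        finally show ?thesis unfolding face_part_eq_iff .
      qed
      also have "face_part \<Delta> (f {}) = f {}"
        unfolding face_part_def using f by (intro part_eq_self) (auto simp: chain_space_def elim!: mon_ideal_mono)
      finally show ?thesis using True by (simp add: face_diff_def koszul_diff_empty)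
    next
      case False
      show ?thesis
      proof (cases "A \<subseteq> {1..d}")
        case True
        hence "card A \<noteq> 0" using False finite_subset[of A "{1..d}"] by simp
        moreover have "koszul_chain d (Suc 0) h" using hs by (simp add: chain_space_def)
        ultimately have "koszul_diff d (\<lambda>j. linform (b j)) h A = 0"
          using koszul_diff_degree[OF _ True, of 0 h] by blast
        thus ?thesis using f0[OF False] by (simp add: face_diff_def face_part_def)
      qed (simp add: face_diff_def f0[OF False])
    qed
    hence "face_diff \<Delta> d b h = f" by (simp add: fun_eq_iff)
    thus "f \<in> face_diff \<Delta> d b ` chain_space \<Delta> d n 1" using hs by blast
  qed
next
  assume eq: "face_diff \<Delta> d b ` chain_space \<Delta> d n 1 = chain_space \<Delta> d n 0"
  show "covers \<Delta> d b n"
    unfolding covers_def covered_def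
  proof
    fix f :: "('v, 'k) mpoly" assume f: "f \<in> homog n"
    define v where "v A = (if A = {} then face_part \<Delta> f else 0)" for A :: "nat set"
    have "v \<in> chain_space \<Delta> d n 0"
      using f by (auto simp: v_def chain_space_def koszul_chain_def mon_ideal_iff face_part_def lookup_part split: if_splits)
    then obtain g where g: "g \<in> chain_space \<Delta> d n 1" "v = face_diff \<Delta> d b g" unfolding eq[symmetric] by blast
    have "face_part \<Delta> f = face_part \<Delta> (\<Sum>j=1..d. linform (b j) * g {j})"
      using fun_cong[OF g(2), of "{}"] by (simp add: v_def face_diff_def koszul_diff_empty)
    moreover have "g {j} \<in> homog (n - 1)" for j using g(1) by (auto simp: chain_space_def elim!: mon_ideal_mono)
    ultimately show "\<exists>g. (\<forall>i. g i \<in> homog (n - 1)) \<and> f - (\<Sum>i=1..d. linform (b i) * g i) \<in> nonfaces \<Delta>"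
      unfolding face_part_eq_iff by (intro exI[of _ "\<lambda>j. g {j}"]) simp
  qed
qed

text \<open>The strand is exact except at its end, so its Euler characteristic is the dimension of
  the cokernel of the last map. By \<open>alternating_hilbert_sum\<close> this number is 0 for
  \<open>n > d\<close>, and for \<open>n = d\<close> it is, up to sign, the sum over the
  faces.\<close>

theorem covers_iff_of_koszul_exact:
  fixes b :: "nat \<Rightarrow> 'v::finite \<Rightarrow> 'k::field"
  assumes \<Delta>: "simplicial_complex \<Delta>" and dim: "\<And>F. F \<in> \<Delta> \<Longrightarrow> card F \<le> d" and d: "d > 0" "d \<le> n"
    and exact: "\<And>i. i > 0 \<Longrightarrow> koszul_exact d (\<lambda>j. linform (b j)) (nonfaces \<Delta>) i"
  shows "covers \<Delta> d b n \<longleftrightarrow> n \<noteq> d \<or> (\<Sum>F\<in>\<Delta>. (- 1) ^ card F) = (0 :: int)"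
proof -
  let ?V = "chain_space \<Delta> d n :: nat \<Rightarrow> (nat set \<Rightarrow> ('v, 'k) mpoly) set"
  let ?D = "face_diff \<Delta> d b"
  have "(\<Sum>i\<le>d. (- 1) ^ i * int (chains.dim (?V i))) = int (chains.dim (?V 0)) - int (chains.dim (?D ` ?V 1))"
  proof (rule chains.euler_characteristic_exact[OF linear_face_diff chain_space_subspace chain_space_span])
    show "finite (chain_basis ` chain_index \<Delta> d n i :: (nat set \<Rightarrow> ('v, 'k) mpoly) set)" for i
      by (intro finite_imageI finite_chain_index)
    show "{v \<in> ?V i. ?D v = 0} = ?D ` ?V (Suc i)" if "i > 0" for i
      by (rule face_diff_exact[OF \<Delta> d(2) exact[OF that]])
    show "?D ` ?V (Suc d) = {0}" by (simp add: chain_space_big face_diff_0)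
  qed
  moreover have "(\<Sum>i\<le>d. (- 1) ^ i * int (chains.dim (?V i))) = (if n = d then (- 1) ^ d * (\<Sum>F\<in>\<Delta>. (- 1) ^ card F) else 0)"
    using alternating_hilbert_sum[OF dim d] by (simp add: dim_chain_space mult.assoc)
  ultimately have diff: "int (chains.dim (?V 0)) - int (chains.dim (?D ` ?V 1)) = (if n = d then (- 1) ^ d * (\<Sum>F\<in>\<Delta>. (- 1) ^ card F) else 0)"
    by simp
  have "?D ` ?V 1 = ?V 0 \<longleftrightarrow> chains.dim (?V 0) = chains.dim (?D ` ?V 1)"
  proof
    assume eq: "chains.dim (?V 0) = chains.dim (?D ` ?V 1)"
    interpret D: Vector_Spaces.linear chain_scale chain_scale ?D by (rule linear_face_diff)
    show "?D ` ?V 1 = ?V 0"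
    proof (rule chains.subspace_eq_of_dim)
      show "chains.subspace (?D ` ?V 1)" by (rule D.subspace_image[OF chain_space_subspace])
      show "?D ` ?V 1 \<subseteq> ?V 0" using face_diff_chain_space[OF _ d(2), of _ \<Delta> 0 b] by auto
      show "?V 0 \<subseteq> chains.span (chain_basis ` chain_index \<Delta> d n 0)" by (rule chain_space_span)
    qed (simp_all add: chain_space_subspace finite_chain_index eq)
  qed simp
  also have "\<dots> \<longleftrightarrow> n \<noteq> d \<or> (\<Sum>F\<in>\<Delta>. (- 1) ^ card F) = (0 :: int)"
    using diff by (auto split: if_splits)
  finally show ?thesis unfolding covers_iff_surj[OF \<Delta> d(2,1)] .
qed

section \<open>Lengths of chains of sets\<close>

lemma chain_length_image_le:
  assumes \<phi>: "\<And>Z. Z \<in> \<A> \<Longrightarrow> \<phi> Z \<in> \<B>"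
    and mono: "\<And>Z Y. Z \<in> \<A> \<Longrightarrow> Y \<in> \<A> \<Longrightarrow> Z \<subset> Y \<Longrightarrow> \<phi> Z \<subset> \<phi> Y"
  shows "chain_length \<A> \<le> chain_length \<B>"
  unfolding chain_length_def
proof (rule SUP_least)
  fix C assume "C \<in> {C. finite C \<and> subset.chain \<A> C}"
  hence C: "finite C" "C \<subseteq> \<A>" "\<And>Z Y. Z \<in> C \<Longrightarrow> Y \<in> C \<Longrightarrow> Z \<subseteq> Y \<or> Y \<subseteq> Z"
    by (auto simp: subset_chain_def)
  have le: "\<phi> Z \<subseteq> \<phi> Y" if "Z \<in> C" "Y \<in> C" "Z \<subseteq> Y" for Z Y
    using mono[of Z Y] that C(2) by (cases "Z = Y") auto
  have "inj_on \<phi> C"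
  proof (rule inj_onI, rule ccontr)
    fix Z Y assume *: "Z \<in> C" "Y \<in> C" "\<phi> Z = \<phi> Y" "Z \<noteq> Y"
    hence "Z \<subset> Y \<or> Y \<subset> Z" using C(3) by blast
    thus False using mono[of Z Y] mono[of Y Z] * C(2) by blast
  qed
  hence "card (\<phi> ` C) = card C" by (rule card_image)
  moreover have "subset.chain \<B> (\<phi> ` C)"
    unfolding subset_chain_def
  proof (intro conjI ballI)
    show "\<phi> ` C \<subseteq> \<B>" using \<phi> C(2) by blast
    fix Z Y assume "Z \<in> \<phi> ` C" "Y \<in> \<phi> ` C"
    then obtain Z' Y' where "Z' \<in> C" "Y' \<in> C" "Z = \<phi> Z'" "Y = \<phi> Y'" by blast
    thus "Z \<subseteq> Y \<or> Y \<subseteq> Z" using C(3)[of Z' Y'] le[of Z' Y'] le[of Y' Z'] by blast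
  qed
  ultimately show "enat (card C - 1) \<le> (SUP C\<in>{C. finite C \<and> subset.chain \<B> C}. enat (card C - 1))"
    using C(1) by (intro SUP_upper2[of "\<phi> ` C"]) auto
qed

lemma chain_length_ge:
  assumes "\<And>i. i \<le> n \<Longrightarrow> J i \<in> \<A>" "\<And>i. i < n \<Longrightarrow> J i \<subset> J (Suc i)"
  shows "chain_length \<A> \<ge> enat n"
proof -
  have less: "J i \<subset> J j" if "i < j" "j \<le> n" for i j
    using that
  proof (induction j)
    case (Suc j)
    show ?case
    proof (cases "i = j")
      case False
      hence "J i \<subset> J j" using Suc by simp
      also have "J j \<subset> J (Suc j)" using assms(2) Suc.prems by simp
      finally show ?thesis .
    qed (use assms(2) Suc.prems in simp)
  qed simp
  have inj: "inj_on J {..n}"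
  proof (rule inj_onI)
    fix i j assume *: "i \<in> {..n}" "j \<in> {..n}" "J i = J j"
    show "i = j" using less[of i j] less[of j i] * by (cases i j rule: linorder_cases) auto
  qed
  have "subset.chain \<A> (J ` {..n})"
    unfolding subset_chain_def
  proof (intro conjI ballI)
    show "J ` {..n} \<subseteq> \<A>" using assms(1) by auto
    fix Z Y assume "Z \<in> J ` {..n}" "Y \<in> J ` {..n}"
    then obtain i j where *: "Z = J i" "Y = J j" "i \<le> n" "j \<le> n" by auto
    show "Z \<subseteq> Y \<or> Y \<subseteq> Z"
      using less[of i j] less[of j i] * by (cases i j rule: linorder_cases) auto
  qed
  moreover have "card (J ` {..n}) = Suc n" using inj by (simp add: card_image)
  ultimately show ?thesis
    unfolding chain_length_def by (intro SUP_upper2[of "J ` {..n}"]) auto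
qed

lemma chain_length_le:
  assumes "\<And>l J. (\<And>i. i \<le> l \<Longrightarrow> J i \<in> \<A>) \<Longrightarrow> (\<And>i. i < l \<Longrightarrow> J i \<subset> J (Suc i)) \<Longrightarrow> l \<le> n"
  shows "chain_length \<A> \<le> enat n"
  unfolding chain_length_def
proof (rule SUP_least)
  fix C assume "C \<in> {C. finite C \<and> subset.chain \<A> C}"
  hence C: "finite C" "subset.chain \<A> C" by auto
  from finite_chain_enum[OF this] obtain J where
    J: "C = J ` {..<card C}" "\<And>i j. i < j \<Longrightarrow> j < card C \<Longrightarrow> J i \<subset> J j" by blast
  have "card C - 1 \<le> n" if "card C > 0"
  proof (rule assms)
    fix i assume "i \<le> card C - 1"
    hence "i \<in> {..<card C}" using that by simp
    hence "J i \<in> C" using J(1) by blast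
    thus "J i \<in> \<A>" using C(2) by (auto simp: subset_chain_def)
  next
    fix i assume "i < card C - 1"
    thus "J i \<subset> J (Suc i)" by (intro J(2)) auto
  qed
  thus "enat (card C - 1) \<le> enat n" by (cases "card C > 0") auto
qed

section \<open>Ideals of quotients of polynomial rings\<close>

definition primeset :: "'r::comm_ring_1 set \<Rightarrow> bool" where
  "primeset P \<longleftrightarrow> idealset P \<and> 1 \<notin> P \<and> (\<forall>f g. f * g \<in> P \<longrightarrow> f \<in> P \<or> g \<in> P)"

text \<open>A HOL-Algebra ring presented by a type-class ring. Ideals of \<open>B\<close> are
  handled through their preimages, which contain \<open>ker\<close>.\<close>

locale ring_surj = cring B for B (structure) +
  fixes h :: "'r::comm_ring_1 \<Rightarrow> 'a"
  assumes h_add: "h (f + g) = h f \<oplus> h g"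
    and h_mult: "h (f * g) = h f \<otimes> h g"
    and h_one: "h 1 = \<one>"
    and h_surj: "carrier B = range h"
begin

lemma h_closed [simp]: "h f \<in> carrier B"
  by (simp add: h_surj)

lemma h_zero: "h 0 = \<zero>"
proof -
  have "h 0 \<oplus> h 0 = h 0" using h_add[of 0 0] by simp
  thus ?thesis by (simp add: add.r_cancel_one)
qed

lemma h_uminus: "h (- f) = \<ominus> h f"
proof -
  have "h (- f) \<oplus> h f = \<zero>" using h_add[of "- f" f] by (simp add: h_zero)
  thus ?thesis by (simp add: minus_equality)
qed

lemma h_diff: "h (f - g) = h f \<ominus> h g"
  using h_add[of f "- g"] by (simp add: h_uminus a_minus_def)

lemma h_eq_iff: "h f = h g \<longleftrightarrow> h (f - g) = \<zero>"
  by (simp add: h_diff)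

lemma h_power: "h (f ^ n) = h f [^] n"
  by (induction n) (simp_all add: h_one h_mult m_comm)

definition pre :: "'a set \<Rightarrow> 'r set" where
  "pre K = {f. h f \<in> K}"

definition ker :: "'r set" where
  "ker = {f. h f = \<zero>}"

lemma in_pre [simp]: "f \<in> pre K \<longleftrightarrow> h f \<in> K"
  by (simp add: pre_def)

lemma image_pre: "K \<subseteq> carrier B \<Longrightarrow> h ` pre K = K"
  unfolding h_surj by (auto simp: pre_def)

lemma idealset_pre:
  assumes "ideal K B" shows "idealset (pre K)"
proof -
  interpret K: ideal K B by (rule assms)
  show ?thesis
    by (auto simp: idealset_def h_zero h_add h_mult K.I_l_closed K.a_closed K.zero_closed)
qed

lemma ker_pre: "ideal K B \<Longrightarrow> ker \<subseteq> pre K"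
  by (auto simp: ker_def additive_subgroup.zero_closed ideal.axioms(1))

lemma ideal_image:
  assumes "idealset J" shows "ideal (h ` J) B"
proof (rule idealI)
  show "ring B" by (rule ring_axioms)
  show "subgroup (h ` J) (add_monoid B)"
  proof (rule add.subgroupI)
    show "h ` J \<subseteq> carrier B" by auto
    show "h ` J \<noteq> {}" using idealset_0[OF assms] by auto
    show "\<ominus> a \<in> h ` J" if "a \<in> h ` J" for a
      using that idealset_uminus[OF assms] by (auto simp flip: h_uminus)
    show "a \<oplus> b \<in> h ` J" if "a \<in> h ` J" "b \<in> h ` J" for a b
      using that idealset_add[OF assms] by (auto simp flip: h_add)
  qed
  show "x \<otimes> a \<in> h ` J" if "a \<in> h ` J" "x \<in> carrier B" for a x
    using that idealset_mult[OF assms] by (auto simp: h_surj simp flip: h_mult)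
  show "a \<otimes> x \<in> h ` J" if "a \<in> h ` J" "x \<in> carrier B" for a x
    using that idealset_mult_right[OF assms] by (auto simp: h_surj simp flip: h_mult)
qed

lemma h_in_image:
  assumes "idealset J" shows "h f \<in> h ` J \<longleftrightarrow> (\<exists>k\<in>ker. f - k \<in> J)"
proof
  assume "h f \<in> h ` J"
  then obtain g where g: "g \<in> J" "h f = h g" by blast
  have "f - g \<in> ker" using g(2) by (simp add: ker_def flip: h_eq_iff)
  thus "\<exists>k\<in>ker. f - k \<in> J" using g(1) by (intro bexI[of _ "f - g"]) simp_all
next
  assume "\<exists>k\<in>ker. f - k \<in> J"
  then obtain k where "h k = \<zero>" "f - k \<in> J" by (auto simp: ker_def)
  moreover have "h (f - k) = h f" using \<open>h k = \<zero>\<close> by (simp add: h_diff a_minus_def)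
  ultimately show "h f \<in> h ` J" by (metis imageI)
qed

lemma pre_image:
  assumes "idealset J" "ker \<subseteq> J" shows "pre (h ` J) = J"
proof
  show "pre (h ` J) \<subseteq> J"
  proof
    fix f assume "f \<in> pre (h ` J)"
    hence "h f \<in> h ` J" by simp
    then obtain k where "k \<in> ker" "f - k \<in> J" unfolding h_in_image[OF assms(1)] by blast
    thus "f \<in> J" using idealset_add[OF assms(1), of "f - k" k] assms(2) by auto
  qed
qed auto

lemma primeset_pre:
  assumes "primeideal P B" shows "primeset (pre P)"
proof -
  interpret P: primeideal P B by (rule assms)
  have "\<one> \<notin> P" using P.I_notcarr P.one_imp_carrier by blast
  show ?thesis
    unfolding primeset_def
  proof (intro conjI allI impI)
    show "idealset (pre P)" by (rule idealset_pre[OF P.ideal_axioms])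
    show "1 \<notin> pre P" using \<open>\<one> \<notin> P\<close> by (simp add: h_one)
    show "f \<in> pre P \<or> g \<in> pre P" if "f * g \<in> pre P" for f g
      using P.I_prime[of "h f" "h g"] that by (simp add: h_mult)
  qed
qed

lemma primeideal_image:
  assumes "primeset P" "ker \<subseteq> P" shows "primeideal (h ` P) B"
proof (rule primeidealI)
  have P: "idealset P" using assms(1) by (simp add: primeset_def)
  have pre: "h f \<in> h ` P \<longleftrightarrow> f \<in> P" for f
    unfolding in_pre[symmetric] pre_image[OF P assms(2)] ..
  show "ideal (h ` P) B" by (rule ideal_image[OF P])
  show "cring B" by (rule is_cring)
  have "\<one> \<notin> h ` P" using pre[of 1] assms(1) by (simp add: h_one primeset_def)
  thus "carrier B \<noteq> h ` P" by auto
  show "a \<in> h ` P \<or> b \<in> h ` P" if ab: "a \<in> carrier B" "b \<in> carrier B" "a \<otimes> b \<in> h ` P" for a b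
  proof -
    obtain f g where fg: "a = h f" "b = h g" using ab(1,2) unfolding h_surj by blast
    have "f * g \<in> P" using ab(3) unfolding fg pre[symmetric] h_mult .
    thus ?thesis using assms(1) unfolding fg pre primeset_def by blast
  qed
qed

lemma pre_strict_mono:
  assumes "K \<subseteq> carrier B" "L \<subseteq> carrier B" "K \<subset> L" shows "pre K \<subset> pre L"
proof -
  have "K \<noteq> L" "K \<subseteq> L" using assms(3) by blast+
  hence "pre K \<noteq> pre L" using image_pre[OF assms(1)] image_pre[OF assms(2)] by metis
  moreover have "pre K \<subseteq> pre L" using \<open>K \<subseteq> L\<close> unfolding pre_def by blast
  ultimately show ?thesis by blast
qed

lemma image_strict_mono:
  assumes "idealset J" "ker \<subseteq> J" "idealset L" "ker \<subseteq> L" "J \<subset> L" shows "h ` J \<subset> h ` L"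
proof -
  have "J \<noteq> L" "J \<subseteq> L" using assms(5) by blast+
  hence "h ` J \<noteq> h ` L" using pre_image[OF assms(1,2)] pre_image[OF assms(3,4)] by metis
  moreover have "h ` J \<subseteq> h ` L" using \<open>J \<subseteq> L\<close> by blast
  ultimately show ?thesis by blast
qed

text \<open>The correspondence between ideals and ideals containing the kernel, for any pair of
  matching classes \<open>P\<close> and \<open>Q\<close>; used for prime ideals and for all
  ideals.\<close>

lemma chain_length_ideals:
  assumes "\<And>K. P K \<Longrightarrow> ideal K B" "\<And>J. Q J \<Longrightarrow> idealset J \<and> ker \<subseteq> J"
    and "\<And>K. P K \<Longrightarrow> Q (pre K)" "\<And>J. Q J \<Longrightarrow> P (h ` J)"
  shows "chain_length {K. P K} = chain_length {J. Q J}"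
proof (rule antisym)
  have carr: "K \<subseteq> carrier B" if "P K" for K
    using assms(1)[OF that] by (rule additive_subgroup.a_subset[OF ideal.axioms(1)])
  show "chain_length {K. P K} \<le> chain_length {J. Q J}"
    by (rule chain_length_image_le[where \<phi> = pre]) (use assms(3) carr pre_strict_mono in auto)
  show "chain_length {J. Q J} \<le> chain_length {K. P K}"
    by (rule chain_length_image_le[where \<phi> = "(`) h"]) (use assms(2,4) image_strict_mono in auto)
qed

lemma krull_dim_eq: "krull_dim B = chain_length {P. primeset P \<and> ker \<subseteq> P}"
  unfolding krull_dim_def
proof (rule chain_length_ideals)
  show "primeset (pre K) \<and> ker \<subseteq> pre K" if "primeideal K B" for K
    using primeset_pre[OF that] ker_pre[OF primeideal.axioms(1)[OF that]] by blast
qed (auto simp: primeset_def primeideal_image intro: primeideal.axioms(1))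

lemma ring_length_eq: "ring_length B = chain_length {J. idealset J \<and> ker \<subseteq> J}"
  unfolding ring_length_def
proof (rule chain_length_ideals)
  show "idealset (pre K) \<and> ker \<subseteq> pre K" if "ideal K B" for K
    using idealset_pre[OF that] ker_pre[OF that] by blast
qed (auto intro: ideal_image)

lemma pre_Idl_empty: "pre (Idl {}) = ker"
proof -
  have "Idl {} = {\<zero>}"
  proof
    show "Idl {} \<subseteq> {\<zero>}" by (rule genideal_minimal[OF zeroideal]) (rule empty_subsetI)
    have "ideal (Idl {}) B" by (rule genideal_ideal) (rule empty_subsetI)
    from additive_subgroup.zero_closed[OF ideal.axioms(1)[OF this]] show "{\<zero>} \<subseteq> Idl {}" by blast
  qed
  thus ?thesis unfolding pre_def ker_def by simp
qed

text \<open>Adjoining one generator, in the shape that \<open>koszul_exact_of_regular\<close>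
  demands of consecutive ideals.\<close>

lemma pre_Idl_insert:
  assumes "A \<subseteq> carrier B"
  shows "pre (Idl (insert (h x) A)) = {a + r * x |a r. a \<in> pre (Idl A)}"
proof
  define J where "J = {a + r * x |a r. a \<in> pre (Idl A)}"
  have IA: "ideal (Idl A) B" by (rule genideal_ideal[OF assms])
  have sub: "insert (h x) A \<subseteq> carrier B" using assms by simp
  have I2: "ideal (Idl (insert (h x) A)) B" by (rule genideal_ideal[OF sub])
  note P = idealset_pre[OF IA] and P2 = idealset_pre[OF I2]
  have J_I: "a + r * x \<in> J" if "a \<in> pre (Idl A)" for a r
    unfolding J_def using that by blast
  have J_E: "\<exists>a r. u = a + r * x \<and> a \<in> pre (Idl A)" if "u \<in> J" for u
    using that unfolding J_def by blast
  have base: "a \<in> J" if "a \<in> pre (Idl A)" for a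
    using J_I[OF that, of 0] by simp
  have J: "idealset J"
    unfolding idealset_def
  proof (intro conjI ballI allI)
    show "0 \<in> J" by (rule base[OF idealset_0[OF P]])
    show "u + v \<in> J" if uv: "u \<in> J" "v \<in> J" for u v
    proof -
      obtain a s where u: "u = a + s * x" "a \<in> pre (Idl A)" using J_E[OF uv(1)] by blast
      obtain b t where v: "v = b + t * x" "b \<in> pre (Idl A)" using J_E[OF uv(2)] by blast
      have "u + v = (a + b) + (s + t) * x" unfolding u v by (simp add: algebra_simps)
      thus ?thesis using J_I[OF idealset_add[OF P u(2) v(2)]] by simp
    qed
    show "r * u \<in> J" if uJ: "u \<in> J" for u r
    proof -
      obtain a s where u: "u = a + s * x" "a \<in> pre (Idl A)" using J_E[OF uJ] by blast
      have "r * u = r * a + (r * s) * x" unfolding u by (simp add: algebra_simps)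
      thus ?thesis using J_I[OF idealset_mult[OF P u(2)]] by simp
    qed
  qed
  have x: "x \<in> J" using J_I[OF idealset_0[OF P], of 1] by simp
  have "insert (h x) A \<subseteq> h ` J"
  proof (rule insert_subsetI)
    show "h x \<in> h ` J" using x by (rule imageI)
    show "A \<subseteq> h ` J"
    proof
      fix y assume y: "y \<in> A"
      then obtain f where f: "y = h f" using assms unfolding h_surj by blast
      have "h f \<in> Idl A" using y f genideal_self[OF assms] by blast
      hence "f \<in> J" by (intro base) simp
      thus "y \<in> h ` J" unfolding f by (rule imageI)
    qed
  qed
  hence Idl_le: "Idl (insert (h x) A) \<subseteq> h ` J" by (rule genideal_minimal[OF ideal_image[OF J]])
  have "ker \<subseteq> J" using ker_pre[OF IA] base by blast
  hence "pre (h ` J) = J" by (rule pre_image[OF J])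
  moreover have "pre (Idl (insert (h x) A)) \<subseteq> pre (h ` J)" using Idl_le unfolding pre_def by blast
  ultimately have "pre (Idl (insert (h x) A)) \<subseteq> J" by simp
  thus "pre (Idl (insert (h x) A)) \<subseteq> {a + r * x |a r. a \<in> pre (Idl A)}" unfolding J_def .
  have "A \<subseteq> Idl (insert (h x) A)" using genideal_self[OF sub] by blast
  hence "Idl A \<subseteq> Idl (insert (h x) A)" by (rule genideal_minimal[OF I2])
  hence A2: "a \<in> pre (Idl (insert (h x) A))" if "a \<in> pre (Idl A)" for a using that unfolding pre_def by blast
  have x2: "x \<in> pre (Idl (insert (h x) A))" using genideal_self[OF sub] unfolding pre_def by blast
  show "{a + r * x |a r. a \<in> pre (Idl A)} \<subseteq> pre (Idl (insert (h x) A))"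
  proof
    fix u assume "u \<in> {a + r * x |a r. a \<in> pre (Idl A)}"
    then obtain a r where u: "u = a + r * x" "a \<in> pre (Idl A)" by blast
    show "u \<in> pre (Idl (insert (h x) A))"
      unfolding u(1) by (intro idealset_add[OF P2] idealset_mult[OF P2] x2 A2 u(2))
  qed
qed

lemma pre_Idl_image:
  fixes a :: "nat \<Rightarrow> 'r"
  shows "pre (Idl ((\<lambda>i. h (a i)) ` {1..d})) = {f. \<exists>g. f - (\<Sum>i=1..d. a i * g i) \<in> ker}"
proof (induction d)
  case 0
  show ?case by (simp add: pre_Idl_empty)
next
  case (Suc d)
  have sub: "(\<lambda>i. h (a i)) ` {1..d} \<subseteq> carrier B" by (rule image_subsetI) (rule h_closed)
  have "(\<lambda>i. h (a i)) ` {1..Suc d} = insert (h (a (Suc d))) ((\<lambda>i. h (a i)) ` {1..d})"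
    by (simp add: atLeastAtMostSuc_conv)
  hence "pre (Idl ((\<lambda>i. h (a i)) ` {1..Suc d})) = {f + r * a (Suc d) |f r. \<exists>g. f - (\<Sum>i=1..d. a i * g i) \<in> ker}"
    using pre_Idl_insert[OF sub, of "a (Suc d)"] unfolding Suc by (simp only: mem_Collect_eq)
  also have "\<dots> = {f. \<exists>g. f - (\<Sum>i=1..Suc d. a i * g i) \<in> ker}"
  proof (intro equalityI subsetI)
    fix f assume "f \<in> {f + r * a (Suc d) |f r. \<exists>g. f - (\<Sum>i=1..d. a i * g i) \<in> ker}"
    then obtain f' r g where *: "f = f' + r * a (Suc d)" "f' - (\<Sum>i=1..d. a i * g i) \<in> ker" by blast
    have "(\<Sum>i=1..d. a i * (g(Suc d := r)) i) = (\<Sum>i=1..d. a i * g i)" by (intro sum.cong) auto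
    hence E: "f - (\<Sum>i=1..Suc d. a i * (g(Suc d := r)) i) = f' - (\<Sum>i=1..d. a i * g i)"
      by (simp add: *(1) mult.commute)
    have "f - (\<Sum>i=1..Suc d. a i * (g(Suc d := r)) i) \<in> ker" unfolding E by (rule *(2))
    thus "f \<in> {f. \<exists>g. f - (\<Sum>i=1..Suc d. a i * g i) \<in> ker}"
      by (intro CollectI exI[of _ "g(Suc d := r)"])
  next
    fix f assume "f \<in> {f. \<exists>g. f - (\<Sum>i=1..Suc d. a i * g i) \<in> ker}"
    then obtain g where g: "f - (\<Sum>i=1..Suc d. a i * g i) \<in> ker" by blast
    define f' where "f' = f - g (Suc d) * a (Suc d)"
    have "f' - (\<Sum>i=1..d. a i * g i) \<in> ker" using g by (simp add: f'_def algebra_simps)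
    moreover have "f = f' + g (Suc d) * a (Suc d)" by (simp add: f'_def)
    ultimately show "f \<in> {f + r * a (Suc d) |f r. \<exists>g. f - (\<Sum>i=1..d. a i * g i) \<in> ker}" by blast
  qed
  finally show ?case .
qed

text \<open>Quotients of \<open>B\<close> are presented by the same ring with a larger kernel, so
  their dimension and length are read off from chains above \<open>pre K\<close>.\<close>

lemma ring_surj_quotient:
  assumes "ideal K B"
  shows "ring_surj (B Quot K) (\<lambda>f. K +> h f)" "ring_surj.ker (B Quot K) (\<lambda>f. K +> h f) = pre K"
proof -
  interpret K: ideal K B by (rule assms)
  interpret Q: cring "B Quot K" by (rule K.quotient_is_cring[OF is_cring])
  have hom: "(+>) K \<in> ring_hom B (B Quot K)" by (rule K.rcos_ring_hom)
  show surj: "ring_surj (B Quot K) (\<lambda>f. K +> h f)"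
  proof (unfold_locales)
    show "K +> h (f + g) = (K +> h f) \<oplus>\<^bsub>B Quot K\<^esub> (K +> h g)" for f g
      unfolding h_add by (rule ring_hom_add[OF hom]) auto
    show "K +> h (f * g) = (K +> h f) \<otimes>\<^bsub>B Quot K\<^esub> (K +> h g)" for f g
      unfolding h_mult by (rule ring_hom_mult[OF hom]) auto
    show "K +> h 1 = \<one>\<^bsub>B Quot K\<^esub>"
      unfolding h_one by (rule ring_hom_one[OF hom])
    show "carrier (B Quot K) = range (\<lambda>f. K +> h f)"
      unfolding FactRing_def A_RCOSETS_def' by (auto simp: h_surj)
  qed
  show "ring_surj.ker (B Quot K) (\<lambda>f. K +> h f) = pre K"
  proof -
    have "K +> h f = K \<longleftrightarrow> h f \<in> K" for f
      using K.a_rcos_self[of "h f"] K.a_rcos_const[of "h f"] by auto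
    thus ?thesis unfolding ring_surj.ker_def[OF surj] by (auto simp: FactRing_def)
  qed
qed

end

lemma ring_surj_id: "ring_surj (ring_of_type_algebra :: 'r::comm_ring_1 ring) (\<lambda>f. f)"
proof -
  interpret cring "ring_of_type_algebra :: 'r ring" by (rule cring_from_type_algebra)
  show ?thesis by unfold_locales (simp_all add: ring_of_type_algebra_def)
qed

lemma mon_ideal_subset:
  fixes J :: "('m::comm_monoid_add \<Rightarrow>\<^sub>0 'k::comm_ring_1) set"
  assumes "idealset J" "\<And>u. Q u \<Longrightarrow> Poly_Mapping.single u 1 \<in> J"
  shows "mon_ideal Q \<subseteq> J"
proof
  fix f :: "'m \<Rightarrow>\<^sub>0 'k" assume f: "f \<in> mon_ideal Q"
  have "(\<Sum>u\<in>Poly_Mapping.keys f. Poly_Mapping.single u (Poly_Mapping.lookup f u)) \<in> J"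
  proof (rule idealset_sum[OF assms(1)])
    fix u assume "u \<in> Poly_Mapping.keys f"
    hence "Poly_Mapping.single u 1 \<in> J" using f assms(2) by (simp add: mon_ideal_def)
    from idealset_mult[OF assms(1) this, of "Poly_Mapping.single 0 (Poly_Mapping.lookup f u)"]
    show "Poly_Mapping.single u (Poly_Mapping.lookup f u) \<in> J" by (simp only: scale_single mult_1_right)
  qed
  thus "f \<in> J" by (simp only: sum_singles)
qed

section \<open>The Stanley-Reisner ideal as a monomial ideal\<close>

definition sqfree_mon :: "'v::finite set \<Rightarrow> 'v \<Rightarrow>\<^sub>0 nat" where
  "sqfree_mon F = (\<Sum>x\<in>F. Poly_Mapping.single x 1)"

lemma lookup_sqfree_mon: "Poly_Mapping.lookup (sqfree_mon F) x = (if x \<in> F then 1 else 0)"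
proof -
  have "Poly_Mapping.lookup (sqfree_mon F) x = (\<Sum>y\<in>F. if y = x then 1 else 0)"
    unfolding sqfree_mon_def lookup_sum by (intro sum.cong refl) (simp add: lookup_single when_def)
  thus ?thesis by (simp add: sum.delta)
qed

lemma keys_sqfree_mon: "Poly_Mapping.keys (sqfree_mon F) = F"
  by (auto simp: in_keys_iff lookup_sqfree_mon split: if_splits)

lemma prod_indet: "(\<Prod>x\<in>F. indet x) = Poly_Mapping.single (sqfree_mon F) (1 :: 'k::comm_ring_1)"
proof (induction F rule: infinite_finite_induct)
  case (insert x F)
  thus ?case by (simp add: sqfree_mon_def indet_def mult_single)
qed (simp_all add: sqfree_mon_def)

lemma sqfree_mon_dvd:
  assumes "Poly_Mapping.keys u = F" obtains w where "u = w + sqfree_mon F"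
proof
  show "u = (u - sqfree_mon F) + sqfree_mon F"
    by (rule poly_mapping_eqI)
      (use assms in \<open>auto simp: lookup_add lookup_minus lookup_sqfree_mon in_keys_iff split: if_splits\<close>)
qed

text \<open>A monomial whose support is not a face is a multiple of the squarefree monomial of its
  support, which is a generator.\<close>

lemma SR_ideal_eq_nonfaces:
  assumes "simplicial_complex \<Delta>"
  shows "(SR_ideal \<Delta> :: ('v::finite, 'k::comm_ring_1) mpoly set) = nonfaces \<Delta>"
proof -
  interpret S: ring_surj "poly_ring :: ('v, 'k) mpoly ring" "\<lambda>f. f" by (rule ring_surj_id)
  let ?G = "{\<Prod>x\<in>F. indet x | F. F \<notin> \<Delta>} :: ('v, 'k) mpoly set"
  have G: "?G \<subseteq> carrier poly_ring" by (simp add: ring_of_type_algebra_def)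
  have N: "idealset (nonfaces \<Delta> :: ('v, 'k) mpoly set)" by (rule idealset_nonfaces[OF assms])
  have "ideal (nonfaces \<Delta> :: ('v, 'k) mpoly set) poly_ring" using S.ideal_image[OF N] by simp
  moreover have "?G \<subseteq> nonfaces \<Delta>"
    unfolding prod_indet by (auto intro!: single_mon_ideal simp: keys_sqfree_mon)
  ultimately have "(SR_ideal \<Delta> :: ('v, 'k) mpoly set) \<subseteq> nonfaces \<Delta>" unfolding SR_ideal_def by (rule S.genideal_minimal)
  moreover have "nonfaces \<Delta> \<subseteq> (SR_ideal \<Delta> :: ('v, 'k) mpoly set)"
  proof (rule mon_ideal_subset)
    have "idealset (S.pre (Idl\<^bsub>poly_ring\<^esub> ?G))" by (rule S.idealset_pre[OF S.genideal_ideal[OF G]])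
    thus I: "idealset (SR_ideal \<Delta> :: ('v, 'k) mpoly set)" by (simp add: S.pre_def SR_ideal_def)
    fix u :: "'v \<Rightarrow>\<^sub>0 nat" assume "Poly_Mapping.keys u \<notin> \<Delta>"
    hence "Poly_Mapping.single (sqfree_mon (Poly_Mapping.keys u)) 1 \<in> ?G" unfolding prod_indet by blast
    hence "Poly_Mapping.single (sqfree_mon (Poly_Mapping.keys u)) 1 \<in> (SR_ideal \<Delta> :: ('v, 'k) mpoly set)"
      unfolding SR_ideal_def using S.genideal_self[OF G] by blast
    moreover obtain w where w: "u = w + sqfree_mon (Poly_Mapping.keys u)" using sqfree_mon_dvd[OF refl] by blast
    have "Poly_Mapping.single u (1 :: 'k) = Poly_Mapping.single w 1 * Poly_Mapping.single (sqfree_mon (Poly_Mapping.keys u)) 1"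
      using w by (simp add: mult_single)
    ultimately show "Poly_Mapping.single u 1 \<in> (SR_ideal \<Delta> :: ('v, 'k) mpoly set)"
      using idealset_mult[OF I] by simp
  qed
  ultimately show ?thesis by (rule antisym)
qed

lemma ring_surj_SR:
  assumes "simplicial_complex \<Delta>"
  shows "ring_surj (SR_ring \<Delta> :: ('v::finite, 'k::comm_ring_1) mpoly set ring) (SR_class \<Delta>)"
    and "ring_surj.ker (SR_ring \<Delta> :: ('v::finite, 'k::comm_ring_1) mpoly set ring) (SR_class \<Delta>) = nonfaces \<Delta>"
proof -
  interpret S: ring_surj "poly_ring :: ('v, 'k) mpoly ring" "\<lambda>f. f" by (rule ring_surj_id)
  have "ideal (nonfaces \<Delta> :: ('v, 'k) mpoly set) poly_ring"
    using S.ideal_image[OF idealset_nonfaces[OF assms]] by simp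
  from S.ring_surj_quotient[OF this]
  show "ring_surj (SR_ring \<Delta> :: ('v::finite, 'k::comm_ring_1) mpoly set ring) (SR_class \<Delta>)"
    "ring_surj.ker (SR_ring \<Delta> :: ('v::finite, 'k::comm_ring_1) mpoly set ring) (SR_class \<Delta>) = nonfaces \<Delta>"
    by (simp_all add: SR_ring_def SR_class_def[abs_def] SR_ideal_eq_nonfaces[OF assms] S.pre_def)
qed

lemma mdeg_split:
  assumes "n \<le> mdeg u" obtains w z where "u = w + z" "mdeg w = n"
  using assms
proof (induction n arbitrary: thesis)
  case 0
  show ?case by (rule 0(1)[of 0 u]) simp_all
next
  case (Suc n)
  then obtain w z where wz: "u = w + z" "mdeg w = n" by (metis Suc_leD)
  have "mdeg z \<noteq> 0" using Suc.prems(2) wz by simp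
  hence "Poly_Mapping.keys z \<noteq> {}" by (auto simp: mdeg_eq_0_iff)
  then obtain x where x: "x \<in> Poly_Mapping.keys z" by blast
  have z: "z - Poly_Mapping.single x 1 + Poly_Mapping.single x 1 = z" by (rule minus_single_add[OF x])
  show ?case
  proof (rule Suc.prems(1))
    show "u = (w + Poly_Mapping.single x 1) + (z - Poly_Mapping.single x 1)"
      unfolding wz(1) by (subst z[symmetric]) (simp only: add_ac)
    show "mdeg (w + Poly_Mapping.single x 1) = Suc n" using wz(2) by simp
  qed
qed

lemma idealset_covered:
  assumes "simplicial_complex \<Delta>" "\<And>u w. Q u \<Longrightarrow> Q (u + w)"
  shows "idealset {f. covered \<Delta> d a Q f}"
  unfolding idealset_def
proof (intro conjI ballI allI)
  show "0 \<in> {f. covered \<Delta> d a Q f}" by (simp add: covered_nonfaces mon_ideal_0)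
  show "f + g \<in> {f. covered \<Delta> d a Q f}" if "f \<in> {f. covered \<Delta> d a Q f}" "g \<in> {f. covered \<Delta> d a Q f}" for f g
    using that by (simp add: covered_add)
  show "r * f \<in> {f. covered \<Delta> d a Q f}" if f: "f \<in> {f. covered \<Delta> d a Q f}" for f r
  proof -
    obtain g where g: "\<forall>i. g i \<in> mon_ideal Q" "f - (\<Sum>i=1..d. a i * g i) \<in> nonfaces \<Delta>"
      using f unfolding covered_def by blast
    have "r * f - (\<Sum>i=1..d. a i * (r * g i)) = r * (f - (\<Sum>i=1..d. a i * g i))"
      by (simp add: right_diff_distrib sum_distrib_left mult.left_commute)
    also have "\<dots> \<in> nonfaces \<Delta>" by (rule idealset_mult[OF idealset_nonfaces[OF assms(1)] g(2)])
    finally have "r * f - (\<Sum>i=1..d. a i * (r * g i)) \<in> nonfaces \<Delta>" .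
    moreover have "\<forall>i. r * g i \<in> mon_ideal Q" using g(1) idealset_mult[OF idealset_mon_ideal[of Q, OF assms(2)]] by blast
    ultimately show ?thesis unfolding covered_def by (intro CollectI exI[of _ "\<lambda>i. r * g i"] conjI)
  qed
qed

section \<open>Powers of the maximal ideal in the Stanley-Reisner ring\<close>

locale stanley_reisner =
  fixes \<Delta> :: "'v::{finite,linorder} set set" and R :: "('v, 'k::field) mpoly set ring" (structure)
  assumes complex: "simplicial_complex \<Delta>" and R_def: "R = SR_ring \<Delta>"

sublocale stanley_reisner \<subseteq> ring_surj R "SR_class \<Delta>"
  unfolding R_def by (rule ring_surj_SR(1)[OF complex])

context stanley_reisner
begin

abbreviation \<pi> :: "('v, 'k) mpoly \<Rightarrow> ('v, 'k) mpoly set" where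
  "\<pi> \<equiv> SR_class \<Delta>"

lemma ker_eq: "ker = nonfaces \<Delta>"
  unfolding R_def by (rule ring_surj_SR(2)[OF complex])

lemma \<pi>_eq_iff: "\<pi> f = \<pi> g \<longleftrightarrow> f - g \<in> nonfaces \<Delta>"
  unfolding h_eq_iff ker_eq[symmetric] by (simp add: ker_def)

text \<open>\<mm>^n, defined by orders of representatives; \<open>max_ideal_eq\<close> and
  \<open>MM_pow\<close> identify it with the power of the maximal ideal.\<close>

definition MM :: "nat \<Rightarrow> ('v, 'k) mpoly set set" where
  "MM n = \<pi> ` Ge n"

lemma ideal_MM: "ideal (MM n) R"
  unfolding MM_def by (rule ideal_image[OF idealset_Ge])

lemma \<pi>_in_MM: "\<pi> f \<in> MM n \<longleftrightarrow> (\<exists>g\<in>Ge n. f - g \<in> nonfaces \<Delta>)"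
  unfolding MM_def image_iff \<pi>_eq_iff ..

lemma Ge_MM: "f \<in> Ge n \<Longrightarrow> \<pi> f \<in> MM n"
  unfolding MM_def by (rule imageI)

lemma MM_0: "MM 0 = carrier R"
proof -
  have "Ge 0 = (UNIV :: ('v, 'k) mpoly set)" using Ge_0 by blast
  thus ?thesis unfolding MM_def h_surj by (simp only:)
qed

lemma ideal_subset_carrier: "ideal K R \<Longrightarrow> K \<subseteq> carrier R"
  by (rule additive_subgroup.a_subset[OF ideal.axioms(1)])

lemma subset_iff_pre:
  assumes "K \<subseteq> carrier R" shows "K \<subseteq> L \<longleftrightarrow> pre K \<subseteq> pre L"
  using assms unfolding pre_def h_surj by blast

lemma MM_subset:
  assumes "ideal K R" "\<And>u. n \<le> mdeg u \<Longrightarrow> \<pi> (Poly_Mapping.single u 1) \<in> K"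
  shows "MM n \<subseteq> K"
proof -
  have "Ge n \<subseteq> pre K" by (rule mon_ideal_subset[OF idealset_pre[OF assms(1)]]) (simp add: assms(2))
  thus ?thesis unfolding MM_def pre_def by blast
qed

lemma MM_mono: "m \<le> n \<Longrightarrow> MM n \<subseteq> MM m"
  unfolding MM_def by (intro image_mono subsetI) (rule Ge_mono)

lemma ideal_prod_subset:
  assumes "ideal L R" "\<And>a b. a \<in> I \<Longrightarrow> b \<in> J \<Longrightarrow> a \<otimes> b \<in> L"
  shows "I \<cdot> J \<subseteq> L"
proof
  fix x assume "x \<in> I \<cdot> J"
  thus "x \<in> L"
  proof (induction x rule: ideal_prod.induct)
    case (sum s1 s2)
    thus ?case using additive_subgroup.a_closed[OF ideal.axioms(1)[OF assms(1)]] by blast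
  qed (rule assms(2))
qed

lemma MM_prod: "MM a \<cdot> MM b = MM (a + b)"
proof
  show "MM a \<cdot> MM b \<subseteq> MM (a + b)"
  proof (rule ideal_prod_subset[OF ideal_MM])
    fix x y assume "x \<in> MM a" "y \<in> MM b"
    then obtain f g where "x = \<pi> f" "y = \<pi> g" "f \<in> Ge a" "g \<in> Ge b" unfolding MM_def by blast
    thus "x \<otimes> y \<in> MM (a + b)" using Ge_MM[OF Ge_mult] by (simp add: h_mult)
  qed
  show "MM (a + b) \<subseteq> MM a \<cdot> MM b"
  proof (rule MM_subset[OF ideal_prod_is_ideal[OF ideal_MM ideal_MM]])
    fix u :: "'v \<Rightarrow>\<^sub>0 nat" assume u: "a + b \<le> mdeg u"
    then obtain w z where wz: "u = w + z" "mdeg w = a" by (metis add_leD1 mdeg_split)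
    have "Poly_Mapping.single w 1 \<in> (Ge a :: ('v, 'k) mpoly set)" by (rule single_mon_ideal) (simp add: wz)
    moreover have "Poly_Mapping.single z 1 \<in> (Ge b :: ('v, 'k) mpoly set)" by (rule single_mon_ideal) (use u wz in simp)
    ultimately have "\<pi> (Poly_Mapping.single w 1) \<otimes> \<pi> (Poly_Mapping.single z 1) \<in> MM a \<cdot> MM b"
      by (intro ideal_prod.prod Ge_MM)
    thus "\<pi> (Poly_Mapping.single u 1) \<in> MM a \<cdot> MM b"
      unfolding h_mult[symmetric] mult_single wz(1) by simp
  qed
qed

lemma mult_ideals_set [simp]: "I \<otimes>\<^bsub>ideals_set R\<^esub> J = I \<cdot> J"
  and one_ideals_set [simp]: "\<one>\<^bsub>ideals_set R\<^esub> = carrier R"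
  and add_ideals_set [simp]: "I \<oplus>\<^bsub>ideals_set R\<^esub> J = I <+> J"
  and zero_ideals_set [simp]: "\<zero>\<^bsub>ideals_set R\<^esub> = {\<zero>}"
  and carrier_ideals_set [simp]: "carrier (ideals_set R) = {I. ideal I R}"
  by (simp_all add: ideals_set_def)

lemma MM_pow: "MM 1 [^]\<^bsub>ideals_set R\<^esub> (n::nat) = MM n"
proof (induction n)
  case 0
  show ?case by (simp add: nat_pow_def MM_0)
next
  case (Suc n)
  have "MM 1 [^]\<^bsub>ideals_set R\<^esub> Suc n = MM 1 [^]\<^bsub>ideals_set R\<^esub> n \<otimes>\<^bsub>ideals_set R\<^esub> MM 1"
    by (simp add: nat_pow_def)
  thus ?case unfolding Suc by (simp add: MM_prod)
qed

lemma max_ideal_eq: "SR_max_ideal \<Delta> = MM 1"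
proof -
  let ?G = "range (\<lambda>x. \<pi> (indet x))"
  have G: "?G \<subseteq> carrier R" by (rule image_subsetI) (rule h_closed)
  have "Idl ?G \<subseteq> MM 1"
  proof (rule genideal_minimal[OF ideal_MM])
    show "?G \<subseteq> MM 1"
      by (rule image_subsetI) (intro Ge_MM; unfold indet_def; rule single_mon_ideal; simp)
  qed
  moreover have "MM 1 \<subseteq> Idl ?G"
  proof (rule MM_subset[OF genideal_ideal[OF G]])
    fix u :: "'v \<Rightarrow>\<^sub>0 nat" assume "1 \<le> mdeg u"
    then obtain w z where wz: "u = w + z" "mdeg w = 1" by (rule mdeg_split)
    from wz(2) obtain x where w: "w = Poly_Mapping.single x 1" by (rule mdeg_1E)
    have "\<pi> (indet x) \<in> Idl ?G" using genideal_self[OF G] by blast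
    hence "indet x \<in> pre (Idl ?G)" by simp
    from idealset_mult_right[OF idealset_pre[OF genideal_ideal[OF G]] this, of "Poly_Mapping.single z 1"]
    have "indet x * Poly_Mapping.single z 1 \<in> pre (Idl ?G)" .
    moreover have "indet x * Poly_Mapping.single z 1 = (Poly_Mapping.single u 1 :: ('v, 'k) mpoly)"
      by (simp add: indet_def mult_single wz(1) w)
    ultimately show "\<pi> (Poly_Mapping.single u 1) \<in> Idl ?G" by simp
  qed
  ultimately show ?thesis unfolding SR_max_ideal_def R_def[symmetric] by (rule antisym)
qed

text \<open>The preimage of the sum of the ideals a_i \<mm>^n. If the \<open>a i\<close> have order
  at least 1, that sum lies in \<mm>^(n+1), whence the shift by \<open>Suc\<close> in
  \<open>gcovers_iff\<close>.\<close>

definition Cov :: "nat \<Rightarrow> (nat \<Rightarrow> ('v, 'k) mpoly) \<Rightarrow> nat \<Rightarrow> ('v, 'k) mpoly set" where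
  "Cov d a n = {f. covered \<Delta> d a (\<lambda>u. n \<le> mdeg u) f}"

lemma idealset_Cov: "idealset (Cov d a n)"
  unfolding Cov_def by (rule idealset_covered[OF complex]) simp

lemma ker_Cov: "ker \<subseteq> Cov d a n"
  unfolding ker_eq Cov_def by (auto intro: covered_nonfaces)

lemma ideal_Cov: "ideal (\<pi> ` Cov d a n) R"
  by (rule ideal_image[OF idealset_Cov])

lemma pre_Cov: "pre (\<pi> ` Cov d a n) = Cov d a n"
  by (rule pre_image[OF idealset_Cov ker_Cov])

lemma gcovers_iff: "gcovers \<Delta> d a (Suc n) \<longleftrightarrow> MM (Suc n) \<subseteq> \<pi> ` Cov d a n"
proof -
  have "MM (Suc n) \<subseteq> \<pi> ` Cov d a n \<longleftrightarrow> Ge (Suc n) \<subseteq> pre (\<pi> ` Cov d a n)"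
    unfolding MM_def pre_def by blast
  thus ?thesis unfolding pre_Cov by (auto simp: gcovers_def Cov_def)
qed

lemma Cov_MM:
  assumes a: "\<And>i. i \<in> {1..d} \<Longrightarrow> a i \<in> Ge 1"
  shows "\<pi> ` Cov d a n \<subseteq> MM (Suc n)"
proof
  fix z assume "z \<in> \<pi> ` Cov d a n"
  then obtain f g where z: "z = \<pi> f" and g: "\<forall>i. g i \<in> Ge n" "f - (\<Sum>i=1..d. a i * g i) \<in> nonfaces \<Delta>"
    unfolding Cov_def covered_def by blast
  have "(\<Sum>i=1..d. a i * g i) \<in> Ge (Suc n)"
    by (rule mon_ideal_sum) (use Ge_mult[OF a g(1)[rule_format]] in simp)
  thus "z \<in> MM (Suc n)" unfolding z \<pi>_in_MM using g(2) by blast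
qed

lemma Cov_prod_MM: "(\<pi> ` Cov d a n) \<cdot> MM m \<subseteq> \<pi> ` Cov d a (n + m)"
proof (rule ideal_prod_subset[OF ideal_Cov])
  fix x y assume "x \<in> \<pi> ` Cov d a n" "y \<in> MM m"
  then obtain f r g where x: "x = \<pi> f" and g: "\<forall>i. g i \<in> Ge n" "f - (\<Sum>i=1..d. a i * g i) \<in> nonfaces \<Delta>"
    and y: "y = \<pi> r" "r \<in> Ge m" unfolding Cov_def covered_def MM_def by blast
  have "f * r - (\<Sum>i=1..d. a i * (g i * r)) = r * (f - (\<Sum>i=1..d. a i * g i))"
    by (simp add: right_diff_distrib sum_distrib_left mult_ac)
  also have "\<dots> \<in> nonfaces \<Delta>" by (rule idealset_mult[OF idealset_nonfaces[OF complex] g(2)])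
  finally have "f * r - (\<Sum>i=1..d. a i * (g i * r)) \<in> nonfaces \<Delta>" .
  moreover have "g i * r \<in> Ge (n + m)" for i by (rule Ge_mult[OF g(1)[rule_format] y(2)])
  ultimately have "f * r \<in> Cov d a (n + m)"
    unfolding Cov_def covered_def by (intro CollectI exI[of _ "\<lambda>i. g i * r"]) blast
  thus "x \<otimes> y \<in> \<pi> ` Cov d a (n + m)" unfolding x y(1) h_mult[symmetric] by (rule imageI)
qed

lemma Idl_prod_MM:
  fixes a :: "nat \<Rightarrow> ('v, 'k) mpoly"
  shows "(Idl ((\<lambda>i. \<pi> (a i)) ` {1..d})) \<cdot> MM n = \<pi> ` Cov d a n"
proof
  let ?I = "(Idl ((\<lambda>i. \<pi> (a i)) ` {1..d}))"
  have gens: "(\<lambda>i. \<pi> (a i)) ` {1..d} \<subseteq> carrier R" by (rule image_subsetI) (rule h_closed)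
  have I: "ideal ?I R" by (rule genideal_ideal[OF gens])
  have P: "idealset (pre (?I \<cdot> MM n))" by (rule idealset_pre[OF ideal_prod_is_ideal[OF I ideal_MM]])
  have K: "nonfaces \<Delta> \<subseteq> pre (?I \<cdot> MM n)"
    unfolding ker_eq[symmetric] by (rule ker_pre[OF ideal_prod_is_ideal[OF I ideal_MM]])
  show "?I \<cdot> MM n \<subseteq> \<pi> ` Cov d a n"
  proof (rule ideal_prod_subset[OF ideal_Cov])
    fix x y assume xy: "x \<in> ?I" "y \<in> MM n"
    have "x \<in> carrier R" using xy(1) ideal_subset_carrier[OF I] by blast
    then obtain f where x: "x = \<pi> f" unfolding h_surj by blast
    have "f \<in> pre ?I" using xy(1) x by simp
    then obtain g where g: "f - (\<Sum>i=1..d. a i * g i) \<in> nonfaces \<Delta>" unfolding pre_Idl_image ker_eq by blast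
    hence "f \<in> Cov d a 0" unfolding Cov_def covered_def using Ge_0 by blast
    hence "x \<in> \<pi> ` Cov d a 0" unfolding x by (rule imageI)
    hence "x \<otimes> y \<in> (\<pi> ` Cov d a 0) \<cdot> MM n" using xy(2) by (rule ideal_prod.prod)
    thus "x \<otimes> y \<in> \<pi> ` Cov d a n" using Cov_prod_MM[of d a 0 n] by auto
  qed
  show "\<pi> ` Cov d a n \<subseteq> ?I \<cdot> MM n"
  proof
    fix z assume "z \<in> \<pi> ` Cov d a n"
    then obtain f g where z: "z = \<pi> f" and g: "\<forall>i. g i \<in> Ge n" "f - (\<Sum>i=1..d. a i * g i) \<in> nonfaces \<Delta>"
      unfolding Cov_def covered_def by blast
    have "(\<Sum>i=1..d. a i * g i) \<in> pre (?I \<cdot> MM n)"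
    proof (rule idealset_sum[OF P])
      fix i assume "i \<in> {1..d}"
      hence "\<pi> (a i) \<in> ?I" using genideal_self[OF gens] by blast
      hence "\<pi> (a i) \<otimes> \<pi> (g i) \<in> ?I \<cdot> MM n" by (rule ideal_prod.prod[OF _ Ge_MM[OF g(1)[rule_format]]])
      thus "a i * g i \<in> pre (?I \<cdot> MM n)" by (simp add: h_mult)
    qed
    moreover have "f - (\<Sum>i=1..d. a i * g i) \<in> pre (?I \<cdot> MM n)" using g(2) K by blast
    ultimately have "(f - (\<Sum>i=1..d. a i * g i)) + (\<Sum>i=1..d. a i * g i) \<in> pre (?I \<cdot> MM n)"
      by (intro idealset_add[OF P])
    thus "z \<in> ?I \<cdot> MM n" unfolding z by simp
  qed
qed

lemma Idl_prod_MM_iff: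
  fixes a :: "nat \<Rightarrow> ('v, 'k) mpoly"
  assumes "\<And>i. i \<in> {1..d} \<Longrightarrow> a i \<in> Ge 1"
  shows "(Idl ((\<lambda>i. \<pi> (a i)) ` {1..d})) \<cdot> MM n = MM (Suc n) \<longleftrightarrow> gcovers \<Delta> d a (Suc n)"
  unfolding Idl_prod_MM gcovers_iff using Cov_MM[where a = a and d = d, OF assms] by blast

text \<open>\<open><#\<close> forms the set of products of one element with \<open>T\<close>, so
  this is the product of a principal ideal with \<open>T\<close>.\<close>

lemma ideal_l_coset:
  assumes "ideal T R" shows "ideal (\<pi> a <# T) R"
proof -
  have T: "\<pi> ` pre T = T" by (rule image_pre[OF ideal_subset_carrier[OF assms]])
  have eq: "\<pi> a <# T = \<pi> ` ((*) a ` pre T)"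
    unfolding l_coset_def image_image h_mult by (subst (1) T[symmetric]) auto
  have P: "idealset (pre T)" by (rule idealset_pre[OF assms])
  have "idealset ((*) a ` pre T)"
    unfolding idealset_def
  proof (intro conjI ballI allI)
    show "0 \<in> (*) a ` pre T" by (rule image_eqI[of _ _ 0]) (simp_all add: idealset_0[OF P] del: in_pre)
    show "u + v \<in> (*) a ` pre T" if uv: "u \<in> (*) a ` pre T" "v \<in> (*) a ` pre T" for u v
    proof -
      obtain f g where "u = a * f" "v = a * g" "f \<in> pre T" "g \<in> pre T" using uv by blast
      thus ?thesis using idealset_add[OF P] by (intro image_eqI[of _ _ "f + g"]) (simp_all add: distrib_left del: in_pre)
    qed
    show "r * u \<in> (*) a ` pre T" if uv: "u \<in> (*) a ` pre T" for r u
    proof -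
      obtain f where "u = a * f" "f \<in> pre T" using uv by blast
      thus ?thesis using idealset_mult[OF P] by (intro image_eqI[of _ _ "r * f"]) (simp_all add: mult.left_commute del: in_pre)
    qed
  qed
  thus ?thesis unfolding eq by (rule ideal_image)
qed

lemma \<pi>_in_l_coset: "ideal T R \<Longrightarrow> z \<in> \<pi> a <# T \<longleftrightarrow> (\<exists>f. z = \<pi> (a * f) \<and> \<pi> f \<in> T)"
proof -
  assume T: "ideal T R"
  have "t \<in> T \<Longrightarrow> \<exists>f. t = \<pi> f" for t using ideal_subset_carrier[OF T] unfolding h_surj by blast
  thus ?thesis unfolding l_coset_def h_mult by blast
qed

lemma abelian_monoid_ideals: "abelian_monoid (ideals_set R)"
  using ideals_set_is_semiring by (rule semiring.axioms(1))

text \<open>Both claims share one induction: the preimage is computed through representatives, which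
  requires the partial sum to be an ideal.\<close>

lemma finsum_l_cosets:
  assumes "finite A" "\<And>i. i \<in> A \<Longrightarrow> ideal (T i) R"
  shows "ideal (\<Oplus>\<^bsub>ideals_set R\<^esub> i\<in>A. \<pi> (a i) <# T i) R \<and>
    pre (\<Oplus>\<^bsub>ideals_set R\<^esub> i\<in>A. \<pi> (a i) <# T i)
      = {f. \<exists>g. (\<forall>i\<in>A. \<pi> (g i) \<in> T i) \<and> f - (\<Sum>i\<in>A. a i * g i) \<in> nonfaces \<Delta>}"
  using assms
proof (induction A rule: finite_induct)
  case empty
  interpret M: abelian_monoid "ideals_set R" by (rule abelian_monoid_ideals)
  show ?case by (simp add: zeroideal pre_def ker_eq[symmetric] ker_def)
next
  case (insert j A)
  interpret M: abelian_monoid "ideals_set R" by (rule abelian_monoid_ideals)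
  let ?S = "\<lambda>A. \<Oplus>\<^bsub>ideals_set R\<^esub> i\<in>A. \<pi> (a i) <# T i"
  have T: "ideal (T i) R" if "i \<in> insert j A" for i using insert.prems that .
  have IH: "ideal (?S A) R" "pre (?S A) = {f. \<exists>g. (\<forall>i\<in>A. \<pi> (g i) \<in> T i) \<and> f - (\<Sum>i\<in>A. a i * g i) \<in> nonfaces \<Delta>}"
    using insert.IH T by blast+
  have eq: "?S (insert j A) = (\<pi> (a j) <# T j) <+> ?S A"
    using insert.hyps T by (subst M.finsum_insert) (auto intro: ideal_l_coset)
  have I: "ideal (?S (insert j A)) R" unfolding eq by (intro add_ideals ideal_l_coset T IH) simp
  have "pre (?S (insert j A)) = {f. \<exists>g. (\<forall>i\<in>insert j A. \<pi> (g i) \<in> T i) \<and> f - (\<Sum>i\<in>insert j A. a i * g i) \<in> nonfaces \<Delta>}"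
  proof (intro equalityI subsetI)
    fix f assume "f \<in> pre (?S (insert j A))"
    hence "\<pi> f \<in> (\<pi> (a j) <# T j) <+> ?S A" unfolding pre_def eq by blast
    then obtain y z where yz: "y \<in> \<pi> (a j) <# T j" "z \<in> ?S A" "\<pi> f = y \<oplus> z" unfolding set_add_def' by blast
    obtain r where r: "y = \<pi> (a j * r)" "\<pi> r \<in> T j" using yz(1) unfolding \<pi>_in_l_coset[OF T[OF insertI1]] by blast
    obtain s where s: "z = \<pi> s" using yz(2) ideal_subset_carrier[OF IH(1)] unfolding h_surj by blast
    have "s \<in> pre (?S A)" using yz(2) s unfolding pre_def by simp
    then obtain g where g: "\<forall>i\<in>A. \<pi> (g i) \<in> T i" "s - (\<Sum>i\<in>A. a i * g i) \<in> nonfaces \<Delta>" unfolding IH(2) by blast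
    have f: "f - (a j * r + s) \<in> nonfaces \<Delta>" using yz(3) unfolding r s h_add[symmetric] \<pi>_eq_iff .
    let ?g = "g(j := r)"
    have "(\<Sum>i\<in>A. a i * ?g i) = (\<Sum>i\<in>A. a i * g i)" using insert.hyps by (intro sum.cong) auto
    hence E: "f - (\<Sum>i\<in>insert j A. a i * ?g i) = (f - (a j * r + s)) + (s - (\<Sum>i\<in>A. a i * g i))"
      using insert.hyps by simp
    have "f - (\<Sum>i\<in>insert j A. a i * ?g i) \<in> nonfaces \<Delta>" unfolding E by (rule mon_ideal_add[OF f g(2)])
    moreover have "\<forall>i\<in>insert j A. \<pi> (?g i) \<in> T i" using g(1) r(2) insert.hyps by auto
    ultimately show "f \<in> {f. \<exists>g. (\<forall>i\<in>insert j A. \<pi> (g i) \<in> T i) \<and> f - (\<Sum>i\<in>insert j A. a i * g i) \<in> nonfaces \<Delta>}"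
      by (intro CollectI exI[of _ ?g] conjI)
  next
    fix f assume "f \<in> {f. \<exists>g. (\<forall>i\<in>insert j A. \<pi> (g i) \<in> T i) \<and> f - (\<Sum>i\<in>insert j A. a i * g i) \<in> nonfaces \<Delta>}"
    then obtain g where g: "\<forall>i\<in>insert j A. \<pi> (g i) \<in> T i" "f - (\<Sum>i\<in>insert j A. a i * g i) \<in> nonfaces \<Delta>" by blast
    define s where "s = f - a j * g j"
    have "s - (\<Sum>i\<in>A. a i * g i) \<in> nonfaces \<Delta>" using g(2) insert.hyps by (simp add: s_def algebra_simps)
    hence "s \<in> pre (?S A)" unfolding IH(2) using g(1) by blast
    hence "\<pi> s \<in> ?S A" by (simp add: pre_def)
    moreover have "\<pi> (a j * g j) \<in> \<pi> (a j) <# T j"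
      unfolding \<pi>_in_l_coset[OF T[OF insertI1]] using g(1) by blast
    moreover have "\<pi> f = \<pi> (a j * g j) \<oplus> \<pi> s" unfolding h_add[symmetric] by (simp add: s_def)
    ultimately show "f \<in> pre (?S (insert j A))" unfolding pre_def eq set_add_def' by blast
  qed
  thus ?case using I by blast
qed

lemma finsum_l_cosets_MM:
  "(\<Oplus>\<^bsub>ideals_set R\<^esub> i\<in>{1..d}. \<pi> (a i) <# MM n) = \<pi> ` Cov d a n" (is "?S = _")
proof -
  have I: "ideal ?S R" and pre: "pre ?S = {f. \<exists>g. (\<forall>i\<in>{1..d}. \<pi> (g i) \<in> MM n) \<and> f - (\<Sum>i=1..d. a i * g i) \<in> nonfaces \<Delta>}"
    using finsum_l_cosets[of "{1..d}" "\<lambda>_. MM n" a] ideal_MM by auto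
  have "pre ?S = Cov d a n"
    unfolding pre
  proof (intro equalityI subsetI)
    fix f assume "f \<in> {f. \<exists>g. (\<forall>i\<in>{1..d}. \<pi> (g i) \<in> MM n) \<and> f - (\<Sum>i=1..d. a i * g i) \<in> nonfaces \<Delta>}"
    then obtain g where g: "\<forall>i\<in>{1..d}. \<pi> (g i) \<in> MM n" "f - (\<Sum>i=1..d. a i * g i) \<in> nonfaces \<Delta>" by blast
    have "\<forall>i. \<exists>g'. i \<in> {1..d} \<longrightarrow> g' \<in> Ge n \<and> g i - g' \<in> nonfaces \<Delta>" using g(1) unfolding \<pi>_in_MM by blast
    then obtain g' where g': "\<And>i. i \<in> {1..d} \<Longrightarrow> g' i \<in> Ge n \<and> g i - g' i \<in> nonfaces \<Delta>" by metis
    \<comment> \<open>Representatives of high order replace the \<open>g i\<close>; the value 0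
      outside \<open>{1..d}\<close> is there because \<open>covered\<close> restricts the cofactors
      at all indices.\<close>
    define k where "k i = (if i \<in> {1..d} then g' i else 0)" for i
    have "(\<Sum>i=1..d. a i * k i) = (\<Sum>i=1..d. a i * g' i)" by (intro sum.cong) (auto simp: k_def)
    hence "f - (\<Sum>i=1..d. a i * k i) = (f - (\<Sum>i=1..d. a i * g i)) + (\<Sum>i=1..d. a i * (g i - g' i))"
      by (simp add: right_diff_distrib sum_subtractf)
    also have "\<dots> \<in> nonfaces \<Delta>"
    proof (intro mon_ideal_add g(2) mon_ideal_sum)
      fix i assume "i \<in> {1..d}"
      thus "a i * (g i - g' i) \<in> nonfaces \<Delta>" using g' by (intro idealset_mult[OF idealset_nonfaces[OF complex]]) blast
    qed
    finally have "f - (\<Sum>i=1..d. a i * k i) \<in> nonfaces \<Delta>" .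
    moreover have "k i \<in> Ge n" for i using g' by (simp add: k_def mon_ideal_0)
    ultimately show "f \<in> Cov d a n" unfolding Cov_def covered_def by blast
  next
    fix f assume "f \<in> Cov d a n"
    thus "f \<in> {f. \<exists>g. (\<forall>i\<in>{1..d}. \<pi> (g i) \<in> MM n) \<and> f - (\<Sum>i=1..d. a i * g i) \<in> nonfaces \<Delta>}"
      unfolding Cov_def covered_def using Ge_MM by blast
  qed
  thus ?thesis using image_pre[OF ideal_subset_carrier[OF I]] by simp
qed

end

section \<open>Minimal primes and tight closure\<close>

definition facet :: "'v set set \<Rightarrow> 'v set \<Rightarrow> bool" where
  "facet \<Delta> F \<longleftrightarrow> F \<in> \<Delta> \<and> (\<forall>G\<in>\<Delta>. F \<subseteq> G \<longrightarrow> G = F)"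

lemma facet_exists:
  fixes \<Delta> :: "'v::finite set set"
  assumes "F \<in> \<Delta>" obtains G where "facet \<Delta> G" "F \<subseteq> G"
proof -
  have "finite {G\<in>\<Delta>. F \<subseteq> G}" by simp
  moreover have "{G\<in>\<Delta>. F \<subseteq> G} \<noteq> {}" using assms by blast
  ultimately obtain G where G: "G \<in> {G\<in>\<Delta>. F \<subseteq> G}" "\<And>H. H \<in> {G\<in>\<Delta>. F \<subseteq> G} \<Longrightarrow> G \<subseteq> H \<Longrightarrow> H = G"
    using finite_has_maximal[of "{G\<in>\<Delta>. F \<subseteq> G}"] by metis
  show ?thesis
  proof
    show "facet \<Delta> G" unfolding facet_def using G by blast
    show "F \<subseteq> G" using G(1) by blast
  qed
qed

lemma primeset_face_prime: "primeset (face_prime F :: ('v::{finite,linorder}, 'k::field) mpoly set)"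
  unfolding primeset_def using idealset_face_prime one_notin_face_prime face_prime_prime by blast

lemma primeset_prod:
  assumes "primeset P" "finite A" "(\<Prod>x\<in>A. f x) \<in> P" shows "\<exists>x\<in>A. f x \<in> P"
  using assms(2,3)
proof (induction A rule: finite_induct)
  case empty
  thus ?case using assms(1) by (simp add: primeset_def)
next
  case (insert x A)
  hence "f x * prod f A \<in> P" by simp
  hence "f x \<in> P \<or> prod f A \<in> P" using assms(1) unfolding primeset_def by blast
  thus ?case using insert.IH by blast
qed

lemma indet_in_face_prime: "(indet x :: ('v::finite, 'k::comm_ring_1) mpoly) \<in> face_prime F \<longleftrightarrow> x \<notin> F"
  by (auto simp: indet_def mon_ideal_def)

lemma single_of_indet:
  assumes J: "idealset (J :: ('v::finite, 'k::comm_ring_1) mpoly set)" and x: "x \<in> Poly_Mapping.keys u" "indet x \<in> J"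
  shows "Poly_Mapping.single u 1 \<in> J"
proof -
  have u: "u - Poly_Mapping.single x 1 + Poly_Mapping.single x 1 = u" by (rule minus_single_add[OF x(1)])
  have "Poly_Mapping.single (u - Poly_Mapping.single x 1) 1 * indet x = (Poly_Mapping.single u 1 :: ('v, 'k) mpoly)"
    unfolding indet_def mult_single u by simp
  thus ?thesis using idealset_mult[OF J x(2), of "Poly_Mapping.single (u - Poly_Mapping.single x 1) 1"] by simp
qed

lemma face_prime_subset:
  assumes J: "idealset (J :: ('v::finite, 'k::comm_ring_1) mpoly set)" and x: "\<And>x. x \<notin> F \<Longrightarrow> indet x \<in> J"
  shows "face_prime F \<subseteq> J"
proof (rule mon_ideal_subset[OF J])
  fix u :: "'v \<Rightarrow>\<^sub>0 nat" assume "\<not> Poly_Mapping.keys u \<subseteq> F"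
  then obtain x where "x \<in> Poly_Mapping.keys u" "x \<notin> F" by blast
  thus "Poly_Mapping.single u 1 \<in> J" using single_of_indet[OF J] assms(2) by blast
qed

lemma diff_power_in:
  assumes J: "idealset (J :: 'r::comm_ring_1 set)" and "f - g \<in> J"
  shows "f ^ q - g ^ q \<in> J"
proof (induction q)
  case 0
  show ?case using idealset_0[OF J] by simp
next
  case (Suc q)
  have "f ^ Suc q - g ^ Suc q = f * (f ^ q - g ^ q) + g ^ q * (f - g)" by (simp add: algebra_simps)
  thus ?case using idealset_add[OF J idealset_mult[OF J Suc] idealset_mult[OF J assms(2)]] by simp
qed

context stanley_reisner
begin

lemma ker_face_prime: "F \<in> \<Delta> \<Longrightarrow> ker \<subseteq> face_prime F"
  unfolding ker_eq using nonfaces_face_prime[OF complex] by blast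

lemma face_primeideal: "F \<in> \<Delta> \<Longrightarrow> primeideal (\<pi> ` face_prime F) R"
  by (rule primeideal_image[OF primeset_face_prime ker_face_prime])

lemma pre_face_prime: "F \<in> \<Delta> \<Longrightarrow> pre (\<pi> ` face_prime F) = face_prime F"
  by (rule pre_image[OF idealset_face_prime ker_face_prime])

text \<open>The variables outside a prime form a face, since otherwise their product would be zero
  in the ring; hence the prime contains the prime of any facet above that face. Conversely, let a
  prime lie inside the prime of a facet \<open>F\<close>. For \<open>x\<close> outside
  \<open>F\<close> the product of the variables in \<open>insert x F\<close> is zero, and of its
  factors only \<open>x\<close> can lie in the smaller prime.\<close>

lemma minimal_prime_iff: "minimal_prime R P \<longleftrightarrow> (\<exists>F. facet \<Delta> F \<and> P = \<pi> ` face_prime F)"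
proof
  assume P: "minimal_prime R P"
  hence prime: "primeideal P R" by (simp add: minimal_prime_def)
  have I: "ideal P R" by (rule primeideal.axioms(1)[OF prime])
  have pP: "primeset (pre P)" by (rule primeset_pre[OF prime])
  define F where "F = {x. indet x \<notin> pre P}"
  have "F \<in> \<Delta>"
  proof (rule ccontr)
    assume "F \<notin> \<Delta>"
    hence "(\<Prod>x\<in>F. indet x) \<in> nonfaces \<Delta>"
      unfolding prod_indet by (intro single_mon_ideal) (simp add: keys_sqfree_mon)
    hence "(\<Prod>x\<in>F. indet x) \<in> pre P" using ker_pre[OF I] unfolding ker_eq by blast
    then obtain x where "x \<in> F" "indet x \<in> pre P" using primeset_prod[OF pP finite] by blast
    thus False unfolding F_def by blast
  qed
  then obtain G where G: "facet \<Delta> G" "F \<subseteq> G" by (rule facet_exists)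
  have G\<Delta>: "G \<in> \<Delta>" using G(1) by (simp add: facet_def)
  have "face_prime G \<subseteq> pre P"
    by (rule face_prime_subset[OF idealset_pre[OF I]]) (use G(2) F_def in blast)
  hence "\<pi> ` face_prime G \<subseteq> P" unfolding pre_def by blast
  moreover have "primeideal (\<pi> ` face_prime G) R" by (rule face_primeideal[OF G\<Delta>])
  ultimately have "\<pi> ` face_prime G = P" using P unfolding minimal_prime_def by blast
  thus "\<exists>F. facet \<Delta> F \<and> P = \<pi> ` face_prime F" using G(1) by blast
next
  assume "\<exists>F. facet \<Delta> F \<and> P = \<pi> ` face_prime F"
  then obtain F where F: "facet \<Delta> F" and P: "P = \<pi> ` face_prime F" by blast
  have F\<Delta>: "F \<in> \<Delta>" using F by (simp add: facet_def)
  have "Q = P" if Q: "primeideal Q R" "Q \<subseteq> P" for Q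
  proof
    have I: "ideal Q R" by (rule primeideal.axioms(1)[OF Q(1)])
    have pQ: "primeset (pre Q)" by (rule primeset_pre[OF Q(1)])
    have sub: "pre Q \<subseteq> face_prime F"
    proof -
      have "pre Q \<subseteq> pre P" using Q(2) unfolding pre_def by blast
      thus ?thesis unfolding P pre_face_prime[OF F\<Delta>] .
    qed
    have "face_prime F \<subseteq> pre Q"
    proof (rule face_prime_subset[OF idealset_pre[OF I]])
      fix x assume x: "x \<notin> F"
      have "insert x F \<notin> \<Delta>" using F x unfolding facet_def by blast
      hence "(\<Prod>y\<in>insert x F. indet y) \<in> nonfaces \<Delta>"
        unfolding prod_indet by (intro single_mon_ideal) (simp add: keys_sqfree_mon)
      hence "(\<Prod>y\<in>insert x F. indet y) \<in> pre Q" using ker_pre[OF I] unfolding ker_eq by blast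
      then obtain y where y: "y \<in> insert x F" "indet y \<in> pre Q" using primeset_prod[OF pQ finite] by blast
      have "(indet y :: ('v, 'k) mpoly) \<in> face_prime F" using y(2) sub by blast
      hence "y \<notin> F" unfolding indet_in_face_prime .
      thus "indet x \<in> pre Q" using y by blast
    qed
    hence "\<pi> ` face_prime F \<subseteq> Q" unfolding pre_def by blast
    thus "P \<subseteq> Q" unfolding P .
  qed (rule that(2))
  thus "minimal_prime R P" unfolding minimal_prime_def using face_primeideal[OF F\<Delta>] P by blast
qed

text \<open>On every face \<open>F\<close>, the ideal \<open>J\<close> restricts to the \<open>n\<close>-th power of the maximal ideal of the
  polynomial ring \<open>k[F]\<close>.\<close>

definition apx :: "('v, 'k) mpoly set set \<Rightarrow> nat \<Rightarrow> bool" where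
  "apx J n \<longleftrightarrow> ideal J R \<and> J \<subseteq> MM n \<and> (\<forall>F\<in>\<Delta>. \<forall>f\<in>Ge n. \<exists>g. \<pi> g \<in> J \<and> f - g \<in> face_prime F)"

lemma idealset_face_sum:
  assumes "ideal J R"
  shows "idealset {f. \<exists>g. \<pi> g \<in> J \<and> f - g \<in> face_prime F}"
  unfolding idealset_def
proof (intro conjI ballI allI)
  have P: "idealset (pre J)" by (rule idealset_pre[OF assms])
  note Q = idealset_face_prime
  show "0 \<in> {f. \<exists>g. \<pi> g \<in> J \<and> f - g \<in> face_prime F}"
    using idealset_0[OF P] by (intro CollectI exI[of _ 0]) (simp add: mon_ideal_0)
  fix f assume "f \<in> {f. \<exists>g. \<pi> g \<in> J \<and> f - g \<in> face_prime F}"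
  then obtain r where r: "r \<in> pre J" "f - r \<in> face_prime F" unfolding pre_def by blast
  show "f + g \<in> {f. \<exists>g. \<pi> g \<in> J \<and> f - g \<in> face_prime F}" if g: "g \<in> {f. \<exists>g. \<pi> g \<in> J \<and> f - g \<in> face_prime F}" for g
  proof -
    obtain s where s: "s \<in> pre J" "g - s \<in> face_prime F" using g unfolding pre_def by blast
    have eq: "f + g - (r + s) = (f - r) + (g - s)" by simp
    have "f + g - (r + s) \<in> face_prime F" unfolding eq by (rule mon_ideal_add[OF r(2) s(2)])
    moreover have "\<pi> (r + s) \<in> J" using idealset_add[OF P r(1) s(1)] by simp
    ultimately show ?thesis by blast
  qed
  show "c * f \<in> {f. \<exists>g. \<pi> g \<in> J \<and> f - g \<in> face_prime F}" for c
  proof -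
    have "c * f - c * r \<in> face_prime F" using idealset_mult[OF Q r(2), of c] by (simp add: right_diff_distrib)
    moreover have "\<pi> (c * r) \<in> J" using idealset_mult[OF P r(1), of c] by simp
    ultimately show ?thesis by blast
  qed
qed

lemma apxI:
  assumes "ideal J R" "J \<subseteq> MM n"
    and "\<And>F u. F \<in> \<Delta> \<Longrightarrow> n \<le> mdeg u \<Longrightarrow> \<exists>g. \<pi> g \<in> J \<and> Poly_Mapping.single u 1 - g \<in> face_prime F"
  shows "apx J n"
proof -
  have "Ge n \<subseteq> {f. \<exists>g. \<pi> g \<in> J \<and> f - g \<in> face_prime F}" if "F \<in> \<Delta>" for F
    by (rule mon_ideal_subset[OF idealset_face_sum[OF assms(1)]]) (use assms(3)[OF that] in blast)
  thus ?thesis unfolding apx_def using assms(1,2) by blast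
qed

lemma apx_carrier: "apx (carrier R) 0"
proof (rule apxI[OF oneideal])
  show "\<exists>g. \<pi> g \<in> carrier R \<and> Poly_Mapping.single u 1 - g \<in> face_prime F" for F u
    by (rule exI[of _ "Poly_Mapping.single u 1"]) (simp add: mon_ideal_0)
qed (simp add: MM_0)

lemma apx_prod:
  assumes J: "apx J m" and L: "apx L n" shows "apx (J \<cdot> L) (m + n)"
proof (rule apxI)
  have I: "ideal J R" "ideal L R" using J L by (auto simp: apx_def)
  show "ideal (J \<cdot> L) R" by (rule ideal_prod_is_ideal[OF I])
  show "J \<cdot> L \<subseteq> MM (m + n)"
  proof (rule ideal_prod_subset[OF ideal_MM])
    fix a b assume "a \<in> J" "b \<in> L"
    hence "a \<in> MM m" "b \<in> MM n" using J L unfolding apx_def by blast+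
    hence "a \<otimes> b \<in> MM m \<cdot> MM n" by (rule ideal_prod.prod)
    thus "a \<otimes> b \<in> MM (m + n)" by (simp only: MM_prod)
  qed
  fix F and u :: "'v \<Rightarrow>\<^sub>0 nat" assume F: "F \<in> \<Delta>" and u: "m + n \<le> mdeg u"
  then obtain w z where wz: "u = w + z" "mdeg w = m" by (metis add_leD1 mdeg_split)
  have "(Poly_Mapping.single w 1 :: ('v, 'k) mpoly) \<in> Ge m" by (rule single_mon_ideal) (simp add: wz)
  then obtain r where r: "\<pi> r \<in> J" "Poly_Mapping.single w 1 - r \<in> face_prime F" using J F unfolding apx_def by blast
  have "(Poly_Mapping.single z 1 :: ('v, 'k) mpoly) \<in> Ge n" by (rule single_mon_ideal) (use u wz in simp)
  then obtain s where s: "\<pi> s \<in> L" "Poly_Mapping.single z 1 - s \<in> face_prime F" using L F unfolding apx_def by blast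
  have "Poly_Mapping.single u 1 = (Poly_Mapping.single w 1 * Poly_Mapping.single z 1 :: ('v, 'k) mpoly)"
    unfolding wz(1) mult_single by simp
  hence "Poly_Mapping.single u 1 - r * s
    = Poly_Mapping.single z 1 * (Poly_Mapping.single w 1 - r) + r * (Poly_Mapping.single z 1 - s)"
    by (simp add: algebra_simps)
  also have "\<dots> \<in> face_prime F"
    by (intro idealset_add[OF idealset_face_prime] idealset_mult[OF idealset_face_prime] r s)
  finally have "Poly_Mapping.single u 1 - r * s \<in> face_prime F" .
  moreover have "\<pi> (r * s) \<in> J \<cdot> L" unfolding h_mult by (rule ideal_prod.prod[OF r(1) s(1)])
  ultimately show "\<exists>g. \<pi> g \<in> J \<cdot> L \<and> Poly_Mapping.single u 1 - g \<in> face_prime F" by blast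
qed

lemma apx_pow: "apx J m \<Longrightarrow> apx (J [^]\<^bsub>ideals_set R\<^esub> (k::nat)) (k * m)"
proof (induction k)
  case 0
  show ?case using apx_carrier by (simp add: nat_pow_def)
next
  case (Suc k)
  have "J [^]\<^bsub>ideals_set R\<^esub> Suc k = (J [^]\<^bsub>ideals_set R\<^esub> k) \<cdot> J" by (simp add: nat_pow_def)
  thus ?case using apx_prod[OF Suc.IH[OF Suc.prems] Suc.prems] by (simp add: add.commute)
qed

lemma apx_finprod:
  assumes "finite A" "\<And>j. j \<in> A \<Longrightarrow> apx (K j) (n j)"
  shows "apx (\<Otimes>\<^bsub>ideals_set R\<^esub> j\<in>A. K j) (\<Sum>j\<in>A. n j)"
  using assms
proof (induction A rule: finite_induct)
  case empty
  interpret M: comm_monoid "ideals_set R" by (rule ideals_set_is_comm_monoid)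
  show ?case using apx_carrier by simp
next
  case (insert j A)
  interpret M: comm_monoid "ideals_set R" by (rule ideals_set_is_comm_monoid)
  have "(\<Otimes>\<^bsub>ideals_set R\<^esub> i\<in>insert j A. K i) = K j \<cdot> (\<Otimes>\<^bsub>ideals_set R\<^esub> i\<in>A. K i)"
    using insert.hyps insert.prems by (subst M.finprod_insert) (auto simp: apx_def)
  moreover have "apx (K j \<cdot> (\<Otimes>\<^bsub>ideals_set R\<^esub> i\<in>A. K i)) (n j + (\<Sum>i\<in>A. n i))"
    using insert.prems insert.IH by (intro apx_prod) auto
  ultimately show ?case using insert.hyps by simp
qed

text \<open>On a face \<open>F\<close>, some combination of the forms restricts to a given variable
  of \<open>F\<close>, by \<open>spanning_dual\<close>; so the forms generate all variables of
  k[F].\<close>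

lemma apx_spanning:
  assumes "spanning \<Delta> d b"
  shows "apx (Idl ((\<lambda>i. \<pi> (linform (b i))) ` {1..d})) 1"
proof (rule apxI)
  let ?G = "(\<lambda>i. \<pi> (linform (b i))) ` {1..d}"
  have G: "?G \<subseteq> carrier R" by (rule image_subsetI) (rule h_closed)
  show I: "ideal (Idl ?G) R" by (rule genideal_ideal[OF G])
  have "linform (b i) \<in> Ge 1" for i by (rule homog_Ge[OF linform_homog])
  hence "?G \<subseteq> MM 1" by (intro image_subsetI Ge_MM)
  thus "Idl ?G \<subseteq> MM 1" by (rule genideal_minimal[OF ideal_MM])
  fix F and u :: "'v \<Rightarrow>\<^sub>0 nat" assume F: "F \<in> \<Delta>" and u: "1 \<le> mdeg u"
  let ?J = "{f. \<exists>g. \<pi> g \<in> Idl ?G \<and> f - g \<in> face_prime F}"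
  from u have "u \<noteq> 0" by auto
  then obtain x where x: "x \<in> Poly_Mapping.keys u" by (metis ex_in_conv keys_eq_empty)
  have "indet x \<in> ?J"
  proof (cases "x \<in> F")
    case False
    have "\<pi> 0 \<in> Idl ?G" using idealset_0[OF idealset_pre[OF I]] by simp
    moreover have "indet x - 0 \<in> (face_prime F :: ('v, 'k) mpoly set)" using False by (simp add: indet_in_face_prime)
    ultimately show ?thesis by blast
  next
    case True
    obtain l where l: "\<forall>y\<in>F. (\<Sum>i=1..d. l i * b i y) = (if y = x then 1 else 0)"
      using spanning_dual[OF assms F] by blast
    define g where "g = (\<Sum>i=1..d. Poly_Mapping.single 0 (l i) * linform (b i))"
    have "g \<in> pre (Idl ?G)"
      unfolding g_def
    proof (rule idealset_sum[OF idealset_pre[OF I]], rule idealset_mult[OF idealset_pre[OF I]])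
      fix i assume "i \<in> {1..d}"
      hence "\<pi> (linform (b i)) \<in> Idl ?G" using genideal_self[OF G] by blast
      thus "linform (b i) \<in> pre (Idl ?G)" by simp
    qed
    moreover have "indet x - g \<in> face_prime F"
    proof -
      have gu: "Poly_Mapping.lookup g w = (\<Sum>i=1..d. l i * Poly_Mapping.lookup (linform (b i)) w)" for w
        unfolding g_def lookup_sum lookup_scale ..
      have "Poly_Mapping.lookup (indet x - g) w = 0" if w: "Poly_Mapping.keys w \<subseteq> F" for w
      proof (cases "mdeg w = 1")
        case True
        then obtain y where y: "w = Poly_Mapping.single y 1" by (rule mdeg_1E)
        have "y \<in> F" using w y by simp
        have "Poly_Mapping.lookup g w = (\<Sum>i=1..d. l i * b i y)"
          unfolding gu y using linpart_linform[of "b _"] by (simp add: linpart_def fun_eq_iff)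
        also have "\<dots> = (if y = x then 1 else 0)" using l \<open>y \<in> F\<close> by blast
        also have "\<dots> = Poly_Mapping.lookup (indet x) w"
        proof -
          have "Poly_Mapping.single x (1::nat) = Poly_Mapping.single y 1 \<longleftrightarrow> y = x"
            by (metis keys_single singleton_inject zero_neq_one)
          thus ?thesis unfolding indet_def y by (simp add: lookup_single when_def)
        qed
        finally show ?thesis by (simp add: lookup_minus)
      next
        case False
        have "Poly_Mapping.lookup (linform (b i)) w = 0" for i
          using linform_homog[of "b i"] False unfolding mon_ideal_iff by blast
        moreover have "w \<noteq> Poly_Mapping.single x 1" using False by auto
        hence "Poly_Mapping.lookup (indet x) w = 0"
          unfolding indet_def lookup_single by (simp add: when_def)
        ultimately show ?thesis by (simp add: lookup_minus gu)
      qed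
      thus ?thesis unfolding mon_ideal_iff by blast
    qed
    ultimately show ?thesis unfolding pre_def by blast
  qed
  hence "Poly_Mapping.single u 1 \<in> ?J" by (rule single_of_indet[OF idealset_face_sum[OF I] x])
  thus "\<exists>g. \<pi> g \<in> Idl ?G \<and> Poly_Mapping.single u 1 - g \<in> face_prime F" by blast
qed

lemma \<pi>_in_MM_iff: "\<pi> f \<in> MM n \<longleftrightarrow> f \<in> mon_ideal (\<lambda>u. Poly_Mapping.keys u \<in> \<Delta> \<longrightarrow> n \<le> mdeg u)"
proof
  assume "\<pi> f \<in> MM n"
  then obtain g where g: "g \<in> Ge n" "f - g \<in> nonfaces \<Delta>" unfolding \<pi>_in_MM by blast
  have "g + (f - g) \<in> mon_ideal (\<lambda>u. Poly_Mapping.keys u \<in> \<Delta> \<longrightarrow> n \<le> mdeg u)"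
    using mon_ideal_mono[OF g(1)] mon_ideal_mono[OF g(2)] by (intro mon_ideal_add) auto
  thus "f \<in> mon_ideal (\<lambda>u. Poly_Mapping.keys u \<in> \<Delta> \<longrightarrow> n \<le> mdeg u)" by simp
next
  assume f: "f \<in> mon_ideal (\<lambda>u. Poly_Mapping.keys u \<in> \<Delta> \<longrightarrow> n \<le> mdeg u)"
  have "f - part (\<lambda>u. n \<le> mdeg u) f \<in> nonfaces \<Delta>"
    using f by (auto simp: mon_ideal_iff lookup_part lookup_minus split: if_splits)
  thus "\<pi> f \<in> MM n" unfolding \<pi>_in_MM using part_in by blast
qed

text \<open>If c x^q lies in \<mm>^(qn), restriction to a facet gives ord c + q ord x >= qn; were
  ord x < n, then q <= ord c for all large q. Conversely, on a facet \<open>F\<close> a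
  representative \<open>f\<close> agrees with some \<open>g\<close> over \<open>J\<close> modulo the
  prime of \<open>F\<close>; the difference f^q - g^q is a multiple of f - g, and the monomial of
  \<open>F\<close> carries the prime of \<open>F\<close> into the nonface ideal.\<close>

lemma tight_closure_apx:
  assumes p: "p > (1::nat)" and J: "apx J n"
  shows "tight_closure p R J = MM n"
proof
  have I: "ideal J R" and JM: "J \<subseteq> MM n" using J by (auto simp: apx_def)
  have JR: "J \<subseteq> carrier R" by (rule ideal_subset_carrier[OF I])
  have img: "(\<lambda>x. x [^] q) ` J \<subseteq> carrier R" for q :: nat using JR by auto
  show "tight_closure p R J \<subseteq> MM n"
  proof
    fix x assume "x \<in> tight_closure p R J"
    then obtain c where x: "x \<in> carrier R" and c: "c \<in> carrier R" "\<forall>P. minimal_prime R P \<longrightarrow> c \<notin> P"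
      and ev: "\<forall>\<^sub>F e in sequentially. c \<otimes> (x [^] (p ^ e)) \<in> frobenius_power R J (p ^ e)"
      unfolding tight_closure_def by blast
    obtain f where f: "x = \<pi> f" using x unfolding h_surj by blast
    obtain k where k: "c = \<pi> k" using c(1) unfolding h_surj by blast
    obtain E where E: "\<And>e. e \<ge> E \<Longrightarrow> c \<otimes> (x [^] (p ^ e)) \<in> frobenius_power R J (p ^ e)"
      using ev unfolding eventually_sequentially by blast
    have frob: "frobenius_power R J q \<subseteq> MM (q * n)" for q
      unfolding frobenius_power_def
    proof (rule genideal_minimal[OF ideal_MM], rule image_subsetI)
      fix y assume "y \<in> J"
      then obtain g where g: "y = \<pi> g" "g \<in> Ge n" using JM unfolding MM_def by blast
      show "y [^] q \<in> MM (q * n)" unfolding g(1) h_power[symmetric] by (rule Ge_MM[OF Ge_power[OF g(2)]])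
    qed
    have facet: "part (\<lambda>u. Poly_Mapping.keys u \<subseteq> F) f \<in> Ge n" if F: "facet \<Delta> F" for F
    proof (rule ccontr)
      let ?p = "part (\<lambda>u. Poly_Mapping.keys u \<subseteq> F)"
      have F\<Delta>: "F \<in> \<Delta>" using F by (simp add: facet_def)
      assume n: "?p f \<notin> Ge n"
      hence f0: "?p f \<noteq> 0" using mon_ideal_0[of "\<lambda>u. n \<le> mdeg u"] by metis
      have lt: "ord (?p f) < n" using n ord_ge_iff[OF f0, of n] by simp
      have "k \<notin> face_prime F"
      proof
        assume "k \<in> face_prime F"
        hence "c \<in> \<pi> ` face_prime F" unfolding k by (rule imageI)
        thus False using c(2) F unfolding minimal_prime_iff by blast
      qed
      hence k0: "?p k \<noteq> 0" unfolding part_eq_0_iff .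
      \<comment> \<open>With q = p^e > e this makes q exceed the order of the restricted multiplier,
        while \<open>e \<ge> E\<close> keeps the containment available.\<close>
      define e where "e = max E (Suc (ord (?p k)))"
      define q where "q = p ^ e"
      have "e < q" unfolding q_def using p power_gt_expt[of p e] by simp
      have pw: "?p (f ^ q) = ?p f ^ q"
        by (induction q) (simp_all add: part_face_mult part_eq_self mon_ideal_iff lookup_one when_def)
      have "\<pi> (k * f ^ q) \<in> MM (q * n)"
        using E[of e] frob[of q] unfolding e_def[symmetric] q_def[symmetric] k f h_power[symmetric] h_mult[symmetric]
        by (auto simp: e_def)
      then obtain g where g: "g \<in> Ge (q * n)" "k * f ^ q - g \<in> nonfaces \<Delta>" unfolding \<pi>_in_MM by blast
      have "?p (k * f ^ q - g) = 0" unfolding part_eq_0_iff by (rule nonfaces_face_prime[OF complex F\<Delta> g(2)])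
      hence "?p k * ?p f ^ q = ?p g" by (simp only: part_diff right_minus_eq part_face_mult pw)
      hence "?p k * ?p f ^ q \<in> Ge (q * n)" using part_in_of[OF g(1)] by simp
      moreover have nz: "?p f ^ q \<noteq> 0" using f0 by simp
      ultimately have "q * n \<le> ord (?p k) + q * ord (?p f)"
        using ord_ge_iff[of "?p k * ?p f ^ q" "q * n"] k0 f0 by (simp add: ord_mult ord_power)
      moreover have "q * Suc (ord (?p f)) \<le> q * n" using lt by (intro mult_le_mono2) simp
      ultimately have "q \<le> ord (?p k)" by simp
      thus False using \<open>e < q\<close> unfolding e_def by simp
    qed
    have "f \<in> mon_ideal (\<lambda>u. Poly_Mapping.keys u \<in> \<Delta> \<longrightarrow> n \<le> mdeg u)"
      unfolding mon_ideal_iff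
    proof (intro allI impI)
      fix u assume nz: "Poly_Mapping.lookup f u \<noteq> 0" and u: "Poly_Mapping.keys u \<in> \<Delta>"
      from u obtain G where G: "facet \<Delta> G" "Poly_Mapping.keys u \<subseteq> G" by (rule facet_exists)
      have "Poly_Mapping.lookup (part (\<lambda>u. Poly_Mapping.keys u \<subseteq> G) f) u \<noteq> 0" using nz G(2) by (simp add: lookup_part)
      thus "n \<le> mdeg u" using facet[OF G(1)] unfolding mon_ideal_iff by blast
    qed
    thus "x \<in> MM n" unfolding f \<pi>_in_MM_iff .
  qed
  show "MM n \<subseteq> tight_closure p R J"
  proof
    fix x assume "x \<in> MM n"
    then obtain f where f: "x = \<pi> f" "f \<in> Ge n" unfolding MM_def by blast
    define M where "M F = (Poly_Mapping.single (sqfree_mon F) 1 :: ('v, 'k) mpoly)" for F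
    \<comment> \<open>Modulo the prime of a facet \<open>G\<close> only \<open>M G\<close> survives,
      because no other facet is contained in \<open>G\<close>; so \<open>k\<close> avoids every
      minimal prime.\<close>
    define k where "k = (\<Sum>F | facet \<Delta> F. M F)"
    have c: "\<pi> k \<notin> P" if P: "minimal_prime R P" for P
    proof
      assume "\<pi> k \<in> P"
      obtain G where G: "facet \<Delta> G" "P = \<pi> ` face_prime G" using P unfolding minimal_prime_iff by blast
      have G\<Delta>: "G \<in> \<Delta>" using G(1) by (simp add: facet_def)
      have "k \<in> pre P" using \<open>\<pi> k \<in> P\<close> by simp
      hence "k \<in> face_prime G" unfolding G(2) pre_face_prime[OF G\<Delta>] .
      moreover have "Poly_Mapping.lookup k (sqfree_mon G) = (\<Sum>F | facet \<Delta> F. if F = G then 1 else 0)"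
        unfolding k_def lookup_sum M_def
      proof (intro sum.cong refl)
        fix F :: "'v set"
        have "sqfree_mon F = sqfree_mon G \<longleftrightarrow> F = G" by (metis keys_sqfree_mon)
        thus "Poly_Mapping.lookup (Poly_Mapping.single (sqfree_mon F) 1) (sqfree_mon G) = (if F = G then 1 else (0::'k))"
          by (simp add: lookup_single when_def)
      qed
      hence "Poly_Mapping.lookup k (sqfree_mon G) = 1" using G(1) by simp
      ultimately show False unfolding mon_ideal_iff using keys_sqfree_mon[of G] by (metis order_refl zero_neq_one)
    qed
    have frob: "\<pi> k \<otimes> (x [^] q) \<in> frobenius_power R J q" for q
    proof -
      let ?Q = "frobenius_power R J q"
      have Q: "ideal ?Q R" unfolding frobenius_power_def by (rule genideal_ideal[OF img])
      have "(\<Sum>F | facet \<Delta> F. M F * f ^ q) \<in> pre ?Q"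
      proof (rule idealset_sum[OF idealset_pre[OF Q]])
        fix F assume "F \<in> {F. facet \<Delta> F}"
        hence F: "facet \<Delta> F" "F \<in> \<Delta>" by (auto simp: facet_def)
        obtain g where g: "\<pi> g \<in> J" "f - g \<in> face_prime F" using J F(2) f(2) unfolding apx_def by blast
        have "f ^ q - g ^ q \<in> face_prime F" by (rule diff_power_in[OF idealset_face_prime g(2)])
        moreover have "M F \<in> mon_ideal (\<lambda>u. Poly_Mapping.keys u = F)"
          unfolding M_def by (rule single_mon_ideal) (rule keys_sqfree_mon)
        ultimately have "M F * (f ^ q - g ^ q) \<in> nonfaces \<Delta>"
        proof (intro mon_ideal_mult)
          fix u w :: "'v \<Rightarrow>\<^sub>0 nat" assume "Poly_Mapping.keys u = F" "\<not> Poly_Mapping.keys w \<subseteq> F"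
          thus "Poly_Mapping.keys (u + w) \<notin> \<Delta>" using F(1) unfolding facet_def keys_add_nat by blast
        qed
        hence 1: "M F * (f ^ q - g ^ q) \<in> pre ?Q" using ker_pre[OF Q] unfolding ker_eq by blast
        have "\<pi> g [^] q \<in> ?Q" unfolding frobenius_power_def using genideal_self[OF img[of q]] g(1) by blast
        hence "g ^ q \<in> pre ?Q" by (simp add: h_power)
        hence "M F * (f ^ q - g ^ q) + M F * g ^ q \<in> pre ?Q"
          by (intro idealset_add[OF idealset_pre[OF Q] 1] idealset_mult[OF idealset_pre[OF Q]])
        thus "M F * f ^ q \<in> pre ?Q" by (simp only: right_diff_distrib diff_add_cancel)
      qed
      hence "k * f ^ q \<in> pre ?Q" unfolding k_def sum_distrib_right .
      thus ?thesis by (simp add: f(1) h_mult h_power)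
    qed
    show "x \<in> tight_closure p R J"
      unfolding tight_closure_def
    proof (intro CollectI conjI bexI[of _ "\<pi> k"])
      show "x \<in> carrier R" by (simp add: f(1))
      show "\<forall>P. minimal_prime R P \<longrightarrow> \<pi> k \<notin> P" using c by blast
      show "\<forall>\<^sub>F e in sequentially. \<pi> k \<otimes> (x [^] (p ^ e)) \<in> frobenius_power R J (p ^ e)"
        by (rule always_eventually) (intro allI frob)
    qed (rule h_closed)
  qed
qed

end

section \<open>Dimension and systems of parameters\<close>

text \<open>Dimension theory by counting: \<open>indep_family P m N\<close> says that the polynomials of degree at most
  \<open>m\<close> span a space of dimension at least \<open>N\<close> modulo \<open>P\<close>. Passing to a smaller prime multiplies
  the growth in \<open>m\<close> by a linear factor.\<close>

definition indep_family :: "('v::finite, 'k::comm_ring_1) mpoly set \<Rightarrow> nat \<Rightarrow> nat \<Rightarrow> bool" where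
  "indep_family P m N \<longleftrightarrow> (\<exists>b. (\<forall>i<N. b i \<in> mon_ideal (\<lambda>u. mdeg u \<le> m)) \<and>
     (\<forall>c. (\<Sum>i<N. Poly_Mapping.single 0 (c i) * b i) \<in> P \<longrightarrow> (\<forall>i<N. c i = 0)))"

lemma sum_lessThan_add: "(\<Sum>j<a + b. g j) = (\<Sum>j<a. g j) + (\<Sum>j<b. g (a + j))" for a b :: nat
  by (induction b) (simp_all add: add.assoc)

lemma indep_family_mono:
  assumes "indep_family P m N" "m \<le> m'" "N' \<le> N"
  shows "indep_family P m' N'"
proof -
  obtain b where b: "\<And>i. i < N \<Longrightarrow> b i \<in> mon_ideal (\<lambda>u. mdeg u \<le> m)"
    "\<And>c. (\<Sum>i<N. Poly_Mapping.single 0 (c i) * b i) \<in> P \<Longrightarrow> \<forall>i<N. c i = 0"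
    using assms(1) unfolding indep_family_def by blast
  have "\<forall>i<N'. c i = 0" if c: "(\<Sum>i<N'. Poly_Mapping.single 0 (c i) * b i) \<in> P" for c
  proof -
    define c' where "c' i = (if i < N' then c i else 0)" for i
    have "(\<Sum>i<N. Poly_Mapping.single 0 (c' i) * b i) = (\<Sum>i<N'. Poly_Mapping.single 0 (c i) * b i)"
      using assms(3) by (intro sum.mono_neutral_cong_right) (auto simp: c'_def)
    hence c0: "\<forall>i<N. c' i = 0" using c b(2)[of c'] by simp
    have "c i = 0" if "i < N'" for i
      using c0[rule_format, of i] that assms(3) by (simp add: c'_def)
    thus ?thesis by blast
  qed
  moreover have "b i \<in> mon_ideal (\<lambda>u. mdeg u \<le> m')" if "i < N'" for i
    by (rule mon_ideal_mono[OF b(1)]) (use that assms(2,3) in auto)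
  ultimately show ?thesis unfolding indep_family_def by blast
qed

text \<open>Let \<open>f\<close> lie in \<open>Q\<close> but not in \<open>P\<close>. If a family b
  is independent modulo \<open>Q\<close>, then b, f b, f^2 b, ... are jointly independent modulo
  \<open>P\<close>: reduction modulo \<open>Q\<close> isolates the first block, and afterwards
  \<open>f\<close> cancels modulo the prime \<open>P\<close>.\<close>

lemma indep_family_prime_step:
  fixes P Q :: "('v::finite, 'k::comm_ring_1) mpoly set"
  assumes P: "primeset P" and Q: "idealset Q" and PQ: "P \<subset> Q"
  shows "\<exists>e. \<forall>m N. indep_family Q m N \<longrightarrow> indep_family P (Suc m * Suc e) (Suc m * N)"
proof -
  obtain f where f: "f \<in> Q" "f \<notin> P" using PQ by blast
  obtain e where e: "f \<in> mon_ideal (\<lambda>u. mdeg u \<le> e)"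
  proof
    show "f \<in> mon_ideal (\<lambda>u. mdeg u \<le> Max (mdeg ` Poly_Mapping.keys f))" by (simp add: mon_ideal_def)
  qed
  have IP: "idealset P" using P by (simp add: primeset_def)
  have "indep_family P (m + K * e) (K * N)" if QN: "indep_family Q m N" for m N K
  proof (induction K)
    case 0
    show ?case by (simp add: indep_family_def)
  next
    case (Suc K)
    obtain b where b: "\<And>i. i < N \<Longrightarrow> b i \<in> mon_ideal (\<lambda>u. mdeg u \<le> m)"
      "\<And>c. (\<Sum>i<N. Poly_Mapping.single 0 (c i) * b i) \<in> Q \<Longrightarrow> \<forall>i<N. c i = 0"
      using QN unfolding indep_family_def by blast
    obtain b' where b': "\<And>i. i < K * N \<Longrightarrow> b' i \<in> mon_ideal (\<lambda>u. mdeg u \<le> m + K * e)"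
      "\<And>c. (\<Sum>i<K * N. Poly_Mapping.single 0 (c i) * b' i) \<in> P \<Longrightarrow> \<forall>i<K * N. c i = 0"
      using Suc unfolding indep_family_def by blast
    define b'' where "b'' j = (if j < N then b j else f * b' (j - N))" for j
    have deg: "b'' j \<in> mon_ideal (\<lambda>u. mdeg u \<le> m + Suc K * e)" if j: "j < N + K * N" for j
    proof (cases "j < N")
      case True
      thus ?thesis using mon_ideal_mono[OF b(1)[OF True], of "\<lambda>u. mdeg u \<le> m + Suc K * e"] by (simp add: b''_def)
    next
      case False
      have "f * b' (j - N) \<in> mon_ideal (\<lambda>u. mdeg u \<le> m + Suc K * e)"
        by (rule mon_ideal_mult[OF e b'(1)]) (use False j in auto)
      thus ?thesis using False by (simp add: b''_def)
    qed
    have ind: "\<forall>i<N + K * N. c i = 0" if c: "(\<Sum>i<N + K * N. Poly_Mapping.single 0 (c i) * b'' i) \<in> P" for c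
    proof -
      define s where "s = (\<Sum>i<N. Poly_Mapping.single 0 (c i) * b i)"
      define t where "t = (\<Sum>i<K * N. Poly_Mapping.single 0 (c (N + i)) * b' i)"
      have "(\<Sum>i<N + K * N. Poly_Mapping.single 0 (c i) * b'' i) = s + t * f"
        unfolding sum_lessThan_add s_def t_def sum_distrib_right by (simp add: b''_def mult_ac)
      hence st: "s + t * f \<in> P" using c by simp
      hence "s + t * f - t * f \<in> Q" using PQ idealset_diff[OF Q] idealset_mult[OF Q f(1)] by blast
      hence "s \<in> Q" by simp
      from b(2)[OF this[unfolded s_def]] have c0: "\<forall>i<N. c i = 0" .
      hence "s = 0" by (simp add: s_def)
      hence "t * f \<in> P" using st by simp
      hence "t \<in> P" using P f(2) unfolding primeset_def by blast
      from b'(2)[OF this[unfolded t_def]] have c1: "\<forall>i<K * N. c (N + i) = 0" .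
      have "c i = 0" if "i < N + K * N" for i
      proof (cases "i < N")
        case False
        hence "i - N < K * N" "i = N + (i - N)" using that by auto
        thus ?thesis using c1 by metis
      qed (use c0 in blast)
      thus ?thesis by blast
    qed
    have "indep_family P (m + Suc K * e) (N + K * N)"
      unfolding indep_family_def using deg ind by blast
    thus ?case by simp
  qed
  \<comment> \<open>Taking \<open>Suc m\<close> blocks gains one linear factor in \<open>m\<close>
    while the degree stays linear in \<open>m\<close>; the bound is coarsened to a product so that
    it can be iterated.\<close>
  hence "indep_family P (Suc m * Suc e) (Suc m * N)" if "indep_family Q m N" for m N
    by (rule indep_family_mono[of P "m + Suc m * e" "Suc m * N"]) (use that in auto)
  thus ?thesis by blast
qed

text \<open>Each strict inclusion of primes contributes one more factor linear in \<open>m\<close>;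
  the start is the constant 1, independent modulo every prime.\<close>

lemma indep_family_chain:
  fixes J :: "nat \<Rightarrow> ('v::finite, 'k::field) mpoly set"
  assumes "\<And>i. i \<le> l \<Longrightarrow> primeset (J i)" "\<And>i. i < l \<Longrightarrow> J i \<subset> J (Suc i)"
  shows "\<exists>E\<ge>1. \<forall>m. indep_family (J 0) (E * Suc m) (Suc m ^ l)"
  using assms
proof (induction l arbitrary: J)
  case 0
  have prime: "primeset (J 0)" using 0 by simp
  have "indep_family (J 0) m 1" for m
    unfolding indep_family_def
  proof (intro exI conjI allI impI)
    show "(1 :: ('v, 'k) mpoly) \<in> mon_ideal (\<lambda>u. mdeg u \<le> m)" by (simp add: mon_ideal_def)
    fix c :: "nat \<Rightarrow> 'k" and i :: nat
    assume c: "(\<Sum>i<1. Poly_Mapping.single 0 (c i) * 1) \<in> J 0" and i: "i < 1"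
    show "c i = 0"
    proof (rule ccontr)
      assume nz: "c i \<noteq> 0"
      have "Poly_Mapping.single 0 (c i) \<in> J 0" using c i by simp
      hence "Poly_Mapping.single 0 (inverse (c i)) * Poly_Mapping.single 0 (c i) \<in> J 0"
        using prime idealset_mult unfolding primeset_def by blast
      thus False using prime nz unfolding scale_single by (simp add: primeset_def)
    qed
  qed
  thus ?case by (intro exI[of _ 1]) simp
next
  case (Suc l)
  obtain E where E: "E \<ge> 1" "\<And>m. indep_family (J 1) (E * Suc m) (Suc m ^ l)"
    using Suc.IH[of "\<lambda>i. J (Suc i)"] Suc.prems by auto
  have J: "primeset (J 0)" "idealset (J 1)" "J 0 \<subset> J 1"
    using Suc.prems(1)[of 0] Suc.prems(1)[of 1] Suc.prems(2)[of 0] by (auto simp: primeset_def)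
  obtain e where e: "\<And>m N. indep_family (J 1) m N \<Longrightarrow> indep_family (J 0) (Suc m * Suc e) (Suc m * N)"
    using indep_family_prime_step[OF J] by blast
  have "indep_family (J 0) (Suc E * Suc e * Suc m) (Suc m ^ Suc l)" for m
  proof (rule indep_family_mono[OF e[OF E(2)[of m]]])
    have "Suc (E * Suc m) \<le> Suc E * Suc m" by simp
    hence "Suc (E * Suc m) * Suc e \<le> Suc E * Suc m * Suc e" by (rule mult_le_mono1)
    thus "Suc (E * Suc m) * Suc e \<le> Suc E * Suc e * Suc m" by (simp only: mult_ac)
    have "1 * Suc m \<le> E * Suc m" using E(1) by (rule mult_le_mono1)
    hence "Suc m \<le> Suc (E * Suc m)" by simp
    hence "Suc m * Suc m ^ l \<le> Suc (E * Suc m) * Suc m ^ l" by (rule mult_le_mono1)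
    thus "Suc m ^ Suc l \<le> Suc (E * Suc m) * Suc m ^ l" by simp
  qed
  thus ?case by (intro exI[of _ "Suc E * Suc e"]) simp
qed

text \<open>Modulo the nonface ideal the face monomials of degree at most \<open>m\<close> span, so
  more than that many polynomials satisfy a linear relation.\<close>

lemma indep_family_bound:
  fixes P :: "('v::finite, 'k::field) mpoly set"
  assumes "nonfaces \<Delta> \<subseteq> P" "indep_family P m N"
  shows "N \<le> card {u :: 'v \<Rightarrow>\<^sub>0 nat. Poly_Mapping.keys u \<in> \<Delta> \<and> mdeg u \<le> m}" (is "_ \<le> card ?T")
proof (rule ccontr)
  assume "\<not> N \<le> card ?T"
  hence less: "card ?T < card {..<N}" by simp
  obtain b where b: "\<And>i. i < N \<Longrightarrow> b i \<in> mon_ideal (\<lambda>u. mdeg u \<le> m)"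
    "\<And>c. (\<Sum>i<N. Poly_Mapping.single 0 (c i) * b i) \<in> P \<Longrightarrow> \<forall>i<N. c i = 0"
    using assms(2) unfolding indep_family_def by blast
  obtain c where c: "\<exists>i\<in>{..<N}. c i \<noteq> 0" "\<forall>t\<in>?T. (\<Sum>i\<in>{..<N}. c i * Poly_Mapping.lookup (b i) t) = 0"
    using underdetermined_system[OF finite_mdeg_le' finite_lessThan less, of "\<lambda>i. Poly_Mapping.lookup (b i)"] by blast
  let ?s = "\<Sum>i<N. Poly_Mapping.single 0 (c i) * b i"
  have s: "Poly_Mapping.lookup ?s u = (\<Sum>i<N. c i * Poly_Mapping.lookup (b i) u)" for u
    by (simp add: lookup_sum lookup_scale)
  have "?s \<in> mon_ideal (\<lambda>u. mdeg u \<le> m)" by (rule mon_ideal_sum) (rule scale_mon_ideal, rule b(1), simp)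
  hence "?s \<in> nonfaces \<Delta>" using c(2) unfolding mon_ideal_iff s by blast
  hence "?s \<in> P" using assms(1) by blast
  thus False using b(2)[of c] c(1) by auto
qed

lemma card_monomials_faces_le:
  fixes \<Delta> :: "'v::finite set set"
  assumes "\<And>F. F \<in> \<Delta> \<Longrightarrow> card F \<le> D"
  shows "card {u :: 'v \<Rightarrow>\<^sub>0 nat. Poly_Mapping.keys u \<in> \<Delta> \<and> mdeg u \<le> m} \<le> card \<Delta> * Suc m ^ D"
proof -
  have "{u :: 'v \<Rightarrow>\<^sub>0 nat. Poly_Mapping.keys u \<in> \<Delta> \<and> mdeg u \<le> m} = {u. Poly_Mapping.keys u \<in> \<Delta> \<and> mdeg u < Suc m}"
    by auto
  hence "int (card {u :: 'v \<Rightarrow>\<^sub>0 nat. Poly_Mapping.keys u \<in> \<Delta> \<and> mdeg u \<le> m}) = (\<Sum>F\<in>\<Delta>. int (m choose card F))"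
    using card_monomials_faces_below[of "Suc m" \<Delta>] by (simp add: ichoose_int)
  hence "card {u :: 'v \<Rightarrow>\<^sub>0 nat. Poly_Mapping.keys u \<in> \<Delta> \<and> mdeg u \<le> m} = (\<Sum>F\<in>\<Delta>. m choose card F)"
    unfolding of_nat_sum[symmetric] of_nat_eq_iff .
  also have "\<dots> \<le> (\<Sum>F\<in>\<Delta>. Suc m ^ D)"
  proof (rule sum_mono)
    fix F assume F: "F \<in> \<Delta>"
    show "m choose card F \<le> Suc m ^ D"
    proof (cases "card F \<le> m")
      case True
      have "m choose card F \<le> m ^ card F" by (rule binomial_le_pow[OF True])
      also have "\<dots> \<le> Suc m ^ card F" by (rule power_mono) simp_all
      also have "\<dots> \<le> Suc m ^ D" by (rule power_increasing[OF assms[OF F]]) simp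
      finally show ?thesis .
    qed (simp add: binomial_eq_0)
  qed
  finally show ?thesis by simp
qed

text \<open>Growth of order m^l forced by the chain meets the bound of order m^D from counting face
  monomials.\<close>

lemma prime_chain_bound:
  fixes J :: "nat \<Rightarrow> ('v::finite, 'k::field) mpoly set"
  assumes dim: "\<And>F. F \<in> \<Delta> \<Longrightarrow> card F \<le> D" and J: "\<And>i. i \<le> l \<Longrightarrow> primeset (J i)" "\<And>i. i < l \<Longrightarrow> J i \<subset> J (Suc i)"
    and sub: "nonfaces \<Delta> \<subseteq> J 0"
  shows "l \<le> D"
proof (rule ccontr)
  assume "\<not> l \<le> D"
  hence l: "Suc D \<le> l" by simp
  obtain E where E: "\<And>m. indep_family (J 0) (E * Suc m) (Suc m ^ l)" using indep_family_chain[where J = J and l = l, OF J] by blast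
  define C where "C = card \<Delta> * Suc E ^ D"
  have "Suc m \<le> C" for m
  proof -
    have "Suc m ^ l \<le> card \<Delta> * Suc (E * Suc m) ^ D"
      using indep_family_bound[OF sub E[of m]] card_monomials_faces_le[OF dim] by (rule order_trans)
    also have "\<dots> \<le> card \<Delta> * (Suc E * Suc m) ^ D"
      by (intro mult_le_mono2 power_mono) simp_all
    also have "\<dots> = C * Suc m ^ D" unfolding C_def power_mult_distrib by (simp only: mult.assoc)
    finally have "Suc m ^ l \<le> C * Suc m ^ D" .
    moreover have "Suc m ^ Suc D \<le> Suc m ^ l" by (rule power_increasing[OF l]) simp
    ultimately have "Suc m * Suc m ^ D \<le> C * Suc m ^ D" by simp
    thus ?thesis by (metis mult_le_cancel2 zero_less_Suc zero_less_power)
  qed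
  from this[of C] show False by simp
qed

text \<open>\<open>ray v\<close> is a ring homomorphism into k[t], which is a domain; its kernel is
  the prime that is tested against a system of parameters.\<close>

lemma primeset_ray: "primeset {f :: ('v::finite, 'k::field) mpoly. ray v f = 0}"
  unfolding primeset_def idealset_def
proof (intro conjI ballI allI impI)
  have "ray v (1 :: ('v, 'k) mpoly) = monom (1 * mval v 0) 0" using ray_single[of v 0 1] by simp
  thus "(1 :: ('v, 'k) mpoly) \<notin> {f. ray v f = 0}" by (simp add: mval_0 monom_eq_0_iff)
qed (auto simp: ray_add ray_mult)

lemma ray_eq_0_of_covered:
  fixes b :: "nat \<Rightarrow> 'v::finite \<Rightarrow> 'k::field"
  assumes \<Delta>: "simplicial_complex \<Delta>" "F \<in> \<Delta>" and v: "\<And>x. x \<notin> F \<Longrightarrow> v x = 0"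
    and b: "\<And>i. i \<in> {1..d} \<Longrightarrow> (\<Sum>x\<in>UNIV. b i x * v x) = 0"
    and g: "f - (\<Sum>i=1..d. linform (b i) * g i) \<in> nonfaces \<Delta>"
  shows "ray v f = 0"
proof -
  have "ray v (f - (\<Sum>i=1..d. linform (b i) * g i)) = 0" by (rule ray_nonfaces[OF \<Delta> v g])
  hence "ray v f = (\<Sum>i=1..d. monom (\<Sum>x\<in>UNIV. b i x * v x) 1 * ray v (g i))"
    by (simp only: ray_diff ray_sum ray_mult ray_linform right_minus_eq)
  also have "\<dots> = 0" using b by (intro sum.neutral) simp
  finally show ?thesis .
qed

lemma ray_ker_Ge:
  fixes v :: "'v::finite \<Rightarrow> 'k::field"
  assumes "v x \<noteq> 0" shows "{f. ray v f = 0} \<subset> Ge 1"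
proof
  show "{f. ray v f = 0} \<subseteq> Ge 1"
  proof
    fix f assume "f \<in> {f. ray v f = 0}"
    hence "coeff (ray v f) 0 = 0" by simp
    hence f0: "Poly_Mapping.lookup f 0 = 0" by (simp only: coeff_ray_0)
    show "f \<in> Ge 1"
      unfolding mon_ideal_iff
    proof (intro allI impI)
      fix u assume "Poly_Mapping.lookup f u \<noteq> 0"
      hence "u \<noteq> 0" using f0 by auto
      thus "1 \<le> mdeg u" using mdeg_eq_0_iff[of u] by linarith
    qed
  qed
  have "ray v (indet x) = monom (v x) 1" unfolding indet_def ray_single mval_single by simp
  hence "indet x \<notin> {f. ray v f = 0}" using assms by (simp add: monom_eq_0_iff)
  moreover have "(indet x :: ('v, 'k) mpoly) \<in> Ge 1" unfolding indet_def by (rule single_mon_ideal) simp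
  ultimately show "{f. ray v f = 0} \<noteq> Ge 1" by blast
qed

context stanley_reisner
begin

lemma Ge_1_eq: "Ge 1 = (face_prime {} :: ('v, 'k) mpoly set)"
proof -
  have "1 \<le> mdeg u \<longleftrightarrow> \<not> Poly_Mapping.keys u \<subseteq> {}" for u :: "'v \<Rightarrow>\<^sub>0 nat"
  proof -
    have "1 \<le> mdeg u \<longleftrightarrow> mdeg u \<noteq> 0" by linarith
    also have "\<dots> \<longleftrightarrow> \<not> Poly_Mapping.keys u \<subseteq> {}" unfolding mdeg_eq_0_iff by simp
    finally show ?thesis .
  qed
  thus ?thesis by simp
qed

lemma empty_face: "{} \<in> \<Delta>"
  using complex unfolding simplicial_complex_def by blast

lemma MM_1_eq: "MM 1 = \<pi> ` face_prime {}"
  unfolding MM_def Ge_1_eq ..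

lemma maximalideal_MM: "maximalideal (MM 1) R"
proof (rule maximalidealI)
  show "ideal (MM 1) R" by (rule ideal_MM)
  have "primeideal (MM 1) R" unfolding MM_1_eq by (rule face_primeideal[OF empty_face])
  thus "carrier R \<noteq> MM 1" by (rule primeideal.I_notcarr)
  fix K assume K: "ideal K R" "MM 1 \<subseteq> K" "K \<subseteq> carrier R"
  show "K = MM 1 \<or> K = carrier R"
  proof (cases "K \<subseteq> MM 1")
    case False
    then obtain z where "z \<in> K" "z \<notin> MM 1" by blast
    then obtain f where f: "\<pi> f \<in> K" "\<pi> f \<notin> MM 1" using K(3) unfolding h_surj by blast
    define c where "c = Poly_Mapping.lookup f 0"
    have "f - Poly_Mapping.single 0 c \<in> Ge 1"
      unfolding Ge_1_eq mon_ideal_iff by (auto simp: c_def lookup_minus lookup_single when_def split: if_splits)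
    hence fc: "\<pi> (f - Poly_Mapping.single 0 c) \<in> K" using K(2) Ge_MM by blast
    have P: "idealset (pre K)" by (rule idealset_pre[OF K(1)])
    have "f - (f - Poly_Mapping.single 0 c) \<in> pre K" by (rule idealset_diff[OF P]) (simp_all add: f fc)
    hence sc: "Poly_Mapping.single 0 c \<in> pre K" by simp
    have "c \<noteq> 0"
    proof
      assume "c = 0"
      hence "f \<in> Ge 1" using \<open>f - Poly_Mapping.single 0 c \<in> Ge 1\<close> by simp
      thus False using f(2) Ge_MM by blast
    qed
    hence "Poly_Mapping.single 0 (inverse c) * Poly_Mapping.single 0 c = (1 :: ('v, 'k) mpoly)"
      unfolding scale_single by simp
    hence "1 \<in> pre K" using idealset_mult[OF P sc, of "Poly_Mapping.single 0 (inverse c)"] by simp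
    hence "\<one> \<in> K" by (simp add: h_one)
    thus ?thesis using ideal.one_imp_carrier[OF K(1)] by blast
  qed (use K(2) in blast)
qed

text \<open>Removing the vertices of \<open>F\<close> one at a time gives a strictly increasing
  chain of face primes that ends at \<open>MM 1\<close>.\<close>

lemma height_ge:
  assumes "F \<in> \<Delta>" shows "height R (MM 1) \<ge> enat (card F)"
proof -
  obtain xs where xs: "set xs = F" "distinct xs" using finite_distinct_list[OF finite[of F]] by blast
  define n where "n = length xs"
  have n: "card F = n" using xs by (auto simp: n_def distinct_card)
  define G where "G i = set (take (n - i) xs)" for i
  have G\<Delta>: "G i \<in> \<Delta>" for i
    using complex assms set_take_subset[of "n - i" xs] unfolding simplicial_complex_def G_def xs(1) by blast
  show ?thesis
    unfolding height_def n
  proof (rule chain_length_ge[where J = "\<lambda>i. \<pi> ` face_prime (G i)"])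
    fix i assume "i \<le> n"
    have "\<pi> ` face_prime (G i) \<subseteq> MM 1"
      unfolding MM_1_eq by (intro image_mono subsetI) (erule mon_ideal_mono, blast)
    thus "\<pi> ` face_prime (G i) \<in> {Q. primeideal Q R \<and> Q \<subseteq> MM 1}"
      using face_primeideal[OF G\<Delta>] by blast
  next
    fix i assume i: "i < n"
    define x where "x = xs ! (n - Suc i)"
    have "take (n - i) xs = take (n - Suc i) xs @ [x]"
      unfolding x_def using i take_Suc_conv_app_nth[of "n - Suc i" xs] by (simp add: n_def Suc_diff_Suc)
    hence Gi: "G i = insert x (G (Suc i))" unfolding G_def by simp
    have "distinct (take (n - i) xs)" using xs(2) by simp
    hence x: "x \<notin> G (Suc i)" unfolding \<open>take (n - i) xs = _\<close> G_def by simp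
    show "\<pi> ` face_prime (G i) \<subset> \<pi> ` face_prime (G (Suc i))"
    proof (rule image_strict_mono[OF idealset_face_prime ker_face_prime[OF G\<Delta>] idealset_face_prime ker_face_prime[OF G\<Delta>]])
      have "face_prime (G i) \<subseteq> (face_prime (G (Suc i)) :: ('v, 'k) mpoly set)"
        unfolding Gi by (rule subsetI) (erule mon_ideal_mono, blast)
      moreover have "(indet x :: ('v, 'k) mpoly) \<in> face_prime (G (Suc i)) - face_prime (G i)"
        using x by (simp add: indet_in_face_prime Gi)
      ultimately show "face_prime (G i) \<subset> (face_prime (G (Suc i)) :: ('v, 'k) mpoly set)" by blast
    qed
  qed
qed

lemma height_le_krull_dim: "height R Q \<le> krull_dim R"
  unfolding height_def krull_dim_def by (rule chain_length_image_le[where \<phi> = "\<lambda>x. x"]) auto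

lemma krull_dim_le:
  assumes "\<And>F. F \<in> \<Delta> \<Longrightarrow> card F \<le> D" shows "krull_dim R \<le> enat D"
  unfolding krull_dim_eq
proof (rule chain_length_le)
  fix l J assume J: "\<And>i. i \<le> l \<Longrightarrow> J i \<in> {P. primeset P \<and> ker \<subseteq> P}" "\<And>i. i < l \<Longrightarrow> J i \<subset> J (Suc i)"
  show "l \<le> D"
  proof (rule prime_chain_bound[OF assms])
    show "nonfaces \<Delta> \<subseteq> J 0" using J(1)[of 0] unfolding ker_eq by blast
  qed (use J in blast)+
qed

text \<open>The dimension is the largest size of a face: chains of face primes give one inequality,
  the growth bound in \<open>krull_dim_le\<close> the other. The same chains bound the height of the
  maximal ideal from below.\<close>

lemma krull_dim_complex:
  assumes "krull_dim R = enat d"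
  shows "\<And>F. F \<in> \<Delta> \<Longrightarrow> card F \<le> d" "\<exists>F\<in>\<Delta>. card F = d" "height R (MM 1) \<ge> enat d" "d > 0"
proof -
  show le: "card F \<le> d" if "F \<in> \<Delta>" for F
    using order_trans[OF height_ge[OF that] height_le_krull_dim] unfolding assms by simp
  obtain F where F: "F \<in> \<Delta>" "\<And>G. G \<in> \<Delta> \<Longrightarrow> card G \<le> card F"
  proof -
    have fin: "finite (card ` \<Delta>)" "card ` \<Delta> \<noteq> {}" using empty_face by auto
    obtain F where "F \<in> \<Delta>" "card F = Max (card ` \<Delta>)" using Max_in[OF fin] by auto
    thus ?thesis using that Max_ge[OF fin(1)] by auto
  qed
  have "enat d \<le> enat (card F)" using krull_dim_le[OF F(2)] unfolding assms .
  hence "card F = d" using le[OF F(1)] by simp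
  thus "\<exists>F\<in>\<Delta>. card F = d" using F(1) by blast
  show "height R (MM 1) \<ge> enat d" using height_ge[OF F(1)] \<open>card F = d\<close> by simp
  \<comment> \<open>The vertices form a type, which is nonempty, and every vertex is a face.\<close>
  have "{undefined} \<in> \<Delta>" using complex unfolding simplicial_complex_def by blast
  from le[OF this] show "d > 0" by simp
qed

text \<open>A nonzero common zero of the forms in a face would put a whole line into their zero set;
  the prime of this line lies strictly below \<mm>, so the quotient would have positive
  dimension.\<close>

lemma spanning_of_linear_sop:
  assumes "linear_sop \<Delta> d \<theta>"
  shows "\<exists>b. spanning \<Delta> d b \<and> Idl (\<theta> ` {1..d}) = Idl ((\<lambda>i. \<pi> (linform (b i))) ` {1..d})"
proof -
  have \<theta>: "\<And>i. i \<in> {1..d} \<Longrightarrow> \<theta> i \<in> SR_linear_forms \<Delta>"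
    and dim0: "krull_dim (R Quot Idl (\<theta> ` {1..d})) = 0"
    using assms unfolding linear_sop_def R_def by blast+
  have "\<forall>i. \<exists>c. i \<in> {1..d} \<longrightarrow> \<theta> i = \<pi> (linform c)"
    using \<theta> unfolding SR_linear_forms_def linform_def by blast
  then obtain b where b: "\<And>i. i \<in> {1..d} \<Longrightarrow> \<theta> i = \<pi> (linform (b i))" by metis
  have img: "\<theta> ` {1..d} = (\<lambda>i. \<pi> (linform (b i))) ` {1..d}" by (rule image_cong[OF refl b])
  let ?K = "Idl ((\<lambda>i. \<pi> (linform (b i))) ` {1..d})"
  have K: "ideal ?K R" by (rule genideal_ideal) (rule image_subsetI, rule h_closed)
  have preK: "pre ?K = {f. \<exists>g. f - (\<Sum>i=1..d. linform (b i) * g i) \<in> nonfaces \<Delta>}"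
    unfolding pre_Idl_image ker_eq ..
  note Q = ring_surj_quotient[OF K]
  have "spanning \<Delta> d b"
  proof (rule ccontr)
    assume "\<not> spanning \<Delta> d b"
    then obtain F v x where F: "F \<in> \<Delta>" and v: "\<And>x. x \<notin> F \<Longrightarrow> v x = 0"
      and bv: "\<And>i. i \<in> {1..d} \<Longrightarrow> (\<Sum>x\<in>UNIV. b i x * v x) = 0" and x: "v x \<noteq> 0"
      unfolding spanning_def by blast
    define P where "P = {f. ray v f = 0}"
    have P: "primeset P" unfolding P_def by (rule primeset_ray)
    have KP: "pre ?K \<subseteq> P"
      unfolding preK P_def using ray_eq_0_of_covered[where b = b and d = d and v = v, OF complex F v bv] by blast
    have PM: "P \<subset> Ge 1" unfolding P_def by (rule ray_ker_Ge[where v = v, OF x])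
    have "krull_dim (R Quot ?K) = chain_length {P. primeset P \<and> pre ?K \<subseteq> P}"
      unfolding ring_surj.krull_dim_eq[OF Q(1)] Q(2) ..
    also have "\<dots> \<ge> enat 1"
    proof (rule chain_length_ge[where J = "\<lambda>i. if i = 0 then P else Ge 1"])
      have M: "primeset (Ge 1 :: ('v, 'k) mpoly set)" unfolding Ge_1_eq by (rule primeset_face_prime)
      show "(if i = 0 then P else Ge 1) \<in> {P. primeset P \<and> pre ?K \<subseteq> P}" for i :: nat
        using P M KP PM by auto
      show "(if i = 0 then P else Ge 1) \<subset> (if Suc i = 0 then P else Ge 1)" if "i < 1" for i :: nat
        using that PM by simp
    qed
    finally show False using dim0 unfolding img by (simp add: zero_enat_def)
  qed
  thus ?thesis using img by (intro exI[of _ b]) simp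
qed

text \<open>Depth supplies a regular sequence of length at least \<open>d\<close> in the maximal
  ideal. The spanning forms generate an ideal containing a high power of \<mm>, hence a power of
  each member of the sequence, as \<open>koszul_exact_of_regular\<close> requires.\<close>

lemma koszul_exact_of_cohen_macaulay:
  fixes b :: "nat \<Rightarrow> 'v \<Rightarrow> 'k"
  assumes CM: "cohen_macaulay R" and dim: "krull_dim R = enat d" and span: "spanning \<Delta> d b" and i: "i > 0"
  shows "koszul_exact d (\<lambda>j. linform (b j)) (nonfaces \<Delta>) i"
proof -
  have "depth R (MM 1) = height R (MM 1)" using CM maximalideal_MM unfolding cohen_macaulay_def by blast
  hence depth: "depth R (MM 1) \<ge> enat d" using krull_dim_complex(3)[OF dim] by simp
  have "\<exists>xs. regular_sequence R xs \<and> set xs \<subseteq> MM 1 \<and> d \<le> length xs"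
  proof (rule ccontr)
    assume no: "\<not> ?thesis"
    \<comment> \<open>Depth is a supremum; if all regular sequences were shorter than
      \<open>d\<close>, it would be at most \<open>d - 1\<close>, which is less than
      \<open>d\<close> because \<open>d > 0\<close>.\<close>
    have "depth R (MM 1) \<le> enat (d - 1)"
      unfolding depth_def
    proof (rule SUP_least)
      fix xs assume xs: "xs \<in> {xs. regular_sequence R xs \<and> set xs \<subseteq> MM 1}"
      have "length xs < d"
      proof (rule ccontr)
        assume "\<not> length xs < d"
        hence "d \<le> length xs" by simp
        thus False using no xs by blast
      qed
      thus "enat (length xs) \<le> enat (d - 1)" by simp
    qed
    hence "enat d \<le> enat (d - 1)" using depth by (rule order_trans[rotated])
    thus False using krull_dim_complex(4)[OF dim] by simp
  qed
  then obtain xs where xs: "regular_sequence R xs" "set xs \<subseteq> MM 1" "d \<le> length xs" by blast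
  have "\<forall>k. \<exists>f. k < length xs \<longrightarrow> f \<in> Ge 1 \<and> xs ! k = \<pi> f"
  proof
    fix k
    show "\<exists>f. k < length xs \<longrightarrow> f \<in> Ge 1 \<and> xs ! k = \<pi> f"
    proof (cases "k < length xs")
      case True
      hence "xs ! k \<in> MM 1" using xs(2) by auto
      thus ?thesis unfolding MM_def by blast
    qed simp
  qed
  then obtain \<xi> where \<xi>: "\<And>k. k < length xs \<Longrightarrow> \<xi> k \<in> Ge 1" "\<And>k. k < length xs \<Longrightarrow> xs ! k = \<pi> (\<xi> k)" by metis
  define J where "J k = pre (Idl (set (take k xs)))" for k
  have carr: "set (take k xs) \<subseteq> carrier R" for k
    using xs(1) set_take_subset[of k xs] unfolding regular_sequence_def by blast
  have "koszul_exact d (\<lambda>j. linform (b j)) (J 0) i"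
  proof (rule koszul_exact_of_regular[where x = \<xi>])
    show "idealset (J k)" for k unfolding J_def by (rule idealset_pre[OF genideal_ideal[OF carr]])
    show "J (Suc k) = {a + r * \<xi> k |a r. a \<in> J k}" if "k < d" for k
    proof -
      have k: "k < length xs" using that xs(3) by simp
      have "set (take (Suc k) xs) = insert (\<pi> (\<xi> k)) (set (take k xs))"
        using take_Suc_conv_app_nth[OF k] \<xi>(2)[OF k] by simp
      thus ?thesis unfolding J_def by (simp only: pre_Idl_insert[OF carr])
    qed
    show "r \<in> J k" if "k < d" "r * \<xi> k \<in> J k" for k r
    proof -
      have k: "k < length xs" using that xs(3) by simp
      have "\<pi> r \<otimes> xs ! k \<in> Idl (set (take k xs))"
        using that(2) unfolding J_def \<xi>(2)[OF k] by (simp add: h_mult)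
      moreover have "\<forall>i<length xs. \<forall>r\<in>carrier R. r \<otimes> xs ! i \<in> Idl (set (take i xs)) \<longrightarrow> r \<in> Idl (set (take i xs))"
        using xs(1) unfolding regular_sequence_def by (elim conjE)
      ultimately have "\<pi> r \<in> Idl (set (take k xs))" using k h_closed by blast
      thus ?thesis by (simp add: J_def)
    qed
    have J0: "J 0 = nonfaces \<Delta>" unfolding J_def by (simp add: pre_Idl_empty ker_eq)
    show "\<exists>N c. \<xi> k ^ N - (\<Sum>j=1..d. c j * linform (b j)) \<in> J 0" if "k < d" for k
    proof -
      \<comment> \<open>One more than the number of variables, the bound from which
        \<open>covers_of_spanning\<close> applies.\<close>
      let ?N = "Suc (card (UNIV :: 'v set))"
      have "gcovers \<Delta> d (\<lambda>i. linform (b i)) ?N"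
        by (rule gcovers_of_covers) (rule covers_of_spanning[OF complex span], simp)
      moreover have "\<xi> k ^ ?N \<in> Ge ?N" using Ge_power[OF \<xi>(1), of k ?N] that xs(3) by simp
      ultimately obtain g where "\<xi> k ^ ?N - (\<Sum>i=1..d. linform (b i) * g i) \<in> nonfaces \<Delta>"
        unfolding gcovers_def covered_def by blast
      thus ?thesis unfolding J0 by (intro exI[of _ ?N] exI[of _ g]) (simp only: mult.commute)
    qed
  qed (rule i)
  thus ?thesis unfolding J_def by (simp add: pre_Idl_empty ker_eq)
qed

lemma pre_MM: "pre (MM n) = mon_ideal (\<lambda>u. Poly_Mapping.keys u \<in> \<Delta> \<longrightarrow> n \<le> mdeg u)"
  unfolding pre_def \<pi>_in_MM_iff by blast

lemma idealset_low:
  assumes "\<And>u w. u \<in> T \<Longrightarrow> Poly_Mapping.keys (u + w) \<in> \<Delta> \<Longrightarrow> n \<le> mdeg (u + w) \<or> u + w \<in> T"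
  shows "idealset (mon_ideal (\<lambda>u. Poly_Mapping.keys u \<in> \<Delta> \<longrightarrow> n \<le> mdeg u \<or> u \<in> T) :: ('v, 'k) mpoly set)"
proof (rule idealset_mon_ideal, rule impI)
  fix u w :: "'v \<Rightarrow>\<^sub>0 nat"
  assume Q: "Poly_Mapping.keys u \<in> \<Delta> \<longrightarrow> n \<le> mdeg u \<or> u \<in> T" and uw: "Poly_Mapping.keys (u + w) \<in> \<Delta>"
  have "Poly_Mapping.keys u \<subseteq> Poly_Mapping.keys (u + w)" by (simp add: keys_add_nat)
  hence "Poly_Mapping.keys u \<in> \<Delta>" using uw complex unfolding simplicial_complex_def by blast
  with Q have "n \<le> mdeg u \<or> u \<in> T" by (rule mp)
  thus "n \<le> mdeg (u + w) \<or> u + w \<in> T"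
  proof
    assume "u \<in> T"
    thus ?thesis by (rule assms[OF _ uw])
  qed simp
qed

text \<open>A chain longer than the number of low face monomials yields elements \<open>b i\<close>
  of \<open>J (Suc i) - J i\<close> with a linear relation modulo \<mm>^n, which is impossible. A
  chain of exactly that length arises by adjoining the monomials one at a time, in decreasing
  degree.\<close>

lemma ring_length_MM:
  "ring_length (R Quot MM n) = enat (card {u :: 'v \<Rightarrow>\<^sub>0 nat. Poly_Mapping.keys u \<in> \<Delta> \<and> mdeg u < n})"
proof -
  let ?T = "{u :: 'v \<Rightarrow>\<^sub>0 nat. Poly_Mapping.keys u \<in> \<Delta> \<and> mdeg u < n}"
  note Q = ring_surj_quotient[OF ideal_MM[of n]]
  have finT: "finite ?T" by (rule finite_mdeg_less)
  have "ring_length (R Quot MM n) = chain_length {J. idealset J \<and> pre (MM n) \<subseteq> J}"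
    unfolding ring_surj.ring_length_eq[OF Q(1)] Q(2) ..
  also have "\<dots> = enat (card ?T)"
  proof (rule antisym)
    show "chain_length {J. idealset J \<and> pre (MM n) \<subseteq> J} \<le> enat (card ?T)"
    proof (rule chain_length_le, rule ccontr)
      fix l J assume J: "\<And>i. i \<le> l \<Longrightarrow> J i \<in> {J. idealset J \<and> pre (MM n) \<subseteq> J}" "\<And>i. i < l \<Longrightarrow> J i \<subset> J (Suc i)"
        and "\<not> l \<le> card ?T"
      hence less: "card ?T < card {..<l}" by simp
      have "\<forall>i. \<exists>b. i < l \<longrightarrow> b \<in> J (Suc i) - J i" using J(2) by blast
      then obtain b where b: "\<And>i. i < l \<Longrightarrow> b i \<in> J (Suc i)" "\<And>i. i < l \<Longrightarrow> b i \<notin> J i" by (metis Diff_iff)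
      obtain c where c: "\<exists>i\<in>{..<l}. c i \<noteq> 0" "\<forall>t\<in>?T. (\<Sum>i\<in>{..<l}. c i * Poly_Mapping.lookup (b i) t) = 0"
        using underdetermined_system[OF finT finite_lessThan less, of "\<lambda>i. Poly_Mapping.lookup (b i)"] by blast
      \<comment> \<open>The last index with a nonzero coefficient: the earlier terms lie in
        \<open>J j\<close>, since \<open>b i\<close> lies in \<open>J (Suc i)\<close>, and the
        relation forces \<open>b j\<close> into \<open>J j\<close>.\<close>
      define j where "j = Max {i. i < l \<and> c i \<noteq> 0}"
      have fin: "finite {i. i < l \<and> c i \<noteq> 0}" and ne: "{i. i < l \<and> c i \<noteq> 0} \<noteq> {}" using c(1) by auto
      have j: "j < l" "c j \<noteq> 0" using Max_in[OF fin ne] unfolding j_def by blast+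
      have j_max: "i \<le> j" if "i < l" "c i \<noteq> 0" for i
        unfolding j_def by (rule Max_ge[OF fin]) (use that in blast)
      have Jj: "idealset (J j)" "pre (MM n) \<subseteq> J j" using J(1)[of j] j(1) by auto
      have Jmono: "k \<le> l \<Longrightarrow> J i \<subseteq> J k" if "i \<le> k" for i k
        using that
      proof (induction k rule: dec_induct)
        case (step k)
        hence "J i \<subseteq> J k" by simp
        moreover have "J k \<subset> J (Suc k)" using J(2)[of k] step.prems by simp
        ultimately show ?case by blast
      qed simp
      let ?s = "\<lambda>i. Poly_Mapping.single 0 (c i) * b i"
      have "(\<Sum>i<l. ?s i) \<in> pre (MM n)"
        unfolding pre_MM mon_ideal_iff
      proof (intro allI impI)
        fix u assume nz: "Poly_Mapping.lookup (\<Sum>i<l. ?s i) u \<noteq> 0" and u: "Poly_Mapping.keys u \<in> \<Delta>"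
        have "u \<notin> ?T" using nz c(2) by (auto simp: lookup_sum lookup_scale)
        thus "n \<le> mdeg u" using u by simp
      qed
      hence all: "(\<Sum>i<l. ?s i) \<in> J j" using Jj(2) by blast
      have "j \<in> {..<l}" using j(1) by simp
      hence split: "(\<Sum>i<l. ?s i) = ?s j + (\<Sum>i\<in>{..<l} - {j}. ?s i)"
        by (rule sum.remove[OF finite_lessThan])
      have rest: "(\<Sum>i\<in>{..<l} - {j}. ?s i) \<in> J j"
      proof (rule idealset_sum[OF Jj(1)])
        fix i assume i: "i \<in> {..<l} - {j}"
        show "?s i \<in> J j"
        proof (cases "c i = 0")
          case True
          thus ?thesis using idealset_0[OF Jj(1)] by simp
        next
          case False
          hence "Suc i \<le> j" using j_max[of i] i by auto
          hence "b i \<in> J j" using b(1)[of i] i Jmono[of "Suc i" j] j(1) by auto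
          thus ?thesis by (rule idealset_mult[OF Jj(1)])
        qed
      qed
      have "?s j \<in> J j" using idealset_diff[OF Jj(1) all rest] unfolding split by simp
      hence "Poly_Mapping.single 0 (inverse (c j)) * ?s j \<in> J j" by (rule idealset_mult[OF Jj(1)])
      hence "b j \<in> J j" using j(2) by (simp add: mult.assoc[symmetric] scale_single)
      thus False using b(2)[OF j(1)] by blast
    qed
  next
    obtain ts0 where ts0: "set ts0 = ?T" "distinct ts0" using finite_distinct_list[OF finT] by blast
    \<comment> \<open>In decreasing degree every proper multiple of a monomial precedes it in the
      list, so each prefix spans an ideal together with \<mm>^n.\<close>
    define ts where "ts = rev (sort_key mdeg ts0)"
    have ts: "set ts = ?T" "distinct ts"
      unfolding ts_def set_rev set_sort distinct_rev distinct_sort by (fact ts0)+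
    have len: "length ts = card ?T" using distinct_card[OF ts(2)] unfolding ts(1) by (rule sym)
    have sorted: "mdeg (ts ! k) \<le> mdeg (ts ! j)" if "j \<le> k" "k < length ts" for j k
    proof -
      have "sorted (rev (map mdeg ts))" unfolding ts_def by (simp only: rev_map rev_rev_ident sorted_sort_key)
      from sorted_rev_nth_mono[OF this, of j k] show ?thesis using that by simp
    qed
    define J where "J i = (mon_ideal (\<lambda>u. Poly_Mapping.keys u \<in> \<Delta> \<longrightarrow> n \<le> mdeg u \<or> u \<in> set (take i ts)) :: ('v, 'k) mpoly set)" for i
    show "enat (card ?T) \<le> chain_length {J. idealset J \<and> pre (MM n) \<subseteq> J}"
      unfolding len[symmetric]
    proof (rule chain_length_ge[where J = J])
      fix i
      have "idealset (J i)"
        unfolding J_def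
      proof (rule idealset_low)
        fix u w assume u: "u \<in> set (take i ts)" and uw: "Poly_Mapping.keys (u + w) \<in> \<Delta>"
        show "n \<le> mdeg (u + w) \<or> u + w \<in> set (take i ts)"
        proof (cases "mdeg w = 0 \<or> n \<le> mdeg (u + w)")
          case True
          thus ?thesis using u by (auto simp: mdeg_eq_0_iff)
        next
          case False
          hence "u + w \<in> set ts" using uw unfolding ts(1) by simp
          then obtain k where k: "k < length ts" "ts ! k = u + w" unfolding in_set_conv_nth by (elim exE conjE)
          from u obtain j where "j < length (take i ts)" "take i ts ! j = u"
            unfolding in_set_conv_nth by (elim exE conjE)
          hence j: "j < i" "j < length ts" "ts ! j = u" by simp_all
          have "k < j"
          proof (rule ccontr)
            assume "\<not> k < j"
            hence "mdeg (ts ! k) \<le> mdeg (ts ! j)" using sorted[of j k] k(1) by simp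
            hence "mdeg (u + w) \<le> mdeg u" unfolding k(2) j(3) .
            thus False using False by simp
          qed
          hence "k < i" using j(1) by simp
          hence "take i ts ! k = u + w" "k < length (take i ts)" using k by simp_all
          hence "u + w \<in> set (take i ts)" unfolding in_set_conv_nth by (intro exI[of _ k] conjI)
          thus ?thesis by (rule disjI2)
        qed
      qed
      moreover have "pre (MM n) \<subseteq> J i"
      proof
        fix f assume "f \<in> pre (MM n)"
        thus "f \<in> J i" unfolding pre_MM J_def by (rule mon_ideal_mono) simp
      qed
      ultimately show "J i \<in> {J. idealset J \<and> pre (MM n) \<subseteq> J}" by (intro CollectI conjI)
    next
      fix i assume i: "i < length ts"
      have tk: "take (Suc i) ts = take i ts @ [ts ! i]" by (rule take_Suc_conv_app_nth[OF i])
      have sub: "J i \<subseteq> J (Suc i)"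
      proof
        fix f assume "f \<in> J i"
        thus "f \<in> J (Suc i)" unfolding J_def by (rule mon_ideal_mono) (auto simp: tk)
      qed
      have "ts ! i \<in> set (take (Suc i) ts)" unfolding tk by simp
      hence in_Suc: "Poly_Mapping.single (ts ! i) 1 \<in> J (Suc i)" unfolding J_def by (intro single_mon_ideal impI disjI2)
      have notin: "Poly_Mapping.single (ts ! i) 1 \<notin> J i"
      proof
        assume "Poly_Mapping.single (ts ! i) 1 \<in> J i"
        hence *: "Poly_Mapping.keys (ts ! i) \<in> \<Delta> \<longrightarrow> n \<le> mdeg (ts ! i) \<or> ts ! i \<in> set (take i ts)"
          unfolding J_def by (simp add: mon_ideal_def)
        have "ts ! i \<in> ?T" using nth_mem[OF i] unfolding ts(1) .
        hence "ts ! i \<in> set (take i ts)" using * by simp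
        moreover have "distinct (take (Suc i) ts)" using ts(2) by (rule distinct_take)
        ultimately show False unfolding tk distinct_append by simp
      qed
      show "J i \<subset> J (Suc i)"
      proof (rule psubsetI[OF sub])
        show "J i \<noteq> J (Suc i)" using in_Suc notin by metis
      qed
    qed
  qed
  finally show ?thesis .
qed

end

section \<open>Hilbert coefficients and the Euler characteristic\<close>

lemma tight_hilbert_sum_eq:
  assumes "n \<ge> (1::nat)"
  shows "(\<Sum>i\<le>d. (- 1) ^ i * e i * int ((n + d - 1 - i) choose (d - i)))
    = binomial_poly d (\<lambda>j. (- 1) ^ (d - j) * e (d - j)) (int n)"
  unfolding binomial_poly_def
proof (rule sum.reindex_bij_witness[of _ "\<lambda>j. d - j" "\<lambda>i. d - i"])
  fix i assume i: "i \<in> {..d}"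
  have "int n + int (d - i) - 1 = int (n + d - 1 - i)" using i assms by (simp add: of_nat_diff)
  thus "(- 1) ^ (d - (d - i)) * e (d - (d - i)) * ((int n + int (d - i) - 1) ichoose (d - i))
    = (- 1) ^ i * e i * int ((n + d - 1 - i) choose (d - i))" using i by (simp only: ichoose_int) simp
qed auto

text \<open>The definite description needs uniqueness: binomial polynomials that agree for large
  \<open>n\<close> have equal coefficients. Reversing the index by \<open>d - i\<close> turns the
  last coefficient into the constant one, with sign (-1)^d.\<close>

lemma tight_hilbert_coeff_eq:
  assumes l: "\<And>n. n \<ge> 1 \<Longrightarrow> ring_length (R Quot tight_closure p R (J [^]\<^bsub>ideals_set R\<^esub> n)) = enat (l n)"
    and poly: "\<And>n. n \<ge> 1 \<Longrightarrow> int (l n) = binomial_poly d e (int n)"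
  shows "tight_hilbert_coeff p R d d J = (- 1) ^ d * e 0"
  unfolding tight_hilbert_coeff_def
proof (rule the_equality)
  let ?t = "\<lambda>e j. (- 1) ^ (d - j) * e (d - j) :: int"
  define e' where "e' i = (- 1) ^ i * e (d - i)" for i
  have sq: "(- 1) ^ k * ((- 1) ^ k * z) = (z :: int)" for k z
    by (simp flip: mult.assoc power_mult_distrib)
  have e': "binomial_poly d (?t e') = binomial_poly d e"
    unfolding binomial_poly_def e'_def by (intro ext sum.cong refl) (simp add: sq)
  have "tight_hilbert_coeffs p R d J e'"
    unfolding tight_hilbert_coeffs_def eventually_sequentially
  proof (rule exI[of _ 1], intro allI impI)
    fix n :: nat assume n: "1 \<le> n"
    show "\<exists>l. ring_length (R Quot tight_closure p R (J [^]\<^bsub>ideals_set R\<^esub> n)) = enat l \<and>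
       int l = (\<Sum>i\<le>d. (- 1) ^ i * e' i * int (n + d - 1 - i choose (d - i)))"
      unfolding tight_hilbert_sum_eq[OF n] e' using l[OF n] poly[OF n] by blast
  qed
  moreover have "e' d = (- 1) ^ d * e 0" by (simp add: e'_def)
  ultimately show "\<exists>e'. tight_hilbert_coeffs p R d J e' \<and> e' d = (- 1) ^ d * e 0" by blast
  fix c assume "\<exists>e. tight_hilbert_coeffs p R d J e \<and> e d = c"
  then obtain g where g: "tight_hilbert_coeffs p R d J g" "g d = c" by blast
  obtain N where N: "\<And>n. n \<ge> N \<Longrightarrow> \<exists>l. ring_length (R Quot tight_closure p R (J [^]\<^bsub>ideals_set R\<^esub> n)) = enat l \<and>
       int l = (\<Sum>i\<le>d. (- 1) ^ i * g i * int (n + d - 1 - i choose (d - i)))"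
    using g(1) unfolding tight_hilbert_coeffs_def eventually_sequentially by blast
  have zero: "binomial_poly d (\<lambda>j. ?t g j - e j) z = 0" if z: "z \<ge> int (max N 1)" for z
  proof -
    define n where "n = nat z"
    have n: "n \<ge> N" "n \<ge> 1" "z = int n" using z by (auto simp: n_def)
    from N[OF n(1)] l[OF n(2)] have "int (l n) = binomial_poly d (?t g) (int n)"
      unfolding tight_hilbert_sum_eq[OF n(2)] by auto
    hence "binomial_poly d (?t g) z = binomial_poly d e z" using poly[OF n(2)] n(3) by simp
    thus ?thesis unfolding binomial_poly_def by (simp add: left_diff_distrib sum_subtractf)
  qed
  have "?t g 0 - e 0 = 0" by (rule binomial_poly_eventually_zero[OF zero]) simp_all
  hence "(- 1) ^ d * g d = e 0" by simp
  thus "c = (- 1) ^ d * e 0" using sq[of d "g d"] g(2) by simp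
qed

text \<open>The sum over all faces is 1 - \<chi>(\<Delta>): the empty face contributes 1, and the
  exponent \<open>card F\<close> exceeds the dimension of \<open>F\<close> by one.\<close>

lemma eulerian_iff:
  fixes \<Delta> :: "'v::finite set set"
  assumes "simplicial_complex \<Delta>"
  shows "eulerian \<Delta> \<longleftrightarrow> (\<Sum>F\<in>\<Delta>. (- 1) ^ card F) = (0 :: int)"
proof -
  have empty: "{} \<in> \<Delta>" using assms unfolding simplicial_complex_def by blast
  let ?D = "Max (card ` \<Delta>)"
  have "euler_characteristic \<Delta> = (\<Sum>i<?D. \<Sum>F\<in>{F \<in> \<Delta> - {{}}. card F - 1 = i}. (- 1) ^ (card F - 1))"
    unfolding euler_characteristic_def num_faces_def
  proof (intro sum.cong refl)
    fix i
    have "card F = i + 1 \<longleftrightarrow> F \<noteq> {} \<and> card F - 1 = i" for F :: "'v set"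
    proof (cases "F = {}")
      case False
      hence "card F > 0" by (simp add: card_gt_0_iff)
      thus ?thesis using False by auto
    qed simp
    hence "{F \<in> \<Delta>. card F = i + 1} = {F \<in> \<Delta> - {{}}. card F - 1 = i}" by simp
    thus "(- 1) ^ i * int (card {F \<in> \<Delta>. card F = i + 1}) = (\<Sum>F\<in>{F \<in> \<Delta> - {{}}. card F - 1 = i}. (- 1) ^ (card F - 1))"
      by simp
  qed
  also have "\<dots> = (\<Sum>F\<in>\<Delta> - {{}}. (- 1) ^ (card F - 1))"
  proof (rule sum.group)
    show "(\<lambda>F. card F - 1) ` (\<Delta> - {{}}) \<subseteq> {..<?D}"
    proof (rule image_subsetI)
      fix F assume F: "F \<in> \<Delta> - {{}}"
      hence "card F > 0" by (simp add: card_gt_0_iff)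
      moreover have "card F \<le> ?D" using F by (intro Max_ge) auto
      ultimately show "card F - 1 \<in> {..<?D}" by simp
    qed
  qed auto
  also have "\<dots> = - (\<Sum>F\<in>\<Delta> - {{}}. (- 1) ^ card F)"
    unfolding sum_negf[symmetric]
  proof (intro sum.cong refl)
    fix F assume "F \<in> \<Delta> - {{}}"
    hence "card F = Suc (card F - 1)" by (simp add: card_gt_0_iff)
    hence "(- 1 :: int) ^ card F = (- 1) ^ Suc (card F - 1)" by (rule arg_cong)
    thus "(- 1 :: int) ^ (card F - 1) = - ((- 1) ^ card F)" by simp
  qed
  also have "(\<Sum>F\<in>\<Delta> - {{}}. (- 1 :: int) ^ card F) = (\<Sum>F\<in>\<Delta>. (- 1) ^ card F) - 1"
    using empty by (simp add: sum_diff1)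
  finally show ?thesis unfolding eulerian_def by linarith
qed

section \<open>Lines and minimality of linear reductions\<close>

lemma coeff_ray_low:
  assumes "f \<in> Ge n" "j < n" shows "coeff (ray v f) j = 0"
  unfolding ray_def coeff_sum coeff_monom
  using assms by (intro sum.neutral) (auto simp: mon_ideal_def)

text \<open>Along the line \<open>f\<close> has order at least 2 and \<open>g\<close> order at least
  \<open>n\<close>, so the product starts in degree \<open>n + 2\<close>.\<close>

lemma coeff_ray_mult_eq_0:
  assumes f: "coeff (ray v f) 0 = 0" "coeff (ray v f) 1 = 0" and g: "g \<in> Ge n"
  shows "coeff (ray v (f * g)) (Suc n) = 0"
  unfolding ray_mult coeff_mult
proof (intro sum.neutral ballI)
  fix i assume "i \<in> {..Suc n}"
  show "coeff (ray v f) i * coeff (ray v g) (Suc n - i) = 0"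
  proof (cases "i \<le> 1")
    case True
    hence "i = 0 \<or> i = 1" by auto
    thus ?thesis using f by auto
  next
    case False
    hence "Suc n - i < n" using \<open>i \<in> {..Suc n}\<close> by auto
    from coeff_ray_low[OF g this] show ?thesis by simp
  qed
qed

lemma coeff_ray_linform_sum:
  fixes v :: "'v::finite \<Rightarrow> 'k::field"
  shows "coeff (ray v (\<Sum>i=1..d. linform (b i) * r i)) 0 = 0"
  "coeff (ray v (\<Sum>i=1..d. linform (b i) * r i)) 1
    = (\<Sum>i=1..d. (\<Sum>x\<in>UNIV. b i x * v x) * Poly_Mapping.lookup (r i) 0)"
proof -
  have "ray v (\<Sum>i=1..d. linform (b i) * r i) = (\<Sum>i=1..d. monom (\<Sum>x\<in>UNIV. b i x * v x) 1 * ray v (r i))"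
    unfolding ray_sum ray_mult ray_linform ..
  moreover have "monom c 1 * q = pCons 0 (smult c q)" for c :: 'k and q
    by (simp add: monom_Suc monom_0)
  ultimately have eq: "ray v (\<Sum>i=1..d. linform (b i) * r i) = (\<Sum>i=1..d. pCons 0 (smult (\<Sum>x\<in>UNIV. b i x * v x) (ray v (r i))))"
    by simp
  show "coeff (ray v (\<Sum>i=1..d. linform (b i) * r i)) 0 = 0"
    unfolding eq coeff_sum by (intro sum.neutral) simp
  show "coeff (ray v (\<Sum>i=1..d. linform (b i) * r i)) 1
    = (\<Sum>i=1..d. (\<Sum>x\<in>UNIV. b i x * v x) * Poly_Mapping.lookup (r i) 0)"
    unfolding eq coeff_sum by (intro sum.cong refl) (simp add: coeff_ray_0)
qed

text \<open>On a face with \<open>d\<close> vertices the \<open>d\<close> forms give an injective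
  square system. A functional \<open>u\<close> vanishing on its image would make one equation
  redundant, and the remaining d - 1 equations in d unknowns would have a nontrivial
  solution.\<close>

lemma spanning_surjective:
  fixes b :: "nat \<Rightarrow> 'v::finite \<Rightarrow> 'k::field"
  assumes span: "spanning \<Delta> d b" and F: "F \<in> \<Delta>" "card F = d"
  shows "\<exists>v. (\<forall>x. x \<notin> F \<longrightarrow> v x = 0) \<and> (\<forall>i\<in>{1..d}. (\<Sum>x\<in>UNIV. b i x * v x) = w i)"
proof -
  define ev where "ev v i = (\<Sum>x\<in>UNIV. b i x * v x)" for v i
  define V where "V = {v :: 'v \<Rightarrow> 'k. \<forall>x. x \<notin> F \<longrightarrow> v x = 0}"
  have "(\<forall>g. \<exists>w\<in>ev ` V. \<forall>t\<in>{1..d}. w t = g t) \<or>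
    (\<exists>u. (\<exists>t\<in>{1..d}. u t \<noteq> 0) \<and> (\<forall>w\<in>ev ` V. (\<Sum>t\<in>{1..d}. u t * w t) = 0))"
  proof (rule full_or_orthogonal)
    have "ev (\<lambda>_. 0) = (\<lambda>_. 0)" by (simp add: ev_def fun_eq_iff)
    moreover have "(\<lambda>_. 0) \<in> V" by (simp add: V_def)
    ultimately show "(\<lambda>_. 0) \<in> ev ` V" by (metis imageI)
    show "(\<lambda>t. f t + g t) \<in> ev ` V" if fg: "f \<in> ev ` V" "g \<in> ev ` V" for f g
    proof -
      obtain v v' where v: "f = ev v" "g = ev v'" "v \<in> V" "v' \<in> V" using fg by blast
      have "(\<lambda>t. f t + g t) = ev (\<lambda>x. v x + v' x)" by (simp add: v ev_def fun_eq_iff distrib_left sum.distrib)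
      moreover have "(\<lambda>x. v x + v' x) \<in> V" using v by (simp add: V_def)
      ultimately show ?thesis by (metis imageI)
    qed
    show "(\<lambda>t. c * f t) \<in> ev ` V" if fV: "f \<in> ev ` V" for c f
    proof -
      obtain v where v: "f = ev v" "v \<in> V" using fV by blast
      have "(\<lambda>t. c * f t) = ev (\<lambda>x. c * v x)" by (simp add: v ev_def fun_eq_iff sum_distrib_left mult.left_commute)
      moreover have "(\<lambda>x. c * v x) \<in> V" using v by (simp add: V_def)
      ultimately show ?thesis by (metis imageI)
    qed
  qed simp
  thus ?thesis
  proof
    assume full: "\<forall>g. \<exists>w\<in>ev ` V. \<forall>t\<in>{1..d}. w t = g t"
    obtain v where "v \<in> V" "\<forall>t\<in>{1..d}. ev v t = w t" using full[rule_format, of w] by blast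
    thus ?thesis unfolding ev_def V_def by blast
  next
    assume "\<exists>u. (\<exists>t\<in>{1..d}. u t \<noteq> 0) \<and> (\<forall>w\<in>ev ` V. (\<Sum>t\<in>{1..d}. u t * w t) = 0)"
    then obtain u j where u: "j \<in> {1..d}" "u j \<noteq> 0" "\<And>v. v \<in> V \<Longrightarrow> (\<Sum>t\<in>{1..d}. u t * ev v t) = 0" by blast
    have less: "card ({1..d} - {j}) < card F" using u(1) F(2) by simp
    obtain c where c: "\<exists>x\<in>F. c x \<noteq> 0" "\<forall>i\<in>{1..d}-{j}. (\<Sum>x\<in>F. c x * b i x) = 0"
      using underdetermined_system[OF _ _ less, of "\<lambda>x i. b i x"] by auto
    define v where "v x = (if x \<in> F then c x else 0)" for x
    have vV: "v \<in> V" by (simp add: V_def v_def)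
    have ev: "ev v i = (\<Sum>x\<in>F. c x * b i x)" for i
      unfolding ev_def by (intro sum.mono_neutral_cong_right) (auto simp: v_def)
    have z: "ev v i = 0" if "i \<in> {1..d} - {j}" for i using c(2) that unfolding ev by blast
    have "(\<Sum>t\<in>{1..d}. u t * ev v t) = u j * ev v j"
      using u(1) z by (subst sum.remove[of _ j]) (auto intro!: sum.neutral)
    hence "ev v j = 0" using u(2) u(3)[OF vV] by simp
    hence "\<forall>i\<in>{1..d}. ev v i = 0" using z by blast
    hence "\<forall>x. v x = 0" using span F(1) vV unfolding spanning_def ev_def V_def by blast
    moreover obtain x where "x \<in> F" "c x \<noteq> 0" using c(1) by blast
    ultimately have False using v_def[of x] by simp
    thus ?thesis ..
  qed
qed

context stanley_reisner
begin

lemma ideal_MM_pow: "J \<cdot> (MM 1 [^]\<^bsub>ideals_set R\<^esub> n) = MM 1 [^]\<^bsub>ideals_set R\<^esub> (n + 1) \<longleftrightarrow> J \<cdot> MM n = MM (Suc n)"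
  unfolding MM_pow by simp

lemma prod_MM_mono:
  assumes J: "ideal J R" and eq: "J \<cdot> MM n = MM (Suc n)" and "n \<le> m"
  shows "J \<cdot> MM m = MM (Suc m)"
proof -
  obtain k where m: "m = n + k" using le_Suc_ex[OF assms(3)] by blast
  have "J \<cdot> MM m = J \<cdot> (MM n \<cdot> MM k)" unfolding m MM_prod ..
  also have "\<dots> = (J \<cdot> MM n) \<cdot> MM k" by (rule ideal_prod_assoc[OF J ideal_MM ideal_MM, symmetric])
  also have "\<dots> = MM (Suc m)" unfolding eq MM_prod m by simp
  finally show ?thesis .
qed

text \<open>A smaller reduction contains elements with arbitrary linear parts, since otherwise all its
  linear parts would vanish at a common point of a facet.\<close>

lemma linear_reduction_minimal:
  fixes b :: "nat \<Rightarrow> 'v \<Rightarrow> 'k"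
  assumes span: "spanning \<Delta> d b" and F: "F \<in> \<Delta>" "card F = d"
    and K: "ideal K R" "K \<subseteq> Idl ((\<lambda>i. \<pi> (linform (b i))) ` {1..d})" "K \<cdot> MM n = MM (Suc n)"
  shows "K = Idl ((\<lambda>i. \<pi> (linform (b i))) ` {1..d})"
proof
  let ?J = "Idl ((\<lambda>i. \<pi> (linform (b i))) ` {1..d})"
  let ?lb = "\<lambda>i. linform (b i)"
  have P: "idealset (pre K)" by (rule idealset_pre[OF K(1)])
  \<comment> \<open>The constant terms of the cofactors when elements of \<open>K\<close> are
    written through the forms; these are the linear parts of \<open>K\<close> in the coordinates of
    the forms.\<close>
  define W where "W = {c. \<exists>f r. f \<in> pre K \<and> f - (\<Sum>i=1..d. ?lb i * r i) \<in> nonfaces \<Delta> \<and>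
      (\<forall>i. c i = Poly_Mapping.lookup (r i) 0)}"
  have W_I: "(\<lambda>i. Poly_Mapping.lookup (r i) 0) \<in> W" if "f \<in> pre K" "f - (\<Sum>i=1..d. ?lb i * r i) \<in> nonfaces \<Delta>" for f r
    unfolding W_def using that by blast
  have W_E: "\<exists>f r. f \<in> pre K \<and> f - (\<Sum>i=1..d. ?lb i * r i) \<in> nonfaces \<Delta> \<and> c = (\<lambda>i. Poly_Mapping.lookup (r i) 0)"
    if "c \<in> W" for c
    using that unfolding W_def fun_eq_iff by blast
  have "(\<forall>g. \<exists>w\<in>W. \<forall>t\<in>{1..d}. w t = g t) \<or>
    (\<exists>u. (\<exists>t\<in>{1..d}. u t \<noteq> 0) \<and> (\<forall>w\<in>W. (\<Sum>t\<in>{1..d}. u t * w t) = 0))"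
  proof (rule full_or_orthogonal)
    have "(0 :: ('v, 'k) mpoly) - (\<Sum>i=1..d. ?lb i * 0) \<in> nonfaces \<Delta>" by (simp add: mon_ideal_0)
    from W_I[OF idealset_0[OF P] this] show "(\<lambda>_. 0) \<in> W" by simp
    show "(\<lambda>t. c t + c' t) \<in> W" if cc: "c \<in> W" "c' \<in> W" for c c'
    proof -
      obtain f r where f: "f \<in> pre K" "f - (\<Sum>i=1..d. ?lb i * r i) \<in> nonfaces \<Delta>" "c = (\<lambda>i. Poly_Mapping.lookup (r i) 0)"
        using W_E[OF cc(1)] by blast
      obtain g s where g: "g \<in> pre K" "g - (\<Sum>i=1..d. ?lb i * s i) \<in> nonfaces \<Delta>" "c' = (\<lambda>i. Poly_Mapping.lookup (s i) 0)"
        using W_E[OF cc(2)] by blast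
      have eq: "f + g - (\<Sum>i=1..d. ?lb i * (r i + s i)) = (f - (\<Sum>i=1..d. ?lb i * r i)) + (g - (\<Sum>i=1..d. ?lb i * s i))"
        by (simp add: distrib_left sum.distrib)
      have "f + g - (\<Sum>i=1..d. ?lb i * (r i + s i)) \<in> nonfaces \<Delta>" unfolding eq by (rule mon_ideal_add[OF f(2) g(2)])
      from W_I[OF idealset_add[OF P f(1) g(1)] this] show ?thesis unfolding f(3) g(3) lookup_add .
    qed
    show "(\<lambda>t. z * c t) \<in> W" if cW: "c \<in> W" for z c
    proof -
      let ?z = "Poly_Mapping.single 0 z :: ('v, 'k) mpoly"
      obtain f r where f: "f \<in> pre K" "f - (\<Sum>i=1..d. ?lb i * r i) \<in> nonfaces \<Delta>" "c = (\<lambda>i. Poly_Mapping.lookup (r i) 0)"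
        using W_E[OF cW] by blast
      have eq: "?z * f - (\<Sum>i=1..d. ?lb i * (?z * r i)) = ?z * (f - (\<Sum>i=1..d. ?lb i * r i))"
        by (simp add: right_diff_distrib sum_distrib_left mult.left_commute)
      have "?z * f - (\<Sum>i=1..d. ?lb i * (?z * r i)) \<in> nonfaces \<Delta>" unfolding eq by (rule scale_mon_ideal[OF f(2)])
      from W_I[OF idealset_mult[OF P f(1)] this] show ?thesis unfolding f(3) lookup_scale .
    qed
  qed simp
  hence full: "\<forall>g. \<exists>w\<in>W. \<forall>t\<in>{1..d}. w t = g t"
  proof
    assume "\<exists>u. (\<exists>t\<in>{1..d}. u t \<noteq> 0) \<and> (\<forall>w\<in>W. (\<Sum>t\<in>{1..d}. u t * w t) = 0)"
    then obtain u j where u: "j \<in> {1..d}" "u j \<noteq> 0" "\<And>w. w \<in> W \<Longrightarrow> (\<Sum>t\<in>{1..d}. u t * w t) = 0" by blast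
    \<comment> \<open>A point of \<open>F\<close> at which the forms take the values
      \<open>u i\<close>. By orthogonality the linear part of every element of \<open>K\<close>
      vanishes there, so products with \<mm>^n vanish in degree \<open>Suc n\<close> along this
      line, although \<mm>^(n+1) contains all pure powers.\<close>
    obtain v where v: "\<And>x. x \<notin> F \<Longrightarrow> v x = 0" "\<And>i. i \<in> {1..d} \<Longrightarrow> (\<Sum>x\<in>UNIV. b i x * v x) = u i"
      using spanning_surjective[OF span F, of u] by blast
    have ray_eq: "ray v f = ray v g" if "f - g \<in> nonfaces \<Delta>" for f g
      using ray_nonfaces[OF complex F(1) v(1) that] by (simp add: ray_diff)
    have Kcoeff: "Polynomial.coeff (ray v f) 0 = 0 \<and> Polynomial.coeff (ray v f) 1 = 0" if f: "f \<in> pre K" for f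
    proof -
      have "f \<in> pre ?J" using f K(2) unfolding pre_def by blast
      then obtain r where r: "f - (\<Sum>i=1..d. ?lb i * r i) \<in> nonfaces \<Delta>" unfolding pre_Idl_image ker_eq by blast
      have "(\<Sum>i=1..d. (\<Sum>x\<in>UNIV. b i x * v x) * Poly_Mapping.lookup (r i) 0) = (\<Sum>i=1..d. u i * Poly_Mapping.lookup (r i) 0)"
        by (intro sum.cong refl) (simp add: v(2))
      also have "\<dots> = 0" using u(3)[OF W_I[OF f r]] .
      finally have s0: "(\<Sum>i=1..d. (\<Sum>x\<in>UNIV. b i x * v x) * Poly_Mapping.lookup (r i) 0) = 0" .
      show ?thesis
        unfolding ray_eq[OF r] coeff_ray_linform_sum s0 by (intro conjI refl)
    qed
    have vanish: "Polynomial.coeff (ray v f) (Suc n) = 0" if f: "\<pi> f \<in> K \<cdot> MM n" for f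
    proof -
      have "\<forall>f. z = \<pi> f \<longrightarrow> Polynomial.coeff (ray v f) (Suc n) = 0" if "z \<in> K \<cdot> MM n" for z
        using that
      proof (induction z rule: ideal_prod.induct)
        case (prod i j)
        obtain g where g: "i = \<pi> g" using prod(1) ideal_subset_carrier[OF K(1)] unfolding h_surj by blast
        obtain h where h: "j = \<pi> h" "h \<in> Ge n" using prod(2) unfolding MM_def by blast
        have gK: "g \<in> pre K" using prod(1) g by simp
        show ?case
        proof (intro allI impI)
          fix f assume "i \<otimes> j = \<pi> f"
          hence "f - g * h \<in> nonfaces \<Delta>" unfolding g h(1) h_mult[symmetric] \<pi>_eq_iff[symmetric] by (rule sym)
          from ray_eq[OF this] show "Polynomial.coeff (ray v f) (Suc n) = 0"
            using coeff_ray_mult_eq_0[OF _ _ h(2), of v g] Kcoeff[OF gK] by (simp only:)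
        qed
      next
        case (sum s1 s2)
        have KM: "K \<cdot> MM n \<subseteq> carrier R" by (rule ideal_prod_in_carrier[OF K(1) ideal_MM])
        obtain f1 f2 where f12: "s1 = \<pi> f1" "s2 = \<pi> f2" using sum.hyps KM unfolding h_surj by blast
        show ?case
        proof (intro allI impI)
          fix f assume "s1 \<oplus> s2 = \<pi> f"
          hence "f - (f1 + f2) \<in> nonfaces \<Delta>" unfolding f12 h_add[symmetric] \<pi>_eq_iff[symmetric] by (rule sym)
          from ray_eq[OF this] have "ray v f = ray v f1 + ray v f2" by (simp only: ray_add)
          thus "Polynomial.coeff (ray v f) (Suc n) = 0" using sum.IH f12 by (simp add: coeff_add)
        qed
      qed
      thus ?thesis using f by blast
    qed
    have "v x = 0" for x
    proof -
      let ?m = "Poly_Mapping.single (Poly_Mapping.single x (Suc n)) 1 :: ('v, 'k) mpoly"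
      have "?m \<in> Ge (Suc n)" by (rule single_mon_ideal) simp
      hence "\<pi> ?m \<in> K \<cdot> MM n" unfolding K(3) by (rule Ge_MM)
      hence "Polynomial.coeff (ray v ?m) (Suc n) = 0" by (rule vanish)
      hence "v x ^ Suc n = 0" unfolding ray_single mval_single by (simp add: coeff_monom)
      thus ?thesis by auto
    qed
    hence "u j = 0" using v(2)[OF u(1)] by simp
    thus ?thesis using u(2) by blast
  qed
  show "K \<subseteq> ?J" by (rule K(2))
  have gens: "(\<lambda>i. \<pi> (?lb i)) ` {1..d} \<subseteq> carrier R" by (rule image_subsetI) (rule h_closed)
  \<comment> \<open>The ideal \<open>K\<close> plus the forms times \<mm>^m, on the level of
    polynomials.\<close>
  let ?S = "\<lambda>m. {f. \<exists>k c. k \<in> pre K \<and> c \<in> Cov d ?lb m \<and> f = k + c}"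
  have S: "idealset (?S m)" for m
    unfolding idealset_def
  proof (intro conjI ballI allI)
    show "0 \<in> ?S m" using idealset_0[OF P] idealset_0[OF idealset_Cov] by (intro CollectI exI[of _ 0]) simp
    show "f + g \<in> ?S m" if fg: "f \<in> ?S m" "g \<in> ?S m" for f g
    proof -
      obtain k c where 1: "k \<in> pre K" "c \<in> Cov d ?lb m" "f = k + c" using fg(1) by blast
      obtain k' c' where 2: "k' \<in> pre K" "c' \<in> Cov d ?lb m" "g = k' + c'" using fg(2) by blast
      have "f + g = (k + k') + (c + c')" using 1 2 by simp
      thus ?thesis using idealset_add[OF P 1(1) 2(1)] idealset_add[OF idealset_Cov 1(2) 2(2)] by blast
    qed
    show "r * f \<in> ?S m" if fS: "f \<in> ?S m" for f r
    proof -
      obtain k c where 1: "k \<in> pre K" "c \<in> Cov d ?lb m" "f = k + c" using fS by blast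
      have "r * f = r * k + r * c" using 1 by (simp add: distrib_left)
      thus ?thesis using idealset_mult[OF P 1(1)] idealset_mult[OF idealset_Cov 1(2)] by blast
    qed
  qed
  have Cov_I: "?lb i * g \<in> Cov d ?lb m" if i: "i \<in> {1..d}" and g: "g \<in> Ge m" for i g m
  proof -
    define g' where "g' j = (if j = i then g else 0)" for j
    have "(\<Sum>j=1..d. ?lb j * g' j) = (\<Sum>j=1..d. if j = i then ?lb i * g else 0)"
      by (intro sum.cong refl) (simp add: g'_def)
    also have "\<dots> = ?lb i * g" using i by simp
    finally have "?lb i * g - (\<Sum>j=1..d. ?lb j * g' j) \<in> nonfaces \<Delta>" by (simp add: mon_ideal_0)
    moreover have "g' j \<in> Ge m" for j using g by (simp add: g'_def mon_ideal_0)
    ultimately show ?thesis unfolding Cov_def covered_def by blast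
  qed
  \<comment> \<open>\<open>K\<close> contains an element whose cofactor at \<open>i\<close> has
    constant term 1 and whose other cofactors have constant term 0; it differs from the i-th form by
    combinations of the forms with cofactors in \<mm>.\<close>
  have base: "?lb i \<in> ?S 1" if i: "i \<in> {1..d}" for i
  proof -
    obtain w where w: "w \<in> W" "\<forall>t\<in>{1..d}. w t = (if t = i then 1 else 0)"
      using full[rule_format, of "\<lambda>t. if t = i then 1 else 0"] by (elim bexE)
    obtain f r where f: "f \<in> pre K" "f - (\<Sum>j=1..d. ?lb j * r j) \<in> nonfaces \<Delta>" "w = (\<lambda>i. Poly_Mapping.lookup (r i) 0)"
      using W_E[OF w(1)] by blast
    define s where "s j = (if j \<in> {1..d} then (if j = i then 1 else 0) - r j else 0)" for j
    have s: "s j \<in> Ge 1" for j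
    proof (cases "j \<in> {1..d}")
      case True
      hence "Poly_Mapping.lookup (r j) 0 = (if j = i then 1 else 0)" using w(2) unfolding f(3) by blast
      hence "Poly_Mapping.lookup (s j) 0 = 0" using True by (simp add: s_def lookup_minus lookup_one when_def)
      thus ?thesis unfolding Ge_1_eq mon_ideal_iff by auto
    next
      case False
      hence "s j = 0" unfolding s_def by (rule if_not_P)
      thus ?thesis by (simp only: mon_ideal_0)
    qed
    have "(\<Sum>j=1..d. ?lb j * s j) = (\<Sum>j=1..d. (if j = i then ?lb i else 0) - ?lb j * r j)"
      by (intro sum.cong refl) (auto simp: s_def right_diff_distrib)
    also have "\<dots> = ?lb i - (\<Sum>j=1..d. ?lb j * r j)" using i by (simp add: sum_subtractf)
    finally have "(?lb i - f) - (\<Sum>j=1..d. ?lb j * s j) = - (f - (\<Sum>j=1..d. ?lb j * r j))" by simp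
    hence "(?lb i - f) - (\<Sum>j=1..d. ?lb j * s j) \<in> nonfaces \<Delta>" using mon_ideal_uminus[OF f(2)] by (simp only:)
    hence "?lb i - f \<in> Cov d ?lb 1" unfolding Cov_def covered_def using s by blast
    moreover have "?lb i = f + (?lb i - f)" by simp
    ultimately show ?thesis using f(1) by blast
  qed
  have step: "Cov d ?lb m \<subseteq> ?S (Suc m)" for m
  proof
    fix f assume "f \<in> Cov d ?lb m"
    then obtain g where g: "\<forall>i. g i \<in> Ge m" "f - (\<Sum>i=1..d. ?lb i * g i) \<in> nonfaces \<Delta>"
      unfolding Cov_def covered_def by blast
    have "(\<Sum>i=1..d. ?lb i * g i) \<in> ?S (Suc m)"
    proof (rule idealset_sum[OF S])
      fix i assume "i \<in> {1..d}"
      then obtain k c where kc: "k \<in> pre K" "c \<in> Cov d ?lb 1" "?lb i = k + c" using base by blast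
      have "c * g i \<in> Cov d ?lb (Suc m)"
      proof -
        have "\<pi> c \<otimes> \<pi> (g i) \<in> (\<pi> ` Cov d ?lb 1) \<cdot> MM m"
          using kc(2) Ge_MM[OF g(1)[rule_format]] by (intro ideal_prod.prod) auto
        hence "\<pi> (c * g i) \<in> \<pi> ` Cov d ?lb (Suc m)" using Cov_prod_MM[of d ?lb 1 m] unfolding h_mult by auto
        hence "c * g i \<in> pre (\<pi> ` Cov d ?lb (Suc m))" by simp
        thus ?thesis unfolding pre_Cov .
      qed
      moreover have "k * g i \<in> pre K" by (rule idealset_mult_right[OF P kc(1)])
      moreover have "?lb i * g i = k * g i + c * g i" unfolding kc(3) by (rule distrib_right)
      ultimately show "?lb i * g i \<in> ?S (Suc m)" by blast
    qed
    moreover have "f - (\<Sum>i=1..d. ?lb i * g i) \<in> ?S (Suc m)"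
    proof -
      have "f - (\<Sum>i=1..d. ?lb i * g i) \<in> pre K" using g(2) ker_pre[OF K(1)] unfolding ker_eq by blast
      moreover have "f - (\<Sum>i=1..d. ?lb i * g i) = (f - (\<Sum>i=1..d. ?lb i * g i)) + 0" by simp
      ultimately show ?thesis using idealset_0[OF idealset_Cov] by blast
    qed
    ultimately have "(f - (\<Sum>i=1..d. ?lb i * g i)) + (\<Sum>i=1..d. ?lb i * g i) \<in> ?S (Suc m)"
      by (intro idealset_add[OF S])
    thus "f \<in> ?S (Suc m)" by (simp only: diff_add_cancel)
  qed
  \<comment> \<open>Nakayama by iteration: the error moves into ever higher powers of \<mm>, until
    it lies in \<mm>^(n+2), hence in \<mm>^(n+1), which equals K \<mm>^n and is contained in
    \<open>K\<close>.\<close>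
  have all: "?lb i \<in> ?S (Suc m)" if i: "i \<in> {1..d}" for i m
  proof (induction m)
    case 0
    show ?case using base[OF i] by simp
  next
    case (Suc m)
    then obtain k c where kc: "k \<in> pre K" "c \<in> Cov d ?lb (Suc m)" "?lb i = k + c" by blast
    have "c \<in> ?S (Suc (Suc m))" using step kc(2) by blast
    then obtain k' c' where kc': "k' \<in> pre K" "c' \<in> Cov d ?lb (Suc (Suc m))" "c = k' + c'" by blast
    have "?lb i = (k + k') + c'" unfolding kc(3) kc'(3) by (simp only: add.assoc)
    thus ?case using idealset_add[OF P kc(1) kc'(1)] kc'(2) by blast
  qed
  have lb_Ge: "?lb i \<in> Ge 1" for i by (rule homog_Ge[OF linform_homog])
  have "\<pi> (?lb i) \<in> K" if i: "i \<in> {1..d}" for i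
  proof -
    obtain k c where kc: "k \<in> pre K" "c \<in> Cov d ?lb (Suc n)" "?lb i = k + c" using all[OF i] by blast
    have "\<pi> c \<in> MM (Suc (Suc n))" using Cov_MM[of d ?lb "Suc n"] kc(2) lb_Ge by blast
    hence "\<pi> c \<in> K \<cdot> MM n" using MM_mono[of "Suc n" "Suc (Suc n)"] unfolding K(3) by auto
    hence "\<pi> c \<in> K" using ideal_prod_inter[OF K(1) ideal_MM] by blast
    hence "k + c \<in> pre K" using kc(1) by (intro idealset_add[OF P]) simp_all
    thus ?thesis unfolding kc(3) by simp
  qed
  hence "(\<lambda>i. \<pi> (?lb i)) ` {1..d} \<subseteq> K" by blast
  thus "?J \<subseteq> K" by (rule genideal_minimal[OF K(1)])
qed

end

section \<open>The Cohen-Macaulay case\<close>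

locale cm_stanley_reisner = stanley_reisner \<Delta> R
  for \<Delta> :: "'v::{finite,linorder} set set" and R :: "('v, 'k::field) mpoly set ring" (structure) +
  fixes d :: nat
  assumes CM: "cohen_macaulay R" and dim: "krull_dim R = enat d"
begin

lemmas face_card = krull_dim_complex(1)[OF dim]
lemmas d_pos = krull_dim_complex(4)[OF dim]

lemma covers_iff:
  fixes b :: "nat \<Rightarrow> 'v \<Rightarrow> 'k"
  assumes "spanning \<Delta> d b" "d \<le> n"
  shows "covers \<Delta> d b n \<longleftrightarrow> n \<noteq> d \<or> eulerian \<Delta>"
  using covers_iff_of_koszul_exact[OF complex face_card d_pos assms(2) koszul_exact_of_cohen_macaulay[OF CM dim assms(1)]]
  unfolding eulerian_iff[OF complex] .

text \<open>That some power is covered at all makes the linear parts of the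
  \<open>\<alpha> i\<close> spanning. Then all degrees above \<open>d\<close> are covered by the
  linear parts, and degree \<open>d\<close> is the one in which the Euler characteristic
  decides.\<close>

lemma gcovers_iff_eulerian:
  fixes \<alpha> :: "nat \<Rightarrow> ('v, 'k) mpoly"
  assumes \<alpha>: "\<And>i. i \<in> {1..d} \<Longrightarrow> \<alpha> i \<in> Ge 1" and top: "gcovers \<Delta> d \<alpha> M" "M \<ge> 1"
  shows "gcovers \<Delta> d \<alpha> d \<longleftrightarrow> eulerian \<Delta>"
proof -
  have span: "spanning \<Delta> d (\<lambda>i. linpart (\<alpha> i))"
    by (rule spanning_of_covers[OF complex gcovers_imp_covers[where a = \<alpha> and d = d, OF \<alpha> top(2,1)] top(2)])
  have d1: "d \<ge> 1" using d_pos by simp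
  show ?thesis
  proof
    assume "gcovers \<Delta> d \<alpha> d"
    from gcovers_imp_covers[where a = \<alpha> and d = d, OF \<alpha> d1 this]
    have "covers \<Delta> d (\<lambda>i. linpart (\<alpha> i)) d" .
    thus "eulerian \<Delta>" using covers_iff[OF span order_refl] by simp
  next
    assume e: "eulerian \<Delta>"
    show "gcovers \<Delta> d \<alpha> d"
      by (rule gcovers_descend[where a = \<alpha> and d = d, OF \<alpha> complex _ top(1) d1]) (use covers_iff[OF span] e in blast)+
  qed
qed

text \<open>The second claim comes from \<open>covers_of_spanning\<close> and is independent of the
  Euler characteristic; the same bound supplies the covered power on which the first claim
  rests.\<close>

lemma linear_Idl_MM_iff:
  fixes b :: "nat \<Rightarrow> 'v \<Rightarrow> 'k"
  assumes span: "spanning \<Delta> d b"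
  shows "(Idl ((\<lambda>i. \<pi> (linform (b i))) ` {1..d})) \<cdot> MM (d - 1) = MM d \<longleftrightarrow> eulerian \<Delta>"
    and "card (UNIV :: 'v set) \<le> n \<Longrightarrow> (Idl ((\<lambda>i. \<pi> (linform (b i))) ` {1..d})) \<cdot> MM n = MM (Suc n)"
proof -
  have lb: "linform (b i) \<in> Ge 1" for i by (rule homog_Ge[OF linform_homog])
  have big: "gcovers \<Delta> d (\<lambda>i. linform (b i)) (Suc n)" if "card (UNIV :: 'v set) \<le> n" for n
    by (rule gcovers_of_covers) (rule covers_of_spanning[OF complex span], use that in simp)
  show "(Idl ((\<lambda>i. \<pi> (linform (b i))) ` {1..d})) \<cdot> MM n = MM (Suc n)" if "card (UNIV :: 'v set) \<le> n"
    using Idl_prod_MM_iff[where a = "\<lambda>i. linform (b i)" and d = d, OF lb] big[OF that] by blast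
  have "(Idl ((\<lambda>i. \<pi> (linform (b i))) ` {1..d})) \<cdot> MM (d - 1) = MM (Suc (d - 1)) \<longleftrightarrow> gcovers \<Delta> d (\<lambda>i. linform (b i)) (Suc (d - 1))"
    by (rule Idl_prod_MM_iff[where a = "\<lambda>i. linform (b i)" and d = d, OF lb])
  also have "Suc (d - 1) = d" using d_pos by simp
  finally show "(Idl ((\<lambda>i. \<pi> (linform (b i))) ` {1..d})) \<cdot> MM (d - 1) = MM d \<longleftrightarrow> eulerian \<Delta>"
    using gcovers_iff_eulerian[where \<alpha> = "\<lambda>i. linform (b i)", OF lb big[OF order_refl]] by simp
qed

text \<open>A minimal reduction attaining the bound has at most \<open>d\<close> generators and is
  padded to \<open>d\<close> by elements of itself. The equation J \<mm>^r = \<mm>^(r+1) persists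
  for larger exponents, so it holds at \<open>d - 1\<close>, where
  \<open>gcovers_iff_eulerian\<close> decides.\<close>

lemma eulerian_of_reduction_number:
  assumes "reduction_number R (MM 1) \<le> enat (d - 1)"
  shows "eulerian \<Delta>"
proof -
  let ?S = "(\<lambda>J. enat (reduction_number_wrt R J (MM 1))) ` {J. minimal_reduction R J (MM 1)}"
  \<comment> \<open>The infimum of the empty set would be infinite; a nonempty set of extended
    naturals contains its infimum.\<close>
  have "?S \<noteq> {}"
  proof
    assume "?S = {}"
    hence "reduction_number R (MM 1) = \<infinity>" unfolding reduction_number_def by (simp only: Inf_empty top_enat_def)
    thus False using assms by simp
  qed
  hence "Inf ?S \<in> ?S" by (metis all_not_in_conv wellorder_InfI)
  then obtain J where J: "minimal_reduction R J (MM 1)" "reduction_number_wrt R J (MM 1) \<le> d - 1"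
    using assms unfolding reduction_number_def by auto
  have red: "is_reduction R J (MM 1)" using J(1) by (simp add: minimal_reduction_def)
  have JI: "ideal J R" and JM: "J \<subseteq> MM 1" using red by (auto simp: is_reduction_def)
  define r where "r = reduction_number_wrt R J (MM 1)"
  have "\<exists>n :: nat. J \<cdot> (MM 1 [^]\<^bsub>ideals_set R\<^esub> n) = MM 1 [^]\<^bsub>ideals_set R\<^esub> (n + 1)"
    using red unfolding is_reduction_def by (elim conjE)
  hence "J \<cdot> (MM 1 [^]\<^bsub>ideals_set R\<^esub> r) = MM 1 [^]\<^bsub>ideals_set R\<^esub> (r + 1)"
    unfolding r_def reduction_number_wrt_def by (rule LeastI_ex)
  hence "J \<cdot> MM r = MM (Suc r)" unfolding ideal_MM_pow .
  moreover have "r \<le> d - 1" using J(2) by (simp add: r_def)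
  ultimately have Jd: "J \<cdot> MM (d - 1) = MM (Suc (d - 1))" by (rule prod_MM_mono[OF JI])
  obtain A where A: "A \<subseteq> carrier R" "finite A" "card A \<le> d" "J = Idl A"
    using J(1) unfolding minimal_reduction_def dim by auto
  obtain xs where xs: "set xs = A" "distinct xs" using finite_distinct_list[OF A(2)] by blast
  have len: "length xs \<le> d" using A(3) xs distinct_card by metis
  have AJ: "A \<subseteq> J" unfolding A(4) by (rule genideal_self[OF A(1)])
  have "\<forall>i. \<exists>f. f \<in> Ge 1 \<and> (i < length xs \<longrightarrow> xs ! i = \<pi> f) \<and> \<pi> f \<in> J"
  proof
    fix i
    show "\<exists>f. f \<in> Ge 1 \<and> (i < length xs \<longrightarrow> xs ! i = \<pi> f) \<and> \<pi> f \<in> J"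
    proof (cases "i < length xs")
      case True
      hence "xs ! i \<in> J" using AJ xs(1) nth_mem by blast
      moreover from this obtain f where "xs ! i = \<pi> f" "f \<in> Ge 1" using JM unfolding MM_def by blast
      ultimately show ?thesis by (intro exI[of _ f]) simp
    next
      case False
      have "0 \<in> pre J" by (rule idealset_0[OF idealset_pre[OF JI]])
      thus ?thesis using False by (intro exI[of _ 0]) (simp add: mon_ideal_0)
    qed
  qed
  then obtain f where f: "\<And>i. f i \<in> Ge 1" "\<And>i. i < length xs \<Longrightarrow> xs ! i = \<pi> (f i)" "\<And>i. \<pi> (f i) \<in> J" by metis
  \<comment> \<open>List positions from 0 become indices from 1. Beyond the length of
    \<open>xs\<close>, \<open>f\<close> is just some element of order at least 1 lying over
    \<open>J\<close>, for which 0 is a witness.\<close>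
  define \<alpha> where "\<alpha> i = f (i - 1)" for i
  let ?G = "(\<lambda>i. \<pi> (\<alpha> i)) ` {1..d}"
  have gens: "?G \<subseteq> carrier R" by (rule image_subsetI) (rule h_closed)
  have "A \<subseteq> ?G"
  proof
    fix x assume "x \<in> A"
    then obtain i where i: "i < length xs" "x = xs ! i" using xs(1) by (metis in_set_conv_nth)
    have "x = \<pi> (\<alpha> (Suc i))" using i f(2) by (simp add: \<alpha>_def)
    moreover have "Suc i \<in> {1..d}" using i(1) len by simp
    ultimately show "x \<in> ?G" by blast
  qed
  hence "A \<subseteq> Idl ?G" using genideal_self[OF gens] by blast
  hence "J \<subseteq> Idl ?G" unfolding A(4) by (rule genideal_minimal[OF genideal_ideal[OF gens]])
  moreover have "?G \<subseteq> J" unfolding \<alpha>_def using f(3) by blast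
  hence "Idl ?G \<subseteq> J" by (rule genideal_minimal[OF JI])
  ultimately have JG: "J = Idl ?G" by (rule antisym)
  have \<alpha>: "\<alpha> i \<in> Ge 1" for i unfolding \<alpha>_def by (rule f(1))
  have "gcovers \<Delta> d \<alpha> (Suc (d - 1))"
    using Jd Idl_prod_MM_iff[where a = \<alpha> and d = d, OF \<alpha>] unfolding JG by blast
  hence "gcovers \<Delta> d \<alpha> d" using d_pos by simp
  moreover have "d \<ge> 1" using d_pos by simp
  ultimately show ?thesis using gcovers_iff_eulerian[where \<alpha> = \<alpha>, OF \<alpha>] by blast
qed

text \<open>The ideal of the given forms is itself a minimal reduction; minimality is tested on a
  face with \<open>d\<close> vertices, and the reduction equation holds at exponent
  \<open>d - 1\<close>.\<close>

lemma reduction_number_of_eulerian: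
  fixes b :: "nat \<Rightarrow> 'v \<Rightarrow> 'k"
  assumes "eulerian \<Delta>" and span: "spanning \<Delta> d b"
  shows "reduction_number R (MM 1) \<le> enat (d - 1)"
proof -
  let ?G = "(\<lambda>i. \<pi> (linform (b i))) ` {1..d}"
  let ?J = "Idl ?G"
  have gens: "?G \<subseteq> carrier R" by (rule image_subsetI) (rule h_closed)
  have JI: "ideal ?J R" by (rule genideal_ideal[OF gens])
  have JM: "?J \<subseteq> MM 1" using apx_spanning[OF span] by (simp add: apx_def)
  have "?J \<cdot> MM (d - 1) = MM d" using linear_Idl_MM_iff(1)[OF span] assms(1) by blast
  hence "?J \<cdot> MM (d - 1) = MM (Suc (d - 1))" using d_pos by simp
  hence eq: "?J \<cdot> (MM 1 [^]\<^bsub>ideals_set R\<^esub> (d - 1)) = MM 1 [^]\<^bsub>ideals_set R\<^esub> (d - 1 + 1)" unfolding ideal_MM_pow .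
  have red: "is_reduction R ?J (MM 1)" unfolding is_reduction_def using JI JM eq by blast
  obtain F where F: "F \<in> \<Delta>" "card F = d" using krull_dim_complex(2)[OF dim] by blast
  have "minimal_reduction R ?J (MM 1)"
    unfolding minimal_reduction_def
  proof (intro conjI allI impI red)
    fix K assume K: "is_reduction R K (MM 1) \<and> K \<subseteq> ?J"
    then obtain n where n: "ideal K R" "K \<cdot> MM n = MM (Suc n)" unfolding is_reduction_def ideal_MM_pow by blast
    show "K = ?J" by (rule linear_reduction_minimal[OF span F n(1) _ n(2)]) (use K in blast)
  next
    have "card ?G \<le> card {1..d}" by (rule card_image_le) simp
    hence "enat (card ?G) \<le> krull_dim R" unfolding dim by simp
    thus "\<exists>A\<subseteq>carrier R. finite A \<and> enat (card A) \<le> krull_dim R \<and> ?J = Idl A"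
      using gens by (intro exI[of _ ?G]) simp
  qed
  hence "reduction_number R (MM 1) \<le> enat (reduction_number_wrt R ?J (MM 1))"
    unfolding reduction_number_def by (intro INF_lower CollectI)
  also have "\<dots> \<le> enat (d - 1)"
    unfolding reduction_number_wrt_def using eq by (simp only: enat_ord_simps) (rule Least_le)
  finally show ?thesis .
qed

text \<open>In high degrees \<open>J\<close> multiplies like \<mm>^k. The I_i themselves may be
  strictly smaller than \<mm>, so products of them are compared with powers of \<mm> only after this
  multiplication; the threshold is that of \<open>covers_of_spanning\<close>.\<close>

definition absorbs :: "('v, 'k) mpoly set set \<Rightarrow> nat \<Rightarrow> bool" where
  "absorbs J k \<longleftrightarrow> ideal J R \<and> (\<forall>n\<ge>card (UNIV :: 'v set). J \<cdot> MM n = MM (n + k))"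

lemma absorbs_prod:
  assumes J: "absorbs J k" and L: "absorbs L l" shows "absorbs (J \<cdot> L) (k + l)"
proof -
  have I: "ideal J R" "ideal L R" using J L by (auto simp: absorbs_def)
  have "(J \<cdot> L) \<cdot> MM n = MM (n + (k + l))" if n: "card (UNIV :: 'v set) \<le> n" for n
  proof -
    have "(J \<cdot> L) \<cdot> MM n = J \<cdot> (L \<cdot> MM n)" by (rule ideal_prod_assoc[OF I ideal_MM])
    also have "L \<cdot> MM n = MM (n + l)" using L n by (simp add: absorbs_def)
    also have "J \<cdot> MM (n + l) = MM (n + l + k)" using J n by (simp add: absorbs_def)
    finally show ?thesis by (simp add: ac_simps)
  qed
  thus ?thesis unfolding absorbs_def using ideal_prod_is_ideal[OF I] by blast
qed

lemma absorbs_carrier: "absorbs (carrier R) 0"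
proof -
  have "carrier R \<cdot> MM n = MM n" for n using MM_prod[of 0 n] unfolding MM_0 by simp
  thus ?thesis unfolding absorbs_def using oneideal by simp
qed

lemma absorbs_pow: "absorbs J k \<Longrightarrow> absorbs (J [^]\<^bsub>ideals_set R\<^esub> (t::nat)) (t * k)"
proof (induction t)
  case 0
  show ?case using absorbs_carrier by (simp add: nat_pow_def)
next
  case (Suc t)
  have "J [^]\<^bsub>ideals_set R\<^esub> Suc t = (J [^]\<^bsub>ideals_set R\<^esub> t) \<cdot> J" by (simp add: nat_pow_def)
  thus ?case using absorbs_prod[OF Suc.IH[OF Suc.prems] Suc.prems] by (simp add: add.commute)
qed

lemma absorbs_finprod:
  assumes "finite A" "\<And>j. j \<in> A \<Longrightarrow> absorbs (K j) 1"
  shows "absorbs (\<Otimes>\<^bsub>ideals_set R\<^esub> j\<in>A. K j) (card A)"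
  using assms
proof (induction A rule: finite_induct)
  case empty
  interpret M: comm_monoid "ideals_set R" by (rule ideals_set_is_comm_monoid)
  show ?case using absorbs_carrier by simp
next
  case (insert j A)
  interpret M: comm_monoid "ideals_set R" by (rule ideals_set_is_comm_monoid)
  have "(\<Otimes>\<^bsub>ideals_set R\<^esub> i\<in>insert j A. K i) = K j \<cdot> (\<Otimes>\<^bsub>ideals_set R\<^esub> i\<in>A. K i)"
    using insert.hyps insert.prems by (subst M.finprod_insert) (auto simp: absorbs_def)
  moreover have "absorbs (K j \<cdot> (\<Otimes>\<^bsub>ideals_set R\<^esub> i\<in>A. K i)) (1 + card A)"
    using insert.prems insert.IH by (intro absorbs_prod) auto
  ultimately show ?case using insert.hyps by simp
qed

end

section \<open>Joint reductions and mixed products of the ideals\<close>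

locale linear_ideals = cm_stanley_reisner \<Delta> R d
  for \<Delta> :: "'v::{finite,linorder} set set" and R :: "('v, 'k::field) mpoly set ring" (structure) and d +
  fixes I :: "nat \<Rightarrow> ('v, 'k) mpoly set set"
  assumes I: "\<And>i. i \<in> {1..d} \<Longrightarrow> \<exists>\<theta>. linear_sop \<Delta> d \<theta> \<and> I i = Idl (\<theta> ` {1..d})"
begin

lemma I_linear:
  assumes "i \<in> {1..d}"
  shows "\<exists>b. spanning \<Delta> d b \<and> I i = Idl ((\<lambda>j. \<pi> (linform (b j))) ` {1..d})"
proof -
  obtain \<theta> where "linear_sop \<Delta> d \<theta>" "I i = Idl (\<theta> ` {1..d})" using I[OF assms] by blast
  thus ?thesis using spanning_of_linear_sop[of d \<theta>] by auto
qed

lemma apx_I: "i \<in> {1..d} \<Longrightarrow> apx (I i) 1"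
  using I_linear[of i] apx_spanning by auto

lemma ideal_I: "i \<in> {1..d} \<Longrightarrow> ideal (I i) R"
  using apx_I unfolding apx_def by blast

lemma absorbs_I: "i \<in> {1..d} \<Longrightarrow> absorbs (I i) 1"
  using I_linear[of i] linear_Idl_MM_iff(2) ideal_I[of i] unfolding absorbs_def by auto

lemma apx_prod_I:
  assumes "A \<subseteq> {1..d}" shows "apx (\<Otimes>\<^bsub>ideals_set R\<^esub> j\<in>A. I j) (card A)"
proof -
  have "apx (\<Otimes>\<^bsub>ideals_set R\<^esub> j\<in>A. I j) (\<Sum>j\<in>A. 1)"
    using assms finite_subset by (intro apx_finprod apx_I) auto
  thus ?thesis by simp
qed

lemma tight_closure_mixed_power:
  assumes "p > 1"
  shows "tight_closure p R (mixed_power R d I s) = MM (\<Sum>i=1..d. s i)"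
proof (rule tight_closure_apx[OF assms])
  have "apx (\<Otimes>\<^bsub>ideals_set R\<^esub> j\<in>{1..d}. I j [^]\<^bsub>ideals_set R\<^esub> s j) (\<Sum>j\<in>{1..d}. s j * 1)"
    by (intro apx_finprod apx_pow apx_I) auto
  thus "apx (mixed_power R d I s) (\<Sum>i=1..d. s i)" unfolding mixed_power_def by simp
qed

text \<open>The reduction equation K P^t = P^(t+1) is multiplied by \<mm>^v, with v the number of
  variables: there products of the I_i act as powers of \<mm>, and K lies in the sum of the a_i
  \<mm>^(d-1). So \<mm>^(v+(t+1)d) lies in the sum of the a_i \<mm>^(v+(t+1)d-1).\<close>

lemma joint_reduction_gcovers:
  assumes "joint_reduction R d a I"
  obtains \<alpha> M where "\<And>i. i \<in> {1..d} \<Longrightarrow> a i = \<pi> (\<alpha> i)" "\<And>i. i \<in> {1..d} \<Longrightarrow> \<alpha> i \<in> Ge 1"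
    "gcovers \<Delta> d \<alpha> M" "M \<ge> 1"
proof -
  let ?P = "\<Otimes>\<^bsub>ideals_set R\<^esub> j\<in>{1..d}. I j"
  let ?Q = "\<lambda>i. \<Otimes>\<^bsub>ideals_set R\<^esub> j\<in>{1..d}-{i}. I j"
  let ?K = "\<Oplus>\<^bsub>ideals_set R\<^esub> i\<in>{1..d}. a i <# ?Q i"
  have aI: "\<And>i. i \<in> {1..d} \<Longrightarrow> a i \<in> I i" and red: "is_reduction R ?K ?P"
    using assms unfolding joint_reduction_def by blast+
  have "\<forall>i. \<exists>f. i \<in> {1..d} \<longrightarrow> f \<in> Ge 1 \<and> a i = \<pi> f"
  proof
    fix i
    show "\<exists>f. i \<in> {1..d} \<longrightarrow> f \<in> Ge 1 \<and> a i = \<pi> f"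
    proof (cases "i \<in> {1..d}")
      case True
      have "a i \<in> MM 1" using aI[OF True] apx_I[OF True] unfolding apx_def by blast
      thus ?thesis unfolding MM_def by blast
    next
      case False
      thus ?thesis by blast
    qed
  qed
  then obtain \<alpha> where \<alpha>: "\<And>i. i \<in> {1..d} \<Longrightarrow> \<alpha> i \<in> Ge 1" "\<And>i. i \<in> {1..d} \<Longrightarrow> a i = \<pi> (\<alpha> i)" by metis
  have apxQ: "apx (?Q i) (d - 1)" if "i \<in> {1..d}" for i
    using apx_prod_I[of "{1..d} - {i}"] that by simp
  have QI: "ideal (?Q i) R" if "i \<in> {1..d}" for i using apxQ[OF that] by (simp add: apx_def)
  interpret M: abelian_monoid "ideals_set R" by (rule abelian_monoid_ideals)
  have K_eq: "?K = (\<Oplus>\<^bsub>ideals_set R\<^esub> i\<in>{1..d}. \<pi> (\<alpha> i) <# ?Q i)"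
    by (rule M.finsum_cong') (use \<alpha>(2) ideal_l_coset[OF QI] in \<open>auto simp del: atLeastAtMost_iff\<close>)
  have KI: "ideal ?K R" using red by (simp add: is_reduction_def)
  have K_sub: "?K \<subseteq> \<pi> ` Cov d \<alpha> (d - 1)"
  proof -
    have preK: "pre ?K = {f. \<exists>g. (\<forall>i\<in>{1..d}. \<pi> (g i) \<in> ?Q i) \<and> f - (\<Sum>i=1..d. \<alpha> i * g i) \<in> nonfaces \<Delta>}"
      unfolding K_eq using finsum_l_cosets[of "{1..d}" ?Q \<alpha>] QI by blast
    have preM: "pre (\<pi> ` Cov d \<alpha> (d - 1)) = {f. \<exists>g. (\<forall>i\<in>{1..d}. \<pi> (g i) \<in> MM (d - 1)) \<and> f - (\<Sum>i=1..d. \<alpha> i * g i) \<in> nonfaces \<Delta>}"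
      unfolding finsum_l_cosets_MM[symmetric] using finsum_l_cosets[of "{1..d}" "\<lambda>_. MM (d - 1)" \<alpha>] ideal_MM by blast
    have "?Q i \<subseteq> MM (d - 1)" if "i \<in> {1..d}" for i using apxQ[OF that] by (simp add: apx_def)
    hence "pre ?K \<subseteq> pre (\<pi> ` Cov d \<alpha> (d - 1))" unfolding preK preM by blast
    thus ?thesis using subset_iff_pre[OF ideal_subset_carrier[OF KI]] by blast
  qed
  obtain t :: nat where t: "?K \<cdot> (?P [^]\<^bsub>ideals_set R\<^esub> t) = ?P [^]\<^bsub>ideals_set R\<^esub> (t + 1)"
    using red unfolding is_reduction_def by blast
  let ?v = "card (UNIV :: 'v set)"
  have P: "absorbs ?P d" using absorbs_finprod[of "{1..d}" I] absorbs_I by simp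
  have Pt: "absorbs (?P [^]\<^bsub>ideals_set R\<^esub> t) (t * d)" and Pt1: "absorbs (?P [^]\<^bsub>ideals_set R\<^esub> (t + 1)) ((t + 1) * d)"
    by (rule absorbs_pow[OF P])+
  have PI: "ideal (?P [^]\<^bsub>ideals_set R\<^esub> t) R" using Pt by (simp add: absorbs_def)
  have "MM (?v + (t + 1) * d) = (?K \<cdot> (?P [^]\<^bsub>ideals_set R\<^esub> t)) \<cdot> MM ?v"
    unfolding t using Pt1 by (simp add: absorbs_def)
  also have "\<dots> = ?K \<cdot> ((?P [^]\<^bsub>ideals_set R\<^esub> t) \<cdot> MM ?v)" by (rule ideal_prod_assoc[OF KI PI ideal_MM])
  also have "(?P [^]\<^bsub>ideals_set R\<^esub> t) \<cdot> MM ?v = MM (?v + t * d)" using Pt by (simp add: absorbs_def)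
  also have "?K \<cdot> MM (?v + t * d) \<subseteq> (\<pi> ` Cov d \<alpha> (d - 1)) \<cdot> MM (?v + t * d)"
  proof (rule ideal_prod_subset[OF ideal_prod_is_ideal[OF ideal_Cov ideal_MM]])
    fix x y assume "x \<in> ?K" "y \<in> MM (?v + t * d)"
    thus "x \<otimes> y \<in> (\<pi> ` Cov d \<alpha> (d - 1)) \<cdot> MM (?v + t * d)" using K_sub by (intro ideal_prod.prod) auto
  qed
  also have "\<dots> \<subseteq> \<pi> ` Cov d \<alpha> (d - 1 + (?v + t * d))" by (rule Cov_prod_MM)
  finally have sub: "MM (?v + (t + 1) * d) \<subseteq> \<pi> ` Cov d \<alpha> (d - 1 + (?v + t * d))" .
  have v: "?v + (t + 1) * d = Suc (d - 1 + (?v + t * d))" using d_pos by simp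
  have "gcovers \<Delta> d \<alpha> (Suc (d - 1 + (?v + t * d)))" unfolding gcovers_iff using sub by (simp only: v)
  thus thesis using that[OF \<alpha>(2,1)] by simp
qed

text \<open>Both sides depend on \<open>s\<close> only through its sum n, and the equation says that
  the a_i \<mm>^(n-1) add up to \<mm>^n. Positive exponents give n >= d, with equality when all are
  1; the larger n follow from n = d by \<open>gcovers_mono\<close>.\<close>

lemma mixed_tight_closure_iff:
  assumes p: "p > 1" and joint: "joint_reduction R d a I"
  shows "eulerian \<Delta> \<longleftrightarrow> (\<forall>s :: nat \<Rightarrow> nat. (\<forall>i \<in> {1..d}. s i \<ge> 1) \<longrightarrow>
        (\<Oplus>\<^bsub>ideals_set R\<^esub> i \<in> {1..d}.
           a i <# tight_closure p R (mixed_power R d I (s(i := s i - 1)))) =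
        tight_closure p R (mixed_power R d I s))"
proof -
  obtain \<alpha> M where \<alpha>: "\<And>i. i \<in> {1..d} \<Longrightarrow> a i = \<pi> (\<alpha> i)" "\<And>i. i \<in> {1..d} \<Longrightarrow> \<alpha> i \<in> Ge 1"
    and top: "gcovers \<Delta> d \<alpha> M" "M \<ge> 1" using joint_reduction_gcovers[OF joint] by blast
  have key: "(\<Oplus>\<^bsub>ideals_set R\<^esub> i \<in> {1..d}. a i <# tight_closure p R (mixed_power R d I (s(i := s i - 1)))) =
        tight_closure p R (mixed_power R d I s) \<longleftrightarrow> gcovers \<Delta> d \<alpha> (\<Sum>i=1..d. s i)"
    if s: "\<forall>i\<in>{1..d}. s i \<ge> 1" for s :: "nat \<Rightarrow> nat"
  proof -
    define n where "n = (\<Sum>i=1..d. s i)"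
    have n_i: "(\<Sum>j=1..d. (s(i := s i - 1)) j) = n - 1 \<and> n \<ge> 1" if i: "i \<in> {1..d}" for i
    proof -
      have "n = s i + (\<Sum>j\<in>{1..d}-{i}. s j)" unfolding n_def using i by (intro sum.remove) auto
      moreover have "(\<Sum>j=1..d. (s(i := s i - 1)) j) = (s(i := s i - 1)) i + (\<Sum>j\<in>{1..d}-{i}. (s(i := s i - 1)) j)"
        using i by (intro sum.remove) auto
      moreover have "(\<Sum>j\<in>{1..d}-{i}. (s(i := s i - 1)) j) = (\<Sum>j\<in>{1..d}-{i}. s j)"
        by (intro sum.cong) auto
      moreover have "s i \<ge> 1" using s i by blast
      ultimately show ?thesis by simp
    qed
    have "1 \<in> {1..d}" using d_pos by simp
    hence n1: "Suc (n - 1) = n" using n_i[of 1] by simp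
    interpret M: abelian_monoid "ideals_set R" by (rule abelian_monoid_ideals)
    have "(\<Oplus>\<^bsub>ideals_set R\<^esub> i \<in> {1..d}. a i <# tight_closure p R (mixed_power R d I (s(i := s i - 1))))
        = (\<Oplus>\<^bsub>ideals_set R\<^esub> i \<in> {1..d}. \<pi> (\<alpha> i) <# MM (n - 1))"
    proof (rule M.finsum_cong')
      show "(\<lambda>i. \<pi> (\<alpha> i) <# MM (n - 1)) \<in> {1..d} \<rightarrow> carrier (ideals_set R)"
        using ideal_l_coset[OF ideal_MM] by simp
      show "a i <# tight_closure p R (mixed_power R d I (s(i := s i - 1))) = \<pi> (\<alpha> i) <# MM (n - 1)" if "i \<in> {1..d}" for i
        unfolding tight_closure_mixed_power[OF p] \<alpha>(1)[OF that] using n_i[OF that] by simp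
    qed simp
    also have "\<dots> = \<pi> ` Cov d \<alpha> (n - 1)" by (rule finsum_l_cosets_MM)
    finally have lhs: "(\<Oplus>\<^bsub>ideals_set R\<^esub> i \<in> {1..d}. a i <# tight_closure p R (mixed_power R d I (s(i := s i - 1))))
        = \<pi> ` Cov d \<alpha> (n - 1)" .
    have "\<pi> ` Cov d \<alpha> (n - 1) = MM n \<longleftrightarrow> gcovers \<Delta> d \<alpha> (Suc (n - 1))"
      unfolding gcovers_iff using Cov_MM[where a = \<alpha> and d = d and n = "n - 1", OF \<alpha>(2)] n1 by auto
    thus ?thesis unfolding lhs unfolding tight_closure_mixed_power[OF p] n_def[symmetric] n1 .
  qed
  have euler: "gcovers \<Delta> d \<alpha> d \<longleftrightarrow> eulerian \<Delta>" by (rule gcovers_iff_eulerian[where \<alpha> = \<alpha>, OF \<alpha>(2) top])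
  show ?thesis
  proof
    assume "eulerian \<Delta>"
    hence cov: "gcovers \<Delta> d \<alpha> d" using euler by blast
    show "\<forall>s :: nat \<Rightarrow> nat. (\<forall>i \<in> {1..d}. s i \<ge> 1) \<longrightarrow>
        (\<Oplus>\<^bsub>ideals_set R\<^esub> i \<in> {1..d}. a i <# tight_closure p R (mixed_power R d I (s(i := s i - 1)))) =
        tight_closure p R (mixed_power R d I s)"
    proof (intro allI impI)
      fix s :: "nat \<Rightarrow> nat" assume s: "\<forall>i \<in> {1..d}. s i \<ge> 1"
      have "d = (\<Sum>i=1..d. 1)" by simp
      also have "\<dots> \<le> (\<Sum>i=1..d. s i)" using s by (intro sum_mono) blast
      finally have "gcovers \<Delta> d \<alpha> (\<Sum>i=1..d. s i)" by (rule gcovers_mono[OF complex cov])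
      thus "(\<Oplus>\<^bsub>ideals_set R\<^esub> i \<in> {1..d}. a i <# tight_closure p R (mixed_power R d I (s(i := s i - 1)))) =
        tight_closure p R (mixed_power R d I s)" unfolding key[OF s] .
    qed
  next
    assume all: "\<forall>s :: nat \<Rightarrow> nat. (\<forall>i \<in> {1..d}. s i \<ge> 1) \<longrightarrow>
        (\<Oplus>\<^bsub>ideals_set R\<^esub> i \<in> {1..d}. a i <# tight_closure p R (mixed_power R d I (s(i := s i - 1)))) =
        tight_closure p R (mixed_power R d I s)"
    have ones: "\<forall>i\<in>{1..d}. (\<lambda>_. 1 :: nat) i \<ge> 1" by simp
    have "gcovers \<Delta> d \<alpha> (\<Sum>i=1..d. 1)"
      using all[rule_format, of "\<lambda>_. 1"] unfolding key[OF ones] by simp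
    hence "gcovers \<Delta> d \<alpha> d" by simp
    thus "eulerian \<Delta>" using euler by blast
  qed
qed

text \<open>For \<open>k\<close> factors the tight closure of the n-th power is \<mm>^(kn), so the
  length is one fixed polynomial evaluated at kn. Its value at n = 0, which is the coefficient up to
  sign, does not depend on \<open>k\<close>. The condition \<open>A \<noteq> {1..d}\<close> ensures
  \<open>k > 0\<close>.\<close>

lemma tight_hilbert_coeff_prod:
  assumes p: "p > 1" and A: "A \<subseteq> {1..d}" "A \<noteq> {1..d}"
  shows "tight_hilbert_coeff p R d d (\<Otimes>\<^bsub>ideals_set R\<^esub> j\<in>{1..d} - A. I j) = (- 1) ^ d * (\<Sum>F\<in>\<Delta>. (- 1) ^ card F)"
proof -
  let ?J = "\<Otimes>\<^bsub>ideals_set R\<^esub> j\<in>{1..d} - A. I j"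
  define k where "k = card ({1..d} - A)"
  have "{1..d} - A \<noteq> {}" using A by blast
  hence k: "k > 0" unfolding k_def by (simp add: card_gt_0_iff)
  have J: "apx ?J k" unfolding k_def by (rule apx_prod_I) blast
  obtain e where e: "\<And>n. (\<Sum>F\<in>\<Delta>. ((int k * n + (- 1)) ichoose card F)) = binomial_poly d e n"
    using sum_ichoose_linear_binomial_poly[of \<Delta> card d k "- 1"] face_card by blast
  have "tight_hilbert_coeff p R d d ?J = (- 1) ^ d * e 0"
  proof (rule tight_hilbert_coeff_eq)
    fix n :: nat assume n: "n \<ge> 1"
    have "tight_closure p R (?J [^]\<^bsub>ideals_set R\<^esub> n) = MM (n * k)"
      by (rule tight_closure_apx[OF p apx_pow[OF J]])
    thus "ring_length (R Quot tight_closure p R (?J [^]\<^bsub>ideals_set R\<^esub> n))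
        = enat (card {u :: 'v \<Rightarrow>\<^sub>0 nat. Poly_Mapping.keys u \<in> \<Delta> \<and> mdeg u < n * k})" by (simp only: ring_length_MM)
    have "n * k > 0" using n k by simp
    hence "int (card {u :: 'v \<Rightarrow>\<^sub>0 nat. Poly_Mapping.keys u \<in> \<Delta> \<and> mdeg u < n * k}) = (\<Sum>F\<in>\<Delta>. (int (n * k) - 1) ichoose card F)"
      by (rule card_monomials_faces_below)
    also have "\<dots> = binomial_poly d e (int n)" unfolding e[symmetric] by (simp add: mult.commute)
    finally show "int (card {u :: 'v \<Rightarrow>\<^sub>0 nat. Poly_Mapping.keys u \<in> \<Delta> \<and> mdeg u < n * k}) = binomial_poly d e (int n)" .
  qed
  also have "e 0 = (\<Sum>F\<in>\<Delta>. (- 1) ^ card F)"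
    using e[of 0] unfolding binomial_poly_0 by (simp add: ichoose_minus_one)
  finally show ?thesis .
qed

text \<open>Every coefficient equals (-1)^d E, where E is the sum over the faces. The full
  alternating sum of binomials being zero, the sets with fewer than \<open>d\<close> elements carry
  total weight -(-1)^d, so the whole expression is -E.\<close>

lemma tight_hilbert_coeff_alternating_iff:
  assumes p: "p > 1"
  shows "eulerian \<Delta> \<longleftrightarrow> (\<Sum>k<d. (- 1) ^ k * (\<Sum>A | A \<subseteq> {1..d} \<and> card A = k.
         tight_hilbert_coeff p R d d (\<Otimes>\<^bsub>ideals_set R\<^esub> j \<in> {1..d} - A. I j))) = 0"
proof -
  define E :: int where "E = (\<Sum>F\<in>\<Delta>. (- 1) ^ card F)"
  have "(\<Sum>A | A \<subseteq> {1..d} \<and> card A = k. tight_hilbert_coeff p R d d (\<Otimes>\<^bsub>ideals_set R\<^esub> j \<in> {1..d} - A. I j))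
      = int (d choose k) * ((- 1) ^ d * E)" if "k < d" for k
  proof -
    have "(\<Sum>A | A \<subseteq> {1..d} \<and> card A = k. tight_hilbert_coeff p R d d (\<Otimes>\<^bsub>ideals_set R\<^esub> j \<in> {1..d} - A. I j))
      = (\<Sum>A | A \<subseteq> {1..d} \<and> card A = k. (- 1) ^ d * E)"
    proof (intro sum.cong refl)
      fix A assume A: "A \<in> {A. A \<subseteq> {1..d} \<and> card A = k}"
      hence "A \<noteq> {1..d}" using that by auto
      thus "tight_hilbert_coeff p R d d (\<Otimes>\<^bsub>ideals_set R\<^esub> j \<in> {1..d} - A. I j) = (- 1) ^ d * E"
        unfolding E_def using A by (intro tight_hilbert_coeff_prod[OF p]) auto
    qed
    thus ?thesis using n_subsets[of "{1..d}" k] by simp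
  qed
  hence "(\<Sum>k<d. (- 1) ^ k * (\<Sum>A | A \<subseteq> {1..d} \<and> card A = k.
         tight_hilbert_coeff p R d d (\<Otimes>\<^bsub>ideals_set R\<^esub> j \<in> {1..d} - A. I j)))
      = (\<Sum>k<d. (- 1) ^ k * (int (d choose k) * ((- 1) ^ d * E)))" by (intro sum.cong) auto
  also have "\<dots> = (\<Sum>k<d. (- 1) ^ k * int (d choose k)) * ((- 1) ^ d * E)"
    by (simp add: sum_distrib_right mult.assoc)
  also have "(\<Sum>k<d. (- 1) ^ k * int (d choose k)) = - ((- 1) ^ d)"
  proof -
    have "(\<Sum>k\<le>d. (- 1) ^ k * int (d choose k)) = 0" using choose_alternating_sum[OF d_pos, where 'a = int] by simp
    hence "(\<Sum>k<d. (- 1) ^ k * int (d choose k)) + (- 1) ^ d = 0" by (simp flip: lessThan_Suc_atMost)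
    thus ?thesis by linarith
  qed
  finally show ?thesis unfolding eulerian_iff[OF complex] E_def by simp
qed

end

theorem theorem1p5:
  fixes \<Delta> :: "'v::{finite, linorder} set set"
    and R :: "('v, 'k::field) mpoly set ring"
    and \<mm> :: "('v, 'k) mpoly set set"
    and I :: "nat \<Rightarrow> ('v, 'k) mpoly set set"
    and a :: "nat \<Rightarrow> ('v, 'k) mpoly set"
    and p d :: nat
  defines "p \<equiv> CHAR('k)"
    and "R \<equiv> SR_ring \<Delta>"
    and "\<mm> \<equiv> SR_max_ideal \<Delta>"
  assumes "Factorial_Ring.prime p"
    and "simplicial_complex \<Delta>"
    and "cohen_macaulay R"
    and "krull_dim R = enat d"
    and "\<And>i. i \<in> {1..d} \<Longrightarrow> \<exists>\<theta>. linear_sop \<Delta> d \<theta> \<and> I i = Idl\<^bsub>R\<^esub> (\<theta> ` {1..d})"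
    and "joint_reduction R d a I"
  shows "(eulerian \<Delta> \<longleftrightarrow> reduction_number R \<mm> \<le> enat (d - 1)) \<and>
    (eulerian \<Delta> \<longleftrightarrow>
      (\<forall>s :: nat \<Rightarrow> nat. (\<forall>i \<in> {1..d}. s i \<ge> 1) \<longrightarrow>
        (\<Oplus>\<^bsub>ideals_set R\<^esub> i \<in> {1..d}.
           a i <#\<^bsub>R\<^esub> tight_closure p R (mixed_power R d I (s(i := s i - 1)))) =
        tight_closure p R (mixed_power R d I s))) \<and>
    (eulerian \<Delta> \<longleftrightarrow>
      (\<Sum>k<d. (- 1) ^ k * (\<Sum>A | A \<subseteq> {1..d} \<and> card A = k.
         tight_hilbert_coeff p R d d (\<Otimes>\<^bsub>ideals_set R\<^esub> j \<in> {1..d} - A. I j))) = 0)"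
proof -
  interpret linear_ideals \<Delta> R d I
    by unfold_locales (use assms in \<open>simp_all add: R_def\<close>)
  have p1: "p > 1" using assms(4) by (rule prime_gt_1_nat)
  have m: "\<mm> = MM 1" unfolding assms(3) by (rule max_ideal_eq)
  \<comment> \<open>Since \<open>d > 0\<close>, the ideal \<open>I 1\<close> supplies a linear
    system of parameters, whose ideal serves as the minimal reduction in the bound on the reduction
    number.\<close>
  have "1 \<in> {1..d}" using d_pos by simp
  then obtain b :: "nat \<Rightarrow> 'v \<Rightarrow> 'k" where b: "spanning \<Delta> d b" using I_linear by blast
  have "eulerian \<Delta> \<longleftrightarrow> reduction_number R \<mm> \<le> enat (d - 1)"
    unfolding m using eulerian_of_reduction_number reduction_number_of_eulerian[OF _ b] by blast
  thus ?thesis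
    using mixed_tight_closure_iff[OF p1 assms(9)] tight_hilbert_coeff_alternating_iff[OF p1] by (intro conjI)
qed

end
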